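(* Let $A$ be a cocommutative color Hopf algebra and let $X$ and $Y$ be normal color Hopf subalgebras of $A$. Let $[X,Y]$ be the graded subalgebra of $A$ generated by all the elements $[x,y]:=\phi(|x_2|,|y_1|)\,x_1y_1S(x_2)S(y_2)$ with $x\in X$, $y\in Y$. Then $[X,Y]=[X,Y]_{\mathrm{Huq}}$, i.e. $[X,Y]$ is the Huq commutator of $X$ and $Y$ in the category $\mathrm{Hopf}_{\mathrm{coc}}(\mathrm{Vec}_G)$.
   Context: Let $\Bbbk$ be a field of characteristic different from $2$, $G$ a finitely generated abelian group, and $\phi:G\times G\to\Bbbk\setminus\{0\}$ a bicharacter ($\phi(gh,l)=\phi(g,l)\phi(h,l)$, $\phi(g,hl)=\phi(g,h)\phi(g,l)$) with $\phi(g,h)\phi(h,g)=1$ for all $g,h$. $\mathrm{Vec}_G$ is the category of $G$-graded vector spaces and degree-preserving linear maps, symmetric monoidal with $\otimes=\otimes_{\Bbbk}$ and braiding $x\otimes y\mapsto\phi(g,h)\,y\otimes x$ for $x$ of degree $g$, $y$ of degree $h$. $|x|$ denotes the degree of a homogeneous element $x$; formulas involving $\phi$ are written for homogeneous elements and extended linearly. Sweedler notation $\Delta(x)=x_1\otimes x_2$ is used (sum understood, components homogeneous). A color Hopf algebra is a Hopf monoid in $\mathrm{Vec}_G$: a $G$-graded algebra and $G$-graded coalgebra $(A,m,u,\Delta,\epsilon)$ with $\epsilon$ an algebra map, $\Delta(1)=1\otimes 1$, $\Delta(ab)=\phi(|a_2|,|b_1|)a_1b_1\otimes a_2b_2$,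 and a degree-preserving antipode $S$. It is cocommutative if $a_1\otimes a_2=\phi(|a_1|,|a_2|)a_2\otimes a_1$. $\mathrm{Hopf}_{\mathrm{coc}}(\mathrm{Vec}_G)$ is the category of cocommutative color Hopf algebras with degree-preserving maps that are both algebra and coalgebra maps; it is semi-abelian, with zero object $\Bbbk$ and binary product $X\times Y=X\otimes Y$. A color Hopf subalgebra of $A$ is a graded subspace which is a subalgebra (containing $1_A$), a subcoalgebra, and closed under $S$. It is normal if $\phi(|a_2|,|x|)a_1xS(a_2)\in X$ for all $a\in A$, $x\in X$. Two color Hopf subalgebras $X,Y$ of $A$ commute (in the sense of Huq) if there is a morphism $p:X\otimes Y\to A$ in $\mathrm{Hopf}_{\mathrm{coc}}(\mathrm{Vec}_G)$ with $p(x\otimes 1)=x$ and $p(1\otimes y)=y$ for all $x\in X$, $y\in Y$. For a normal color Hopf subalgebra $B$ of $A$, the cokernel of the inclusion $B\to A$ is the canonical projection $q:A\to A/AB^+$, where $B^+=B\cap\ker\epsilon$. The Huq commutator $[X,Y]_{\mathrm{Huq}}$ of normal color Hopf subalgebras $X,Y$ of $A$ is the smallest normal color Hopf subalgebra $B$ of $A$ such that $q(X)$ and $q(Y)$ commute in $A/AB^+$. *)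

theory Defs
  imports
    "HOL-Algebra.Module"
    "HOL-Algebra.QuotRing"
    "HOL-Algebra.Ideal_Product"
    "HOL-Algebra.Algebraic_Closure_Type"
    "HOL-Computational_Algebra.Group_Closure"
    "HOL-Library.Poly_Mapping"
begin

text \<open>
  The ground field is the type \<open>'k\<close> (seen as a ring record via \<^const>\<open>ring_of_type_algebra\<close>)
  and the grading group is the type \<open>'g\<close>, written additively. Vector spaces, algebras and Hopf
  algebras are records with an explicit carrier, so that subobjects, quotients and tensor products
  are again objects of the same kind.
\<close>

section \<open>The grading group and the commutation factor\<close>

definition fin_gen_group :: "'g::ab_group_add itself \<Rightarrow> bool" where
  "fin_gen_group _ \<longleftrightarrow> (\<exists>S :: 'g set. finite S \<and> group_closure S = UNIV)"

definition bicharacter :: "('g::ab_group_add \<Rightarrow> 'g \<Rightarrow> 'k::field) \<Rightarrow> bool" where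
  "bicharacter \<phi> \<longleftrightarrow>
     (\<forall>g h. \<phi> g h \<noteq> 0) \<and>
     (\<forall>g h l. \<phi> (g + h) l = \<phi> g l * \<phi> h l) \<and>
     (\<forall>g h l. \<phi> g (h + l) = \<phi> g h * \<phi> g l)"

definition commutation_factor :: "('g::ab_group_add \<Rightarrow> 'g \<Rightarrow> 'k::field) \<Rightarrow> bool" where
  "commutation_factor \<phi> \<longleftrightarrow> bicharacter \<phi> \<and> (\<forall>g h. \<phi> g h * \<phi> h g = 1)"

section \<open>Graded vector spaces\<close>

record ('k, 'g, 'a) graded_module = "('k, 'a) module" +
  homog :: "'g \<Rightarrow> 'a set"

definition decomposition ::
  "('k, 'g, 'a, 'm) graded_module_scheme \<Rightarrow> 'a \<Rightarrow> ('g \<Rightarrow> 'a) \<Rightarrow> bool" where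
  "decomposition V v c \<longleftrightarrow>
     (\<forall>g. c g \<in> homog V g) \<and> finite {g. c g \<noteq> \<zero>\<^bsub>V\<^esub>} \<and>
     v = (\<Oplus>\<^bsub>V\<^esub>g\<in>{g. c g \<noteq> \<zero>\<^bsub>V\<^esub>}. c g)"

locale graded_space =
  module ring_of_type_algebra V
  for V :: "('k::field, 'g::ab_group_add, 'a, 'm) graded_module_scheme" (structure) +
  assumes homog_submodule: "submodule (homog V g) (ring_of_type_algebra :: 'k ring) V"
    and ex1_decomposition: "v \<in> carrier V \<Longrightarrow> \<exists>!c. decomposition V v c"

definition component :: "('k, 'g, 'a, 'm) graded_module_scheme \<Rightarrow> 'a \<Rightarrow> 'g \<Rightarrow> 'a" where
  "component V v = (THE c. decomposition V v c)"

definition degrees :: "('k, 'g, 'a, 'm) graded_module_scheme \<Rightarrow> 'a \<Rightarrow> 'g set" where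
  "degrees V v = {g. component V v g \<noteq> \<zero>\<^bsub>V\<^esub>}"

definition graded_linear ::
  "('k, 'g, 'a, 'm) graded_module_scheme \<Rightarrow> ('k, 'g, 'b, 'n) graded_module_scheme \<Rightarrow>
   ('a \<Rightarrow> 'b) \<Rightarrow> bool" where
  "graded_linear V W f \<longleftrightarrow>
     f \<in> carrier V \<rightarrow> carrier W \<and>
     (\<forall>v\<in>carrier V. \<forall>v'\<in>carrier V. f (v \<oplus>\<^bsub>V\<^esub> v') = f v \<oplus>\<^bsub>W\<^esub> f v') \<and>
     (\<forall>c. \<forall>v\<in>carrier V. f (c \<odot>\<^bsub>V\<^esub> v) = c \<odot>\<^bsub>W\<^esub> f v) \<and>
     (\<forall>g. f ` homog V g \<subseteq> homog W g)"

definition graded_subspace :: "('k::field, 'g, 'a, 'm) graded_module_scheme \<Rightarrow> 'a set \<Rightarrow> bool" where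
  "graded_subspace V U \<longleftrightarrow>
     submodule U (ring_of_type_algebra :: 'k ring) V \<and> (\<forall>x\<in>U. \<forall>g. component V x g \<in> U)"

text \<open>
  The bilinear extension of \<open>(v, w) \<mapsto> \<phi>(|v|, |w|) \<beta>(v, w)\<close> from homogeneous
  elements to all elements, for \<open>\<beta>\<close> bilinear with values in \<open>P\<close>.
\<close>

definition color_ext ::
  "('g \<Rightarrow> 'g \<Rightarrow> 'k) \<Rightarrow> ('k, 'g, 'a, 'm) graded_module_scheme \<Rightarrow>
   ('k, 'g, 'b, 'n) graded_module_scheme \<Rightarrow> ('k, 'c, 'o) module_scheme \<Rightarrow>
   ('a \<Rightarrow> 'b \<Rightarrow> 'c) \<Rightarrow> 'a \<Rightarrow> 'b \<Rightarrow> 'c" where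
  "color_ext \<phi> V W P \<beta> v w =
     (\<Oplus>\<^bsub>P\<^esub>g\<in>degrees V v. \<Oplus>\<^bsub>P\<^esub>h\<in>degrees W w.
        \<phi> g h \<odot>\<^bsub>P\<^esub> \<beta> (component V v g) (component W w h))"

section \<open>Tensor products\<close>

text \<open>
  \<open>V \<otimes> W\<close> is the free vector space on \<open>carrier V \<times> carrier W\<close> modulo the subspace
  \<open>tensor_rel V W\<close> of bilinearity relations. Its elements are cosets, i.e. sets of
  formal linear combinations of pairs.
\<close>

type_synonym ('a, 'b, 'k) tensor = "('a \<times> 'b \<Rightarrow>\<^sub>0 'k) set"

text \<open>Because of the arbitrary coefficient \<open>c\<close>, closure under addition is enough to obtain a subspace.\<close>

inductive_set tensor_rel ::
  "('k::field, 'a, 'm) module_scheme \<Rightarrow> ('k, 'b, 'n) module_scheme \<Rightarrow> ('a \<times> 'b \<Rightarrow>\<^sub>0 'k) set"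
  for V :: "('k::field, 'a, 'm) module_scheme" and W :: "('k, 'b, 'n) module_scheme" where
  zero: "0 \<in> tensor_rel V W"
| add: "r \<in> tensor_rel V W \<Longrightarrow> s \<in> tensor_rel V W \<Longrightarrow> r + s \<in> tensor_rel V W"
| add_left: "v \<in> carrier V \<Longrightarrow> v' \<in> carrier V \<Longrightarrow> w \<in> carrier W \<Longrightarrow>
    Poly_Mapping.single (v \<oplus>\<^bsub>V\<^esub> v', w) c - Poly_Mapping.single (v, w) c - Poly_Mapping.single (v', w) c
      \<in> tensor_rel V W"
| add_right: "v \<in> carrier V \<Longrightarrow> w \<in> carrier W \<Longrightarrow> w' \<in> carrier W \<Longrightarrow>
    Poly_Mapping.single (v, w \<oplus>\<^bsub>W\<^esub> w') c - Poly_Mapping.single (v, w) c - Poly_Mapping.single (v, w') c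
      \<in> tensor_rel V W"
| smult_left: "v \<in> carrier V \<Longrightarrow> w \<in> carrier W \<Longrightarrow>
    Poly_Mapping.single (d \<odot>\<^bsub>V\<^esub> v, w) c - Poly_Mapping.single (v, w) (d * c) \<in> tensor_rel V W"
| smult_right: "v \<in> carrier V \<Longrightarrow> w \<in> carrier W \<Longrightarrow>
    Poly_Mapping.single (v, d \<odot>\<^bsub>W\<^esub> w) c - Poly_Mapping.single (v, w) (d * c) \<in> tensor_rel V W"

definition tensor_class ::
  "('k::field, 'a, 'm) module_scheme \<Rightarrow> ('k, 'b, 'n) module_scheme \<Rightarrow>
   ('a \<times> 'b \<Rightarrow>\<^sub>0 'k) \<Rightarrow> ('a, 'b, 'k) tensor" where
  "tensor_class V W f = {f + r | r. r \<in> tensor_rel V W}"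

definition tens ::
  "('k::field, 'a, 'm) module_scheme \<Rightarrow> ('k, 'b, 'n) module_scheme \<Rightarrow>
   'a \<Rightarrow> 'b \<Rightarrow> ('a, 'b, 'k) tensor" where
  "tens V W v w = tensor_class V W (Poly_Mapping.single (v, w) 1)"

text \<open>
  The underlying graded vector space of \<open>V \<otimes> W\<close>; the multiplicative fields are only set in
  \<open>color_tensor\<close> below.
\<close>

definition tensor_space ::
  "('k::field, 'g::ab_group_add, 'a, 'm) graded_module_scheme \<Rightarrow>
   ('k, 'g, 'b, 'n) graded_module_scheme \<Rightarrow> ('k, 'g, ('a, 'b, 'k) tensor) graded_module" where
  "tensor_space V W =
     \<lparr>carrier = tensor_class V W ` {f. Poly_Mapping.keys f \<subseteq> carrier V \<times> carrier W},
      monoid.mult = (\<lambda>_ _. undefined),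
      one = undefined,
      ring.zero = tensor_rel V W,
      add = (\<lambda>s t. {f + f' | f f'. f \<in> s \<and> f' \<in> t}),
      module.smult = (\<lambda>c t. {Poly_Mapping.map ((*) c) f + r | f r. f \<in> t \<and> r \<in> tensor_rel V W}),
      homog = (\<lambda>g. tensor_class V W `
        {f. Poly_Mapping.keys f \<subseteq> (\<Union>h. homog V h \<times> homog W (g - h))})\<rparr>"

text \<open>
  The linear map on \<open>V \<otimes> W\<close> induced by a bilinear map \<open>\<beta>\<close> into \<open>P\<close>. Sweedler notation is
  expressed with it: for \<open>\<Delta> x = x\<^sub>1 \<otimes> x\<^sub>2\<close>, the element \<open>\<beta>(x\<^sub>1, x\<^sub>2)\<close> is
  \<open>tensor_lift P \<beta> (\<Delta> x)\<close>.
\<close>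

definition tensor_lift ::
  "('k::field, 'c, 'o) module_scheme \<Rightarrow> ('a \<Rightarrow> 'b \<Rightarrow> 'c) \<Rightarrow> ('a, 'b, 'k) tensor \<Rightarrow> 'c" where
  "tensor_lift P \<beta> t =
     (let f = (SOME f. f \<in> t) in
       \<Oplus>\<^bsub>P\<^esub>ab\<in>Poly_Mapping.keys f. Poly_Mapping.lookup f ab \<odot>\<^bsub>P\<^esub> \<beta> (fst ab) (snd ab))"

definition tensor_map ::
  "('k::field, 'g::ab_group_add, 'c, 'm) graded_module_scheme \<Rightarrow>
   ('k, 'g, 'd, 'n) graded_module_scheme \<Rightarrow>
   ('a \<Rightarrow> 'c) \<Rightarrow> ('b \<Rightarrow> 'd) \<Rightarrow> ('a, 'b, 'k) tensor \<Rightarrow> ('c, 'd, 'k) tensor" where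
  "tensor_map V W f h = tensor_lift (tensor_space V W) (\<lambda>a b. tens V W (f a) (h b))"

text \<open>
  The graded algebra \<open>A \<otimes> B\<close> with
  \<open>(a \<otimes> b)(a' \<otimes> b') = \<phi>(|b|, |a'|) aa' \<otimes> bb'\<close>.
\<close>

definition color_tensor ::
  "('g \<Rightarrow> 'g \<Rightarrow> 'k) \<Rightarrow> ('k::field, 'g::ab_group_add, 'a, 'm) graded_module_scheme \<Rightarrow>
   ('k, 'g, 'b, 'n) graded_module_scheme \<Rightarrow> ('k, 'g, ('a, 'b, 'k) tensor) graded_module" where
  "color_tensor \<phi> A B =
     (let T = tensor_space A B in
       T\<lparr>monoid.mult := (\<lambda>s t.
            tensor_lift T (\<lambda>a b. tensor_lift T (\<lambda>a' b'.
              color_ext \<phi> B A T (\<lambda>b a'. tens A B (a \<otimes>\<^bsub>A\<^esub> a') (b \<otimes>\<^bsub>B\<^esub> b')) b a') t) s),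
         one := tens A B \<one>\<^bsub>A\<^esub> \<one>\<^bsub>B\<^esub>\<rparr>)"

section \<open>Color Hopf algebras\<close>

locale graded_algebra = graded_space A + ring A
  for A :: "('k::field, 'g::ab_group_add, 'a, 'm) graded_module_scheme" (structure) +
  assumes smult_mult_left:
      "a \<in> carrier A \<Longrightarrow> b \<in> carrier A \<Longrightarrow> (c \<odot> a) \<otimes> b = c \<odot> (a \<otimes> b)"
    and smult_mult_right:
      "a \<in> carrier A \<Longrightarrow> b \<in> carrier A \<Longrightarrow> a \<otimes> (c \<odot> b) = c \<odot> (a \<otimes> b)"
    and homog_one: "\<one> \<in> homog A 0"
    and homog_mult: "a \<in> homog A g \<Longrightarrow> b \<in> homog A h \<Longrightarrow> a \<otimes> b \<in> homog A (g + h)"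

record (overloaded) ('k, 'g, 'a) hopf = "('k, 'g, 'a) graded_module" +
  comult :: "'a \<Rightarrow> ('a, 'a, 'k) tensor"
  counit :: "'a \<Rightarrow> 'k"
  antipode :: "'a \<Rightarrow> 'a"

locale color_hopf_algebra = graded_algebra A
  for \<phi> :: "'g::ab_group_add \<Rightarrow> 'g \<Rightarrow> 'k::field"
    and A :: "('k, 'g, 'a, 'm) hopf_scheme" (structure) +
  assumes comult_graded_linear: "graded_linear A (tensor_space A A) (comult A)"
    and counit_add: "a \<in> carrier A \<Longrightarrow> b \<in> carrier A \<Longrightarrow> counit A (a \<oplus> b) = counit A a + counit A b"
    and counit_smult: "a \<in> carrier A \<Longrightarrow> counit A (c \<odot> a) = c * counit A a"
    and counit_degree: "a \<in> homog A g \<Longrightarrow> g \<noteq> 0 \<Longrightarrow> counit A a = 0"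
    and antipode_graded_linear: "graded_linear A A (antipode A)"
    \<comment> \<open>both sides of coassociativity are taken in \<open>A \<otimes> (A \<otimes> A)\<close>\<close>
    and coassoc: "a \<in> carrier A \<Longrightarrow>
      (let T = tensor_space A A; T3 = tensor_space A T in
        tensor_lift T3 (\<lambda>a1 a2. tensor_lift T3 (\<lambda>b1 b2. tens A T b1 (tens A A b2 a2)) (comult A a1))
            (comult A a)
          = tensor_map A T (\<lambda>a1. a1) (comult A) (comult A a))"
    and counit_left: "a \<in> carrier A \<Longrightarrow> tensor_lift A (\<lambda>a1 a2. counit A a1 \<odot> a2) (comult A a) = a"
    and counit_right: "a \<in> carrier A \<Longrightarrow> tensor_lift A (\<lambda>a1 a2. counit A a2 \<odot> a1) (comult A a) = a"
    and counit_mult: "a \<in> carrier A \<Longrightarrow> b \<in> carrier A \<Longrightarrow> counit A (a \<otimes> b) = counit A a * counit A b"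
    and counit_one: "counit A \<one> = 1"
    and comult_mult: "a \<in> carrier A \<Longrightarrow> b \<in> carrier A \<Longrightarrow>
      comult A (a \<otimes> b) = comult A a \<otimes>\<^bsub>color_tensor \<phi> A A\<^esub> comult A b"
    and comult_one: "comult A \<one> = tens A A \<one> \<one>"
    and antipode_left: "a \<in> carrier A \<Longrightarrow>
      tensor_lift A (\<lambda>a1 a2. antipode A a1 \<otimes> a2) (comult A a) = counit A a \<odot> \<one>"
    and antipode_right: "a \<in> carrier A \<Longrightarrow>
      tensor_lift A (\<lambda>a1 a2. a1 \<otimes> antipode A a2) (comult A a) = counit A a \<odot> \<one>"

locale cocommutative_color_hopf_algebra = color_hopf_algebra +
  assumes cocommutative: "a \<in> carrier A \<Longrightarrow>
    comult A a =
      (let T = tensor_space A A in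
        tensor_lift T (color_ext \<phi> A A T (\<lambda>a1 a2. tens A A a2 a1)) (comult A a))"

text \<open>Morphisms of \<open>Hopf\<^sub>c\<^sub>o\<^sub>c(Vec\<^sub>G)\<close>; as for \<^const>\<open>hom\<close>, the objects are not part of the predicate.\<close>

definition hopf_hom ::
  "('k::field, 'g::ab_group_add, 'a, 'm) hopf_scheme \<Rightarrow> ('k, 'g, 'b, 'n) hopf_scheme \<Rightarrow>
   ('a \<Rightarrow> 'b) \<Rightarrow> bool" where
  "hopf_hom A B f \<longleftrightarrow>
     graded_linear A B f \<and>
     (\<forall>x\<in>carrier A. \<forall>y\<in>carrier A. f (x \<otimes>\<^bsub>A\<^esub> y) = f x \<otimes>\<^bsub>B\<^esub> f y) \<and>
     f \<one>\<^bsub>A\<^esub> = \<one>\<^bsub>B\<^esub> \<and>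
     (\<forall>x\<in>carrier A. comult B (f x) = tensor_map B B f f (comult A x)) \<and>
     (\<forall>x\<in>carrier A. counit B (f x) = counit A x)"

text \<open>
  The tensor product of color Hopf algebras, with
  \<open>\<Delta>(a \<otimes> b) = \<phi>(|a\<^sub>2|, |b\<^sub>1|) (a\<^sub>1 \<otimes> b\<^sub>1) \<otimes> (a\<^sub>2 \<otimes> b\<^sub>2)\<close>.
\<close>

definition hopf_tensor ::
  "('g \<Rightarrow> 'g \<Rightarrow> 'k) \<Rightarrow> ('k::field, 'g::ab_group_add, 'a, 'm) hopf_scheme \<Rightarrow>
   ('k, 'g, 'b, 'n) hopf_scheme \<Rightarrow> ('k, 'g, ('a, 'b, 'k) tensor) hopf" where
  "hopf_tensor \<phi> A B =
     (let T = color_tensor \<phi> A B; TT = tensor_space T T in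
       graded_module.extend T (hopf.fields
         (tensor_lift TT (\<lambda>a b. tensor_lift TT (\<lambda>a1 a2. tensor_lift TT (\<lambda>b1 b2.
            color_ext \<phi> A B TT (\<lambda>a2 b1. tens T T (tens A B a1 b1) (tens A B a2 b2)) a2 b1)
              (comult B b)) (comult A a)))
         (\<lambda>t. let f = (SOME f. f \<in> t) in
            \<Sum>ab\<in>Poly_Mapping.keys f.
              Poly_Mapping.lookup f ab * (counit A (fst ab) * counit B (snd ab)))
         (tensor_map A B (antipode A) (antipode B))))"

section \<open>Subobjects, quotients and commutators\<close>

definition color_hopf_subalgebra :: "('k::field, 'g, 'a, 'm) hopf_scheme \<Rightarrow> 'a set \<Rightarrow> bool" where
  "color_hopf_subalgebra A U \<longleftrightarrow>
     graded_subspace A U \<and>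
     \<one>\<^bsub>A\<^esub> \<in> U \<and>
     (\<forall>x\<in>U. \<forall>y\<in>U. x \<otimes>\<^bsub>A\<^esub> y \<in> U) \<and>
     (\<forall>x\<in>U. comult A x \<in> tensor_class A A ` {f. Poly_Mapping.keys f \<subseteq> U \<times> U}) \<and>
     (\<forall>x\<in>U. antipode A x \<in> U)"

text \<open>
  A color Hopf subalgebra as a color Hopf algebra. Its comultiplication takes values in
  \<open>U \<otimes> U\<close> rather than in \<open>A \<otimes> A\<close>, so a representative of \<open>\<Delta> x\<close> supported on \<open>U \<times> U\<close> is
  chosen; its class in \<open>U \<otimes> U\<close> is unique, as \<open>U \<otimes> U \<rightarrow> A \<otimes> A\<close> is injective over a field.
\<close>

definition subobject ::
  "('k::field, 'g, 'a, 'm) hopf_scheme \<Rightarrow> 'a set \<Rightarrow> ('k, 'g, 'a, 'm) hopf_scheme" where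
  "subobject A U =
     A\<lparr>carrier := U,
       homog := (\<lambda>g. homog A g \<inter> U),
       comult := (\<lambda>x. tensor_class (A\<lparr>carrier := U\<rparr>) (A\<lparr>carrier := U\<rparr>)
                    (SOME f. f \<in> comult A x \<and> Poly_Mapping.keys f \<subseteq> U \<times> U))\<rparr>"

definition color_adjoint ::
  "('g \<Rightarrow> 'g \<Rightarrow> 'k) \<Rightarrow> ('k::field, 'g, 'a, 'm) hopf_scheme \<Rightarrow> 'a \<Rightarrow> 'a \<Rightarrow> 'a" where
  "color_adjoint \<phi> A a x =
     tensor_lift A (\<lambda>a1 a2. color_ext \<phi> A A A (\<lambda>a2 x. a1 \<otimes>\<^bsub>A\<^esub> x \<otimes>\<^bsub>A\<^esub> antipode A a2) a2 x) (comult A a)"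

definition normal_color_hopf_subalgebra ::
  "('g \<Rightarrow> 'g \<Rightarrow> 'k) \<Rightarrow> ('k::field, 'g, 'a, 'm) hopf_scheme \<Rightarrow> 'a set \<Rightarrow> bool" where
  "normal_color_hopf_subalgebra \<phi> A U \<longleftrightarrow>
     color_hopf_subalgebra A U \<and> (\<forall>a\<in>carrier A. \<forall>x\<in>U. color_adjoint \<phi> A a x \<in> U)"

definition augmentation_ideal :: "('k::field, 'g, 'a, 'm) hopf_scheme \<Rightarrow> 'a set \<Rightarrow> 'a set" where
  "augmentation_ideal A B = {b \<in> B. counit A b = 0}"

text \<open>
  The quotient \<open>A/I\<close> by a Hopf ideal, extending \<^const>\<open>FactRing\<close>; the structure maps are the ones
  for which \<open>a \<mapsto> I +> a\<close> is a morphism, computed on a representative of the coset.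
\<close>

definition quotient_module ::
  "('k, 'g, 'a, 'm) graded_module_scheme \<Rightarrow> 'a set \<Rightarrow> ('k, 'g, 'a set) graded_module" where
  "quotient_module A I =
     module.extend
       (ring.extend (A Quot I)
         (module.fields (\<lambda>c C. \<Union>a\<in>C. I +>\<^bsub>A\<^esub> (c \<odot>\<^bsub>A\<^esub> a))))
       (graded_module.fields (\<lambda>g. (\<lambda>a. I +>\<^bsub>A\<^esub> a) ` homog A g))"

definition quotient_hopf ::
  "('k::field, 'g::ab_group_add, 'a, 'm) hopf_scheme \<Rightarrow> 'a set \<Rightarrow> ('k, 'g, 'a set) hopf" where
  "quotient_hopf A I =
     (let Q = quotient_module A I; q = (\<lambda>a. I +>\<^bsub>A\<^esub> a) in
       graded_module.extend Q (hopf.fields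
         (\<lambda>C. tensor_map Q Q q q (comult A (SOME a. a \<in> C)))
         (\<lambda>C. counit A (SOME a. a \<in> C))
         (\<lambda>C. q (antipode A (SOME a. a \<in> C)))))"

definition huq_commute ::
  "('g \<Rightarrow> 'g \<Rightarrow> 'k) \<Rightarrow> ('k::field, 'g::ab_group_add, 'a, 'm) hopf_scheme \<Rightarrow>
   'a set \<Rightarrow> 'a set \<Rightarrow> bool" where
  "huq_commute \<phi> A U V \<longleftrightarrow>
     (\<exists>p. hopf_hom (hopf_tensor \<phi> (subobject A U) (subobject A V)) A p \<and>
       (\<forall>x\<in>U. p (tens (subobject A U) (subobject A V) x \<one>\<^bsub>A\<^esub>) = x) \<and>
       (\<forall>y\<in>V. p (tens (subobject A U) (subobject A V) \<one>\<^bsub>A\<^esub> y) = y))"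

definition commute_modulo ::
  "('g \<Rightarrow> 'g \<Rightarrow> 'k) \<Rightarrow> ('k::field, 'g::ab_group_add, 'a, 'm) hopf_scheme \<Rightarrow>
   'a set \<Rightarrow> 'a set \<Rightarrow> 'a set \<Rightarrow> bool" where
  "commute_modulo \<phi> A U V B \<longleftrightarrow>
     (let I = ideal_prod A (carrier A) (augmentation_ideal A B); q = (\<lambda>a. I +>\<^bsub>A\<^esub> a) in
       huq_commute \<phi> (quotient_hopf A I) (q ` U) (q ` V))"

text \<open>\<open>B\<close> is the least normal color Hopf subalgebra modulo which \<open>U\<close> and \<open>V\<close> commute.\<close>

definition is_huq_commutator ::
  "('g \<Rightarrow> 'g \<Rightarrow> 'k) \<Rightarrow> ('k::field, 'g::ab_group_add, 'a, 'm) hopf_scheme \<Rightarrow>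
   'a set \<Rightarrow> 'a set \<Rightarrow> 'a set \<Rightarrow> bool" where
  "is_huq_commutator \<phi> A U V B \<longleftrightarrow>
     normal_color_hopf_subalgebra \<phi> A B \<and> commute_modulo \<phi> A U V B \<and>
     (\<forall>B'. normal_color_hopf_subalgebra \<phi> A B' \<and> commute_modulo \<phi> A U V B' \<longrightarrow> B \<subseteq> B')"

text \<open>\<open>[x, y] = \<phi>(|x\<^sub>2|, |y\<^sub>1|) x\<^sub>1 y\<^sub>1 S(x\<^sub>2) S(y\<^sub>2)\<close>\<close>

definition color_commutator ::
  "('g \<Rightarrow> 'g \<Rightarrow> 'k) \<Rightarrow> ('k::field, 'g, 'a, 'm) hopf_scheme \<Rightarrow> 'a \<Rightarrow> 'a \<Rightarrow> 'a" where
  "color_commutator \<phi> A x y =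
     tensor_lift A (\<lambda>x1 x2. tensor_lift A (\<lambda>y1 y2.
       color_ext \<phi> A A A (\<lambda>x2 y1. x1 \<otimes>\<^bsub>A\<^esub> y1 \<otimes>\<^bsub>A\<^esub> antipode A x2 \<otimes>\<^bsub>A\<^esub> antipode A y2) x2 y1)
         (comult A y)) (comult A x)"

definition graded_subalgebra :: "('k::field, 'g, 'a, 'm) graded_module_scheme \<Rightarrow> 'a set \<Rightarrow> bool" where
  "graded_subalgebra A U \<longleftrightarrow>
     graded_subspace A U \<and> \<one>\<^bsub>A\<^esub> \<in> U \<and> (\<forall>x\<in>U. \<forall>y\<in>U. x \<otimes>\<^bsub>A\<^esub> y \<in> U)"

definition generated_graded_subalgebra ::
  "('k::field, 'g, 'a, 'm) graded_module_scheme \<Rightarrow> 'a set \<Rightarrow> 'a set" where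
  "generated_graded_subalgebra A S = \<Inter>{Z. graded_subalgebra A Z \<and> S \<subseteq> Z}"

definition commutator_subalgebra ::
  "('g \<Rightarrow> 'g \<Rightarrow> 'k) \<Rightarrow> ('k::field, 'g, 'a, 'm) hopf_scheme \<Rightarrow> 'a set \<Rightarrow> 'a set \<Rightarrow> 'a set" where
  "commutator_subalgebra \<phi> A U V =
     generated_graded_subalgebra A {color_commutator \<phi> A x y | x y. x \<in> U \<and> y \<in> V}"

end

theory Submission
  imports Defs
begin

text \<open>
  Over a field, linear functionals separate vectors (\<open>separation\<close>, \<open>lf_eqI\<close>). Every identity in
  Sweedler notation is therefore proved after applying an arbitrary functional: the basic object is the
  scalar \<open>sw a b\<close>, the value \<open>b(a\<^sub>1, a\<^sub>2)\<close> of a bilinear form on \<open>\<Delta>(a) = a\<^sub>1 \<otimes> a\<^sub>2\<close>.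
  Here and below, \<open>B\<^sup>+\<close> is the kernel of the counit on \<open>B\<close>.

  The commutator. Coalgebra maps of degree zero from a cocommutative color coalgebra \<open>C\<close> to \<open>A\<close>, the
  points of \<open>A\<close>, form a group under convolution, and \<open>(x, y) \<mapsto> [x, y]\<close> is the group commutator of
  the two points \<open>U \<otimes> V \<rightarrow> A\<close> given by the factors (\<open>com_points\<close>). Statements on \<open>[x, y]\<close> thus become
  identities in a group: the antipode of a commutator is again a commutator, a conjugate of a
  commutator is the commutator of the conjugates, and \<open>[x, y]\<close> is trivial modulo an ideal iff \<open>x\<close> and
  \<open>y\<close> commute there, up to the color factor (\<open>com_test\<close>). Hence \<open>[U, V]\<close> is a normal color Hopf
  subalgebra (\<open>commutator_subalgebra_nhs\<close>).

  Huq commutation. A morphism \<open>U \<otimes> V \<rightarrow> Q\<close> with the prescribed restrictions must be \<open>x \<otimes> y \<mapsto> xy\<close>, and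
  this map is multiplicative exactly if \<open>yx = \<phi>(|y|, |x|) xy\<close> (\<open>huq_commuteI\<close>,
  \<open>huq_commute_commutes\<close>). For normal \<open>B\<close> the left ideal \<open>AB\<^sup>+\<close> is two-sided (\<open>AB_eq_BA\<close>), and
  \<open>commute_modulo\<close> says that \<open>xy - \<phi>(|x|, |y|) yx\<close> lies in \<open>AB\<^sup>+\<close> (\<open>commute_modulo_iff\<close>). By the
  group identities this means \<open>[x, y] - \<epsilon>(x)\<epsilon>(y)\<close> is in \<open>AB\<^sup>+\<close> for all \<open>x\<close>, \<open>y\<close>. In particular it
  holds for \<open>B = [U, V]\<close>.

  Minimality. It remains to see that \<open>B\<close> can be recovered from \<open>AB\<^sup>+\<close>: a point which is trivial modulo
  \<open>AB\<^sup>+\<close> has its values in \<open>B\<close> (\<open>coinvariant_in\<close>). Given a right \<open>B\<close>-linear graded retraction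
  \<open>\<pi> : A \<rightarrow> B\<close>, the map \<open>\<theta>(a) = a\<^sub>1 S(\<pi>(a\<^sub>2))\<close> satisfies \<open>\<theta>(ab) = \<epsilon>(b)\<theta>(a)\<close> and so factors through
  \<open>A/AB\<^sup>+\<close>. A point \<open>f\<close> which is trivial there satisfies \<open>f * S\<pi>f = 1\<close>, whence \<open>Sf = S\<pi>f\<close> and
  \<open>f = S(S\<pi>f)\<close> has values in \<open>B\<close>.

  The retraction \<open>\<pi>\<close> exists because \<open>A\<close> is cocommutative (\<open>hs_retraction\<close>). Let \<open>Bn B n\<close> be the wedge powers
  of \<open>B\<close> and \<open>B1 B\<close> their union. Cocommutativity gives a coalgebra complement of this union, the sum of
  all subcoalgebras that meet \<open>B\<close> in zero (\<open>carrier_W\<close>), and the projection along it is right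
  \<open>B\<close>-linear (\<open>component_right_linear\<close>). Modulo \<open>Bn B n\<close>, an element
  of \<open>Bn B (Suc n)\<close> behaves like an element of a relative Hopf module over \<open>B\<close>, which splits by its
  antipode; this gives a right \<open>B\<close>-linear step down to \<open>Bn B n\<close> (\<open>filtration_step\<close>); the composites of these steps end in \<open>B\<close>.
\<close>

section \<open>Formal linear combinations\<close>

abbreviation "keys \<equiv> Poly_Mapping.keys"
abbreviation "lookup \<equiv> Poly_Mapping.lookup"
abbreviation "single \<equiv> Poly_Mapping.single"

definition pair :: "('b \<Rightarrow>\<^sub>0 'k::field) => ('b => 'k) => 'k" where
 "pair f F = (\<Sum>x\<in>keys f. lookup f x * F x)"

abbreviation scl :: "'k::field => ('b \<Rightarrow>\<^sub>0 'k) => ('b \<Rightarrow>\<^sub>0 'k)" where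
 "scl c f \<equiv> Poly_Mapping.map ((*) c) f"

lemma lookup_scl [simp]: "lookup (scl c f) x = c * lookup f x"
 by (simp add: Poly_Mapping.map.rep_eq when_def)

lemma keys_scl: "keys (scl c f)\<subseteq>keys f"
 by (auto simp: in_keys_iff)

lemma scl_one [simp]: "scl 1 f = f"
 by (rule poly_mapping_eqI) simp

lemma scl_0 [simp]: "scl 0 f = 0"
 by (rule poly_mapping_eqI) simp

lemma scl_zero [simp]: "scl c 0 = 0"
 by (rule poly_mapping_eqI) simp

lemma scl_add: "scl c (f + g) = scl c f + scl c g"
 by (rule poly_mapping_eqI) (simp add: lookup_add algebra_simps)

lemma scl_scl: "scl c (scl d f) = scl (c * d) f"
 by (rule poly_mapping_eqI) (simp add: lookup_add algebra_simps)

lemma scl_diff: "scl c (f - g) = scl c f - scl c g"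
 by (rule poly_mapping_eqI) (simp add: lookup_minus algebra_simps)

lemma scl_single [simp]: "scl c (single x d) = single x (c * d)"
 by (rule poly_mapping_eqI) (simp add: lookup_single when_def)

lemma scl_m1: "scl (-1) f = - f"
 by (rule poly_mapping_eqI) simp

lemma pair_superset:
 assumes "finite S" "keys f\<subseteq>S" shows "pair f F = (\<Sum>x\<in>S. lookup f x * F x)"
 unfolding pair_def using assms
 by (intro sum.mono_neutral_left) (auto simp: in_keys_iff)

lemma pair_zero [simp]: "pair 0 F = 0" by (simp add: pair_def)

lemma pair_single [simp]: "pair (single x c) F = c * F x"
 by (simp add: pair_def keys_single)

lemma pair_add: "pair (f + g) F = pair f F + pair g F"
 unfolding pair_def by (rule setsum_keys_plus_distrib) (simp_all add: algebra_simps)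

lemma pair_scl: "pair (scl c f) F = c * pair f F"
 using pair_superset[OF finite_keys keys_scl, of c f F]
 by (simp add: pair_def sum_distrib_left mult.assoc)

lemma pair_uminus: "pair (- f) F = - pair f F"
 using pair_scl[of "-1" f F] by (simp add: scl_m1)

lemma pair_diff: "pair (f - g) F = pair f F - pair g F"
 using pair_add[of f "- g" F] by (simp add: pair_uminus)

lemma pair_sum: "pair (\<Sum>i\<in>I. f i) F = (\<Sum>i\<in>I. pair (f i) F)"
 by (induction I rule: infinite_finite_induct) (simp_all add: pair_add)

lemma pair_cong: "(\<And>x. x\<in>keys f ==> F x = G x) ==> pair f F = pair f G"
 unfolding pair_def by (rule sum.cong) auto

lemma pair_fun_add: "pair f (%x. F x + G x) = pair f F + pair f G"
 by (simp add: pair_def algebra_simps sum.distrib)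

lemma pair_fun_diff: "pair f (%x. F x - G x) = pair f F - pair f G"
 by (simp add: pair_def algebra_simps sum_subtractf)

lemma pair_cmult: "pair f (%x. c * F x) = c * pair f F"
 unfolding pair_def sum_distrib_left by (simp add: mult.left_commute)

lemma pair_cmult_right: "pair f (%x. F x * c) = pair f F * c"
 unfolding pair_def sum_distrib_right by (simp add: mult.assoc)

lemma pair_fun_zero [simp]: "pair f (%x. 0) = 0" by (simp add: pair_def)

lemma pair_fun_sum: "pair f (%x. \<Sum>i\<in>I. F i x) = (\<Sum>i\<in>I. pair f (F i))"
 by (induction I rule: infinite_finite_induct) (simp_all add: pair_fun_add)

lemma pair_swap: "pair f (%x. pair g (%y. F x y)) = pair g (%y. pair f (%x. F x y))"
proof -
 have "pair f (%x. pair g (%y. F x y)) = (\<Sum>x\<in>keys f. \<Sum>y\<in>keys g. lookup f x * (lookup g y * F x y))"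
  by (simp add: pair_def sum_distrib_left)
 also have "... = (\<Sum>y\<in>keys g. \<Sum>x\<in>keys f. lookup f x * (lookup g y * F x y))"
  by (rule sum.swap)
 also have "... = pair g (%y. pair f (%x. F x y))"
  by (simp add: pair_def sum_distrib_left mult.assoc mult.left_commute)
 finally show ?thesis .
qed

lemma pair_eqI: "(\<And>F. pair f F = pair g F) ==> f = g"
proof (rule poly_mapping_eqI)
 fix x assume h: "\<And>F. pair f F = pair g F"
 have "pair h (%y. if y = x then 1 else 0) = lookup h x" for h :: "'a \<Rightarrow>\<^sub>0 'b"
  by (simp add: pair_superset[of "insert x (keys h)"] subset_insertI if_distrib cong: if_cong)
 then show "lookup f x = lookup g x" using h by metis
qed

definition pbind :: "('b \<Rightarrow>\<^sub>0 'k::field) => ('b => ('c \<Rightarrow>\<^sub>0 'k)) => ('c \<Rightarrow>\<^sub>0 'k)" where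
 "pbind f G = (\<Sum>x\<in>keys f. scl (lookup f x) (G x))"

lemma pair_pbind: "pair (pbind f G) H = pair f (%x. pair (G x) H)"
 by (simp add: pbind_def pair_sum pair_scl) (simp add: pair_def)

lemma keys_sum_subset: "keys (\<Sum>i\<in>I. f i)\<subseteq>(\<Union>i\<in>I. keys (f i))"
proof (induction I rule: infinite_finite_induct)
 case (insert x F)
 then show ?case using keys_add[of "f x" "sum f F"] by auto
qed auto

lemma keys_pbind: "keys (pbind f G)\<subseteq>(\<Union>x\<in>keys f. keys (G x))"
proof -
 have "keys (pbind f G)\<subseteq>(\<Union>x\<in>keys f. keys (scl (lookup f x) (G x)))"
  unfolding pbind_def by (rule keys_sum_subset)
 also have "...\<subseteq>(\<Union>x\<in>keys f. keys (G x))"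
  by (rule UN_mono[OF subset_refl keys_scl])
 finally show ?thesis .
qed

section \<open>Vector spaces\<close>

lemma K_simps [simp]:
 "carrier (ring_of_type_algebra :: 'k::field ring) = UNIV"
 "x\<otimes>\<^bsub>(ring_of_type_algebra :: 'k::field ring)\<^esub>y = x * y"
 "x\<oplus>\<^bsub>(ring_of_type_algebra :: 'k::field ring)\<^esub>y = x + y"
 "\<one>\<^bsub>(ring_of_type_algebra :: 'k::field ring)\<^esub> = 1"
 "\<zero>\<^bsub>(ring_of_type_algebra :: 'k::field ring)\<^esub> = 0"
 by (simp_all add: ring_of_type_algebra_def)

lemma K_minus [simp]: "\<ominus>\<^bsub>(ring_of_type_algebra :: 'k::field ring)\<^esub> x = - x"
proof -
 interpret ring "ring_of_type_algebra :: 'k::field ring" by (rule ring_from_type_algebra)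
 show ?thesis using minus_equality[of "-x" x] by simp
qed

locale kspace = module "ring_of_type_algebra :: 'k::field ring" V
 for V :: "('k::field, 'a, 'm) module_scheme" (structure)

sublocale graded_space\<subseteq>kspace ..

definition vsum :: "('k::field, 'a, 'm) module_scheme => ('b \<Rightarrow>\<^sub>0 'k) => ('b => 'a) => 'a" where
 "vsum V f F = (\<Oplus>\<^bsub>V\<^esub>x\<in>keys f. lookup f x\<odot>\<^bsub>V\<^esub>F x)"

definition subsp :: "('k::field, 'a, 'm) module_scheme => 'a set => bool" where
 "subsp V N\<longleftrightarrow>N\<subseteq>carrier V\<and>\<zero>\<^bsub>V\<^esub>\<in>N\<and>(\<forall>x\<in>N. \<forall>y\<in>N. x\<oplus>\<^bsub>V\<^esub>y\<in>N) \<and>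
   (\<forall>c. \<forall>x\<in>N. c\<odot>\<^bsub>V\<^esub>x\<in>N)"

definition lf :: "('k::field, 'a, 'm) module_scheme => ('a => 'k) => bool" where
 "lf V l\<longleftrightarrow>(\<forall>x\<in>carrier V. \<forall>y\<in>carrier V. l (x\<oplus>\<^bsub>V\<^esub>y) = l x + l y) \<and>
   (\<forall>c. \<forall>x\<in>carrier V. l (c\<odot>\<^bsub>V\<^esub>x) = c * l x)"

definition lin :: "('k::field, 'a, 'm) module_scheme => ('k, 'b, 'n) module_scheme => ('a => 'b) => bool" where
 "lin V W h\<longleftrightarrow>h\<in>carrier V \<rightarrow> carrier W \<and>
   (\<forall>x\<in>carrier V. \<forall>y\<in>carrier V. h (x\<oplus>\<^bsub>V\<^esub>y) = h x\<oplus>\<^bsub>W\<^esub>h y) \<and>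
   (\<forall>c. \<forall>x\<in>carrier V. h (c\<odot>\<^bsub>V\<^esub>x) = c\<odot>\<^bsub>W\<^esub>h x)"

definition indep :: "('k::field, 'a, 'm) module_scheme => 'a set => bool" where
 "indep V Xs\<longleftrightarrow>Xs\<subseteq>carrier V\<and>(\<forall>f. keys f\<subseteq>Xs\<longrightarrow>vsum V f (%x. x) = \<zero>\<^bsub>V\<^esub>\<longrightarrow>f = 0)"

definition spn :: "('k::field, 'a, 'm) module_scheme => 'a set => 'a set" where
 "spn V Xs = {vsum V f (%x. x) | f. keys f\<subseteq>Xs}"

definition coord :: "('k::field, 'a, 'm) module_scheme => 'a set => 'a => ('a \<Rightarrow>\<^sub>0 'k)" where
 "coord V Xs v = (THE f. keys f\<subseteq>Xs\<and>vsum V f (%x. x) = v)"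

lemma lfD:
 assumes "lf V l" "x\<in>carrier V"
 shows "y\<in>carrier V ==> l (x\<oplus>\<^bsub>V\<^esub>y) = l x + l y" "l (c\<odot>\<^bsub>V\<^esub>x) = c * l x"
 using assms by (auto simp: lf_def)

lemma linD:
 assumes "lin V W h" "x\<in>carrier V"
 shows "h x\<in>carrier W" "y\<in>carrier V ==> h (x\<oplus>\<^bsub>V\<^esub>y) = h x\<oplus>\<^bsub>W\<^esub>h y"
  "h (c\<odot>\<^bsub>V\<^esub>x) = c\<odot>\<^bsub>W\<^esub>h x"
 using assms by (auto simp: lin_def)

lemma linI:
 assumes "\<And>x. x\<in>carrier V ==> h x\<in>carrier W"
  "\<And>x y. x\<in>carrier V ==> y\<in>carrier V ==> h (x\<oplus>\<^bsub>V\<^esub>y) = h x\<oplus>\<^bsub>W\<^esub>h y"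
  "\<And>c x. x\<in>carrier V ==> h (c\<odot>\<^bsub>V\<^esub>x) = c\<odot>\<^bsub>W\<^esub>h x"
 shows "lin V W h"
 using assms by (auto simp: lin_def)

lemma lfI:
 assumes "\<And>x y. x\<in>carrier V ==> y\<in>carrier V ==> l (x\<oplus>\<^bsub>V\<^esub>y) = l x + l y"
  "\<And>c x. x\<in>carrier V ==> l (c\<odot>\<^bsub>V\<^esub>x) = c * l x"
 shows "lf V l"
 using assms by (auto simp: lf_def)

lemma lf_lin: "lf W l ==> lin V W h ==> lf V (%x. l (h x))"
 unfolding lf_def lin_def by (auto simp: Pi_iff)

lemma lin_comp: "lin W Z g ==> lin V W h ==> lin V Z (%x. g (h x))"
 unfolding lin_def by (auto simp: Pi_iff)

lemma lf_0 [simp]: "lf V (%x. 0)" by (simp add: lf_def)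

lemma lf_add: "lf V l ==> lf V l' ==> lf V (%x. l x + l' x)" by (simp add: lf_def algebra_simps)

lemma lf_diff: "lf V l ==> lf V l' ==> lf V (%x. l x - l' x)" by (simp add: lf_def algebra_simps)

lemma lf_cmult: "lf V l ==> lf V (%x. c * l x)" by (simp add: lf_def algebra_simps)

lemma lf_cmult_right: "lf V l ==> lf V (%x. l x * c)" by (simp add: lf_def algebra_simps)

lemma lf_sum: "(\<And>i. i\<in>I ==> lf V (l i)) ==> lf V (%x. \<Sum>i\<in>I. l i x)"
 by (induction I rule: infinite_finite_induct) (auto intro: lf_add)

lemma lf_pair: "(\<And>x. x\<in>keys f ==> lf V (F x)) ==> lf V (%v. pair f (%x. F x v))"
 unfolding pair_def by (intro lf_sum lf_cmult)

lemma subspD: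
 assumes "subsp V N"
 shows "x\<in>N ==> x\<in>carrier V" "\<zero>\<^bsub>V\<^esub>\<in>N" "x\<in>N ==> y\<in>N ==> x\<oplus>\<^bsub>V\<^esub>y\<in>N"
  "x\<in>N ==> c\<odot>\<^bsub>V\<^esub>x\<in>N"
 using assms by (auto simp: subsp_def)

context kspace begin

lemma smult_in [simp, intro]: "x\<in>carrier V ==> c\<odot>x\<in>carrier V" by simp

lemma smult_addl: "x\<in>carrier V ==> (a + b)\<odot>x = a\<odot>x\<oplus>b\<odot>x"
 using smult_l_distr[of a b x] by simp

lemma smult_addr: "x\<in>carrier V ==> y\<in>carrier V ==> a\<odot>(x\<oplus>y) = a\<odot>x\<oplus>a\<odot>y"
 using smult_r_distr[of a x y] by simp

lemma smult_smult: "x\<in>carrier V ==> a\<odot>(b\<odot>x) = (a * b)\<odot>x"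
 using smult_assoc1[of a b x] by simp

lemma smult_1 [simp]: "x\<in>carrier V ==> 1\<odot>x = x"
 using smult_one[of x] by simp

lemma smult_0 [simp]: "x\<in>carrier V ==> 0\<odot>x = \<zero>"
 using smult_l_null[of x] by simp

lemma smult_zero [simp]: "c\<odot>\<zero> = \<zero>"
 using smult_r_null[of c] by simp

lemma neg_smult: "x\<in>carrier V ==>\<ominus>x = (-1)\<odot>x"
 using smult_l_minus[of 1 x] by simp

lemma subsp_submodule: "submodule N ring_of_type_algebra V\<longleftrightarrow>subsp V N"
proof
 assume "submodule N ring_of_type_algebra V"
 then show "subsp V N" unfolding subsp_def using submoduleE[of N] subgroup.one_closed[OF submodule.axioms(1), of N ring_of_type_algebra V]
  by auto
next
 assume "subsp V N"
 then show "submodule N ring_of_type_algebra V"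
  by (intro submoduleI) (auto simp: subsp_def neg_smult subset_iff)
qed

lemma minus_eq: "x\<in>carrier V ==> y\<in>carrier V ==> x\<ominus>y = x\<oplus>(-1)\<odot>y"
 by (simp add: a_minus_def neg_smult)

lemma lf_minus: "lf V l ==> x\<in>carrier V ==> y\<in>carrier V ==> l (x\<ominus>y) = l x - l y"
 by (simp add: minus_eq lfD)

lemma lf_zero: "lf V l ==> l \<zero> = 0"
 using lfD(2)[of V l \<zero> 0] by simp

lemma subsp_minus: "subsp V N ==> x\<in>N ==> y\<in>N ==> x\<ominus>y\<in>N"
 using subspD[of V N] by (simp add: minus_eq)

lemma subsp_carrier: "subsp V (carrier V)" by (simp add: subsp_def)

lemma subsp_zero: "subsp V {\<zero>}" by (simp add: subsp_def)

lemma subsp_Int: "subsp V N ==> subsp V M ==> subsp V (N\<inter>M)" by (auto simp: subsp_def)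

lemma vsum_closed [simp, intro]: "(\<And>x. x\<in>keys f ==> F x\<in>carrier V) ==> vsum V f F\<in>carrier V"
 unfolding vsum_def by (intro finsum_closed) auto

lemma vsum_superset:
 assumes "finite S" "keys f\<subseteq>S" "\<And>x. x\<in>S ==> F x\<in>carrier V"
 shows "vsum V f F = (\<Oplus>x\<in>S. lookup f x\<odot>F x)"
 unfolding vsum_def using assms
 by (intro add.finprod_mono_neutral_cong_left) (auto simp: in_keys_iff)

lemma vsum_zero [simp]: "vsum V 0 F = \<zero>" by (simp add: vsum_def)

lemma vsum_single [simp]: "F x\<in>carrier V ==> vsum V (single x c) F = c\<odot>F x"
 by (cases "c = 0") (simp_all add: vsum_def keys_single)

lemma vsum_add:
 assumes "\<And>x. x\<in>keys f\<union>keys g ==> F x\<in>carrier V"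
 shows "vsum V (f + g) F = vsum V f F\<oplus>vsum V g F"
proof -
 let ?S = "keys f\<union>keys g"
 have "vsum V (f + g) F = (\<Oplus>x\<in>?S. lookup (f + g) x\<odot>F x)"
  using keys_add[of f g] assms by (intro vsum_superset) auto
 also have "... = (\<Oplus>x\<in>?S. lookup f x\<odot>F x\<oplus>lookup g x\<odot>F x)"
  using assms by (intro finsum_cong') (auto simp: lookup_add smult_addl)
 also have "... = (\<Oplus>x\<in>?S. lookup f x\<odot>F x)\<oplus>(\<Oplus>x\<in>?S. lookup g x\<odot>F x)"
  using assms by (intro finsum_addf) auto
 also have "... = vsum V f F\<oplus>vsum V g F"
  using assms vsum_superset[of ?S f F] vsum_superset[of ?S g F] by simp
 finally show ?thesis .
qed

lemma vsum_scl:
 assumes "\<And>x. x\<in>keys f ==> F x\<in>carrier V"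
 shows "vsum V (scl c f) F = c\<odot>vsum V f F"
proof -
 have "vsum V (scl c f) F = (\<Oplus>x\<in>keys f. lookup (scl c f) x\<odot>F x)"
  using assms keys_scl[of c f] by (intro vsum_superset) auto
 also have "... = (\<Oplus>x\<in>keys f. c\<odot>(lookup f x\<odot>F x))"
  using assms by (intro finsum_cong') (auto simp: smult_smult)
 also have "... = c\<odot>vsum V f F"
  unfolding vsum_def using assms by (subst finsum_smult_ldistr) auto
 finally show ?thesis .
qed

lemma vsum_in:
 assumes N: "subsp V N" and F: "\<And>x. x\<in>keys f ==> F x\<in>N"
 shows "vsum V f F\<in>N"
proof -
 have "(\<Oplus>x\<in>S. lookup f x\<odot>F x)\<in>N" if "finite S" "S\<subseteq>keys f" for S
  using that
 proof (induction S)
  case (insert x S)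
  have "(\<Oplus>x\<in>insert x S. lookup f x\<odot>F x) = lookup f x\<odot>F x\<oplus>(\<Oplus>x\<in>S. lookup f x\<odot>F x)"
   using insert F subspD(1)[OF N] by (intro finsum_insert) auto
  then show ?case using insert F subspD[OF N] by auto
 qed (use subspD(2)[OF N] in simp)
 then show ?thesis by (simp add: vsum_def)
qed

lemma lf_vsum:
 assumes l: "lf V l" and F: "\<And>x. x\<in>keys f ==> F x\<in>carrier V"
 shows "l (vsum V f F) = pair f (%x. l (F x))"
proof -
 have "l (\<Oplus>x\<in>S. lookup f x\<odot>F x) = (\<Sum>x\<in>S. lookup f x * l (F x))" if "finite S" "S\<subseteq>keys f" for S
  using that
 proof (induction S)
  case (insert x S)
  have "(\<Oplus>x\<in>insert x S. lookup f x\<odot>F x) = lookup f x\<odot>F x\<oplus>(\<Oplus>x\<in>S. lookup f x\<odot>F x)"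
   using insert F by (intro finsum_insert) auto
  moreover have "(\<Oplus>x\<in>S. lookup f x\<odot>F x)\<in>carrier V"
   using insert F by (intro finsum_closed) auto
  ultimately show ?case using insert F by (auto simp: lfD[OF l])
 qed (simp add: lf_zero[OF l])
 then show ?thesis by (simp add: vsum_def pair_def)
qed

lemma indepD: "indep V Xs ==> keys f\<subseteq>Xs ==> vsum V f (%x. x) = \<zero> ==> f = 0"
 by (simp add: indep_def)

lemma indep_in: "indep V Xs ==> x\<in>Xs ==> x\<in>carrier V"
 by (auto simp: indep_def)

lemma subsp_spn:
 assumes "Xs\<subseteq>carrier V" shows "subsp V (spn V Xs)"
 unfolding subsp_def
proof (intro conjI ballI allI)
 show "spn V Xs\<subseteq>carrier V" using assms by (auto simp: spn_def)
 show "\<zero>\<in>spn V Xs" unfolding spn_def by (auto intro!: exI[of _ 0])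
next
 fix x y assume "x\<in>spn V Xs" "y\<in>spn V Xs"
 then obtain f g where "keys f\<subseteq>Xs" "x = vsum V f (%x. x)" "keys g\<subseteq>Xs" "y = vsum V g (%x. x)"
  by (auto simp: spn_def)
 then show "x\<oplus>y\<in>spn V Xs" using keys_add[of f g] assms unfolding spn_def
  by (auto intro!: exI[of _ "f + g"] vsum_add[symmetric])
next
 fix c x assume "x\<in>spn V Xs"
 then obtain f where "keys f\<subseteq>Xs" "x = vsum V f (%x. x)" by (auto simp: spn_def)
 then show "c\<odot>x\<in>spn V Xs" using keys_scl[of c f] assms unfolding spn_def
  by (auto intro!: exI[of _ "scl c f"] vsum_scl[symmetric])
qed

lemma spn_superset: "Xs\<subseteq>carrier V ==> Xs\<subseteq>spn V Xs"
 unfolding spn_def by (auto intro!: exI[of _ "single _ 1"] simp: keys_single)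

lemma spn_least: "subsp V N ==> Xs\<subseteq>N ==> spn V Xs\<subseteq>N"
 unfolding spn_def by (auto intro: vsum_in)

lemma indep_insert:
 assumes Xs: "indep V Xs" and v: "v\<in>carrier V" "v \<notin> spn V Xs"
 shows "indep V (insert v Xs)"
 unfolding indep_def
proof (intro conjI allI impI)
 show "insert v Xs\<subseteq>carrier V" using assms by (auto simp: indep_def)
 fix f assume f: "keys f\<subseteq>insert v Xs" and z: "vsum V f (%x. x) = \<zero>"
 have Xc: "Xs\<subseteq>carrier V" using Xs by (simp add: indep_def)
 define c where "c = lookup f v"
 define g where "g = f - single v c"
 have g: "keys g\<subseteq>Xs" using f
  by (auto simp: g_def c_def in_keys_iff lookup_minus lookup_single when_def subset_iff split: if_splits)
 have fg: "f = g + single v c" by (simp add: g_def)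
 have eq: "vsum V g (%x. x)\<oplus>c\<odot>v = \<zero>"
  using z v(1) g Xc unfolding fg by (subst (asm) vsum_add) (auto simp: keys_single split: if_splits)
 have gc: "vsum V g (%x. x)\<in>carrier V" using g Xc by auto
 show "f = 0"
 proof (cases "c = 0")
  case True
  then show ?thesis using indepD[OF Xs g] eq v(1) gc fg by auto
 next
  case False
  have "\<ominus> vsum V g (%x. x) = c\<odot>v" using eq gc v(1)
   by (metis a_comm minus_equality smult_in)
  then have "v = (- inverse c)\<odot>vsum V g (%x. x)"
   using False v(1) gc by (metis (no_types, lifting) Fields.field_inverse mult_minus1_right neg_smult smult_1 smult_smult)
  then have "v\<in>spn V Xs" using subsp_spn[OF Xc] g subspD(4)
   by (metis (mono_tags, lifting) mem_Collect_eq spn_def)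
  then show ?thesis using v(2) by simp
 qed
qed

lemma basis_extend:
 assumes "Y\<subseteq>S" "S\<subseteq>carrier V" "indep V Y"
 shows "\<exists>Xs. Y\<subseteq>Xs\<and>Xs\<subseteq>S\<and>indep V Xs\<and>S\<subseteq>spn V Xs"
proof -
 define AA where "AA = {Xs. Y\<subseteq>Xs\<and>Xs\<subseteq>S\<and>indep V Xs}"
 have "\<exists>U\<in>AA. \<forall>Xs\<in>CC. Xs\<subseteq>U" if CC: "subset.chain AA CC" for CC
 proof (cases "CC = {}")
  case True then show ?thesis using assms by (auto simp: AA_def)
 next
  case False
  have sub: "CC\<subseteq>AA" using CC by (simp add: subset_chain_def)
  have "indep V (\<Union>CC)"
   unfolding indep_def
  proof (intro conjI allI impI)
   show "\<Union> CC\<subseteq>carrier V" using sub assms(2) by (auto simp: AA_def)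
   fix f assume "keys f\<subseteq>\<Union>CC" and z: "vsum V f (%x. x) = \<zero>"
   then obtain Xs where "Xs\<in>CC" "keys f\<subseteq>Xs"
    using finite_subset_Union_chain[of "keys f" CC AA] False CC by auto
   then show "f = 0" using indepD[of Xs f] z sub by (auto simp: AA_def)
  qed
  moreover have "Y\<subseteq>\<Union>CC" "\<Union>CC\<subseteq>S" using sub False by (auto simp: AA_def subset_iff)
  ultimately have "\<Union>CC\<in>AA" by (simp add: AA_def)
  then show ?thesis by (intro bexI[of _ "\<Union>CC"]) auto
 qed
 then obtain Xs where Xs: "Xs\<in>AA" and mx: "\<And>Z. Z\<in>AA ==> Xs\<subseteq>Z ==> Z = Xs"
  using subset_Zorn[of AA] by metis
 have "S\<subseteq>spn V Xs"
 proof
  fix v assume v: "v\<in>S"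
  show "v\<in>spn V Xs"
  proof (rule ccontr)
   assume nv: "v \<notin> spn V Xs"
   have "indep V (insert v Xs)" using Xs nv v assms by (intro indep_insert) (auto simp: AA_def)
   then have "insert v Xs\<in>AA" using Xs v by (auto simp: AA_def)
   then have "v\<in>Xs" using mx[of "insert v Xs"] by auto
   then show False using nv spn_superset[of Xs] Xs assms(2) by (auto simp: AA_def)
  qed
 qed
 then show ?thesis using Xs by (auto simp: AA_def)
qed

lemma coord_unique:
 assumes Xs: "indep V Xs" and f: "keys f\<subseteq>Xs" "keys g\<subseteq>Xs"
  and eq: "vsum V f (%x. x) = vsum V g (%x. x)"
 shows "f = g"
proof -
 have c: "x\<in>keys f\<union>keys g ==> x\<in>carrier V" for x using Xs f by (auto simp: indep_def)
 have k: "keys (scl (-1) g)\<subseteq>keys g" by (rule keys_scl)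
 have "vsum V (f + scl (-1) g) (%x. x) = vsum V f (%x. x)\<oplus>(-1)\<odot>vsum V g (%x. x)"
  using c k by (subst vsum_add) (auto simp: vsum_scl)
 also have "... = \<zero>" unfolding eq using c by (subst neg_smult[symmetric]) (auto simp: r_neg)
 finally have "f + scl (-1) g = 0"
  using f k keys_add[of f "scl (-1) g"] by (intro indepD[OF Xs]) auto
 then show ?thesis by (simp add: scl_m1)
qed

lemma coord:
 assumes Xs: "indep V Xs" and v: "v\<in>spn V Xs"
 shows "keys (coord V Xs v)\<subseteq>Xs" "vsum V (coord V Xs v) (%x. x) = v"
proof -
 have "\<exists>!f. keys f\<subseteq>Xs\<and>vsum V f (%x. x) = v"
  using v coord_unique[OF Xs] by (auto simp: spn_def)
 from theI'[OF this] show "keys (coord V Xs v)\<subseteq>Xs" "vsum V (coord V Xs v) (%x. x) = v"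
  by (simp_all add: coord_def)
qed

lemma coord_eqI:
 assumes Xs: "indep V Xs" and f: "keys f\<subseteq>Xs" "vsum V f (%x. x) = v"
 shows "coord V Xs v = f"
proof -
 have v: "v\<in>spn V Xs" using f by (auto simp: spn_def)
 show ?thesis using coord_unique[OF Xs coord(1)[OF Xs v] f(1)] coord(2)[OF Xs v] f(2) by simp
qed

lemma coord_basis: "indep V Xs ==> x\<in>Xs ==> coord V Xs x = single x 1"
 by (rule coord_eqI) (auto simp: keys_single indep_in)

lemma coord_add:
 assumes Xs: "indep V Xs" and v: "v\<in>spn V Xs" "w\<in>spn V Xs"
 shows "coord V Xs (v\<oplus>w) = coord V Xs v + coord V Xs w"
proof (rule coord_eqI[OF Xs])
 note c = coord[OF Xs v(1)] coord[OF Xs v(2)]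
 show "keys (coord V Xs v + coord V Xs w)\<subseteq>Xs" using c(1,3) keys_add[of "coord V Xs v" "coord V Xs w"] by blast
 show "vsum V (coord V Xs v + coord V Xs w) (%x. x) = v\<oplus>w"
  using c indep_in[OF Xs] by (subst vsum_add) (auto simp: subset_iff)
qed

lemma coord_smult:
 assumes Xs: "indep V Xs" and v: "v\<in>spn V Xs"
 shows "coord V Xs (c\<odot>v) = scl c (coord V Xs v)"
proof (rule coord_eqI[OF Xs])
 note c = coord[OF Xs v]
 show "keys (scl c (coord V Xs v))\<subseteq>Xs" using c(1) keys_scl[of c "coord V Xs v"] by blast
 show "vsum V (scl c (coord V Xs v)) (%x. x) = c\<odot>v"
  using c indep_in[OF Xs] by (subst vsum_scl) (auto simp: subset_iff)
qed

lemma lf_coord: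
 assumes "indep V Xs" "carrier V\<subseteq>spn V Xs"
 shows "lf V (%v. pair (coord V Xs v) h)"
 using assms by (intro lfI) (auto simp: coord_add coord_smult pair_add pair_scl subset_iff)

lemma exists_basis:
 assumes "subsp V N" shows "\<exists>Xs. indep V Xs\<and>Xs\<subseteq>N\<and>spn V Xs = N"
proof -
 have "indep V {}" by (simp add: indep_def)
 then obtain Xs where "Xs\<subseteq>N" "indep V Xs" "N\<subseteq>spn V Xs"
  using basis_extend[of "{}" N] assms by (auto simp: subsp_def)
 then show ?thesis using spn_least[OF assms] by blast
qed

text \<open>
  Extend a basis of \<open>N\<close> by \<open>v\<close> and take a coordinate. All later equations and memberships between
  vectors are reduced to scalars by this fact.
\<close>

lemma separation:
 assumes N: "subsp V N" and v: "v\<in>carrier V" "v \<notin> N"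
 shows "\<exists>l. lf V l\<and>(\<forall>x\<in>N. l x = 0)\<and>l v = 1"
proof -
 obtain Xs where Xs: "indep V Xs" "Xs\<subseteq>N" "spn V Xs = N" using exists_basis[OF N] by auto
 have i: "indep V (insert v Xs)" using Xs v by (intro indep_insert) auto
 obtain Z where Z: "insert v Xs\<subseteq>Z" "indep V Z" "carrier V\<subseteq>spn V Z"
  using basis_extend[OF _ _ i, of "carrier V"] i by (auto simp: indep_def)
 define h :: "'a => 'k" where "h x = (if x = v then 1 else 0)" for x
 have "pair (coord V Z x) h = 0" if "x\<in>N" for x
 proof -
  have "x\<in>spn V Xs" using that Xs by simp
  then obtain f where f: "keys f\<subseteq>Xs" "vsum V f (%x. x) = x" by (auto simp: spn_def)
  have "coord V Z x = f" using f Z by (intro coord_eqI) auto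
  then show ?thesis using f Xs v by (auto simp: pair_def h_def intro!: sum.neutral)
 qed
 moreover have "pair (coord V Z v) h = 1" using Z by (simp add: coord_basis h_def)
 ultimately show ?thesis using lf_coord[OF Z(2,3), of h] by blast
qed

lemma lf_eqI:
 assumes "v\<in>carrier V" "w\<in>carrier V" "\<And>l. lf V l ==> l v = l w"
 shows "v = w"
proof (rule ccontr)
 assume "v \<noteq> w"
 then have "v\<ominus>w \<notin> {\<zero>}" using assms minus_equality[of v "\<ominus> w"] by (auto simp: a_minus_def)
 then obtain l where "lf V l" "l (v\<ominus>w) = 1"
  using separation[OF subsp_zero, of "v\<ominus>w"] assms by auto
 then show False using assms(3)[of l] lf_minus[of l v w] assms by simp
qed

lemma lf_subspI:
 assumes "subsp V N" "v\<in>carrier V" "\<And>l. lf V l ==> (\<And>x. x\<in>N ==> l x = 0) ==> l v = 0"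
 shows "v\<in>N"
 using separation[OF assms(1,2)] assms(3) by fastforce

end

lemma lin_vsum:
 assumes V: "kspace V" and W: "kspace W" and h: "lin V W h" and F: "\<And>x. x\<in>keys f ==> F x\<in>carrier V"
 shows "h (vsum V f F) = vsum W f (%x. h (F x))"
proof -
 interpret V: kspace V by fact
 interpret W: kspace W by fact
 show ?thesis
 proof (rule W.lf_eqI)
  fix l assume l: "lf W l"
  show "l (h (vsum V f F)) = l (vsum W f (%x. h (F x)))"
   using V.lf_vsum[OF lf_lin[OF l h], of f F] W.lf_vsum[OF l, of f "%x. h (F x)"] F linD(1)[OF h]
   by simp
 qed (use F linD(1)[OF h] in auto)
qed

section \<open>Gradings\<close>

definition prestr :: "('b \<Rightarrow>\<^sub>0 'k::field) => 'b set => ('b \<Rightarrow>\<^sub>0 'k)" where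
 "prestr f S = pbind f (%x. if x\<in>S then single x 1 else 0)"

lemma pair_prestr: "pair (prestr f S) F = pair f (%x. if x\<in>S then F x else 0)"
 unfolding prestr_def pair_pbind by (intro pair_cong) auto

lemma keys_prestr: "keys (prestr f S)\<subseteq>keys f\<inter>S"
 unfolding prestr_def using keys_pbind[of f "%x. if x\<in>S then single x 1 else 0"]
 by (auto simp: keys_single split: if_splits)

lemma prestr_split: "f = prestr f S + prestr f (- S)"
 by (rule pair_eqI) (simp add: pair_add pair_prestr flip: pair_fun_add, rule pair_cong, auto)

lemma (in kspace) indep_Un:
 assumes i: "indep V Xs" "indep V Ys" and d: "spn V Xs\<inter>spn V Ys\<subseteq>{\<zero>}"
 shows "indep V (Xs\<union>Ys)"
 unfolding indep_def
proof (intro conjI allI impI)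
 have c: "Xs\<subseteq>carrier V" "Ys\<subseteq>carrier V" using i by (auto simp: indep_def)
 then show "Xs\<union>Ys\<subseteq>carrier V" by auto
 fix f assume f: "keys f\<subseteq>Xs\<union>Ys" and z: "vsum V f (%x. x) = \<zero>"
 let ?g = "prestr f Xs" and ?h = "prestr f (- Xs)"
 have k: "keys ?g\<subseteq>Xs" "keys ?h\<subseteq>Ys" using keys_prestr[of f] f by blast+
 have s: "vsum V ?g (%x. x)\<oplus>vsum V ?h (%x. x) = \<zero>"
  using z k c by (subst (asm) prestr_split[of f Xs], subst (asm) vsum_add) auto
 have gc: "vsum V ?g (%x. x)\<in>carrier V" "vsum V ?h (%x. x)\<in>carrier V"
  using k c by (blast intro: vsum_closed)+
 have "vsum V ?g (%x. x) = (-1)\<odot>vsum V ?h (%x. x)"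
  using s gc minus_equality[OF s] by (simp add: neg_smult)
 moreover have "vsum V ?h (%x. x)\<in>spn V Ys" "vsum V ?g (%x. x)\<in>spn V Xs"
  using k by (auto simp: spn_def)
 ultimately have "vsum V ?g (%x. x)\<in>spn V Xs\<inter>spn V Ys"
  using subspD(4)[OF subsp_spn[OF c(2)]] by auto
 then have "vsum V ?g (%x. x) = \<zero>" using d by auto
 then have "?g = 0" "?h = 0" using s gc k i by (auto intro: indepD)
 then show "f = 0" using prestr_split[of f Xs] by simp
qed

definition hset :: "('k, 'g, 'a, 'm) graded_module_scheme => 'a set" where
 "hset V = (\<Union>g. homog V g)"

definition dg :: "('k, 'g, 'a, 'm) graded_module_scheme => 'a => 'g" where
 "dg V x = (SOME g. x\<in>homog V g)"

context graded_space begin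

lemma homog_subsp: "subsp V (homog V g)"
 using homog_submodule subsp_submodule by auto

lemma homog_carrier [simp, intro]: "x\<in>homog V g ==> x\<in>carrier V"
 using subspD(1)[OF homog_subsp] .

lemma hset_carrier: "x\<in>hset V ==> x\<in>carrier V" by (auto simp: hset_def)

lemma dg_in: "x\<in>hset V ==> x\<in>homog V (dg V x)"
 unfolding hset_def dg_def by (auto intro: someI)

lemma hsetI: "x\<in>homog V g ==> x\<in>hset V" by (auto simp: hset_def)

lemma zero_homog [simp]: "\<zero>\<in>homog V g" using homog_subsp[of g] by (simp add: subsp_def)

lemma decomp: "v\<in>carrier V ==> decomposition V v (component V v)"
 unfolding component_def by (rule theI'[OF ex1_decomposition])

lemma comp_in [simp]: "v\<in>carrier V ==> component V v g\<in>homog V g"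
 using decomp[of v] by (simp add: decomposition_def)

lemma comp_carrier [simp]: "v\<in>carrier V ==> component V v g\<in>carrier V"
 using comp_in homog_carrier by blast

lemma finite_degrees [simp]: "v\<in>carrier V ==> finite (degrees V v)"
 using decomp[of v] by (simp add: decomposition_def degrees_def)

lemma lf_finsum:
 assumes l: "lf V l" and S: "finite S" and F: "\<And>x. x\<in>S ==> F x\<in>carrier V"
 shows "l (\<Oplus>x\<in>S. F x) = (\<Sum>x\<in>S. l (F x))"
 using S F by (induction S) (auto simp: lf_zero[OF l] lfD(1)[OF l])

lemma comp_sum: "v\<in>carrier V ==> v = (\<Oplus>g\<in>degrees V v. component V v g)"
 using decomp[of v] by (simp add: decomposition_def degrees_def)

lemma lf_comp_sum: "lf V l ==> v\<in>carrier V ==> l v = (\<Sum>g\<in>degrees V v. l (component V v g))"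
 by (subst comp_sum, assumption, subst lf_finsum) auto

lemma comp_sum_in: "subsp V N ==> v\<in>carrier V ==> (\<And>g. component V v g\<in>N) ==> v\<in>N"
 by (rule lf_subspI) (auto simp: lf_comp_sum[of _ v])

lemma component_eqI:
 assumes c: "\<And>g. c g\<in>homog V g" and S: "finite S" "\<And>g. g \<notin> S ==> c g = \<zero>"
  and v: "v\<in>carrier V" and l: "\<And>l. lf V l ==> l v = (\<Sum>g\<in>S. l (c g))"
 shows "component V v = c"
proof -
 have fin: "finite {g. c g \<noteq> \<zero>}" using S by (rule_tac finite_subset[of _ S]) auto
 have "v = (\<Oplus>g\<in>{g. c g \<noteq> \<zero>}. c g)"
 proof (rule lf_eqI)
  fix l' assume l': "lf V l'"
  have "l' v = (\<Sum>g\<in>S. l' (c g))" using l l' by simp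
  also have "... = (\<Sum>g\<in>{g. c g \<noteq> \<zero>}. l' (c g))"
   using S lf_zero[OF l'] by (intro sum.mono_neutral_right) auto
  also have "... = l' (\<Oplus>g\<in>{g. c g \<noteq> \<zero>}. c g)"
   using c by (subst lf_finsum[OF l' fin]) auto
  finally show "l' v = l' (\<Oplus>g\<in>{g. c g \<noteq> \<zero>}. c g)" .
 qed (use v c in \<open>auto intro!: finsum_closed\<close>)
 then have "decomposition V v c" using c fin by (simp add: decomposition_def)
 then show ?thesis using decomp[OF v] ex1_decomposition[OF v] by auto
qed

lemma comp_homog: "v\<in>homog V g ==> component V v = (%h. if h = g then v else \<zero>)"
 by (rule component_eqI[of _ "{g}"]) auto

lemma comp_homog_same [simp]: "v\<in>homog V g ==> component V v g = v"
 by (simp add: comp_homog)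

lemma degrees_homog: "v\<in>homog V g ==> degrees V v = (if v = \<zero> then {} else {g})"
 by (auto simp: degrees_def comp_homog)

lemma homog_unique: "v\<in>homog V g ==> v\<in>homog V h ==> g \<noteq> h ==> v = \<zero>"
 using comp_homog[of v g] comp_homog[of v h] by metis

lemma dg_eq: "v\<in>homog V g ==> v \<noteq> \<zero> ==> dg V v = g"
 using homog_unique[of v g "dg V v"] dg_in[OF hsetI] by blast

lemma comp_add:
 assumes "v\<in>carrier V" "w\<in>carrier V"
 shows "component V (v\<oplus>w) g = component V v g\<oplus>component V w g"
proof -
 have "component V (v\<oplus>w) = (%g. component V v g\<oplus>component V w g)"
 proof (rule component_eqI[of _ "degrees V v\<union>degrees V w"])
  fix l assume l: "lf V l"
  have "l v = (\<Sum>g\<in>degrees V v\<union>degrees V w. l (component V v g))"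
   using assms lf_zero[OF l] by (subst lf_comp_sum[OF l])
    (auto intro!: sum.mono_neutral_left simp: degrees_def[of V v] finite_degrees[unfolded degrees_def])
  moreover have "l w = (\<Sum>g\<in>degrees V v\<union>degrees V w. l (component V w g))"
   using assms lf_zero[OF l] by (subst lf_comp_sum[OF l])
    (auto intro!: sum.mono_neutral_left simp: degrees_def[of V w] finite_degrees[unfolded degrees_def])
  ultimately show "l (v\<oplus>w) = (\<Sum>g\<in>degrees V v\<union>degrees V w. l (component V v g\<oplus>component V w g))"
   using assms by (simp add: lfD[OF l] sum.distrib)
 qed (use assms subspD(3)[OF homog_subsp] finite_degrees[unfolded degrees_def] in \<open>auto simp: degrees_def\<close>)
 then show ?thesis by simp
qed

lemma comp_smult:
 assumes "v\<in>carrier V"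
 shows "component V (c\<odot>v) g = c\<odot>component V v g"
proof -
 have "component V (c\<odot>v) = (%g. c\<odot>component V v g)"
 proof (rule component_eqI[of _ "degrees V v"])
  fix l assume l: "lf V l"
  show "l (c\<odot>v) = (\<Sum>g\<in>degrees V v. l (c\<odot>component V v g))"
   using assms lf_comp_sum[OF l assms] by (simp add: lfD[OF l] sum_distrib_left)
 qed (use assms subspD(4)[OF homog_subsp] finite_degrees[unfolded degrees_def] in \<open>auto simp: degrees_def\<close>)
 then show ?thesis by simp
qed

lemma lin_comp_g: "lin V V (%v. component V v g)"
 by (intro linI) (auto simp: comp_add comp_smult)

lemma gsub_subsp: "graded_subspace V N\<longleftrightarrow>subsp V N\<and>(\<forall>x\<in>N. \<forall>g. component V x g\<in>N)"
 by (simp add: graded_subspace_def subsp_submodule)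

lemma homog_basis_extend:
 assumes N: "graded_subspace V N" and Y: "indep V Ys" "Ys\<subseteq>N\<inter>hset V"
 shows "\<exists>Xs. Ys\<subseteq>Xs\<and>indep V Xs\<and>Xs\<subseteq>N\<inter>hset V\<and>spn V Xs = N"
proof -
 have N': "subsp V N" using N by (simp add: gsub_subsp)
 have "N\<inter>hset V\<subseteq>carrier V" using subspD(1)[OF N'] by auto
 then obtain Xs where Xs: "Ys\<subseteq>Xs" "Xs\<subseteq>N\<inter>hset V" "indep V Xs" "N\<inter>hset V\<subseteq>spn V Xs"
  using basis_extend[OF Y(2) _ Y(1)] by auto
 have s: "subsp V (spn V Xs)" using Xs by (intro subsp_spn) (auto simp: indep_def)
 have "N\<subseteq>spn V Xs"
 proof
  fix v assume v: "v\<in>N"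
  then have vc: "v\<in>carrier V" using subspD(1)[OF N'] by auto
  have "component V v g\<in>spn V Xs" for g
   using N v vc Xs(4) hsetI[OF comp_in[OF vc, of g]] by (auto simp: gsub_subsp)
  then show "v\<in>spn V Xs" using comp_sum_in[OF s vc] by auto
 qed
 then show ?thesis using Xs spn_least[OF N', of Xs] by (intro exI[of _ Xs]) auto
qed

lemma homog_basis:
 assumes N: "graded_subspace V N"
 shows "\<exists>Xs. indep V Xs\<and>Xs\<subseteq>N\<inter>hset V\<and>spn V Xs = N"
 using homog_basis_extend[OF N, of "{}"] by (auto simp: indep_def)

lemma gsub_carrier: "graded_subspace V (carrier V)" by (simp add: gsub_subsp subsp_carrier)

lemma coord_homog:
 assumes Xs: "indep V Xs" "Xs\<subseteq>hset V" "carrier V\<subseteq>spn V Xs" and v: "v\<in>homog V g"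
 shows "keys (coord V Xs v)\<subseteq>homog V g"
proof -
 have vs: "v\<in>spn V Xs" using Xs v by auto
 note c = coord[OF Xs(1) vs]
 let ?f = "prestr (coord V Xs v) (homog V g)"
 have cc: "x\<in>keys (coord V Xs v) ==> x\<in>carrier V" for x using c(1) Xs hset_carrier by auto
 have kf: "x\<in>keys ?f ==> x\<in>carrier V" for x using keys_prestr[of "coord V Xs v"] cc by auto
 have "vsum V ?f (%x. x) = v"
 proof (rule lf_eqI)
  fix l assume l: "lf V l"
  have lg: "lf V (%v. l (component V v g))" using lf_lin[OF l lin_comp_g] .
  have "l v = l (component V v g)" using v by simp
  also have "... = l (component V (vsum V (coord V Xs v) (%x. x)) g)" using c(2) by simp
  also have "... = pair (coord V Xs v) (%x. l (component V x g))"
   by (rule lf_vsum[OF lg]) (use cc in auto)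
  also have "... = pair (coord V Xs v) (%x. if x\<in>homog V g then l x else 0)"
  proof (rule pair_cong)
   fix x assume "x\<in>keys (coord V Xs v)"
   then obtain h where h: "x\<in>homog V h" using c(1) Xs(2) by (auto simp: hset_def)
   show "l (component V x g) = (if x\<in>homog V g then l x else 0)"
   proof (cases "x\<in>homog V g")
    case False
    then have "g \<noteq> h" using h by auto
    then show ?thesis using False h comp_homog[OF h] lf_zero[OF l] by simp
   qed simp
  qed
  also have "... = l (vsum V ?f (%x. x))" using kf by (simp add: lf_vsum[OF l] pair_prestr)
  finally show "l (vsum V ?f (%x. x)) = l v" by simp
 qed (use v kf in auto)
 then have "coord V Xs v = ?f" using c(1) keys_prestr[of "coord V Xs v"] by (intro coord_eqI[OF Xs(1)]) auto
 then show ?thesis using keys_prestr[of "coord V Xs v" "homog V g"] by auto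
qed

definition gr :: "('a => 'a) => bool" where
 "gr p\<longleftrightarrow>lin V V p\<and>(\<forall>g. \<forall>v\<in>homog V g. p v\<in>homog V g)"

text \<open>
  Homogeneous bases of the two subspaces are independent together, since the subspaces meet in zero;
  a homogeneous basis of the whole space that extends them defines the projection.
\<close>

lemma retraction:
 assumes N: "graded_subspace V N" and M: "graded_subspace V M" and d: "N\<inter>M\<subseteq>{\<zero>}"
 shows "\<exists>p. gr p\<and>(\<forall>v\<in>carrier V. p v\<in>N)\<and>(\<forall>v\<in>N. p v = v)\<and>(\<forall>v\<in>M. p v = \<zero>)"
proof -
 obtain X1 where X1: "indep V X1" "X1\<subseteq>N\<inter>hset V" "spn V X1 = N" using homog_basis[OF N] by auto
 obtain X2 where X2: "indep V X2" "X2\<subseteq>M\<inter>hset V" "spn V X2 = M" using homog_basis[OF M] by auto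
 have "indep V (X1\<union>X2)" using X1 X2 d by (intro indep_Un) auto
 then obtain Xs where Xs: "X1\<union>X2\<subseteq>Xs" "indep V Xs" "Xs\<subseteq>hset V" "spn V Xs = carrier V"
  using homog_basis_extend[OF gsub_carrier, of "X1\<union>X2"] X1 X2 by (auto simp: indep_def)
 have N': "subsp V N" using N by (simp add: gsub_subsp)
 let ?F = "%x. if x\<in>X1 then x else \<zero>"
 define p where "p v = vsum V (coord V Xs v) ?F" for v
 have Fc: "?F x\<in>carrier V" for x using X1 indep_in by auto
 have lp: "l (p v) = pair (coord V Xs v) (%x. if x\<in>X1 then l x else 0)" if "lf V l" for l v
  unfolding p_def by (subst lf_vsum[OF that]) (auto simp: Fc lf_zero[OF that] intro!: pair_cong)
 have lin: "lin V V p"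
 proof (rule linI)
  fix x assume x: "x\<in>carrier V"
  show "p x\<in>carrier V" unfolding p_def using Fc by auto
  then show "p (c\<odot>x) = c\<odot>p x" for c
   unfolding p_def using x Xs Fc by (subst coord_smult) (auto simp: vsum_scl)
  show "p (x\<oplus>y) = p x\<oplus>p y" if "y\<in>carrier V" for y
   unfolding p_def using x that Xs Fc by (subst coord_add) (auto simp: vsum_add)
 qed
 have "p v\<in>homog V g" if v: "v\<in>homog V g" for v g
  unfolding p_def using coord_homog[OF Xs(2,3) _ v] Xs(4)
  by (intro vsum_in[OF homog_subsp]) auto
 then have "gr p" using lin by (simp add: gr_def)
 moreover have "p v\<in>N" for v
  unfolding p_def using X1 subspD(2)[OF N'] by (intro vsum_in[OF N']) auto
 moreover have "p v = v" if "v\<in>N" for v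
 proof (rule lf_eqI)
  show "p v\<in>carrier V" "v\<in>carrier V" using that subspD(1)[OF N'] linD(1)[OF lin] by auto
  fix l assume l: "lf V l"
  have v: "v\<in>spn V X1" using that X1 by simp
  note c = coord[OF X1(1) v]
  have "coord V Xs v = coord V X1 v" using c Xs by (intro coord_eqI) auto
  then have "l (p v) = pair (coord V X1 v) l" using c(1)
   by (auto simp: lp[OF l] intro!: pair_cong)
  also have "... = l (vsum V (coord V X1 v) (%x. x))"
   by (rule lf_vsum[OF l, symmetric]) (use c(1) X1 indep_in in auto)
  finally show "l (p v) = l v" using c(2) by simp
 qed
 moreover have "p v = \<zero>" if "v\<in>M" for v
 proof (rule lf_eqI)
  show "p v\<in>carrier V" "\<zero>\<in>carrier V" using that M linD(1)[OF lin] by (auto simp: gsub_subsp subsp_def)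
  fix l assume l: "lf V l"
  have v: "v\<in>spn V X2" using that X2 by simp
  note c = coord[OF X2(1) v]
  have cx: "coord V Xs v = coord V X2 v" using c Xs by (intro coord_eqI) auto
  have "X1\<inter>X2 = {}"
  proof -
   have "\<zero> \<notin> X1"
   proof
    assume "\<zero>\<in>X1"
    then have "single \<zero> (1::'k) = 0" by (intro indepD[OF X1(1)]) (auto simp: keys_single)
    then show False by (metis lookup_single_eq lookup_zero zero_neq_one)
   qed
   then show ?thesis using X1 X2 d by auto
  qed
  then have "l (p v) = pair (coord V X2 v) (%x. 0)" unfolding lp[OF l] cx using c(1)
   by (intro pair_cong) auto
  then show "l (p v) = l \<zero>" by (simp add: lf_zero[OF l])
 qed
 ultimately show ?thesis by blast
qed

lemma grD: "gr p ==> lin V V p" "gr p ==> v\<in>homog V g ==> p v\<in>homog V g"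
 by (auto simp: gr_def)

lemma gr_comp: "gr p ==> gr q ==> gr (%v. p (q v))"
 by (auto simp: gr_def intro: lin_comp)

end

section \<open>Tensor products and bilinear forms\<close>

definition pair2 :: "('b\<times>'c \<Rightarrow>\<^sub>0 'k::field) => ('b => 'c => 'k) => 'k" where
 "pair2 f b = pair f (%p. b (fst p) (snd p))"

definition bil :: "('k::field, 'a, 'm) module_scheme => ('k, 'b, 'n) module_scheme => ('a => 'b => 'k) => bool" where
 "bil V W b\<longleftrightarrow>(\<forall>v\<in>carrier V. lf W (b v))\<and>(\<forall>w\<in>carrier W. lf V (%v. b v w))"

definition bilin :: "('k::field, 'a, 'm) module_scheme => ('k, 'b, 'n) module_scheme =>
  ('k, 'c, 'o) module_scheme => ('a => 'b => 'c) => bool" where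
 "bilin V W P b\<longleftrightarrow>(\<forall>v\<in>carrier V. lin W P (b v))\<and>(\<forall>w\<in>carrier W. lin V P (%v. b v w))"

definition tform :: "('a => 'b => 'k::field) => ('a, 'b, 'k) tensor => 'k" where
 "tform b t = pair2 (SOME f. f\<in>t) b"

lemma bilI: "(\<And>v. v\<in>carrier V ==> lf W (b v)) ==> (\<And>w. w\<in>carrier W ==> lf V (%v. b v w)) ==> bil V W b"
 by (simp add: bil_def)

lemma bilD: "bil V W b ==> v\<in>carrier V ==> lf W (b v)" "bil V W b ==> w\<in>carrier W ==> lf V (%v. b v w)"
 by (simp_all add: bil_def)

lemma bilinI: "(\<And>v. v\<in>carrier V ==> lin W P (b v)) ==> (\<And>w. w\<in>carrier W ==> lin V P (%v. b v w)) ==> bilin V W P b"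
 by (simp add: bilin_def)

lemma bilinD: "bilin V W P b ==> v\<in>carrier V ==> lin W P (b v)"
 "bilin V W P b ==> w\<in>carrier W ==> lin V P (%v. b v w)"
 by (simp_all add: bilin_def)

lemma bilin_closed: "bilin V W P b ==> v\<in>carrier V ==> w\<in>carrier W ==> b v w\<in>carrier P"
 using linD(1)[OF bilinD(1)[of V W P b v], of w] by simp

lemma bil_lf: "bilin V W P b ==> lf P l ==> bil V W (%v w. l (b v w))"
proof (rule bilI)
 assume h: "bilin V W P b" "lf P l"
 show "lf W (%w. l (b v w))" if "v\<in>carrier V" for v
  by (rule lf_lin[OF h(2) bilinD(1)[OF h(1) that]])
 show "lf V (%v. l (b v w))" if "w\<in>carrier W" for w
  by (rule lf_lin[OF h(2) bilinD(2)[OF h(1) that]])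
qed

lemma bil_prod: "lf V l ==> lf W m ==> bil V W (%v w. l v * m w)"
 by (intro bilI lf_cmult lf_cmult_right)

lemma pair2_add: "pair2 (f + g) b = pair2 f b + pair2 g b" by (simp add: pair2_def pair_add)

lemma pair2_scl: "pair2 (scl c f) b = c * pair2 f b" by (simp add: pair2_def pair_scl)

lemma pair2_diff: "pair2 (f - g) b = pair2 f b - pair2 g b" by (simp add: pair2_def pair_diff)

lemma pair2_single: "pair2 (single (x, y) c) b = c * b x y" by (simp add: pair2_def)

lemma pair2_cong: "(\<And>x y. (x, y)\<in>keys f ==> b x y = b' x y) ==> pair2 f b = pair2 f b'"
 unfolding pair2_def by (rule pair_cong) auto

locale kspace2 = V: kspace V + W: kspace W
 for V :: "('k::field, 'g::ab_group_add, 'a, 'm) graded_module_scheme"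
  and W :: "('k, 'g, 'b, 'n) graded_module_scheme"
begin

abbreviation "T \<equiv> tensor_space V W"
abbreviation "cl \<equiv> tensor_class V W"
abbreviation "rel \<equiv> tensor_rel V W"
abbreviation "ok f \<equiv> keys f\<subseteq>carrier V\<times>carrier W"

lemma rel_ok: "r\<in>rel ==> ok r"
proof (induction rule: tensor_rel.induct)
 case (add r s)
 then show ?case using keys_add[of r s] by blast
qed (auto simp: in_keys_iff lookup_minus lookup_single when_def split: if_splits)

lemma rel_scl: "r\<in>rel ==> scl e r\<in>rel"
proof (induction rule: tensor_rel.induct)
 case zero
 then show ?case by (simp add: tensor_rel.zero)
next
 case (add r s)
 then show ?case by (simp add: scl_add tensor_rel.add)
next
 case (add_left v v' w c)
 then show ?case using tensor_rel.add_left[of v V v' w W "e * c"] by (simp add: scl_diff)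
next
 case (add_right v w w' c)
 then show ?case using tensor_rel.add_right[of v V w W w' "e * c"] by (simp add: scl_diff)
next
 case (smult_left v w d c)
 then show ?case using tensor_rel.smult_left[of v V w W d "e * c"] by (simp add: scl_diff mult.left_commute)
next
 case (smult_right v w d c)
 then show ?case using tensor_rel.smult_right[of v V w W d "e * c"] by (simp add: scl_diff mult.left_commute)
qed

lemma rel_neg: "r\<in>rel ==> - r\<in>rel" using rel_scl[of r "-1"] by (simp add: scl_m1)

lemma rel_diff: "r\<in>rel ==> s\<in>rel ==> r - s\<in>rel"
 using tensor_rel.add[of r V W "- s"] rel_neg by simp

lemma rel_pair2: "r\<in>rel ==> bil V W b ==> pair2 r b = 0"
proof (induction rule: tensor_rel.induct)
 case (add_left v v' w c)
 then show ?case using lfD(1)[OF bilD(2), of V W b w v v'] by (simp add: pair2_diff pair2_add pair2_single algebra_simps)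
next
 case (add_right v w w' c)
 then show ?case using lfD(1)[OF bilD(1), of V W b v w w'] by (simp add: pair2_diff pair2_add pair2_single algebra_simps)
next
 case (smult_left v w d c)
 then show ?case using lfD(2)[OF bilD(2), of V W b w v d] by (simp add: pair2_diff pair2_add pair2_single algebra_simps)
next
 case (smult_right v w d c)
 then show ?case using lfD(2)[OF bilD(1), of V W b v w d] by (simp add: pair2_diff pair2_add pair2_single algebra_simps)
qed (simp_all add: pair2_add, simp add: pair2_def)

lemma cl_self: "f\<in>cl f"
 unfolding tensor_class_def using tensor_rel.zero[of V W] by force

lemma cl_mem: "g\<in>cl f\<longleftrightarrow>g - f\<in>rel"
 unfolding tensor_class_def by (auto intro: exI[of _ "g - f"])

lemma cl_eqI: "f - g\<in>rel ==> cl f = cl g"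
proof -
 assume h: "f - g\<in>rel"
 have "x - f\<in>rel\<longleftrightarrow>x - g\<in>rel" for x
  using tensor_rel.add[OF _ h, of "x - f"] rel_diff[OF _ h, of "x - g"] by auto
 then show ?thesis by (auto simp: cl_mem)
qed

lemma cl_mem_eq: "g\<in>cl f ==> cl g = cl f"
 by (rule cl_eqI) (simp add: cl_mem)

lemma cl_mem_ok: "g\<in>cl f ==> ok f ==> ok g"
 using keys_add[of "g - f" f] rel_ok[of "g - f"] by (fastforce simp: cl_mem)

lemma T_simps: "carrier T = cl ` {f. ok f}" "\<zero>\<^bsub>T\<^esub> = cl 0"
 "homog T g = cl ` {f. keys f\<subseteq>(\<Union>h. homog V h\<times>homog W (g - h))}"
 by (simp_all add: tensor_space_def tensor_class_def)

lemma T_add: "cl f\<oplus>\<^bsub>T\<^esub>cl g = cl (f + g)"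
proof -
 have "{a + b | a b. a\<in>cl f\<and>b\<in>cl g} = cl (f + g)"
 proof (intro equalityI subsetI)
  fix x assume "x\<in>{a + b | a b. a\<in>cl f\<and>b\<in>cl g}"
  then obtain a b where ab: "x = a + b" "a - f\<in>rel" "b - g\<in>rel" by (auto simp: cl_mem)
  then show "x\<in>cl (f + g)" using tensor_rel.add[OF ab(2,3)] by (simp add: cl_mem algebra_simps)
 next
  fix x assume "x\<in>cl (f + g)"
  then have "x - g\<in>cl f" by (simp add: cl_mem algebra_simps)
  then show "x\<in>{a + b | a b. a\<in>cl f\<and>b\<in>cl g}" using cl_self[of g] by force
 qed
 then show ?thesis by (simp add: tensor_space_def)
qed

lemma T_smult: "c\<odot>\<^bsub>T\<^esub>cl f = cl (scl c f)"
proof -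
 have "{scl c a + r | a r. a\<in>cl f\<and>r\<in>rel} = cl (scl c f)"
 proof (intro equalityI subsetI)
  fix x assume "x\<in>{scl c a + r | a r. a\<in>cl f\<and>r\<in>rel}"
  then obtain a r where ab: "x = scl c a + r" "a - f\<in>rel" "r\<in>rel" by (auto simp: cl_mem)
  have "scl c (a - f) + r\<in>rel" using ab by (intro tensor_rel.add rel_scl)
  then show "x\<in>cl (scl c f)" using ab by (simp add: cl_mem scl_diff algebra_simps)
 next
  fix x assume "x\<in>cl (scl c f)"
  then have "x = scl c f + (x - scl c f)" "x - scl c f\<in>rel" by (auto simp: cl_mem)
  then show "x\<in>{scl c a + r | a r. a\<in>cl f\<and>r\<in>rel}" using cl_self[of f] by blast
 qed
 then show ?thesis by (simp add: tensor_space_def)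
qed

lemma ok_add: "ok f ==> ok g ==> ok (f + g)" using keys_add[of f g] by blast

lemma ok_scl: "ok f ==> ok (scl c f)" using keys_scl[of c f] by blast

lemma cl_in: "ok f ==> cl f\<in>carrier T" by (simp add: T_simps)

lemma T_kspace: "kspace T"
 unfolding kspace_def
proof (rule moduleI)
 show "cring (ring_of_type_algebra :: 'k ring)" by (rule cring_from_type_algebra)
 show "abelian_group T"
 proof (rule abelian_groupI)
  fix x assume "x\<in>carrier T"
  then obtain f where f: "ok f" "x = cl f" by (auto simp: T_simps)
  have "cl (scl (-1) f)\<oplus>\<^bsub>T\<^esub>cl f = \<zero>\<^bsub>T\<^esub>" by (simp add: T_add T_simps scl_m1)
  then show "\<exists>y\<in>carrier T. y\<oplus>\<^bsub>T\<^esub>x = \<zero>\<^bsub>T\<^esub>" using f cl_in[OF ok_scl[OF f(1)]] by blast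
 next
  fix x y assume "x\<in>carrier T" "y\<in>carrier T"
  then obtain f g where f: "ok f" "x = cl f" "ok g" "y = cl g" by (auto simp: T_simps)
  then show "x\<oplus>\<^bsub>T\<^esub>y\<in>carrier T" using cl_in[OF ok_add[of f g]] by (simp add: T_add)
  show "x\<oplus>\<^bsub>T\<^esub>y = y\<oplus>\<^bsub>T\<^esub>x" using f by (simp add: T_add add.commute)
  fix z assume "z\<in>carrier T"
  then obtain h where "z = cl h" by (auto simp: T_simps)
  then show "x\<oplus>\<^bsub>T\<^esub>y\<oplus>\<^bsub>T\<^esub>z = x\<oplus>\<^bsub>T\<^esub>(y\<oplus>\<^bsub>T\<^esub>z)" using f by (simp add: T_add add.assoc)
 next
  show "\<zero>\<^bsub>T\<^esub>\<in>carrier T" using cl_in[of 0] by (simp add: T_simps(2))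
  fix x assume "x\<in>carrier T"
  then show "\<zero>\<^bsub>T\<^esub>\<oplus>\<^bsub>T\<^esub>x = x" by (auto simp: T_simps T_add)
 qed
next
 fix a b :: 'k and x assume "x\<in>carrier T"
 then obtain f where f: "ok f" "x = cl f" by (auto simp: T_simps)
 show "a\<odot>\<^bsub>T\<^esub>x\<in>carrier T" using f cl_in[OF ok_scl[of f a]] by (simp add: T_smult)
 have "scl (a + b) f = scl a f + scl b f" by (rule poly_mapping_eqI) (simp add: lookup_add algebra_simps)
 then show "(a\<oplus>\<^bsub>(ring_of_type_algebra :: 'k ring)\<^esub>b)\<odot>\<^bsub>T\<^esub>x = a\<odot>\<^bsub>T\<^esub>x\<oplus>\<^bsub>T\<^esub>b\<odot>\<^bsub>T\<^esub>x"
  using f by (simp add: T_add T_smult)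
 show "(a\<otimes>\<^bsub>(ring_of_type_algebra :: 'k ring)\<^esub>b)\<odot>\<^bsub>T\<^esub>x = a\<odot>\<^bsub>T\<^esub>(b\<odot>\<^bsub>T\<^esub>x)"
  using f by (simp add: T_smult scl_scl)
 show "\<one>\<^bsub>(ring_of_type_algebra :: 'k ring)\<^esub>\<odot>\<^bsub>T\<^esub>x = x" using f by (simp add: T_smult)
 fix y assume "y\<in>carrier T"
 then obtain g where "y = cl g" by (auto simp: T_simps)
 then show "a\<odot>\<^bsub>T\<^esub>(x\<oplus>\<^bsub>T\<^esub>y) = a\<odot>\<^bsub>T\<^esub>x\<oplus>\<^bsub>T\<^esub>a\<odot>\<^bsub>T\<^esub>y"
  using f by (simp add: T_add T_smult scl_add)
qed

sublocale T: kspace T by (rule T_kspace)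

abbreviation "tn \<equiv> tens V W"

lemma tens_in [simp, intro]: "v\<in>carrier V ==> w\<in>carrier W ==> tn v w\<in>carrier T"
 unfolding tens_def by (rule cl_in) (simp add: keys_single)

lemma tens_bilin: "bilin V W T tn"
proof (intro bilinI linI)
 fix v w w' assume v: "v\<in>carrier V" and w: "w\<in>carrier W" "w'\<in>carrier W"
 show "tn v (w\<oplus>\<^bsub>W\<^esub>w') = tn v w\<oplus>\<^bsub>T\<^esub>tn v w'"
  unfolding tens_def T_add using tensor_rel.add_right[OF v w, of 1]
  by (intro cl_eqI) (simp add: algebra_simps)
next
 fix v c w assume v: "v\<in>carrier V" and w: "w\<in>carrier W"
 show "tn v (c\<odot>\<^bsub>W\<^esub>w) = c\<odot>\<^bsub>T\<^esub>tn v w"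
  unfolding tens_def T_smult using tensor_rel.smult_right[OF v w, of c 1]
  by (intro cl_eqI) simp
next
 fix w v v' assume w: "w\<in>carrier W" and v: "v\<in>carrier V" "v'\<in>carrier V"
 show "tn (v\<oplus>\<^bsub>V\<^esub>v') w = tn v w\<oplus>\<^bsub>T\<^esub>tn v' w"
  unfolding tens_def T_add using tensor_rel.add_left[OF v w, of 1]
  by (intro cl_eqI) (simp add: algebra_simps)
next
 fix w c v assume w: "w\<in>carrier W" and v: "v\<in>carrier V"
 show "tn (c\<odot>\<^bsub>V\<^esub>v) w = c\<odot>\<^bsub>T\<^esub>tn v w"
  unfolding tens_def T_smult using tensor_rel.smult_left[OF v w, of c 1]
  by (intro cl_eqI) simp
qed auto

lemma cl_vsum: "ok f ==> cl f = vsum T f (%p. tn (fst p) (snd p))"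
proof -
 assume f: "ok f"
 have tc: "p\<in>keys f ==> tn (fst p) (snd p)\<in>carrier T" for p using f by auto
 have "finite S ==> S\<subseteq>keys f ==>
   cl (\<Sum>p\<in>S. single p (lookup f p)) = (\<Oplus>\<^bsub>T\<^esub>p\<in>S. lookup f p\<odot>\<^bsub>T\<^esub>tn (fst p) (snd p))" for S
 proof (induction S rule: finite_induct)
  case empty
  then show ?case by (simp add: T_simps)
 next
  case (insert x S)
  have "lookup f x\<odot>\<^bsub>T\<^esub>tn (fst x) (snd x) = cl (single x (lookup f x))"
   by (simp add: tens_def T_smult)
  moreover have "(\<Oplus>\<^bsub>T\<^esub>p\<in>insert x S. lookup f p\<odot>\<^bsub>T\<^esub>tn (fst p) (snd p)) =
   lookup f x\<odot>\<^bsub>T\<^esub>tn (fst x) (snd x)\<oplus>\<^bsub>T\<^esub>(\<Oplus>\<^bsub>T\<^esub>p\<in>S. lookup f p\<odot>\<^bsub>T\<^esub>tn (fst p) (snd p))"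
   using insert tc by (intro T.finsum_insert) auto
  ultimately show ?case using insert by (simp add: T_add[symmetric])
 qed
 from this[of "keys f"]
 have "cl (\<Sum>p\<in>keys f. single p (lookup f p)) = vsum T f (%p. tn (fst p) (snd p))"
  by (simp add: vsum_def)
 moreover have "(\<Sum>p\<in>keys f. single p (lookup f p)) = f"
  by (rule pair_eqI) (simp add: pair_sum, simp add: pair_def)
 ultimately show ?thesis by simp
qed

lemma T_obtain:
 assumes "t\<in>carrier T" obtains f where "ok f" "t = cl f" "f\<in>t"
 using assms cl_self by (auto simp: T_simps)

lemma lf_cl: "lf T l ==> ok f ==> l (cl f) = pair2 f (%v w. l (tn v w))"
 unfolding pair2_def by (subst cl_vsum, assumption, rule T.lf_vsum) auto

lemma tform_rep:
 assumes "bil V W b" "f\<in>t" "t\<in>carrier T"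
 shows "tform b t = pair2 f b"
proof -
 obtain g where g: "t = cl g" using assms by (auto simp: T_simps)
 let ?h = "SOME f. f\<in>t"
 have "?h\<in>t" using assms(2) by (rule someI)
 then have "?h - f\<in>rel" using assms(2) rel_diff[of "?h - g" "f - g"] by (simp add: g cl_mem)
 then show ?thesis using rel_pair2[OF _ assms(1), of "?h - f"] by (simp add: tform_def pair2_diff)
qed

lemma tform_cl: "bil V W b ==> ok f ==> tform b (cl f) = pair2 f b"
 using tform_rep[OF _ cl_self cl_in] .

lemma lf_tform: "bil V W b ==> lf T (tform b)"
 by (intro lfI) (auto simp: T_simps T_add T_smult tform_cl ok_add ok_scl pair2_add pair2_scl)

lemma tform_tens [simp]: "bil V W b ==> v\<in>carrier V ==> w\<in>carrier W ==> tform b (tn v w) = b v w"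
 unfolding tens_def by (subst tform_cl) (auto simp: keys_single pair2_single)

lemma lf_tform_tens:
 assumes l: "lf T l" and t: "t\<in>carrier T"
 shows "l t = tform (%v w. l (tn v w)) t"
 using t by (rule T_obtain) (simp add: lf_cl[OF l] tform_cl bil_lf[OF tens_bilin l])

lemma tform_eqI:
 assumes "t\<in>carrier T" "t'\<in>carrier T" "\<And>b. bil V W b ==> tform b t = tform b t'"
 shows "t = t'"
proof (rule T.lf_eqI[OF assms(1,2)])
 fix l assume l: "lf T l"
 show "l t = l t'"
  using lf_tform_tens[OF l] assms bil_lf[OF tens_bilin l] by simp
qed

lemma rep_ok: "t\<in>carrier T ==> f\<in>t ==> ok f\<and>cl f = t"
 using cl_mem_ok cl_mem_eq by (auto simp: T_simps)

lemma tensor_lift_vsum: "tensor_lift P b t = vsum P (SOME f. f\<in>t) (%p. b (fst p) (snd p))"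
 by (simp add: tensor_lift_def vsum_def Let_def)

lemma tensor_lift_closed:
 assumes P: "kspace P" and b: "\<And>v w. v\<in>carrier V ==> w\<in>carrier W ==> b v w\<in>carrier P"
  and t: "t\<in>carrier T"
 shows "tensor_lift P b t\<in>carrier P"
proof -
 interpret P: kspace P by fact
 obtain f where "f\<in>t" using t by (rule T_obtain)
 then have "(SOME f. f\<in>t)\<in>t" by (rule someI)
 then have "ok (SOME f. f\<in>t)" using rep_ok[OF t] by blast
 then show ?thesis unfolding tensor_lift_vsum using b by (intro P.vsum_closed) auto
qed

lemma lf_tensor_lift:
 assumes P: "kspace P" and b: "\<And>v w. v\<in>carrier V ==> w\<in>carrier W ==> b v w\<in>carrier P"
  and t: "t\<in>carrier T" and l: "lf P l"
 shows "l (tensor_lift P b t) = tform (%v w. l (b v w)) t"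
proof -
 interpret P: kspace P by fact
 obtain f where "f\<in>t" using t by (rule T_obtain)
 then have "(SOME f. f\<in>t)\<in>t" by (rule someI)
 then have "ok (SOME f. f\<in>t)" using rep_ok[OF t] by blast
 then show ?thesis unfolding tensor_lift_vsum tform_def pair2_def using b by (intro P.lf_vsum[OF l]) auto
qed

lemma lin_tensor_lift:
 assumes P: "kspace P" and b: "bilin V W P b"
 shows "lin T P (tensor_lift P b)"
proof -
 interpret P: kspace P by fact
 note bc = bilin_closed[OF b]
 have cc: "tensor_lift P b t\<in>carrier P" if "t\<in>carrier T" for t
  by (rule tensor_lift_closed[OF P _ that]) (rule bc)
 have ll: "l (tensor_lift P b t) = tform (%v w. l (b v w)) t" if "t\<in>carrier T" "lf P l" for t l
  by (rule lf_tensor_lift[OF P _ that]) (rule bc)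
 show ?thesis
 proof (rule linI)
  fix x y assume x: "x\<in>carrier T" and y: "y\<in>carrier T"
  show "tensor_lift P b (x\<oplus>\<^bsub>T\<^esub>y) = tensor_lift P b x\<oplus>\<^bsub>P\<^esub>tensor_lift P b y"
   by (rule P.lf_eqI) (use x y cc in \<open>auto simp: ll lfD lfD(1)[OF lf_tform] bil_lf[OF b]\<close>)
 next
  fix c x assume x: "x\<in>carrier T"
  show "tensor_lift P b (c\<odot>\<^bsub>T\<^esub>x) = c\<odot>\<^bsub>P\<^esub>tensor_lift P b x"
   by (rule P.lf_eqI) (use x cc in \<open>auto simp: ll lfD lfD(2)[OF lf_tform] bil_lf[OF b]\<close>)
 qed (rule cc)
qed

lemma tensor_lift_tens:
 assumes P: "kspace P" and b: "bilin V W P b" and v: "v\<in>carrier V" and w: "w\<in>carrier W"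
 shows "tensor_lift P b (tn v w) = b v w"
proof -
 interpret P: kspace P by fact
 show ?thesis
  by (rule P.lf_eqI) (use v w in \<open>auto simp: bilin_closed[OF b] lf_tensor_lift[OF P] tensor_lift_closed[OF P] bil_lf[OF b]\<close>)
qed

text \<open>
  Expanding both arguments in bases writes every bilinear form as a combination of product forms.
\<close>

lemma product_forms:
 assumes f: "ok f" and z: "\<And>l m. lf V l ==> lf W m ==> pair2 f (%v w. l v * m w) = 0" and b: "bil V W b"
 shows "pair2 f b = 0"
proof -
 obtain Xs where Xs: "indep V Xs" "spn V Xs = carrier V" using V.exists_basis[OF V.subsp_carrier] by auto
 obtain Ys where Ys: "indep W Ys" "spn W Ys = carrier W" using W.exists_basis[OF W.subsp_carrier] by auto
 let ?c = "coord V Xs" and ?d = "coord W Ys"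
 have ev: "pair (?c v) (%x. b x w) = b v w" if "v\<in>carrier V" "w\<in>carrier W" for v w
  using V.lf_vsum[OF bilD(2)[OF b that(2)], of "?c v" "%x. x"] V.coord[OF Xs(1), of v] that Xs
   V.indep_in[OF Xs(1)] by (simp add: subset_iff)
 have ew: "pair (?d w) (%y. b x y) = b x w" if "x\<in>carrier V" "w\<in>carrier W" for x w
  using W.lf_vsum[OF bilD(1)[OF b that(1)], of "?d w" "%x. x"] W.coord[OF Ys(1), of w] that Ys
   W.indep_in[OF Ys(1)] by (simp add: subset_iff)
 define I where "I = (\<Union>p\<in>keys f. keys (?c (fst p)))"
 define J where "J = (\<Union>p\<in>keys f. keys (?d (snd p)))"
 have fin: "finite I" "finite J" by (auto simp: I_def J_def)
 have "pair2 f b = pair2 f (%v w. \<Sum>x\<in>I. \<Sum>y\<in>J. lookup (?c v) x * lookup (?d w) y * b x y)"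
 proof (rule pair2_cong)
  fix v w assume vw: "(v, w)\<in>keys f"
  then have c: "v\<in>carrier V" "w\<in>carrier W" using f by auto
  have "b v w = (\<Sum>x\<in>I. lookup (?c v) x * b x w)"
   using ev[OF c] pair_superset[OF fin(1), of "?c v"] vw by (force simp: I_def)
  also have "... = (\<Sum>x\<in>I. lookup (?c v) x * (\<Sum>y\<in>J. lookup (?d w) y * b x y))"
  proof (rule sum.cong)
   fix x assume "x\<in>I"
   then obtain p where p: "p\<in>keys f" "x\<in>keys (?c (fst p))" by (auto simp: I_def)
   have "fst p\<in>carrier V" using f p by auto
   then have "x\<in>carrier V" using p V.coord(1)[OF Xs(1), of "fst p"] Xs V.indep_in[OF Xs(1)] by auto
   then show "lookup (?c v) x * b x w = lookup (?c v) x * (\<Sum>y\<in>J. lookup (?d w) y * b x y)"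
    using ew[of x w] c pair_superset[OF fin(2), of "?d w"] vw by (force simp: J_def)
  qed simp
  finally show "b v w = (\<Sum>x\<in>I. \<Sum>y\<in>J. lookup (?c v) x * lookup (?d w) y * b x y)"
   by (simp add: sum_distrib_left mult.assoc)
 qed
 also have "... = (\<Sum>x\<in>I. \<Sum>y\<in>J. b x y * pair2 f (%v w. lookup (?c v) x * lookup (?d w) y))"
  by (simp add: pair2_def pair_fun_sum pair_cmult mult.commute)
 also have "... = 0"
 proof (intro sum.neutral ballI)
  fix x y
  have e1: "lookup (?c v) x = pair (?c v) (%z. if z = x then 1 else 0)" for v
   by (simp add: pair_superset[of "insert x (keys (?c v))"] subset_insertI if_distrib cong: if_cong)
  have e2: "lookup (?d v) y = pair (?d v) (%z. if z = y then 1 else 0)" for v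
   by (simp add: pair_superset[of "insert y (keys (?d v))"] subset_insertI if_distrib cong: if_cong)
  have "lf V (%v. lookup (?c v) x)" "lf W (%w. lookup (?d w) y)"
   unfolding e1 e2 using Xs Ys by (auto intro!: V.lf_coord W.lf_coord)
  then show "b x y * pair2 f (%v w. lookup (?c v) x * lookup (?d w) y) = 0" using z by simp
 qed
 finally show ?thesis .
qed

end

section \<open>The color braiding and the algebra structure on tensor products\<close>

lemma kspace_cong:
 fixes V :: "('k::field, 'a, 'm) module_scheme" and V' :: "('k, 'a, 'n) module_scheme"
 assumes V: "kspace V" and e: "carrier V' = carrier V" "ring.add V' = ring.add V" "ring.zero V' = ring.zero V" "module.smult V' = module.smult V"
 shows "kspace V'"
proof -
 interpret V: kspace V by fact
 show ?thesis unfolding kspace_def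
 proof (rule moduleI)
  show "cring (ring_of_type_algebra :: 'k ring)" by (rule cring_from_type_algebra)
  show "abelian_group V'"
  proof (rule abelian_groupI)
   fix x assume "x\<in>carrier V'"
   then show "\<exists>y\<in>carrier V'. y\<oplus>\<^bsub>V'\<^esub>x = \<zero>\<^bsub>V'\<^esub>" unfolding e using V.l_neg by blast
  qed (auto simp: e V.a_ac)
 qed (auto simp: e V.smult_addl V.smult_addr V.smult_smult)
qed

lemma bilin_weak:
 assumes "kspace V" "kspace W" "kspace P"
  and c: "\<And>v w. v\<in>carrier V ==> w\<in>carrier W ==> b v w\<in>carrier P"
  and l: "\<And>l. lf P l ==> bil V W (%v w. l (b v w))"
 shows "bilin V W P b"
proof -
 interpret V: kspace V by fact
 interpret W: kspace W by fact
 interpret P: kspace P by fact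
 show ?thesis
 proof (intro bilinI linI)
  fix v w w' assume "v\<in>carrier V" "w\<in>carrier W" "w'\<in>carrier W"
  then show "b v (w\<oplus>\<^bsub>W\<^esub>w') = b v w\<oplus>\<^bsub>P\<^esub>b v w'"
   by (intro P.lf_eqI) (auto simp: c lfD(1) lfD(1)[OF bilD(1)[OF l]])
 next
  fix v d w assume "v\<in>carrier V" "w\<in>carrier W"
  then show "b v (d\<odot>\<^bsub>W\<^esub>w) = d\<odot>\<^bsub>P\<^esub>b v w"
   by (intro P.lf_eqI) (auto simp: c lfD(2) lfD(2)[OF bilD(1)[OF l]])
 next
  fix w v v' assume "w\<in>carrier W" "v\<in>carrier V" "v'\<in>carrier V"
  then show "b (v\<oplus>\<^bsub>V\<^esub>v') w = b v w\<oplus>\<^bsub>P\<^esub>b v' w"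
   by (intro P.lf_eqI) (auto simp: c lfD(1) lfD(1)[OF bilD(2)[OF l]])
 next
  fix w d v assume "w\<in>carrier W" "v\<in>carrier V"
  then show "b (d\<odot>\<^bsub>V\<^esub>v) w = d\<odot>\<^bsub>P\<^esub>b v w"
   by (intro P.lf_eqI) (auto simp: c lfD(2) lfD(2)[OF bilD(2)[OF l]])
 qed (auto simp: c)
qed

context graded_space begin

text \<open>Multiplication by a scalar that depends on the degree; the braiding with an element of
 fixed degree is of this kind.\<close>

definition tws :: "('g => 'k) => 'a => 'a" where
 "tws c v = (\<Oplus>g\<in>degrees V v. c g\<odot>component V v g)"

lemma tws_carrier [simp]: "v\<in>carrier V ==> tws c v\<in>carrier V"
 unfolding tws_def by (intro finsum_closed) auto

lemma lf_tws:
 assumes l: "lf V l" and v: "v\<in>carrier V"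
 shows "l (tws c v) = (\<Sum>g\<in>degrees V v. c g * l (component V v g))"
 unfolding tws_def using v by (subst lf_finsum[OF l]) (auto simp: lfD[OF l])

lemma lf_degsum:
 assumes l: "\<And>g. lf V (l g)"
 shows "lf V (%v. \<Sum>g\<in>degrees V v. l g (component V v g))"
proof (rule lfI)
 fix v w assume v: "v\<in>carrier V" and w: "w\<in>carrier V"
 let ?S = "degrees V v\<union>degrees V w\<union>degrees V (v\<oplus>w)"
 have s: "(\<Sum>g\<in>degrees V u. l g (component V u g)) = (\<Sum>g\<in>?S. l g (component V u g))"
  if "u\<in>{v, w, v\<oplus>w}" for u
  using that v w lf_zero[OF l] by (intro sum.mono_neutral_left) (auto simp: degrees_def finite_degrees[unfolded degrees_def])
 show "(\<Sum>g\<in>degrees V (v\<oplus>w). l g (component V (v\<oplus>w) g)) =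
   (\<Sum>g\<in>degrees V v. l g (component V v g)) + (\<Sum>g\<in>degrees V w. l g (component V w g))"
  unfolding s[of v, simplified] s[of w, simplified] s[of "v\<oplus>w", simplified]
  using v w by (simp add: comp_add lfD[OF l] sum.distrib)
next
 fix c v assume v: "v\<in>carrier V"
 have "(\<Sum>g\<in>degrees V (c\<odot>v). l g (component V (c\<odot>v) g)) = (\<Sum>g\<in>degrees V v. l g (component V (c\<odot>v) g))"
  using v lf_zero[OF l] by (intro sum.mono_neutral_left) (auto simp: degrees_def comp_smult finite_degrees[unfolded degrees_def])
 then show "(\<Sum>g\<in>degrees V (c\<odot>v). l g (component V (c\<odot>v) g)) = c * (\<Sum>g\<in>degrees V v. l g (component V v g))"
  using v by (simp add: comp_smult lfD[OF l] sum_distrib_left)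
qed

lemma tws_homog: "v\<in>homog V g ==> tws c v = c g\<odot>v"
 by (cases "v = \<zero>") (simp_all add: tws_def degrees_homog)

lemma gr_tws: "gr (tws c)"
 unfolding gr_def
proof (intro conjI allI ballI linI)
 have l: "lf V (%v. l (tws c v))" if "lf V l" for l
 proof -
  have "lf V (%v. \<Sum>g\<in>degrees V v. c g * l (component V v g))"
   by (rule lf_degsum) (rule lf_cmult[OF that])
  then show ?thesis using lf_tws[OF that] by (simp add: lf_def)
 qed
 show "tws c (v\<oplus>w) = tws c v\<oplus>tws c w" if "v\<in>carrier V" "w\<in>carrier V" for v w
  by (rule lf_eqI) (use that in \<open>auto simp: lfD(1) lfD(1)[OF l]\<close>)
 show "tws c (d\<odot>v) = d\<odot>tws c v" if "v\<in>carrier V" for v d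
  by (rule lf_eqI) (use that in \<open>auto simp: lfD(2) lfD(2)[OF l]\<close>)
 show "tws c v\<in>homog V g" if "v\<in>homog V g" for v g
  using that subspD(4)[OF homog_subsp] by (simp add: tws_homog)
qed simp

lemma tws_in: "graded_subspace V N ==> v\<in>N ==> tws c v\<in>N"
proof -
 assume N: "graded_subspace V N" and v: "v\<in>N"
 have s: "subsp V N" "\<And>g. component V v g\<in>N" using N v by (auto simp: gsub_subsp)
 have vc: "v\<in>carrier V" using subspD(1)[OF s(1) v] .
 show "tws c v\<in>N"
  by (rule lf_subspI[OF s(1)])
   (use vc s in \<open>auto simp: lf_tws intro!: sum.neutral\<close>)
qed

lemma lf_hset_eq:
 assumes "lf V l" "lf V m" "\<And>v. v\<in>hset V ==> l v = m v" "v\<in>carrier V"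
 shows "l v = m v"
 using assms by (auto simp: lf_comp_sum[of _ v] intro!: sum.cong hsetI[OF comp_in])

end

locale gspace2 = V: graded_space V + W: graded_space W
 for V :: "('k::field, 'g::ab_group_add, 'a, 'm) graded_module_scheme"
  and W :: "('k, 'g, 'b, 'n) graded_module_scheme"

sublocale gspace2\<subseteq>kspace2 V W ..

context gspace2 begin

lemma bil_hset_eq:
 assumes "bil V W b" "bil V W b'" "\<And>v w. v\<in>hset V ==> w\<in>hset W ==> b v w = b' v w"
  "v\<in>carrier V" "w\<in>carrier W"
 shows "b v w = b' v w"
 by (rule V.lf_hset_eq[OF bilD(2)[OF assms(1,5)] bilD(2)[OF assms(2,5)] _ assms(4)],
   rule W.lf_hset_eq[OF bilD(1)[OF assms(1)] bilD(1)[OF assms(2)] assms(3) assms(5)])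
  (auto simp: V.hset_carrier)

lemma lf_T_eq:
 assumes l: "lf T l" "lf T m" and e: "\<And>v w. v\<in>hset V ==> w\<in>hset W ==> l (tn v w) = m (tn v w)"
  and t: "t\<in>carrier T"
 shows "l t = m t"
proof -
 have "l (tn v w) = m (tn v w)" if "v\<in>carrier V" "w\<in>carrier W" for v w
  using bil_hset_eq[OF bil_lf[OF tens_bilin l(1)] bil_lf[OF tens_bilin l(2)] e that] by simp
 then show ?thesis using t
  by (rule_tac T_obtain[OF t]) (auto simp: lf_cl l intro!: pair2_cong)
qed

lemma lin_T_eq:
 assumes "kspace P" and l: "lin T P h" "lin T P k" and e: "\<And>v w. v\<in>hset V ==> w\<in>hset W ==> h (tn v w) = k (tn v w)"
  and t: "t\<in>carrier T"
 shows "h t = k t"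
proof -
 interpret P: kspace P by fact
 show ?thesis
 proof (rule P.lf_eqI)
  fix l' assume l': "lf P l'"
  show "l' (h t) = l' (k t)"
   by (rule lf_T_eq[OF lf_lin[OF l' l(1)] lf_lin[OF l' l(2)] _ t]) (simp add: e)
 qed (use t linD(1)[OF l(1)] linD(1)[OF l(2)] in auto)
qed

lemma color_ext_closed:
 assumes "kspace P" and b: "bilin V W P b" and v: "v\<in>carrier V" and w: "w\<in>carrier W"
 shows "color_ext \<phi> V W P b v w\<in>carrier P"
proof -
 interpret P: kspace P by fact
 show ?thesis unfolding color_ext_def using v w
  by (intro P.finsum_closed funcsetI P.smult_in bilin_closed[OF b]) auto
qed

lemma lf_color_ext:
 assumes P: "kspace P" and b: "bilin V W P b" and v: "v\<in>carrier V" and w: "w\<in>carrier W" and l: "lf P l"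
 shows "l (color_ext \<phi> V W P b v w) =
  (\<Sum>g\<in>degrees V v. \<Sum>h\<in>degrees W w. \<phi> g h * l (b (component V v g) (component W w h)))"
proof -
 interpret P: kspace P by fact
 have lfs: "l (\<Oplus>\<^bsub>P\<^esub>x\<in>S. F x) = (\<Sum>x\<in>S. l (F x))" if "finite S" "\<And>x. x\<in>S ==> F x\<in>carrier P" for S and F :: "'g => _"
  using that by (induction S) (auto simp: P.lf_zero[OF l] lfD(1)[OF l])
 show ?thesis unfolding color_ext_def using v w bilin_closed[OF b]
  by (auto simp: lfs lfD(2)[OF l] intro!: sum.cong P.finsum_closed)
qed

lemma color_ext_bilin:
 assumes P: "kspace P" and b: "bilin V W P b"
 shows "bilin V W P (color_ext \<phi> V W P b)"
proof (rule bilin_weak[OF _ _ P])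
 fix l assume l: "lf P l"
 note bl = bil_lf[OF b l]
 show "bil V W (%v w. l (color_ext \<phi> V W P b v w))"
 proof (rule bilI)
  fix v assume v: "v\<in>carrier V"
  have "lf W (%w. \<Sum>h\<in>degrees W w. \<Sum>g\<in>degrees V v. \<phi> g h * l (b (component V v g) (component W w h)))"
   using v by (intro W.lf_degsum lf_sum lf_cmult bilD(1)[OF bl]) auto
  then show "lf W (%w. l (color_ext \<phi> V W P b v w))"
   using v by (subst (asm) sum.swap) (simp add: lf_def lf_color_ext[OF P b _ _ l])
 next
  fix w assume w: "w\<in>carrier W"
  have "lf V (%v. \<Sum>g\<in>degrees V v. \<Sum>h\<in>degrees W w. \<phi> g h * l (b (component V v g) (component W w h)))"
   using w by (intro V.lf_degsum lf_sum lf_cmult bilD(2)[OF bl]) auto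
  then show "lf V (%v. l (color_ext \<phi> V W P b v w))"
   using w by (simp add: lf_def lf_color_ext[OF P b _ _ l])
 qed
qed (auto intro: color_ext_closed[OF P b] V.kspace_axioms W.kspace_axioms)

lemma color_ext_homog:
 assumes P: "kspace P" and b: "bilin V W P b" and v: "v\<in>homog V g" and w: "w\<in>homog W h"
 shows "color_ext \<phi> V W P b v w = \<phi> g h\<odot>\<^bsub>P\<^esub>b v w"
proof -
 interpret P: kspace P by fact
 have vc: "v\<in>carrier V" "w\<in>carrier W" using v w by auto
 show ?thesis
 proof (rule P.lf_eqI)
  fix l assume l: "lf P l"
  note bl = bil_lf[OF b l]
  have "l (b \<zero>\<^bsub>V\<^esub> w) = 0" "l (b v \<zero>\<^bsub>W\<^esub>) = 0"
   using V.lf_zero[OF bilD(2)[OF bl vc(2)]] W.lf_zero[OF bilD(1)[OF bl vc(1)]] by auto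
  then show "l (color_ext \<phi> V W P b v w) = l (\<phi> g h\<odot>\<^bsub>P\<^esub>b v w)"
   using v w vc bilin_closed[OF b vc]
   by (auto simp: lf_color_ext[OF P b vc l] V.degrees_homog[OF v] W.degrees_homog[OF w] lfD[OF l])
 qed (use color_ext_closed[OF P b vc] bilin_closed[OF b vc] in auto)
qed

lemma bilin_tensor_lift:
 assumes P: "kspace P" and V': "kspace2 V' W'" and t: "t\<in>carrier (tensor_space V' W')"
  and b: "\<And>v w. v\<in>carrier V ==> w\<in>carrier W ==> bilin V' W' P (b v w)"
  and b': "\<And>v w. v\<in>carrier V' ==> w\<in>carrier W' ==> bilin V W P (%x y. b x y v w)"
 shows "bilin V W P (%v w. tensor_lift P (b v w) t)"
proof (rule bilin_weak[OF _ _ P])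
 interpret V': kspace2 V' W' by fact
 show "tensor_lift P (b v w) t\<in>carrier P" if "v\<in>carrier V" "w\<in>carrier W" for v w
  by (rule V'.tensor_lift_closed[OF P _ t]) (rule bilin_closed[OF b[OF that]])
 fix l assume l: "lf P l"
 obtain f where f: "V'.ok f" "t = V'.cl f" using V'.T_obtain[OF t] by metis
 have e: "l (tensor_lift P (b v w) t) = pair2 f (%x y. l (b v w x y))" if "v\<in>carrier V" "w\<in>carrier W" for v w
  using V'.lf_tensor_lift[OF P bilin_closed[OF b[OF that]] t l] V'.tform_cl[OF bil_lf[OF b[OF that] l] f(1)] f(2)
  by simp
 have 1: "lf W (%w. pair2 f (%x y. l (b v w x y)))" if "v\<in>carrier V" for v
  unfolding pair2_def
 proof (rule lf_pair)
  fix p assume "p\<in>keys f"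
  then have "bilin V W P (%x y. b x y (fst p) (snd p))" using f(1) by (intro b') auto
  from bilD(1)[OF bil_lf[OF this l] that] show "lf W (%x. l (b v x (fst p) (snd p)))" .
 qed
 have 2: "lf V (%v. pair2 f (%x y. l (b v w x y)))" if "w\<in>carrier W" for w
  unfolding pair2_def
 proof (rule lf_pair)
  fix p assume "p\<in>keys f"
  then have "bilin V W P (%x y. b x y (fst p) (snd p))" using f(1) by (intro b') auto
  from bilD(2)[OF bil_lf[OF this l] that] show "lf V (%x. l (b x w (fst p) (snd p)))" .
 qed
 show "bil V W (%v w. l (tensor_lift P (b v w) t))"
  by (rule bilI) (use 1 2 in \<open>simp_all add: lf_def e\<close>)
qed (auto intro: V.kspace_axioms W.kspace_axioms)

end

lemma (in graded_algebra) mult_bilin: "bilin A A A (\<otimes>)"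
 by (intro bilinI linI) (auto simp: r_distr l_distr smult_mult_left smult_mult_right)

locale galg2 = A: graded_algebra A + B: graded_algebra B
 for A :: "('k::field, 'g::ab_group_add, 'a, 'm) graded_module_scheme"
  and B :: "('k, 'g, 'b, 'n) graded_module_scheme"

sublocale galg2\<subseteq>AB: gspace2 A B ..
sublocale galg2\<subseteq>BA: gspace2 B A ..

context galg2 begin

abbreviation "CT \<phi> \<equiv> color_tensor \<phi> A B"

lemma CT_simps: "carrier (CT \<phi>) = carrier AB.T" "ring.add (CT \<phi>) = ring.add AB.T" "ring.zero (CT \<phi>) = ring.zero AB.T"
 "module.smult (CT \<phi>) = module.smult AB.T" "homog (CT \<phi>) = homog AB.T" "monoid.one (CT \<phi>) = tens A B \<one>\<^bsub>A\<^esub> \<one>\<^bsub>B\<^esub>"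
 by (simp_all add: color_tensor_def Let_def)

lemma CT_kspace: "kspace (CT \<phi>)"
 by (rule kspace_cong[OF AB.T_kspace]) (simp_all add: CT_simps)

text \<open>
  The product \<open>(a \<otimes> b)(a' \<otimes> b')\<close> of the color tensor algebra, with its color factor.
\<close>

definition Q4 :: "('g => 'g => 'k) => 'a => 'b => 'a => 'b => ('a, 'b, 'k) tensor" where
 "Q4 \<phi> a b a' b' = color_ext \<phi> B A AB.T (%b a'. tens A B (a\<otimes>\<^bsub>A\<^esub>a') (b\<otimes>\<^bsub>B\<^esub>b')) b a'"

lemma CT_mult: "s\<otimes>\<^bsub>CT \<phi>\<^esub>t = tensor_lift AB.T (%a b. tensor_lift AB.T (Q4 \<phi> a b) t) s"
 by (simp add: color_tensor_def Let_def Q4_def[abs_def])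

lemma Q4_inner: "a\<in>carrier A ==> b'\<in>carrier B ==> bilin B A AB.T (%b a'. tens A B (a\<otimes>\<^bsub>A\<^esub>a') (b\<otimes>\<^bsub>B\<^esub>b'))"
 by (rule bilinI) (auto intro!: lin_comp[OF bilinD(1)[OF AB.tens_bilin] bilinD(2)[OF B.mult_bilin]]
  lin_comp[OF bilinD(2)[OF AB.tens_bilin] bilinD(1)[OF A.mult_bilin]])

lemma Q4_homog:
 assumes "a\<in>carrier A" "b\<in>homog B g" "a'\<in>homog A h" "b'\<in>carrier B"
 shows "Q4 \<phi> a b a' b' = \<phi> g h\<odot>\<^bsub>AB.T\<^esub>tens A B (a\<otimes>\<^bsub>A\<^esub>a') (b\<otimes>\<^bsub>B\<^esub>b')"
 unfolding Q4_def using BA.color_ext_homog[OF AB.T_kspace Q4_inner assms(2,3)] assms by simp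

lemma Q4_closed:
 "a\<in>carrier A ==> b\<in>carrier B ==> a'\<in>carrier A ==> b'\<in>carrier B ==> Q4 \<phi> a b a' b'\<in>carrier AB.T"
 unfolding Q4_def by (rule BA.color_ext_closed[OF AB.T_kspace Q4_inner])

lemma Q4_mid: "a\<in>carrier A ==> b'\<in>carrier B ==> bilin B A AB.T (%b a'. Q4 \<phi> a b a' b')"
 unfolding Q4_def by (rule BA.color_ext_bilin[OF AB.T_kspace Q4_inner])

lemma Q4_out:
 assumes "b\<in>carrier B" "a'\<in>carrier A" shows "bilin A B AB.T (%a b'. Q4 \<phi> a b a' b')"
proof (rule bilin_weak)
 fix l assume l: "lf AB.T l"
 have tb: "bil A B (%v w. l (tens A B v w))" by (rule bil_lf[OF AB.tens_bilin l])
 have e: "l (Q4 \<phi> a b a' b') = (\<Sum>g\<in>degrees B b. \<Sum>h\<in>degrees A a'. \<phi> g h *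
   l (tens A B (a\<otimes>\<^bsub>A\<^esub>component A a' h) (component B b g\<otimes>\<^bsub>B\<^esub>b')))"
  if "a\<in>carrier A" "b'\<in>carrier B" for a b'
  unfolding Q4_def using BA.lf_color_ext[OF AB.T_kspace Q4_inner[OF that] assms l] .
 show "bil A B (%a b'. l (Q4 \<phi> a b a' b'))"
 proof (rule bilI)
  fix a assume a: "a\<in>carrier A"
  have "lf B (%b'. \<Sum>g\<in>degrees B b. \<Sum>h\<in>degrees A a'. \<phi> g h *
    l (tens A B (a\<otimes>\<^bsub>A\<^esub>component A a' h) (component B b g\<otimes>\<^bsub>B\<^esub>b')))"
   using a assms by (intro lf_sum lf_cmult lf_lin[OF bilD(1)[OF tb] bilinD(1)[OF B.mult_bilin]]) auto
  then show "lf B (%b'. l (Q4 \<phi> a b a' b'))" using a by (simp add: lf_def e)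
 next
  fix b' assume b': "b'\<in>carrier B"
  have "lf A (%a. \<Sum>g\<in>degrees B b. \<Sum>h\<in>degrees A a'. \<phi> g h *
    l (tens A B (a\<otimes>\<^bsub>A\<^esub>component A a' h) (component B b g\<otimes>\<^bsub>B\<^esub>b')))"
   using b' assms by (intro lf_sum lf_cmult lf_lin[OF bilD(2)[OF tb] bilinD(2)[OF A.mult_bilin]]) auto
  then show "lf A (%a. l (Q4 \<phi> a b a' b'))" using b' by (simp add: lf_def e)
 qed
qed (use assms Q4_closed in \<open>auto intro: AB.T_kspace A.kspace_axioms B.kspace_axioms\<close>)

lemma Q4_right: "a\<in>carrier A ==> b\<in>carrier B ==> bilin A B AB.T (Q4 \<phi> a b)"
 by (rule bilinI) (auto intro: bilinD(1)[OF Q4_out] bilinD(1)[OF Q4_mid])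

lemma Q4_left: "a'\<in>carrier A ==> b'\<in>carrier B ==> bilin A B AB.T (%a b. Q4 \<phi> a b a' b')"
 by (rule bilinI) (auto intro: bilinD(2)[OF Q4_out] bilinD(2)[OF Q4_mid])

lemma Q4_lift: "t\<in>carrier AB.T ==> bilin A B AB.T (%a b. tensor_lift AB.T (Q4 \<phi> a b) t)"
 by (rule AB.bilin_tensor_lift[OF AB.T_kspace AB.kspace2_axioms _ Q4_right Q4_left])

lemma CT_mult_closed: "s\<in>carrier AB.T ==> t\<in>carrier AB.T ==> s\<otimes>\<^bsub>CT \<phi>\<^esub>t\<in>carrier AB.T"
 unfolding CT_mult by (rule linD(1)[OF AB.lin_tensor_lift[OF AB.T_kspace Q4_lift]])

lemma lf_CT_mult:
 assumes l: "lf AB.T l" and s: "s\<in>carrier AB.T" and t: "t\<in>carrier AB.T" and f: "f\<in>s" and g: "g\<in>t"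
 shows "l (s\<otimes>\<^bsub>CT \<phi>\<^esub>t) = pair2 f (%a b. pair2 g (%a' b'. l (Q4 \<phi> a b a' b')))"
proof -
 have fo: "AB.ok f" "AB.ok g" using AB.rep_ok s t f g by blast+
 have "l (s\<otimes>\<^bsub>CT \<phi>\<^esub>t) = tform (%a b. l (tensor_lift AB.T (Q4 \<phi> a b) t)) s"
  unfolding CT_mult by (rule AB.lf_tensor_lift[OF AB.T_kspace bilin_closed[OF Q4_lift[OF t]] s l])
 also have "... = pair2 f (%a b. l (tensor_lift AB.T (Q4 \<phi> a b) t))"
  by (rule AB.tform_rep[OF bil_lf[OF Q4_lift[OF t] l] f s])
 also have "... = pair2 f (%a b. pair2 g (%a' b'. l (Q4 \<phi> a b a' b')))"
 proof (rule pair2_cong)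
  fix a b assume "(a, b)\<in>keys f"
  then have ab: "a\<in>carrier A" "b\<in>carrier B" using fo by auto
  show "l (tensor_lift AB.T (Q4 \<phi> a b) t) = pair2 g (%a' b'. l (Q4 \<phi> a b a' b'))"
   using AB.lf_tensor_lift[OF AB.T_kspace bilin_closed[OF Q4_right[OF ab]] t l]
    AB.tform_rep[OF bil_lf[OF Q4_right[OF ab] l] g t] by simp
 qed
 finally show ?thesis .
qed

lemma CT_mult_bilin: "bilin AB.T AB.T AB.T (monoid.mult (CT \<phi>))"
proof (rule bilin_weak)
 fix l assume l: "lf AB.T l"
 show "bil AB.T AB.T (%s t. l (s\<otimes>\<^bsub>CT \<phi>\<^esub>t))"
 proof (rule bilI)
  fix t assume t: "t\<in>carrier AB.T"
  show "lf AB.T (%s. l (s\<otimes>\<^bsub>CT \<phi>\<^esub>t))"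
   unfolding CT_mult by (rule lf_lin[OF l AB.lin_tensor_lift[OF AB.T_kspace Q4_lift[OF t]]])
 next
  fix s assume s: "s\<in>carrier AB.T"
  obtain f where f: "AB.ok f" "f\<in>s" using AB.T_obtain[OF s] by metis
  have "lf AB.T (%t. pair2 f (%a b. l (tensor_lift AB.T (Q4 \<phi> a b) t)))"
   unfolding pair2_def using f(1)
   by (intro lf_pair lf_lin[OF l] AB.lin_tensor_lift[OF AB.T_kspace] Q4_right) auto
  moreover have "l (s\<otimes>\<^bsub>CT \<phi>\<^esub>t) = pair2 f (%a b. l (tensor_lift AB.T (Q4 \<phi> a b) t))" if t: "t\<in>carrier AB.T" for t
   unfolding CT_mult using AB.lf_tensor_lift[OF AB.T_kspace bilin_closed[OF Q4_lift[OF t]] s l]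
    AB.tform_rep[OF bil_lf[OF Q4_lift[OF t] l] f(2) s] by simp
  ultimately show "lf AB.T (%t. l (s\<otimes>\<^bsub>CT \<phi>\<^esub>t))" by (simp add: lf_def)
 qed
qed (auto intro: AB.T_kspace CT_mult_closed)

lemma CT_mult_tens:
 assumes "a\<in>carrier A" "b\<in>carrier B" "a'\<in>carrier A" "b'\<in>carrier B"
 shows "tens A B a b\<otimes>\<^bsub>CT \<phi>\<^esub>tens A B a' b' = Q4 \<phi> a b a' b'"
 unfolding CT_mult using assms
 by (simp add: AB.tensor_lift_tens[OF AB.T_kspace Q4_lift] AB.tensor_lift_tens[OF AB.T_kspace Q4_right])

end

section \<open>Sweedler calculus with scalar values\<close>

locale cchopf = cocommutative_color_hopf_algebra \<phi> A
 for \<phi> :: "'g::ab_group_add => 'g => 'k::field"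
  and A :: "('k, 'g, 'a, 'm) hopf_scheme" (structure) +
 assumes cf: "commutation_factor \<phi>"

sublocale cchopf\<subseteq>AA: galg2 A A ..

lemma kspace2I: "kspace V ==> kspace W ==> kspace2 V W" by (simp add: kspace2_def)

definition tri :: "('k::field, 'a, 'm) module_scheme => ('a => 'a => 'a => 'k) => bool" where
 "tri V b\<longleftrightarrow>(\<forall>u\<in>carrier V. bil V V (b u))\<and>(\<forall>v\<in>carrier V. \<forall>w\<in>carrier V. lf V (%u. b u v w))"

context cchopf begin

abbreviation "cA \<equiv> carrier A"
abbreviation "TT \<equiv> tensor_space A A"
abbreviation "\<epsilon> \<equiv> counit A"
abbreviation "S \<equiv> antipode A"
abbreviation "\<Delta> \<equiv> comult A"

text \<open>
  In Sweedler notation, \<open>sw a b\<close> is \<open>b(a\<^sub>1, a\<^sub>2)\<close>.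
\<close>

definition sw :: "'a => ('a => 'a => 'k) => 'k" where
 "sw a b = tform b (\<Delta> a)"

text \<open>
  Braiding with an element of degree \<open>h\<close>. A color factor \<open>\<phi>(|v|, h)\<close>, which makes sense for homogeneous
  \<open>v\<close> only, is expressed by this linear map wherever linearity in \<open>v\<close> is needed.
\<close>

definition tw :: "'g => 'a => 'a" where "tw h = tws (%g. \<phi> g h)"

abbreviation "homk f \<equiv> keys f\<subseteq>hset A\<times>hset A"

lemma phi_add: "\<phi> (g + h) l = \<phi> g l * \<phi> h l" "\<phi> g (h + l) = \<phi> g h * \<phi> g l"
 using cf by (auto simp: commutation_factor_def bicharacter_def)

lemma phi_nz [simp]: "\<phi> g h \<noteq> 0"
 using cf by (auto simp: commutation_factor_def bicharacter_def)

lemma phi_inv: "\<phi> g h * \<phi> h g = 1"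
 using cf by (auto simp: commutation_factor_def bicharacter_def)

lemma phi_0 [simp]: "\<phi> 0 h = 1" "\<phi> h 0 = 1"
 using phi_add(1)[of 0 0 h] phi_add(2)[of h 0 0] by simp_all

lemma gr_lin: "gr F ==> lin A A F" by (rule grD)

lemma gr_S: "gr S"
 using antipode_graded_linear by (auto simp: gr_def graded_linear_def lin_def image_subset_iff)

lemma S_carrier [simp]: "a\<in>cA ==> S a\<in>cA"
 using linD(1)[OF gr_lin[OF gr_S]] .

lemma lf_counit: "lf A \<epsilon>" by (simp add: lf_def counit_add counit_smult)

lemma comult_lin: "lin A TT \<Delta>"
 using comult_graded_linear by (auto simp: graded_linear_def lin_def)

lemma comult_in [simp]: "a\<in>cA ==> \<Delta> a\<in>carrier TT"
 using linD(1)[OF comult_lin] .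

lemma lf_sw: "bil A A b ==> lf A (%a. sw a b)"
 unfolding sw_def by (rule lf_lin[OF AA.AB.lf_tform comult_lin])

lemma sw_rep: "bil A A b ==> f\<in>\<Delta> a ==> a\<in>cA ==> sw a b = pair2 f b"
 unfolding sw_def by (rule AA.AB.tform_rep) auto

lemma sw_cong:
 assumes "a\<in>cA" "\<And>u v. u\<in>cA ==> v\<in>cA ==> b u v = b' u v"
 shows "sw a b = sw a b'"
proof -
 obtain f where "f\<in>\<Delta> a" using AA.AB.T_obtain[OF comult_in[OF assms(1)]] by metis
 then have "(SOME f. f\<in>\<Delta> a)\<in>\<Delta> a" by (rule someI)
 then have "AA.AB.ok (SOME f. f\<in>\<Delta> a)" using AA.AB.rep_ok[OF comult_in[OF assms(1)]] by blast
 then show ?thesis unfolding sw_def tform_def using assms(2) by (intro pair2_cong) auto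
qed

lemma sw_add: "sw a (%u v. b u v + c u v) = sw a b + sw a c"
 by (simp add: sw_def tform_def pair2_def pair_fun_add)

lemma sw_diff: "sw a (%u v. b u v - c u v) = sw a b - sw a c"
 by (simp add: sw_def tform_def pair2_def pair_fun_diff)

lemma sw_cmult: "sw a (%u v. c * b u v) = c * sw a b"
 by (simp add: sw_def tform_def pair2_def pair_cmult)

lemma sw_zero [simp]: "sw a (%u v. 0) = 0"
 by (simp add: sw_def tform_def pair2_def)

lemma sw_pair: "sw a (%u v. pair f (%x. F x u v)) = pair f (%x. sw a (F x))"
 unfolding sw_def tform_def pair2_def by (rule pair_swap)

lemma sw_pair2: "sw a (%u v. pair2 f (%x y. F x y u v)) = pair2 f (%x y. sw a (F x y))"
 unfolding pair2_def by (rule sw_pair)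

lemma tens_rep: "t\<in>carrier TT ==> \<exists>f\<in>t. homk f"
proof (rule ccontr)
 assume t: "t\<in>carrier TT" and n: "\<not> (\<exists>f\<in>t. homk f)"
 define H where "H = AA.AB.cl ` {f. homk f}"
 have ok: "homk f ==> AA.AB.ok f" for f using hset_carrier by auto
 have sH: "subsp TT H"
  unfolding subsp_def
 proof (intro conjI ballI allI)
  show "H\<subseteq>carrier TT" using ok by (auto simp: H_def AA.AB.T_simps)
  show "\<zero>\<^bsub>TT\<^esub>\<in>H" by (auto simp: H_def AA.AB.T_simps)
  fix x y assume "x\<in>H" "y\<in>H"
  then obtain f g where fg: "homk f" "x = AA.AB.cl f" "homk g" "y = AA.AB.cl g" by (auto simp: H_def)
  have "homk (f + g)" using keys_add[of f g] fg(1,3) by blast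
  then show "x\<oplus>\<^bsub>TT\<^esub>y\<in>H" unfolding fg AA.AB.T_add H_def by blast
 next
  fix c x assume "x\<in>H"
  then obtain f where fg: "homk f" "x = AA.AB.cl f" by (auto simp: H_def)
  have "homk (scl c f)" using keys_scl[of c f] fg(1) by blast
  then show "c\<odot>\<^bsub>TT\<^esub>x\<in>H" unfolding fg AA.AB.T_smult H_def by blast
 qed
 have "t \<notin> H" using n AA.AB.cl_self by (auto simp: H_def)
 then obtain l where l: "lf TT l" "\<forall>x\<in>H. l x = 0" "l t = 1" using AA.AB.T.separation[OF sH t] by auto
 have "l t = (%x. 0) t"
 proof (rule AA.AB.lf_T_eq[OF l(1) lf_0 _ t])
  fix v w assume "v\<in>hset A" "w\<in>hset A"
  then have "tens A A v w\<in>H" by (auto simp: H_def tens_def keys_single)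
  then show "l (tens A A v w) = 0" using l by auto
 qed
 then show False using l by simp
qed

lemma hom_rep: "a\<in>cA ==> \<exists>f\<in>\<Delta> a. homk f"
 using tens_rep by auto

lemma hom_rep_deg: "a\<in>homog A g ==> \<exists>f\<in>\<Delta> a. keys f\<subseteq>(\<Union>h. homog A h\<times>homog A (g - h))"
proof -
 assume "a\<in>homog A g"
 then have "\<Delta> a\<in>homog TT g" using comult_graded_linear by (auto simp: graded_linear_def image_subset_iff)
 then obtain f where "keys f\<subseteq>(\<Union>h. homog A h\<times>homog A (g - h))" "\<Delta> a = AA.AB.cl f"
  unfolding AA.AB.T_simps by auto
 then show ?thesis using AA.AB.cl_self[of f] by auto
qed

lemma lf_mult_l: "lf A l ==> c\<in>cA ==> lf A (%x. l (c\<otimes>x))"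
 by (rule lf_lin[OF _ bilinD(1)[OF mult_bilin]])

lemma lf_mult_r: "lf A l ==> c\<in>cA ==> lf A (%x. l (x\<otimes>c))"
 by (rule lf_lin[OF _ bilinD(2)[OF mult_bilin]])

lemma lin_mult_l: "lin A A F ==> c\<in>cA ==> lin A A (%x. c\<otimes>F x)"
 by (rule lin_comp[OF bilinD(1)[OF mult_bilin]])

lemma lin_mult_r: "lin A A F ==> c\<in>cA ==> lin A A (%x. F x\<otimes>c)"
 by (rule lin_comp[OF bilinD(2)[OF mult_bilin]])

lemma lin_id: "lin A A (%x. x)" by (simp add: lin_def)

lemma bil_comp:
 assumes b: "bil A A b" and F: "lin A A F" and G: "lin A A G"
 shows "bil A A (%u v. b (F u) (G v))"
proof (rule bilI)
 show "lf A (%v. b (F u) (G v))" if "u\<in>cA" for u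
  by (rule lf_lin[OF bilD(1)[OF b linD(1)[OF F that]] G])
 show "lf A (%u. b (F u) (G v))" if "v\<in>cA" for v
  by (rule lf_lin[OF bilD(2)[OF b linD(1)[OF G that]] F])
qed

lemma bil_mult:
 assumes l: "lf A l" and F: "lin A A F" and G: "lin A A G"
 shows "bil A A (%u v. l (F u\<otimes>G v))"
 by (rule bil_comp[OF bil_lf[OF mult_bilin l] F G])

lemma bil_diff: "bil A A b ==> bil A A c ==> bil A A (%u v. b u v - c u v)"
 unfolding bil_def by (auto intro: lf_diff)

lemma bil_cmult: "bil A A b ==> bil A A (%u v. e * b u v)"
 unfolding bil_def by (auto intro: lf_cmult)

lemma bil_flip: "bil A A b ==> bil A A (%u v. b v u)"
 unfolding bil_def by auto

lemma bil_pair2: "(\<And>x y. (x, y)\<in>keys f ==> bil A A (F x y)) ==> bil A A (%u v. pair2 f (%x y. F x y u v))"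
 unfolding bil_def pair2_def by (auto intro!: lf_pair)

lemma counit_l: "a\<in>cA ==> lf A l ==> sw a (%u v. \<epsilon> u * l v) = l a"
 using counit_left[of a] AA.AB.lf_tensor_lift[OF kspace_axioms, of "%a1 a2. \<epsilon> a1\<odot>a2" "\<Delta> a" l]
 by (simp add: sw_def[symmetric] lfD(2) cong: sw_cong)

lemma counit_r: "a\<in>cA ==> lf A l ==> sw a (%u v. \<epsilon> v * l u) = l a"
 using counit_right[of a] AA.AB.lf_tensor_lift[OF kspace_axioms, of "%a1 a2. \<epsilon> a2\<odot>a1" "\<Delta> a" l]
 by (simp add: sw_def[symmetric] lfD(2) cong: sw_cong)

lemma antipode_l: "a\<in>cA ==> lf A l ==> sw a (%u v. l (S u\<otimes>v)) = \<epsilon> a * l \<one>"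
 using antipode_left[of a] AA.AB.lf_tensor_lift[OF kspace_axioms, of "%a1 a2. S a1\<otimes>a2" "\<Delta> a" l]
 by (simp add: sw_def[symmetric] lfD(2))

lemma antipode_r: "a\<in>cA ==> lf A l ==> sw a (%u v. l (u\<otimes>S v)) = \<epsilon> a * l \<one>"
 using antipode_right[of a] AA.AB.lf_tensor_lift[OF kspace_axioms, of "%a1 a2. a1\<otimes>S a2" "\<Delta> a" l]
 by (simp add: sw_def[symmetric] lfD(2))

lemma sw_one: "bil A A b ==> sw \<one> b = b \<one> \<one>"
 by (simp add: sw_def comult_one)

lemma sw_coassoc:
 assumes g: "tri A \<gamma>" and a: "a\<in>cA"
 shows "sw a (%u v. sw u (%u1 u2. \<gamma> u1 u2 v)) = sw a (%u v. sw v (\<gamma> u))"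
proof -
 interpret A3: kspace2 A TT by (rule kspace2I[OF kspace_axioms AA.AB.T_kspace])
 let ?G = "tform (%u t. tform (\<gamma> u) t)"
 have g1: "bil A A (\<gamma> u)" if "u\<in>cA" for u using g that by (simp add: tri_def)
 have b: "bil A TT (%u t. tform (\<gamma> u) t)"
 proof (rule bilI)
  show "lf TT (tform (\<gamma> u))" if "u\<in>cA" for u by (rule AA.AB.lf_tform[OF g1[OF that]])
  fix t assume "t\<in>carrier TT"
  then obtain f where f: "AA.AB.ok f" "t = AA.AB.cl f" by (auto simp: AA.AB.T_simps)
  have "lf A (%u. pair2 f (\<gamma> u))" unfolding pair2_def using f(1) g
   by (intro lf_pair) (auto simp: tri_def)
  then show "lf A (%u. tform (\<gamma> u) t)" using f by (simp add: lf_def AA.AB.tform_cl g1)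
 qed
 note lG = A3.lf_tform[OF b]
 have tc: "tens A TT u (tens A A v w)\<in>carrier A3.T" if "u\<in>cA" "v\<in>cA" "w\<in>cA" for u v w
  using that by simp
 have G: "?G (tens A TT u t) = tform (\<gamma> u) t" if "u\<in>cA" "t\<in>carrier TT" for u t
  using that b by simp
 have "?G (tensor_lift A3.T (%a1 a2. tensor_lift A3.T (%b1 b2. tens A TT b1 (tens A A b2 a2)) (\<Delta> a1)) (\<Delta> a))
   = sw a (%u v. ?G (tensor_lift A3.T (%b1 b2. tens A TT b1 (tens A A b2 v)) (\<Delta> u)))"
  unfolding sw_def using a
  by (intro AA.AB.lf_tensor_lift[OF A3.T_kspace _ _ lG] AA.AB.tensor_lift_closed[OF A3.T_kspace]) auto
 also have "... = sw a (%u v. sw u (%u1 u2. \<gamma> u1 u2 v))"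
 proof (rule sw_cong[OF a])
  fix u v assume uv: "u\<in>cA" "v\<in>cA"
  have "?G (tensor_lift A3.T (%b1 b2. tens A TT b1 (tens A A b2 v)) (\<Delta> u)) =
    sw u (%b1 b2. ?G (tens A TT b1 (tens A A b2 v)))"
   unfolding sw_def using uv by (intro AA.AB.lf_tensor_lift[OF A3.T_kspace _ _ lG]) auto
  also have "... = sw u (%u1 u2. \<gamma> u1 u2 v)"
   using uv by (intro sw_cong) (auto simp: G g1)
  finally show "?G (tensor_lift A3.T (%b1 b2. tens A TT b1 (tens A A b2 v)) (\<Delta> u)) = sw u (%u1 u2. \<gamma> u1 u2 v)" .
 qed
 finally have 1: "?G (tensor_lift A3.T (%a1 a2. tensor_lift A3.T (%b1 b2. tens A TT b1 (tens A A b2 a2)) (\<Delta> a1)) (\<Delta> a))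
   = sw a (%u v. sw u (%u1 u2. \<gamma> u1 u2 v))" .
 have "?G (tensor_map A TT (%a1. a1) \<Delta> (\<Delta> a)) = sw a (%u v. ?G (tens A TT u (\<Delta> v)))"
  unfolding sw_def tensor_map_def using a by (intro AA.AB.lf_tensor_lift[OF A3.T_kspace _ _ lG]) auto
 also have "... = sw a (%u v. sw v (\<gamma> u))"
  using a by (intro sw_cong) (auto simp: G sw_def)
 finally show ?thesis using 1 coassoc[OF a] by (simp add: Let_def)
qed

lemma gr_tw: "gr (tw h)" unfolding tw_def by (rule gr_tws)

lemma tw_homog: "v\<in>homog A g ==> tw h v = \<phi> g h\<odot>v" unfolding tw_def by (rule tws_homog)

lemma tw_carrier [simp]: "v\<in>cA ==> tw h v\<in>cA" unfolding tw_def by simp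

lemma sw_cocomm:
 assumes b: "bil A A b" and a: "a\<in>cA" and f: "f\<in>\<Delta> a" "homk f"
 shows "sw a b = pair2 f (%u v. \<phi> (dg A u) (dg A v) * b v u)"
proof -
 have fl: "bilin A A TT (%a1 a2. tens A A a2 a1)"
  using AA.AB.tens_bilin by (auto simp: bilin_def)
 let ?b = "color_ext \<phi> A A TT (%a1 a2. tens A A a2 a1)"
 have cb: "bilin A A TT ?b" by (rule AA.AB.color_ext_bilin[OF AA.AB.T_kspace fl])
 note lb = AA.AB.lf_tform[OF b]
 have "sw a b = tform b (tensor_lift TT ?b (\<Delta> a))"
  unfolding sw_def by (subst cocommutative[OF a]) (simp add: Let_def)
 also have "... = tform (%u v. tform b (?b u v)) (\<Delta> a)"
  by (rule AA.AB.lf_tensor_lift[OF AA.AB.T_kspace bilin_closed[OF cb] comult_in[OF a] lb])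
 also have "... = pair2 f (%u v. tform b (?b u v))"
  by (rule AA.AB.tform_rep[OF bil_lf[OF cb lb] f(1) comult_in[OF a]])
 also have "... = pair2 f (%u v. \<phi> (dg A u) (dg A v) * b v u)"
 proof (rule pair2_cong)
  fix u v assume "(u, v)\<in>keys f"
  then have uv: "u\<in>homog A (dg A u)" "v\<in>homog A (dg A v)" using f(2) dg_in by auto
  have "?b u v = \<phi> (dg A u) (dg A v)\<odot>\<^bsub>TT\<^esub>tens A A v u"
   by (rule AA.AB.color_ext_homog[OF AA.AB.T_kspace fl uv])
  then show "tform b (?b u v) = \<phi> (dg A u) (dg A v) * b v u"
   using uv b by (simp add: lfD(2)[OF lb])
 qed
 finally show ?thesis .
qed

lemma sw_mult:
 assumes b: "bil A A b" and x: "x\<in>cA" "y\<in>cA"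
  and f: "f\<in>\<Delta> x" "homk f" and g: "g\<in>\<Delta> y" "homk g"
 shows "sw (x\<otimes>y) b = pair2 f (%x1 x2. pair2 g (%y1 y2. \<phi> (dg A x2) (dg A y1) * b (x1\<otimes>y1) (x2\<otimes>y2)))"
proof -
 note lb = AA.AB.lf_tform[OF b]
 have "sw (x\<otimes>y) b = pair2 f (%x1 x2. pair2 g (%y1 y2. tform b (AA.Q4 \<phi> x1 x2 y1 y2)))"
  unfolding sw_def comult_mult[OF x]
  by (rule AA.lf_CT_mult[OF lb comult_in[OF x(1)] comult_in[OF x(2)] f(1) g(1)])
 also have "... = pair2 f (%x1 x2. pair2 g (%y1 y2. \<phi> (dg A x2) (dg A y1) * b (x1\<otimes>y1) (x2\<otimes>y2)))"
 proof (intro pair2_cong)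
  fix x1 x2 y1 y2 assume "(x1, x2)\<in>keys f" "(y1, y2)\<in>keys g"
  then have h: "x1\<in>cA" "x2\<in>homog A (dg A x2)" "y1\<in>homog A (dg A y1)" "y2\<in>cA"
   using f(2) g(2) dg_in hset_carrier by auto
  show "tform b (AA.Q4 \<phi> x1 x2 y1 y2) = \<phi> (dg A x2) (dg A y1) * b (x1\<otimes>y1) (x2\<otimes>y2)"
   using AA.Q4_homog[OF h] h b by (simp add: lfD(2)[OF lb])
 qed
 finally show ?thesis .
qed

text \<open>
  The factor \<open>\<phi>(|x\<^sub>2|, |y\<^sub>1|)\<close> is absorbed into the leg \<open>x\<^sub>2\<close>, so that only \<open>\<Delta> y\<close> has to be represented
  by homogeneous elements.
\<close>

lemma sw_mult_tw:
 assumes b: "bil A A b" and x: "x\<in>cA" "y\<in>cA" and g: "g\<in>\<Delta> y" "homk g"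
 shows "sw (x\<otimes>y) b = pair2 g (%y1 y2. sw x (%u v. b (u\<otimes>y1) (tw (dg A y1) v\<otimes>y2)))"
proof -
 obtain f where f: "f\<in>\<Delta> x" "homk f" using hom_rep[OF x(1)] by auto
 have "pair2 g (%y1 y2. sw x (%u v. b (u\<otimes>y1) (tw (dg A y1) v\<otimes>y2))) =
   pair2 g (%y1 y2. pair2 f (%x1 x2. \<phi> (dg A x2) (dg A y1) * b (x1\<otimes>y1) (x2\<otimes>y2)))"
 proof (rule pair2_cong)
  fix y1 y2 assume "(y1, y2)\<in>keys g"
  then have y: "y1\<in>cA" "y2\<in>cA" using g hset_carrier by auto
  have "bil A A (%u v. b (u\<otimes>y1) (tw (dg A y1) v\<otimes>y2))"
   using y by (intro bil_comp[OF b] lin_mult_r lin_id gr_lin gr_tw)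
  then have "sw x (%u v. b (u\<otimes>y1) (tw (dg A y1) v\<otimes>y2)) =
   pair2 f (%u v. b (u\<otimes>y1) (tw (dg A y1) v\<otimes>y2))" by (rule sw_rep[OF _ f(1) x(1)])
  also have "... = pair2 f (%x1 x2. \<phi> (dg A x2) (dg A y1) * b (x1\<otimes>y1) (x2\<otimes>y2))"
  proof (rule pair2_cong)
   fix x1 x2 assume "(x1, x2)\<in>keys f"
   then have h: "x1\<in>cA" "x2\<in>homog A (dg A x2)" using f(2) dg_in hset_carrier by auto
   then show "b (x1\<otimes>y1) (tw (dg A y1) x2\<otimes>y2) = \<phi> (dg A x2) (dg A y1) * b (x1\<otimes>y1) (x2\<otimes>y2)"
    using y lfD(2)[OF bilD(1)[OF b]] by (simp add: tw_homog smult_mult_left)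
  qed
  finally show "sw x (%u v. b (u\<otimes>y1) (tw (dg A y1) v\<otimes>y2)) =
   pair2 f (%x1 x2. \<phi> (dg A x2) (dg A y1) * b (x1\<otimes>y1) (x2\<otimes>y2))" .
 qed
 then show ?thesis unfolding sw_mult[OF b x f g] pair2_def by (simp add: pair_swap[of f])
qed

text \<open>The two actions of linear functionals: \<open>Tr j a = j(a\<^sub>2) a\<^sub>1\<close> and \<open>Tl j a = j(a\<^sub>1) a\<^sub>2\<close>.\<close>

definition Tr :: "('a => 'k) => 'a => 'a" where "Tr j a = tensor_lift A (%u v. j v\<odot>u) (\<Delta> a)"
definition Tl :: "('a => 'k) => 'a => 'a" where "Tl j a = tensor_lift A (%u v. j u\<odot>v) (\<Delta> a)"

lemma Tr_bilin: "lf A j ==> bilin A A A (%u v. j v\<odot>u)"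
 by (intro bilinI linI) (auto simp: lfD smult_addl smult_addr smult_smult mult.commute)

lemma Tl_bilin: "lf A j ==> bilin A A A (%u v. j u\<odot>v)"
 by (intro bilinI linI) (auto simp: lfD smult_addl smult_addr smult_smult mult.commute)

lemma Tr_lin: "lf A j ==> lin A A (Tr j)"
 unfolding Tr_def[abs_def] by (rule lin_comp[OF AA.AB.lin_tensor_lift[OF kspace_axioms Tr_bilin] comult_lin])

lemma Tl_lin: "lf A j ==> lin A A (Tl j)"
 unfolding Tl_def[abs_def] by (rule lin_comp[OF AA.AB.lin_tensor_lift[OF kspace_axioms Tl_bilin] comult_lin])

lemma Tr_carrier [simp]: "lf A j ==> a\<in>cA ==> Tr j a\<in>cA"
 using linD(1)[OF Tr_lin] .

lemma Tl_carrier [simp]: "lf A j ==> a\<in>cA ==> Tl j a\<in>cA"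
 using linD(1)[OF Tl_lin] .

lemma lf_Tr: "lf A l ==> a\<in>cA ==> l (Tr j a) = sw a (%u v. j v * l u)"
 unfolding Tr_def by (subst AA.AB.lf_tensor_lift[OF kspace_axioms]) (auto simp: sw_def[symmetric] lfD(2) intro!: sw_cong)

lemma lf_Tl: "lf A l ==> a\<in>cA ==> l (Tl j a) = sw a (%u v. j u * l v)"
 unfolding Tl_def by (subst AA.AB.lf_tensor_lift[OF kspace_axioms]) (auto simp: sw_def[symmetric] lfD(2) intro!: sw_cong)

lemma triI: "(\<And>u v. u\<in>cA ==> v\<in>cA ==> lf A (\<gamma> u v)) ==>
  (\<And>u w. u\<in>cA ==> w\<in>cA ==> lf A (%v. \<gamma> u v w)) ==>
  (\<And>v w. v\<in>cA ==> w\<in>cA ==> lf A (%u. \<gamma> u v w)) ==> tri A \<gamma>"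
 by (simp add: tri_def bil_def)

lemma sw_Tr:
 assumes b: "bil A A b" and j: "lf A j" and a: "a\<in>cA"
 shows "sw (Tr j a) b = sw a (%u v. b u (Tr j v))"
proof -
 have "sw (Tr j a) b = sw a (%u v. j v * sw u b)"
  by (rule lf_Tr[OF lf_sw[OF b] a])
 also have "... = sw a (%u v. sw u (%u1 u2. j v * b u1 u2))" by (simp add: sw_cmult)
 also have "... = sw a (%u v. sw v (%u2 w. j w * b u u2))"
  using b j by (intro sw_coassoc[OF triI a, where \<gamma> = "%u1 u2 v. j v * b u1 u2"] lf_cmult lf_cmult_right) (auto dest: bilD)
 also have "... = sw a (%u v. b u (Tr j v))"
  by (rule sw_cong[OF a]) (simp add: lf_Tr[OF bilD(1)[OF b]])
 finally show ?thesis .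
qed

lemma sw_Tl:
 assumes b: "bil A A b" and j: "lf A j" and a: "a\<in>cA"
 shows "sw (Tl j a) b = sw a (%u v. b (Tl j u) v)"
proof -
 have "sw (Tl j a) b = sw a (%u v. j u * sw v b)"
  by (rule lf_Tl[OF lf_sw[OF b] a])
 also have "... = sw a (%u v. sw v (%v1 v2. j u * b v1 v2))" by (simp add: sw_cmult)
 also have "... = sw a (%u v. sw u (%u1 u2. j u1 * b u2 v))"
  using b j by (intro sw_coassoc[OF triI a, where \<gamma> = "%u v1 v2. j u * b v1 v2", symmetric] lf_cmult lf_cmult_right) (auto dest: bilD)
 also have "... = sw a (%u v. b (Tl j u) v)"
  by (rule sw_cong[OF a]) (simp add: lf_Tl[OF bilD(2)[OF b]])
 finally show ?thesis .
qed

lemma Tl_counit: "a\<in>cA ==> Tl \<epsilon> a = a"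
 by (rule lf_eqI) (auto simp: lf_Tl counit_l lf_counit)

lemma Tr_Tl:
 assumes i: "lf A i" and j: "lf A j" and a: "a\<in>cA"
 shows "Tr i (Tl j a) = Tl j (Tr i a)"
proof (rule lf_eqI)
 fix l assume l: "lf A l"
 have "l (Tr i (Tl j a)) = sw a (%u v. i v * l (Tl j u))"
  using sw_Tl[OF bil_flip[OF bil_prod[OF i l]] j a] a j by (simp add: lf_Tr[OF l])
 also have "... = sw a (%u v. sw u (%u1 u2. i v * (j u1 * l u2)))"
  by (rule sw_cong[OF a]) (simp add: lf_Tl[OF l] sw_cmult)
 also have "... = sw a (%u v. sw v (%u2 w. i w * (j u * l u2)))"
  using i j l by (intro sw_coassoc[OF triI a, where \<gamma> = "%u1 u2 v. i v * (j u1 * l u2)"] lf_cmult lf_cmult_right) auto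
 also have "... = sw a (%u v. j u * l (Tr i v))"
  by (rule sw_cong[OF a]) (simp add: lf_Tr[OF l] sw_cmult[symmetric] mult_ac)
 also have "... = l (Tl j (Tr i a))"
  using sw_Tr[OF bil_prod[OF j l] i a] a i by (simp add: lf_Tl[OF l])
 finally show "l (Tr i (Tl j a)) = l (Tl j (Tr i a))" .
qed (use assms in auto)

lemma lf_Tr_comp: "lf A i ==> lf A s ==> lf A (%v. i (Tr s v))"
 by (rule lf_lin[OF _ Tr_lin])

lemma Tr_Tr: "lf A i ==> lf A s ==> a\<in>cA ==> Tr i (Tr s a) = Tr (%v. i (Tr s v)) a"
 by (rule lf_eqI) (auto simp: lf_Tr lf_Tr_comp sw_Tr[OF bil_flip[OF bil_prod]])

text \<open>
  The two actions are adjoint to each other.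
\<close>

lemma Tr_swap: "lf A i ==> lf A s ==> a\<in>cA ==> i (Tr s a) = s (Tl i a)"
 by (simp add: lf_Tr lf_Tl mult.commute)

end

section \<open>Test coalgebras and convolution\<close>

text \<open>
 A cocommutative color coalgebra given by structure constants on a basis, the index type.
\<close>

locale tcoalg =
 fixes \<phi> :: "'g::ab_group_add => 'g => 'k::field"
  and dgr :: "'i => 'g" and d :: "'i => ('i\<times>'i \<Rightarrow>\<^sub>0 'k)" and eps :: "'i => 'k"
 assumes cft: "commutation_factor \<phi>"
  and d_coassoc: "\<And>x F. pair2 (d x) (%y w. pair2 (d y) (%u v. F u v w)) = pair2 (d x) (%u z. pair2 (d z) (F u))"
  and d_cocomm: "\<And>x F. pair2 (d x) F = pair2 (d x) (%y z. \<phi> (dgr y) (dgr z) * F z y)"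
  and d_counit: "\<And>x F. pair2 (d x) (%y z. eps y * F z) = F x"
  and d_deg: "\<And>x y z. (y, z)\<in>keys (d x) ==> dgr y + dgr z = dgr x"
  and eps_deg: "\<And>x. dgr x \<noteq> 0 ==> eps x = 0"
begin

lemma phi_add: "\<phi> (g + h) l = \<phi> g l * \<phi> h l" "\<phi> g (h + l) = \<phi> g h * \<phi> g l"
 using cft by (auto simp: commutation_factor_def bicharacter_def)

lemma phi_0 [simp]: "\<phi> 0 h = 1" "\<phi> h 0 = 1"
 using phi_add(1)[of 0 0 h] phi_add(2)[of h 0 0] cft
 by (auto simp: commutation_factor_def bicharacter_def)

lemma phi_inv: "\<phi> g h * \<phi> h g = 1"
 using cft by (auto simp: commutation_factor_def bicharacter_def)

lemma phi_eps [simp]: "\<phi> (dgr y) h * eps y = eps y" "\<phi> h (dgr y) * eps y = eps y"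
 "eps y * \<phi> (dgr y) h = eps y" "eps y * \<phi> h (dgr y) = eps y"
 by (cases "dgr y = 0"; simp add: eps_deg)+

lemma phi_eps' [simp]: "\<phi> (dgr y) h * (eps y * e) = eps y * e" "\<phi> h (dgr y) * (eps y * e) = eps y * e"
 by (cases "dgr y = 0"; simp add: eps_deg)+

lemma d_counit_r: "pair2 (d x) (%y z. eps z * F y) = F x"
proof -
 have "pair2 (d x) (%y z. eps z * F y) = pair2 (d x) (%y z. \<phi> (dgr y) (dgr z) * (eps y * F z))"
  by (rule d_cocomm)
 then show ?thesis by (simp add: d_counit)
qed

lemma d_swap4:
 "pair2 (d x) (%y z. pair2 (d y) (%y1 y2. pair2 (d z) (%z1 z2. \<phi> (dgr y2) (dgr z1) * F y1 y2 z1 z2))) =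
  pair2 (d x) (%y z. pair2 (d y) (%y1 y2. pair2 (d z) (%z1 z2. F y1 z1 y2 z2)))"
proof -
 have r: "pair2 (d x) (%y z. pair2 (d y) (%y1 y2. pair2 (d z) (%z1 z2. G y1 y2 z1 z2))) =
   pair2 (d x) (%y1 w. pair2 (d w) (%m z2. pair2 (d m) (%y2 z1. G y1 y2 z1 z2)))" for G
  by (simp add: d_coassoc[where F = "%y1 y2 z. pair2 (d z) (%z1 z2. G y1 y2 z1 z2)" for G]
    d_coassoc[where F = "%u v w. G u v w" for G])
 show ?thesis unfolding r
  by (subst d_cocomm[of _ "%y2 z1. F _ z1 y2 _"]) simp
qed

end

text \<open>
  The coproduct of the color tensor product of two test coalgebras, on the product of the bases.
\<close>

definition dprod :: "('g => 'g => 'k::field) => ('i => 'g) => ('j => 'g) => ('i => ('i\<times>'i \<Rightarrow>\<^sub>0 'k)) =>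
  ('j => ('j\<times>'j \<Rightarrow>\<^sub>0 'k)) => 'i\<times>'j => (('i\<times>'j)\<times>('i\<times>'j) \<Rightarrow>\<^sub>0 'k)" where
 "dprod \<phi> dgr dgr' d d' x = pbind (d (fst x)) (%p. pbind (d' (snd x)) (%q.
   single ((fst p, fst q), (snd p, snd q)) (\<phi> (dgr (snd p)) (dgr' (fst q)))))"

lemma pair2_dprod: "pair2 (dprod \<phi> dgr dgr' d d' (x, x')) F =
  pair2 (d x) (%y z. pair2 (d' x') (%y' z'. \<phi> (dgr z) (dgr' y') * F (y, y') (z, z')))"
 by (simp add: dprod_def pair2_def pair_pbind)

lemma pair2_fun_cmult: "pair2 f (%x y. c * F x y) = c * pair2 f F"
 by (simp add: pair2_def pair_cmult)

lemma pair2_swap: "pair2 f (%x y. pair2 g (%u v. F x y u v)) = pair2 g (%u v. pair2 f (%x y. F x y u v))"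
 by (simp add: pair2_def pair_swap[of f])

lemma tcoalg_prod:
 fixes \<phi> :: "'g::ab_group_add => 'g => 'k::field" and dgr :: "'i => 'g" and dgr' :: "'j => 'g"
 assumes "tcoalg \<phi> dgr d eps" "tcoalg \<phi> dgr' d' eps'"
 shows "tcoalg \<phi> (%x. dgr (fst x) + dgr' (snd x)) (dprod \<phi> dgr dgr' d d') (%x. eps (fst x) * eps' (snd x))"
proof -
 interpret C: tcoalg \<phi> dgr d eps by fact
 interpret D: tcoalg \<phi> dgr' d' eps' by fact
 note [simp] = C.phi_add
 let ?d = "dprod \<phi> dgr dgr' d d'"
 show ?thesis
 proof
  show "commutation_factor \<phi>" by (rule C.cft)
 next
  fix x :: "'i\<times>'j" and F
  obtain a b where x: "x = (a, b)" by force
  have "pair2 (?d x) (%y w. pair2 (?d y) (%u v. F u v w)) =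
   pair2 (d a) (%y w. pair2 (d' b) (%y' w'. \<phi> (dgr w) (dgr' y') * pair2 (d y) (%u v. pair2 (d' y') (%u' v'.
    \<phi> (dgr v) (dgr' u') * F (u, u') (v, v') (w, w')))))"
   by (simp add: x pair2_dprod)
  also have "... = pair2 (d a) (%y w. pair2 (d' b) (%y' w'. pair2 (d y) (%u v. pair2 (d' y') (%u' v'.
    \<phi> (dgr w) (dgr' u') * (\<phi> (dgr w) (dgr' v') * (\<phi> (dgr v) (dgr' u') * F (u, u') (v, v') (w, w')))))))"
   unfolding pair2_fun_cmult[symmetric]
   by (intro pair2_cong) (simp add: D.d_deg[symmetric])
  also have "... = pair2 (d a) (%y w. pair2 (d y) (%u v. pair2 (d' b) (%y' w'. pair2 (d' y') (%u' v'.
    \<phi> (dgr w) (dgr' u') * (\<phi> (dgr w) (dgr' v') * (\<phi> (dgr v) (dgr' u') * F (u, u') (v, v') (w, w')))))))"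
   by (simp add: pair2_swap[of "d' b"])
  also have "... = pair2 (d a) (%u z. pair2 (d z) (%v w. pair2 (d' b) (%u' z'. pair2 (d' z') (%v' w'.
    \<phi> (dgr w) (dgr' u') * (\<phi> (dgr w) (dgr' v') * (\<phi> (dgr v) (dgr' u') * F (u, u') (v, v') (w, w')))))))"
   by (subst C.d_coassoc, subst D.d_coassoc) simp
  also have "... = pair2 (d a) (%u z. pair2 (d' b) (%u' z'. pair2 (d z) (%v w. pair2 (d' z') (%v' w'.
    \<phi> (dgr w) (dgr' u') * (\<phi> (dgr w) (dgr' v') * (\<phi> (dgr v) (dgr' u') * F (u, u') (v, v') (w, w')))))))"
   by (simp add: pair2_swap[of "d' b"])
  also have "... = pair2 (d a) (%u z. pair2 (d' b) (%u' z'. \<phi> (dgr z) (dgr' u') * pair2 (d z) (%v w. pair2 (d' z') (%v' w'.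
    \<phi> (dgr w) (dgr' v') * F (u, u') (v, v') (w, w')))))"
   unfolding pair2_fun_cmult[symmetric]
   by (intro pair2_cong) (simp add: C.d_deg[symmetric])
  also have "... = pair2 (?d x) (%u z. pair2 (?d z) (F u))"
   by (simp add: x pair2_dprod)
  finally show "pair2 (?d x) (%y w. pair2 (?d y) (%u v. F u v w)) = pair2 (?d x) (%u z. pair2 (?d z) (F u))" .
 next
  fix x :: "'i\<times>'j" and F
  obtain a b where x: "x = (a, b)" by force
  have "pair2 (?d x) F = pair2 (d a) (%y z. pair2 (d' b) (%y' z'. \<phi> (dgr z) (dgr' y') * F (y, y') (z, z')))"
   by (simp add: x pair2_dprod)
  also have "... = pair2 (d a) (%y z. \<phi> (dgr y) (dgr z) * pair2 (d' b) (%y' z'. \<phi> (dgr y) (dgr' y') * F (z, y') (y, z')))"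
   by (rule C.d_cocomm)
  also have "... = pair2 (d a) (%y z. \<phi> (dgr y) (dgr z) * pair2 (d' b) (%y' z'. \<phi> (dgr' y') (dgr' z') *
    (\<phi> (dgr y) (dgr' z') * F (z, z') (y, y'))))"
  proof (rule pair2_cong)
   fix y z
   show "\<phi> (dgr y) (dgr z) * pair2 (d' b) (%y' z'. \<phi> (dgr y) (dgr' y') * F (z, y') (y, z')) =
    \<phi> (dgr y) (dgr z) * pair2 (d' b) (%y' z'. \<phi> (dgr' y') (dgr' z') * (\<phi> (dgr y) (dgr' z') * F (z, z') (y, y')))"
    by (subst D.d_cocomm) (rule refl)
  qed
  also have "... = pair2 (d a) (%y z. pair2 (d' b) (%y' z'. \<phi> (dgr z) (dgr' y') *
    (\<phi> (dgr y + dgr' y') (dgr z + dgr' z') * F (z, z') (y, y'))))"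
   unfolding pair2_fun_cmult[symmetric]
  proof (intro pair2_cong)
   fix y z y' z'
   have "\<phi> (dgr z) (dgr' y') * (\<phi> (dgr y + dgr' y') (dgr z + dgr' z') * e) =
    (\<phi> (dgr z) (dgr' y') * \<phi> (dgr' y') (dgr z)) * (\<phi> (dgr y) (dgr z) * (\<phi> (dgr' y') (dgr' z') * (\<phi> (dgr y) (dgr' z') * e)))" for e
    by simp
   then show "\<phi> (dgr y) (dgr z) * (\<phi> (dgr' y') (dgr' z') * (\<phi> (dgr y) (dgr' z') * F (z, z') (y, y'))) =
    \<phi> (dgr z) (dgr' y') * (\<phi> (dgr y + dgr' y') (dgr z + dgr' z') * F (z, z') (y, y'))"
    by (simp only: C.phi_inv mult_1)
  qed
  also have "... = pair2 (?d x) (%y z. \<phi> (dgr (fst y) + dgr' (snd y)) (dgr (fst z) + dgr' (snd z)) * F z y)"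
   by (simp add: x pair2_dprod)
  finally show "pair2 (?d x) F = pair2 (?d x) (%y z. \<phi> (dgr (fst y) + dgr' (snd y)) (dgr (fst z) + dgr' (snd z)) * F z y)" .
 next
  fix x :: "'i\<times>'j" and F :: "'i\<times>'j => 'k"
  obtain a b where x: "x = (a, b)" by force
  have "pair2 (?d x) (%y z. eps (fst y) * eps' (snd y) * F z) =
   pair2 (d a) (%y z. eps y * pair2 (d' b) (%y' z'. eps' y' * F (z, z')))"
   unfolding pair2_fun_cmult[symmetric] x pair2_dprod
  proof (intro pair2_cong)
   fix y z y' z'
   have "\<phi> (dgr z) (dgr' y') * (eps y * eps' y' * e) = \<phi> (dgr z) (dgr' y') * (eps' y' * (eps y * e))" for e
    by (simp add: mult_ac)
   then show "\<phi> (dgr z) (dgr' y') * (eps (fst (y, y')) * eps' (snd (y, y')) * F (z, z')) = eps y * (eps' y' * F (z, z'))"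
    by (simp only: D.phi_eps' fst_conv snd_conv) (simp add: mult_ac)
  qed
  also have "... = F x" by (simp add: C.d_counit D.d_counit x)
  finally show "pair2 (?d x) (%y z. eps (fst y) * eps' (snd y) * F z) = F x" .
 next
  fix x y z :: "'i\<times>'j"
  assume k: "(y, z)\<in>keys (?d x)"
  let ?G = "%p. pbind (d' (snd x)) (%q. single ((fst p, fst q), (snd p, snd q)) (\<phi> (dgr (snd p)) (dgr' (fst q))))"
  obtain p where p: "p\<in>keys (d (fst x))" "(y, z)\<in>keys (?G p)"
   using k keys_pbind[of "d (fst x)" ?G] by (auto simp: dprod_def)
  then obtain q where q: "q\<in>keys (d' (snd x))" "(y, z)\<in>keys (single ((fst p, fst q), (snd p, snd q)) (\<phi> (dgr (snd p)) (dgr' (fst q))))"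
   using keys_pbind[of "d' (snd x)" "%q. single ((fst p, fst q), (snd p, snd q)) (\<phi> (dgr (snd p)) (dgr' (fst q)))"] by auto
  have e: "y = (fst p, fst q)" "z = (snd p, snd q)" using q(2) by (auto simp: keys_single split: if_splits)
  have "dgr (fst p) + dgr (snd p) = dgr (fst x)" "dgr' (fst q) + dgr' (snd q) = dgr' (snd x)"
   using p(1) q(1) by (auto intro: C.d_deg D.d_deg)
  then show "dgr (fst y) + dgr' (snd y) + (dgr (fst z) + dgr' (snd z)) = dgr (fst x) + dgr' (snd x)"
   by (simp add: e algebra_simps)
 next
  fix x :: "'i\<times>'j" assume "dgr (fst x) + dgr' (snd x) \<noteq> 0"
  then have "dgr (fst x) \<noteq> 0 \<or> dgr' (snd x) \<noteq> 0" by auto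
  then show "eps (fst x) * eps' (snd x) = 0" using C.eps_deg D.eps_deg by auto
 qed
qed

locale kalg = kspace P for P :: "('k::field, 'p, 'm) module_scheme" (structure) +
 assumes kmult: "bilin P P P (\<otimes>)"
  and kassoc: "x\<in>carrier P ==> y\<in>carrier P ==> z\<in>carrier P ==> (x\<otimes>y)\<otimes>z = x\<otimes>(y\<otimes>z)"
  and kone [simp]: "\<one>\<in>carrier P"
  and kunit [simp]: "x\<in>carrier P ==> \<one>\<otimes>x = x" "x\<in>carrier P ==> x\<otimes>\<one> = x"

sublocale graded_algebra\<subseteq>kalg A
 by unfold_locales (auto simp: m_assoc intro: mult_bilin)

definition conv :: "('k::field, 'p, 'm) module_scheme => ('i => ('i\<times>'i \<Rightarrow>\<^sub>0 'k)) => ('i => 'p) => ('i => 'p) => 'i => 'p" where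
 "conv P d f g x = vsum P (d x) (%p. f (fst p)\<otimes>\<^bsub>P\<^esub>g (snd p))"

locale convolution = tcoalg \<phi> dgr d eps + P: kalg P
 for \<phi> :: "'g::ab_group_add => 'g => 'k::field" and dgr :: "'i => 'g" and d eps
  and P :: "('k, 'p, 'm) module_scheme"
begin

abbreviation cv (infixr \<open>\<star>\<close> 65) where "f\<star>g \<equiv> conv P d f g"

abbreviation "vals f \<equiv> \<forall>x. f x\<in>carrier P"

definition un :: "'i => 'p" where "un x = eps x\<odot>\<^bsub>P\<^esub>\<one>\<^bsub>P\<^esub>"

lemma mult_closed [simp]: "x\<in>carrier P ==> y\<in>carrier P ==> x\<otimes>\<^bsub>P\<^esub>y\<in>carrier P"
 by (rule bilin_closed[OF P.kmult])

lemma cv_closed [simp]: "vals f ==> vals g ==> (f\<star>g) x\<in>carrier P"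
 unfolding conv_def by (intro P.vsum_closed) simp

lemma un_closed [simp]: "un x\<in>carrier P" by (simp add: un_def)

lemma lf_cv: "lf P l ==> vals f ==> vals g ==> l ((f\<star>g) x) = pair2 (d x) (%y z. l (f y\<otimes>\<^bsub>P\<^esub>g z))"
 unfolding conv_def pair2_def by (rule P.lf_vsum) auto

lemma lf_ml: "lf P l ==> c\<in>carrier P ==> lf P (%x. l (c\<otimes>\<^bsub>P\<^esub>x))"
 by (rule lf_lin[OF _ bilinD(1)[OF P.kmult]])

lemma lf_mr: "lf P l ==> c\<in>carrier P ==> lf P (%x. l (x\<otimes>\<^bsub>P\<^esub>c))"
 by (rule lf_lin[OF _ bilinD(2)[OF P.kmult]])

lemma cv_assoc:
 assumes "vals f" "vals g" "vals h"
 shows "(f\<star>g)\<star>h = f\<star>(g\<star>h)"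
proof
 fix x
 show "((f\<star>g)\<star>h) x = (f\<star>(g\<star>h)) x"
 proof (rule P.lf_eqI)
  fix l assume l: "lf P l"
  have "l (((f\<star>g)\<star>h) x) = pair2 (d x) (%y w. l ((f\<star>g) y\<otimes>\<^bsub>P\<^esub>h w))"
   using assms by (intro lf_cv[OF l]) auto
  also have "... = pair2 (d x) (%y w. pair2 (d y) (%u v. l ((f u\<otimes>\<^bsub>P\<^esub>g v)\<otimes>\<^bsub>P\<^esub>h w)))"
   using assms by (simp add: lf_cv[OF lf_mr[OF l]])
  also have "... = pair2 (d x) (%u z. pair2 (d z) (%v w. l ((f u\<otimes>\<^bsub>P\<^esub>g v)\<otimes>\<^bsub>P\<^esub>h w)))"
   by (rule d_coassoc)
  also have "... = pair2 (d x) (%u z. l (f u\<otimes>\<^bsub>P\<^esub>(g\<star>h) z))"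
   using assms by (simp add: lf_cv[OF lf_ml[OF l]] P.kassoc)
  also have "... = l ((f\<star>(g\<star>h)) x)"
   using assms by (intro lf_cv[OF l, symmetric]) auto
  finally show "l (((f\<star>g)\<star>h) x) = l ((f\<star>(g\<star>h)) x)" .
 qed (use assms in auto)
qed

lemma cv_un_l: "vals f ==> un\<star>f = f"
proof
 fix x assume f: "vals f"
 have e: "c\<odot>\<^bsub>P\<^esub>\<one>\<^bsub>P\<^esub>\<otimes>\<^bsub>P\<^esub>y = c\<odot>\<^bsub>P\<^esub>y" if "y\<in>carrier P" for c y
  using linD(3)[OF bilinD(2)[OF P.kmult that], of "\<one>\<^bsub>P\<^esub>" c] that by simp
 show "(un\<star>f) x = f x"
  by (rule P.lf_eqI) (use f in \<open>auto simp: lf_cv un_def e lfD(2) d_counit\<close>)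
qed

lemma cv_un_r: "vals f ==> f\<star>un = f"
proof
 fix x assume f: "vals f"
 have e: "y\<otimes>\<^bsub>P\<^esub>(c\<odot>\<^bsub>P\<^esub>\<one>\<^bsub>P\<^esub>) = c\<odot>\<^bsub>P\<^esub>y" if "y\<in>carrier P" for c y
  using linD(3)[OF bilinD(1)[OF P.kmult that], of "\<one>\<^bsub>P\<^esub>" c] that by simp
 show "(f\<star>un) x = f x"
  by (rule P.lf_eqI) (use f in \<open>auto simp: lf_cv un_def e lfD(2) d_counit_r\<close>)
qed

lemma cv_inverse_unique: "vals f ==> vals g ==> vals h ==> f\<star>g = un ==> g\<star>h = un ==> f = h"
 using cv_assoc[of f g h] cv_un_l[of h] cv_un_r[of f] by simp

end

context galg2 begin

lemma CT_kalg:
 assumes cf: "commutation_factor \<phi>" shows "kalg (CT \<phi>)"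
proof -
 have pa: "\<phi> (g + h) l = \<phi> g l * \<phi> h l" "\<phi> g (h + l) = \<phi> g h * \<phi> g l" "\<phi> g h \<noteq> 0" for g h l
  using cf by (auto simp: commutation_factor_def bicharacter_def)
 have p0: "\<phi> 0 g = 1" "\<phi> g 0 = 1" for g using pa(1)[of 0 0 g] pa(2)[of g 0 0] pa(3) by auto
 note m = CT_mult_bilin[of \<phi>]
 let ?m = "monoid.mult (CT \<phi>)"
 note mc = CT_mult_closed[of _ _ \<phi>]
 note kc = AB.T_kspace
 have m1: "lin AB.T AB.T (%x. c\<otimes>\<^bsub>CT \<phi>\<^esub>h x)" if "lin AB.T AB.T h" "c\<in>carrier AB.T" for h c
  by (rule lin_comp[OF bilinD(1)[OF m that(2)] that(1)])
 have m2: "lin AB.T AB.T (%x. h x\<otimes>\<^bsub>CT \<phi>\<^esub>c)" if "lin AB.T AB.T h" "c\<in>carrier AB.T" for h c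
  by (rule lin_comp[OF bilinD(2)[OF m that(2)] that(1)])
 have idl: "lin AB.T AB.T (%x. x)" by (simp add: lin_def)
 have tq: "tens A B a b\<otimes>\<^bsub>CT \<phi>\<^esub>tens A B a' b' = \<phi> g h\<odot>\<^bsub>AB.T\<^esub>tens A B (a\<otimes>\<^bsub>A\<^esub>a') (b\<otimes>\<^bsub>B\<^esub>b')"
  if "a\<in>carrier A" "b\<in>homog B g" "a'\<in>homog A h" "b'\<in>carrier B" for a b a' b' g h
  using CT_mult_tens[of a b a' b'] Q4_homog[OF that] that by auto
 have hom: "(tens A B a b\<otimes>\<^bsub>CT \<phi>\<^esub>tens A B a' b')\<otimes>\<^bsub>CT \<phi>\<^esub>tens A B a'' b'' =
   tens A B a b\<otimes>\<^bsub>CT \<phi>\<^esub>(tens A B a' b'\<otimes>\<^bsub>CT \<phi>\<^esub>tens A B a'' b'')"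
  if h: "a\<in>hset A" "b\<in>hset B" "a'\<in>hset A" "b'\<in>hset B" "a''\<in>hset A" "b''\<in>hset B" for a b a' b' a'' b''
 proof -
  obtain g1 g2 g3 g4 g5 g6 where g: "a\<in>homog A g1" "b\<in>homog B g2" "a'\<in>homog A g3" "b'\<in>homog B g4" "a''\<in>homog A g5" "b''\<in>homog B g6"
   using h by (auto simp: hset_def)
  have c: "a\<in>carrier A" "b\<in>carrier B" "a'\<in>carrier A" "b'\<in>carrier B" "a''\<in>carrier A" "b''\<in>carrier B"
   using g by auto
  have "(tens A B a b\<otimes>\<^bsub>CT \<phi>\<^esub>tens A B a' b')\<otimes>\<^bsub>CT \<phi>\<^esub>tens A B a'' b'' =
   \<phi> g2 g3\<odot>\<^bsub>AB.T\<^esub>(tens A B (a\<otimes>\<^bsub>A\<^esub>a') (b\<otimes>\<^bsub>B\<^esub>b')\<otimes>\<^bsub>CT \<phi>\<^esub>tens A B a'' b'')"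
   using c by (simp add: tq[OF c(1) g(2,3) c(4)] linD(3)[OF m2[OF idl]])
  also have "... = (\<phi> g2 g3 * \<phi> (g2 + g4) g5)\<odot>\<^bsub>AB.T\<^esub>tens A B (a\<otimes>\<^bsub>A\<^esub>a'\<otimes>\<^bsub>A\<^esub>a'') (b\<otimes>\<^bsub>B\<^esub>b'\<otimes>\<^bsub>B\<^esub>b'')"
   using c by (simp add: tq[OF _ B.homog_mult[OF g(2,4)] g(5) c(6)] AB.T.smult_smult)
  also have "... = (\<phi> g4 g5 * \<phi> g2 (g3 + g5))\<odot>\<^bsub>AB.T\<^esub>tens A B (a\<otimes>\<^bsub>A\<^esub>(a'\<otimes>\<^bsub>A\<^esub>a'')) (b\<otimes>\<^bsub>B\<^esub>(b'\<otimes>\<^bsub>B\<^esub>b''))"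
   using c by (simp add: pa A.m_assoc B.m_assoc mult_ac)
  also have "... = \<phi> g4 g5\<odot>\<^bsub>AB.T\<^esub>(tens A B a b\<otimes>\<^bsub>CT \<phi>\<^esub>tens A B (a'\<otimes>\<^bsub>A\<^esub>a'') (b'\<otimes>\<^bsub>B\<^esub>b''))"
   using c by (simp add: tq[OF c(1) g(2) A.homog_mult[OF g(3,5)]] AB.T.smult_smult)
  also have "... = tens A B a b\<otimes>\<^bsub>CT \<phi>\<^esub>(tens A B a' b'\<otimes>\<^bsub>CT \<phi>\<^esub>tens A B a'' b'')"
   using c by (simp add: tq[OF c(3) g(4,5) c(6)] linD(3)[OF m1[OF idl]])
  finally show ?thesis .
 qed
 have h1: "(tens A B a b\<otimes>\<^bsub>CT \<phi>\<^esub>tens A B a' b')\<otimes>\<^bsub>CT \<phi>\<^esub>z = tens A B a b\<otimes>\<^bsub>CT \<phi>\<^esub>(tens A B a' b'\<otimes>\<^bsub>CT \<phi>\<^esub>z)"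
  if h: "a\<in>hset A" "b\<in>hset B" "a'\<in>hset A" "b'\<in>hset B" and z: "z\<in>carrier AB.T" for a b a' b' z
 proof -
  have c: "a\<in>carrier A" "b\<in>carrier B" "a'\<in>carrier A" "b'\<in>carrier B"
   using h by (auto intro: A.hset_carrier B.hset_carrier)
  show ?thesis
   by (rule AB.lin_T_eq[OF kc m1[OF idl] m1[OF m1[OF idl]] _ z]) (use c hom[OF h] in \<open>auto intro!: mc\<close>)
 qed
 have h2: "(tens A B a b\<otimes>\<^bsub>CT \<phi>\<^esub>y)\<otimes>\<^bsub>CT \<phi>\<^esub>z = tens A B a b\<otimes>\<^bsub>CT \<phi>\<^esub>(y\<otimes>\<^bsub>CT \<phi>\<^esub>z)"
  if h: "a\<in>hset A" "b\<in>hset B" and y: "y\<in>carrier AB.T" and z: "z\<in>carrier AB.T" for a b y z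
 proof -
  have c: "a\<in>carrier A" "b\<in>carrier B" using h by (auto intro: A.hset_carrier B.hset_carrier)
  show ?thesis
   by (rule AB.lin_T_eq[OF kc m2[OF m1[OF idl]] m1[OF m2[OF idl]] _ y]) (use c z h1[OF h _ _ z] in \<open>auto intro!: mc\<close>)
 qed
 have h3: "(x\<otimes>\<^bsub>CT \<phi>\<^esub>y)\<otimes>\<^bsub>CT \<phi>\<^esub>z = x\<otimes>\<^bsub>CT \<phi>\<^esub>(y\<otimes>\<^bsub>CT \<phi>\<^esub>z)"
  if x: "x\<in>carrier AB.T" and y: "y\<in>carrier AB.T" and z: "z\<in>carrier AB.T" for x y z
  by (rule AB.lin_T_eq[OF kc m2[OF m2[OF idl]] m2[OF idl] _ x]) (use y z h2[OF _ _ y z] in \<open>auto intro!: mc\<close>)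
 let ?o = "tens A B \<one>\<^bsub>A\<^esub> \<one>\<^bsub>B\<^esub>"
 have o: "?o\<in>carrier AB.T" by auto
 have u1: "?o\<otimes>\<^bsub>CT \<phi>\<^esub>x = x" if x: "x\<in>carrier AB.T" for x
 proof (rule AB.lin_T_eq[OF kc m1[OF idl o] idl _ x])
  fix v w assume "v\<in>hset A" "w\<in>hset B"
  then obtain g h where v: "v\<in>homog A g" "w\<in>homog B h" by (auto simp: hset_def)
  then show "?o\<otimes>\<^bsub>CT \<phi>\<^esub>tens A B v w = tens A B v w"
   using tq[OF A.one_closed B.homog_one v(1), of w] A.homog_carrier[OF v(1)] B.homog_carrier[OF v(2)] by (simp add: p0)
 qed
 have u2: "x\<otimes>\<^bsub>CT \<phi>\<^esub>?o = x" if x: "x\<in>carrier AB.T" for x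
 proof (rule AB.lin_T_eq[OF kc m2[OF idl o] idl _ x])
  fix v w assume "v\<in>hset A" "w\<in>hset B"
  then obtain g h where v: "v\<in>homog A g" "w\<in>homog B h" by (auto simp: hset_def)
  then show "tens A B v w\<otimes>\<^bsub>CT \<phi>\<^esub>?o = tens A B v w"
   using tq[OF _ v(2) A.homog_one B.one_closed, of v] A.homog_carrier[OF v(1)] B.homog_carrier[OF v(2)] by (simp add: p0)
 qed
 have bl: "bilin (CT \<phi>) (CT \<phi>) (CT \<phi>) (monoid.mult (CT \<phi>))"
  using m unfolding bilin_def lin_def by (simp add: CT_simps)
 show ?thesis
  unfolding kalg_def kalg_axioms_def using CT_kspace[of \<phi>] bl h3 o u1 u2 by (simp add: CT_simps)
qed

end

section \<open>The group of coalgebra points\<close>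

lemma (in cchopf) ad_inner: "a1\<in>cA ==> bilin A A A (%a2 x. a1\<otimes>x\<otimes>S a2)"
 by (intro bilinI lin_mult_l lin_mult_r lin_id gr_lin gr_S) auto

context cchopf begin

abbreviation "com \<equiv> color_commutator \<phi> A"
abbreviation "ad \<equiv> color_adjoint \<phi> A"

definition R4 :: "'a => 'a => 'a => 'a => 'a" where
 "R4 x1 x2 y1 y2 = color_ext \<phi> A A A (%x2 y1. x1\<otimes>y1\<otimes>S x2\<otimes>S y2) x2 y1"

definition R3 :: "'a => 'a => 'a => 'a" where
 "R3 a1 a2 x = color_ext \<phi> A A A (%a2 x. a1\<otimes>x\<otimes>S a2) a2 x"

lemma com_R4: "com x y = tensor_lift A (%x1 x2. tensor_lift A (R4 x1 x2) (\<Delta> y)) (\<Delta> x)"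
 by (simp add: color_commutator_def R4_def[abs_def])

lemma ad_R3: "ad a x = tensor_lift A (%a1 a2. R3 a1 a2 x) (\<Delta> a)"
 by (simp add: color_adjoint_def R3_def)

lemma R4_inner: "x1\<in>cA ==> y2\<in>cA ==> bilin A A A (%x2 y1. x1\<otimes>y1\<otimes>S x2\<otimes>S y2)"
 by (intro bilinI lin_mult_l lin_mult_r lin_id gr_lin gr_S) auto

lemma R4_mid: "x1\<in>cA ==> y2\<in>cA ==> bilin A A A (%x2 y1. R4 x1 x2 y1 y2)"
 unfolding R4_def by (rule AA.AB.color_ext_bilin[OF kspace_axioms R4_inner])

lemma R4_closed: "x1\<in>cA ==> x2\<in>cA ==> y1\<in>cA ==> y2\<in>cA ==> R4 x1 x2 y1 y2\<in>cA"
 by (rule bilin_closed[OF R4_mid])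

lemma R4_out:
 assumes h: "x2\<in>cA" "y1\<in>cA" shows "bilin A A A (%x1 y2. R4 x1 x2 y1 y2)"
proof (rule bilin_weak)
 fix l assume l: "lf A l"
 have e: "l (R4 x1 x2 y1 y2) = (\<Sum>g\<in>degrees A x2. \<Sum>h\<in>degrees A y1. \<phi> g h *
   l (x1\<otimes>component A y1 h\<otimes>S (component A x2 g)\<otimes>S y2))"
  if "x1\<in>cA" "y2\<in>cA" for x1 y2
  unfolding R4_def by (rule AA.AB.lf_color_ext[OF kspace_axioms R4_inner[OF that] h l])
 show "bil A A (%x1 y2. l (R4 x1 x2 y1 y2))"
 proof (rule bilI)
  fix x1 assume a: "x1\<in>cA"
  have "lf A (%y2. \<Sum>g\<in>degrees A x2. \<Sum>h\<in>degrees A y1. \<phi> g h *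
    l (x1\<otimes>component A y1 h\<otimes>S (component A x2 g)\<otimes>S y2))"
   using a h by (intro lf_sum lf_cmult lf_lin[OF l] lin_mult_l gr_lin gr_S) auto
  then show "lf A (%y2. l (R4 x1 x2 y1 y2))" using a by (simp add: lf_def e)
 next
  fix y2 assume a: "y2\<in>cA"
  have "lf A (%x1. \<Sum>g\<in>degrees A x2. \<Sum>h\<in>degrees A y1. \<phi> g h *
    l (x1\<otimes>component A y1 h\<otimes>S (component A x2 g)\<otimes>S y2))"
   using a h by (intro lf_sum lf_cmult lf_lin[OF l] lin_mult_r lin_id) auto
  then show "lf A (%x1. l (R4 x1 x2 y1 y2))" using a by (simp add: lf_def e)
 qed
qed (use h R4_closed kspace_axioms in auto)

lemma R4_right: "x1\<in>cA ==> x2\<in>cA ==> bilin A A A (R4 x1 x2)"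
 by (rule bilinI) (auto intro: bilinD(1)[OF R4_out] bilinD(1)[OF R4_mid])

lemma R4_left: "y1\<in>cA ==> y2\<in>cA ==> bilin A A A (%x1 x2. R4 x1 x2 y1 y2)"
 by (rule bilinI) (auto intro: bilinD(2)[OF R4_out] bilinD(2)[OF R4_mid])

lemma R4_homog:
 assumes "x1\<in>cA" "x2\<in>homog A g" "y1\<in>homog A h" "y2\<in>cA"
 shows "R4 x1 x2 y1 y2 = \<phi> g h\<odot>(x1\<otimes>y1\<otimes>S x2\<otimes>S y2)"
 unfolding R4_def by (rule AA.AB.color_ext_homog[OF kspace_axioms R4_inner assms(2,3)]) (use assms in auto)

lemma R4_lift: "y\<in>cA ==> bilin A A A (%x1 x2. tensor_lift A (R4 x1 x2) (\<Delta> y))"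
 by (rule AA.AB.bilin_tensor_lift[OF kspace_axioms AA.AB.kspace2_axioms _ R4_right R4_left]) auto

lemma lf_com:
 assumes l: "lf A l" and x: "x\<in>cA" and y: "y\<in>cA" and f: "f\<in>\<Delta> x" and g: "g\<in>\<Delta> y"
 shows "l (com x y) = pair2 f (%x1 x2. pair2 g (%y1 y2. l (R4 x1 x2 y1 y2)))"
proof -
 have fo: "AA.AB.ok f" using AA.AB.rep_ok[OF comult_in[OF x] f] by blast
 have "l (com x y) = tform (%x1 x2. l (tensor_lift A (R4 x1 x2) (\<Delta> y))) (\<Delta> x)"
  unfolding com_R4 by (rule AA.AB.lf_tensor_lift[OF kspace_axioms bilin_closed[OF R4_lift[OF y]] comult_in[OF x] l])
 also have "... = pair2 f (%x1 x2. l (tensor_lift A (R4 x1 x2) (\<Delta> y)))"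
  by (rule AA.AB.tform_rep[OF bil_lf[OF R4_lift[OF y] l] f comult_in[OF x]])
 also have "... = pair2 f (%x1 x2. pair2 g (%y1 y2. l (R4 x1 x2 y1 y2)))"
 proof (rule pair2_cong)
  fix a b assume "(a, b)\<in>keys f"
  then have ab: "a\<in>cA" "b\<in>cA" using fo by auto
  show "l (tensor_lift A (R4 a b) (\<Delta> y)) = pair2 g (%y1 y2. l (R4 a b y1 y2))"
   using AA.AB.lf_tensor_lift[OF kspace_axioms bilin_closed[OF R4_right[OF ab]] comult_in[OF y] l]
    AA.AB.tform_rep[OF bil_lf[OF R4_right[OF ab] l] g comult_in[OF y]] by simp
 qed
 finally show ?thesis .
qed

lemma com_bilin: "bilin A A A com"
proof (rule bilin_weak)
 show cc: "com x y\<in>cA" if "x\<in>cA" "y\<in>cA" for x y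
  unfolding com_R4 using that by (intro linD(1)[OF AA.AB.lin_tensor_lift[OF kspace_axioms R4_lift]]) auto
 fix l assume l: "lf A l"
 show "bil A A (%x y. l (com x y))"
 proof (rule bilI)
  fix y assume y: "y\<in>cA"
  show "lf A (%x. l (com x y))" unfolding com_R4
   by (rule lf_lin[OF l lin_comp[OF AA.AB.lin_tensor_lift[OF kspace_axioms R4_lift[OF y]] comult_lin]])
 next
  fix x assume x: "x\<in>cA"
  obtain f where f: "AA.AB.ok f" "f\<in>\<Delta> x" using AA.AB.T_obtain[OF comult_in[OF x]] by metis
  have "lf A (%y. pair2 f (%x1 x2. l (tensor_lift A (R4 x1 x2) (\<Delta> y))))"
   unfolding pair2_def using f(1)
   by (intro lf_pair lf_lin[OF l] lin_comp[OF AA.AB.lin_tensor_lift[OF kspace_axioms R4_right] comult_lin]) auto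
  moreover have "l (com x y) = pair2 f (%x1 x2. l (tensor_lift A (R4 x1 x2) (\<Delta> y)))" if y: "y\<in>cA" for y
   unfolding com_R4 using AA.AB.lf_tensor_lift[OF kspace_axioms bilin_closed[OF R4_lift[OF y]] comult_in[OF x] l]
    AA.AB.tform_rep[OF bil_lf[OF R4_lift[OF y] l] f(2) comult_in[OF x]] by simp
  ultimately show "lf A (%y. l (com x y))" by (simp add: lf_def)
 qed
qed (use kspace_axioms in auto)

lemma com_closed [simp]: "x\<in>cA ==> y\<in>cA ==> com x y\<in>cA"
 by (rule bilin_closed[OF com_bilin])

lemma R3_mid: "a1\<in>cA ==> bilin A A A (%a2 x. R3 a1 a2 x)"
 unfolding R3_def by (rule AA.AB.color_ext_bilin[OF kspace_axioms ad_inner])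

lemma R3_homog:
 assumes "a1\<in>cA" "a2\<in>homog A g" "x\<in>homog A h"
 shows "R3 a1 a2 x = \<phi> g h\<odot>(a1\<otimes>x\<otimes>S a2)"
 unfolding R3_def by (rule AA.AB.color_ext_homog[OF kspace_axioms ad_inner assms(2,3)]) (use assms in auto)

lemma R3_out: "x\<in>cA ==> bilin A A A (%a1 a2. R3 a1 a2 x)"
proof (rule bilin_weak)
 assume x: "x\<in>cA"
 fix l assume l: "lf A l"
 show "bil A A (%a1 a2. l (R3 a1 a2 x))"
 proof (rule bilI)
  fix a2 assume a: "a2\<in>cA"
  have e: "l (R3 a1 a2 x) = (\<Sum>g\<in>degrees A a2. \<Sum>h\<in>degrees A x. \<phi> g h *
    l (a1\<otimes>component A x h\<otimes>S (component A a2 g)))" if "a1\<in>cA" for a1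
   unfolding R3_def by (rule AA.AB.lf_color_ext[OF kspace_axioms ad_inner[OF that] a x l])
  have "lf A (%a1. \<Sum>g\<in>degrees A a2. \<Sum>h\<in>degrees A x. \<phi> g h *
    l (a1\<otimes>component A x h\<otimes>S (component A a2 g)))"
   using a x by (intro lf_sum lf_cmult lf_lin[OF l] lin_mult_r lin_id) auto
  then show "lf A (%a1. l (R3 a1 a2 x))" by (simp add: lf_def e)
 qed (rule lf_lin[OF l bilinD(2)[OF R3_mid x]])
qed (use bilin_closed[OF R3_mid] kspace_axioms in auto)

lemma lf_ad:
 assumes l: "lf A l" and a: "a\<in>cA" and x: "x\<in>cA" and f: "f\<in>\<Delta> a"
 shows "l (ad a x) = pair2 f (%a1 a2. l (R3 a1 a2 x))"
 unfolding ad_R3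
 using AA.AB.lf_tensor_lift[OF kspace_axioms bilin_closed[OF R3_out[OF x]] comult_in[OF a] l]
  AA.AB.tform_rep[OF bil_lf[OF R3_out[OF x] l] f comult_in[OF a]] by simp

lemma ad_bilin: "bilin A A A ad"
proof (rule bilin_weak)
 show cc: "ad x y\<in>cA" if "x\<in>cA" "y\<in>cA" for x y
  unfolding ad_R3 using that by (intro linD(1)[OF AA.AB.lin_tensor_lift[OF kspace_axioms R3_out]]) auto
 fix l assume l: "lf A l"
 show "bil A A (%x y. l (ad x y))"
 proof (rule bilI)
  fix y assume y: "y\<in>cA"
  show "lf A (%x. l (ad x y))" unfolding ad_R3
   by (rule lf_lin[OF l lin_comp[OF AA.AB.lin_tensor_lift[OF kspace_axioms R3_out[OF y]] comult_lin]])
 next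
  fix x assume x: "x\<in>cA"
  obtain f where f: "AA.AB.ok f" "f\<in>\<Delta> x" using AA.AB.T_obtain[OF comult_in[OF x]] by metis
  have "lf A (%y. pair2 f (%x1 x2. l (R3 x1 x2 y)))"
   unfolding pair2_def using f(1)
   by (intro lf_pair lf_lin[OF l] bilinD(1)[OF R3_mid]) auto
  then show "lf A (%y. l (ad x y))" using lf_ad[OF l x _ f(2)] by (simp add: lf_def)
 qed
qed (use kspace_axioms in auto)

lemma ad_closed [simp]: "x\<in>cA ==> y\<in>cA ==> ad x y\<in>cA"
 by (rule bilin_closed[OF ad_bilin])

end

locale points = cchopf \<phi> A + tcoalg \<phi> dgr d eps
 for \<phi> :: "'g::ab_group_add => 'g => 'k::field" and A :: "('k, 'g, 'a, 'm) hopf_scheme" (structure)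
  and dgr :: "'i => 'g" and d eps

sublocale points\<subseteq>convolution \<phi> dgr d eps A ..

sublocale points\<subseteq>T: convolution \<phi> dgr d eps "color_tensor \<phi> A A"
 unfolding convolution_def using tcoalg_axioms AA.CT_kalg[OF cf] by simp

context points begin

abbreviation cvA (infixr \<open>\<star>\<close> 65) where "f\<star>g \<equiv> conv A d f g"

text \<open>
  A coalgebra map of degree zero from the test coalgebra to \<open>A\<close>, given by its values on the basis.
  Points form a group under convolution, with \<open>S \<circ> f\<close> as the inverse of \<open>f\<close>.
\<close>

definition point :: "('i => 'a) => bool" where
 "point f\<longleftrightarrow>(\<forall>x. f x\<in>homog A (dgr x))\<and>(\<forall>x. \<epsilon> (f x) = eps x) \<and>
   (\<forall>x b. bil A A b\<longrightarrow>sw (f x) b = pair2 (d x) (%y z. b (f y) (f z)))"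

abbreviation "hm f \<equiv> \<forall>x. f x\<in>homog A (dgr x)"

lemma hom_vals: "hm f ==> vals f" by auto

lemma point_hom: "point f ==> f x\<in>homog A (dgr x)" by (simp add: point_def)

lemma point_vals [simp]: "point f ==> f x\<in>cA" using point_hom by auto

lemma point_eps: "point f ==> \<epsilon> (f x) = eps x" by (simp add: point_def)

lemma point_sw: "point f ==> bil A A b ==> sw (f x) b = pair2 (d x) (%y z. b (f y) (f z))"
 by (simp add: point_def)

lemma hom_S: "hm f ==> hm (%x. S (f x))" using grD(2)[OF gr_S] by blast

lemma hom_conv: "hm f ==> hm g ==> hm (f\<star>g)"
proof
 fix x assume f: "hm f" and g: "hm g"
 have "f (fst p)\<otimes>g (snd p)\<in>homog A (dgr x)" if "p\<in>keys (d x)" for p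
  using homog_mult[of "f (fst p)" "dgr (fst p)" "g (snd p)" "dgr (snd p)"] f g d_deg[of "fst p" "snd p" x] that by simp
 then show "(f\<star>g) x\<in>homog A (dgr x)" unfolding conv_def by (intro vsum_in[OF homog_subsp])
qed

definition push :: "('i => 'a) => 'i => ('a\<times>'a \<Rightarrow>\<^sub>0 'k)" where
 "push f x = pbind (d x) (%p. single (f (fst p), f (snd p)) 1)"

lemma pair2_push: "pair2 (push f x) b = pair2 (d x) (%y z. b (f y) (f z))"
 by (simp add: push_def pair2_def pair_pbind)

lemma keys_push: "keys (push f x)\<subseteq>range f\<times>range f"
 unfolding push_def using keys_pbind[of "d x" "%p. single (f (fst p), f (snd p)) 1"]
 by (auto simp: keys_single split: if_splits)

lemma push_homk: "hm f ==> homk (push f x)"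
proof -
 assume "hm f"
 then have "range f\<subseteq>hset A" by (auto simp: hset_def)
 then show ?thesis using keys_push[of f x] by blast
qed

lemma push_ok: "vals f ==> AA.AB.ok (push f x)"
 using keys_push[of f x] by auto

lemma push_in: "point f ==> push f x\<in>\<Delta> (f x)"
proof -
 assume f: "point f"
 then have ok: "AA.AB.ok (push f x)" by (intro push_ok) auto
 have "AA.AB.cl (push f x) = \<Delta> (f x)"
  by (rule AA.AB.tform_eqI)
   (use f ok in \<open>auto simp: AA.AB.cl_in AA.AB.tform_cl pair2_push point_sw[symmetric] sw_def\<close>)
 then show ?thesis using AA.AB.cl_self by blast
qed

lemma dg_fix: "v\<in>homog A g ==> w\<in>homog A h ==> (v = \<zero> \<or> w = \<zero> ==> e = 0) ==> \<phi> (dg A v) (dg A w) * e = \<phi> g h * e"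
 by (cases "v = \<zero> \<or> w = \<zero>") (auto simp: dg_eq)

lemma point_un: "point un"
 unfolding point_def
proof (intro conjI allI impI)
 fix x
 show "un x\<in>homog A (dgr x)" using homog_one eps_deg[of x] subspD(4)[OF homog_subsp]
  by (cases "dgr x = 0") (auto simp: un_def)
 show "\<epsilon> (un x) = eps x" by (simp add: un_def counit_smult counit_one)
 fix b assume b: "bil A A b"
 have "sw (un x) b = eps x * b \<one> \<one>" by (simp add: un_def lfD(2)[OF lf_sw[OF b]] sw_one[OF b])
 also have "... = pair2 (d x) (%y z. eps y * (eps z * b \<one> \<one>))" by (rule d_counit[symmetric])
 also have "... = pair2 (d x) (%y z. b (un y) (un z))"
  by (simp add: un_def lfD(2)[OF bilD(1)[OF b]] lfD(2)[OF bilD(2)[OF b]] mult.left_commute)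
 finally show "sw (un x) b = pair2 (d x) (%y z. b (un y) (un z))" .
qed

lemma point_conv:
 assumes f: "point f" and g: "point g" shows "point (f\<star>g)"
 unfolding point_def
proof (intro conjI)
 have hf: "hm f" "hm g" using f g point_hom by auto
 have v: "vals f" "vals g" using f g by auto
 show "hm (f\<star>g)" by (rule hom_conv[OF hf])
 show "\<forall>x. \<epsilon> ((f\<star>g) x) = eps x"
  using f g v by (simp add: lf_cv[OF lf_counit] counit_mult point_eps d_counit)
 show "\<forall>x b. bil A A b\<longrightarrow>sw ((f\<star>g) x) b = pair2 (d x) (%y z. b ((f\<star>g) y) ((f\<star>g) z))"
 proof (intro allI impI)
  fix x b assume b: "bil A A b"
  have b0: "b u \<zero> = 0" "b \<zero> u = 0" if "u\<in>cA" for u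
   using lf_zero[OF bilD(1)[OF b that]] lf_zero[OF bilD(2)[OF b that]] by auto
  have "sw ((f\<star>g) x) b = pair2 (d x) (%y z. sw (f y\<otimes>g z) b)"
   by (rule lf_cv[OF lf_sw[OF b] v])
  also have "... = pair2 (d x) (%y z. pair2 (d y) (%y1 y2. pair2 (d z) (%z1 z2.
    \<phi> (dgr y2) (dgr z1) * b (f y1\<otimes>g z1) (f y2\<otimes>g z2))))"
  proof (intro pair2_cong)
   fix y z
   have "sw (f y\<otimes>g z) b = pair2 (push f y) (%x1 x2. pair2 (push g z) (%y1 y2. \<phi> (dg A x2) (dg A y1) * b (x1\<otimes>y1) (x2\<otimes>y2)))"
    using v f g hf by (intro sw_mult[OF b] push_in push_homk) auto
   also have "... = pair2 (d y) (%y1 y2. pair2 (d z) (%z1 z2.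
     \<phi> (dg A (f y2)) (dg A (g z1)) * b (f y1\<otimes>g z1) (f y2\<otimes>g z2)))"
    by (simp add: pair2_push)
   also have "... = pair2 (d y) (%y1 y2. pair2 (d z) (%z1 z2. \<phi> (dgr y2) (dgr z1) * b (f y1\<otimes>g z1) (f y2\<otimes>g z2)))"
    using hf v by (intro pair2_cong dg_fix) (auto simp: b0)
   finally show "sw (f y\<otimes>g z) b = pair2 (d y) (%y1 y2. pair2 (d z) (%z1 z2.
     \<phi> (dgr y2) (dgr z1) * b (f y1\<otimes>g z1) (f y2\<otimes>g z2)))" .
  qed
  also have "... = pair2 (d x) (%y z. pair2 (d y) (%y1 y2. pair2 (d z) (%z1 z2. b (f y1\<otimes>g y2) (f z1\<otimes>g z2))))"
   by (rule d_swap4)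
  also have "... = pair2 (d x) (%y z. b ((f\<star>g) y) ((f\<star>g) z))"
  proof (rule pair2_cong)
   fix y z
   have "b ((f\<star>g) y) ((f\<star>g) z) = pair2 (d y) (%y1 y2. b (f y1\<otimes>g y2) ((f\<star>g) z))"
    using v by (intro lf_cv[OF bilD(2)[OF b] v]) auto
   also have "... = pair2 (d y) (%y1 y2. pair2 (d z) (%z1 z2. b (f y1\<otimes>g y2) (f z1\<otimes>g z2)))"
    using v by (intro pair2_cong lf_cv[OF bilD(1)[OF b] v]) auto
   finally show "pair2 (d y) (%y1 y2. pair2 (d z) (%z1 z2. b (f y1\<otimes>g y2) (f z1\<otimes>g z2))) = b ((f\<star>g) y) ((f\<star>g) z)" by simp
  qed
  finally show "sw ((f\<star>g) x) b = pair2 (d x) (%y z. b ((f\<star>g) y) ((f\<star>g) z))" .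
 qed
qed

lemma S_left: "point f ==> (%x. S (f x))\<star>f = un"
proof
 fix x assume f: "point f"
 show "((%x. S (f x))\<star>f) x = un x"
 proof (rule lf_eqI)
  fix l assume l: "lf A l"
  have "bil A A (%u v. l (S u\<otimes>v))" by (intro bil_mult[OF l] gr_lin gr_S lin_id)
  from point_sw[OF f this, of x]
  show "l (((%x. S (f x))\<star>f) x) = l (un x)"
   using f by (simp add: lf_cv[OF l] antipode_l[OF _ l] point_eps un_def lfD(2)[OF l])
 qed (use f in auto)
qed

lemma S_right: "point f ==> f\<star>(%x. S (f x)) = un"
proof
 fix x assume f: "point f"
 show "(f\<star>(%x. S (f x))) x = un x"
 proof (rule lf_eqI)
  fix l assume l: "lf A l"
  have "bil A A (%u v. l (u\<otimes>S v))" by (intro bil_mult[OF l] gr_lin gr_S lin_id)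
  from point_sw[OF f this, of x]
  show "l ((f\<star>(%x. S (f x))) x) = l (un x)"
   using f by (simp add: lf_cv[OF l] antipode_r[OF _ l] point_eps un_def lfD(2)[OF l])
 qed (use f in auto)
qed

text \<open>
 The antipode respects the comultiplication: both \<open>\<Delta> S f\<close> and \<open>(S f\<otimes>S f) \<Delta>\<close> are convolution
 inverses of \<open>\<Delta> f\<close> in the algebra \<open>A\<otimes>A\<close>, the second one by cocommutativity.
\<close>

lemma point_S:
 assumes f: "point f" shows "point (%x. S (f x))"
proof -
 define h where "h = (%x. S (f x))"
 have hf: "hm f" using f point_hom by auto
 have hh: "hm h" using hom_S[OF hf] by (simp add: h_def)
 have v: "vals f" "vals h" using hom_vals[OF hf] hom_vals[OF hh] by auto
 let ?CT = "color_tensor \<phi> A A"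
 have lfe: "lf ?CT = lf TT" by (simp add: lf_def[abs_def] AA.CT_simps)
 have tcT: "tens A A u w\<in>carrier TT" if "u\<in>cA" "w\<in>cA" for u w using that by auto
 define L where "L = (%x. \<Delta> (h x))"
 define N where "N = (%x. \<Delta> (f x))"
 define R where "R = (%x. vsum TT (d x) (%p. tens A A (h (fst p)) (h (snd p))))"
 have Nv: "T.vals N" "T.vals L" using v by (auto simp: N_def L_def AA.CT_simps)
 have Rc: "R x\<in>carrier TT" for x unfolding R_def using v by (intro AA.AB.T.vsum_closed) auto
 have Rv: "T.vals R" using Rc by (simp add: AA.CT_simps)
 have un: "T.un x = \<Delta> (un x)" for x
  unfolding T.un_def un_def using linD(3)[OF comult_lin one_closed] by (simp add: AA.CT_simps comult_one)
 have c1: "conv ?CT d L N = T.un"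
 proof
  fix x
  show "conv ?CT d L N x = T.un x"
  proof (rule AA.AB.T.lf_eqI)
   show "conv ?CT d L N x\<in>carrier TT" using T.cv_closed[OF Nv(2,1)] by (simp add: AA.CT_simps)
   show "T.un x\<in>carrier TT" using T.un_closed by (simp add: AA.CT_simps)
   fix l assume l: "lf TT l"
   have "l (conv ?CT d L N x) = pair2 (d x) (%y z. l (L y\<otimes>\<^bsub>?CT\<^esub>N z))"
    using l Nv by (intro T.lf_cv) (auto simp: lfe)
   also have "... = pair2 (d x) (%y z. l (\<Delta> (h y\<otimes>f z)))"
    unfolding L_def N_def using v by (simp add: comult_mult)
   also have "... = l (\<Delta> ((h\<star>f) x))"
    using lf_cv[OF lf_lin[OF l comult_lin] v(2,1), of x] by simp
   also have "... = l (T.un x)" using S_left[OF f] by (simp add: h_def un)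
   finally show "l (conv ?CT d L N x) = l (T.un x)" .
  qed
 qed
 have c2: "conv ?CT d N R = T.un"
 proof
  fix x
  show "conv ?CT d N R x = T.un x"
  proof (rule AA.AB.T.lf_eqI)
   show "conv ?CT d N R x\<in>carrier TT" using T.cv_closed[OF Nv(1) Rv] by (simp add: AA.CT_simps)
   show "T.un x\<in>carrier TT" using T.un_closed by (simp add: AA.CT_simps)
   fix l assume l: "lf TT l"
   have bt: "bil A A (%u w. l (tens A A u w))" by (rule bil_lf[OF AA.AB.tens_bilin l])
   have t0: "l (tens A A u \<zero>) = 0" "l (tens A A \<zero> u) = 0" if "u\<in>cA" for u
    using lf_zero[OF bilD(1)[OF bt that]] lf_zero[OF bilD(2)[OF bt that]] by auto
   have "l (conv ?CT d N R x) = pair2 (d x) (%y z. l (N y\<otimes>\<^bsub>?CT\<^esub>R z))"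
    using l Nv Rv by (intro T.lf_cv) (auto simp: lfe)
   also have "... = pair2 (d x) (%y z. pair2 (d y) (%y1 y2. pair2 (d z) (%z1 z2.
     \<phi> (dgr y2) (dgr z1) * l (tens A A (f y1\<otimes>h z1) (f y2\<otimes>h z2)))))"
   proof (rule pair2_cong)
    fix y z
    have pr: "push h z\<in>R z"
    proof -
     have "AA.AB.cl (push h z) = R z"
      by (rule AA.AB.T.lf_eqI)
       (use v Rc push_ok[OF v(2)] in \<open>auto simp: AA.AB.cl_in AA.AB.lf_cl pair2_push R_def AA.AB.T.lf_vsum\<close>, simp add: pair2_def)
     then show ?thesis using AA.AB.cl_self by blast
    qed
    have "l (N y\<otimes>\<^bsub>?CT\<^esub>R z) = pair2 (push f y) (%a b. pair2 (push h z) (%a' b'. l (AA.Q4 \<phi> a b a' b')))"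
     using AA.lf_CT_mult[OF l _ Rc, of "N y" "push f y" "push h z" z] push_in[OF f, of y] pr v by (simp add: N_def)
    also have "... = pair2 (d y) (%y1 y2. pair2 (d z) (%z1 z2. l (AA.Q4 \<phi> (f y1) (f y2) (h z1) (h z2))))"
     by (simp add: pair2_push)
    also have "... = pair2 (d y) (%y1 y2. pair2 (d z) (%z1 z2. \<phi> (dgr y2) (dgr z1) * l (tens A A (f y1\<otimes>h z1) (f y2\<otimes>h z2))))"
    proof (intro pair2_cong)
     fix y1 y2 z1 z2
     show "l (AA.Q4 \<phi> (f y1) (f y2) (h z1) (h z2)) = \<phi> (dgr y2) (dgr z1) * l (tens A A (f y1\<otimes>h z1) (f y2\<otimes>h z2))"
      using AA.Q4_homog[of "f y1" "f y2" "dgr y2" "h z1" "dgr z1" "h z2" \<phi>] v hf hh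
      by (simp add: lfD(2)[OF l])
    qed
    finally show "l (N y\<otimes>\<^bsub>?CT\<^esub>R z) = pair2 (d y) (%y1 y2. pair2 (d z) (%z1 z2. \<phi> (dgr y2) (dgr z1) * l (tens A A (f y1\<otimes>h z1) (f y2\<otimes>h z2))))" .
   qed
   also have "... = pair2 (d x) (%y z. pair2 (d y) (%y1 y2. pair2 (d z) (%z1 z2. l (tens A A (f y1\<otimes>h y2) (f z1\<otimes>h z2)))))"
    by (rule d_swap4)
   also have "... = pair2 (d x) (%y z. l (tens A A ((f\<star>h) y) ((f\<star>h) z)))"
   proof (rule pair2_cong)
    fix y z
    have "l (tens A A ((f\<star>h) y) ((f\<star>h) z)) = pair2 (d y) (%y1 y2. l (tens A A (f y1\<otimes>h y2) ((f\<star>h) z)))"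
     using v by (intro lf_cv[OF bilD(2)[OF bt] v]) auto
    also have "... = pair2 (d y) (%y1 y2. pair2 (d z) (%z1 z2. l (tens A A (f y1\<otimes>h y2) (f z1\<otimes>h z2))))"
     using v by (intro pair2_cong lf_cv[OF bilD(1)[OF bt] v]) auto
    finally show "pair2 (d y) (%y1 y2. pair2 (d z) (%z1 z2. l (tens A A (f y1\<otimes>h y2) (f z1\<otimes>h z2)))) =
     l (tens A A ((f\<star>h) y) ((f\<star>h) z))" by simp
   qed
   also have "... = pair2 (d x) (%y z. eps y * (eps z * l (tens A A \<one> \<one>)))"
    using S_right[OF f] by (simp add: h_def un_def lfD(2)[OF bilD(1)[OF bt]] lfD(2)[OF bilD(2)[OF bt]] mult.left_commute)
   also have "... = l (T.un x)" by (simp add: d_counit T.un_def AA.CT_simps lfD(2)[OF l])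
   finally show "l (conv ?CT d N R x) = l (T.un x)" .
  qed
 qed
 have LR: "L = R" by (rule T.cv_inverse_unique[OF Nv(2,1) Rv c1 c2])
 have "\<epsilon> (h x) = eps x" for x
 proof -
  have "\<epsilon> ((h\<star>f) x) = \<epsilon> (h x)" using v f by (simp add: lf_cv[OF lf_counit] counit_mult point_eps mult.commute[of "\<epsilon> _"] d_counit_r)
  then show ?thesis using S_left[OF f] point_eps[OF point_un] by (simp add: h_def)
 qed
 moreover have "sw (h x) b = pair2 (d x) (%y z. b (h y) (h z))" if b: "bil A A b" for x b
 proof -
  have "sw (h x) b = tform b (R x)" using LR by (metis L_def sw_def)
  also have "... = pair (d x) (%p. tform b (tens A A (h (fst p)) (h (snd p))))"
   unfolding R_def using v by (intro AA.AB.T.lf_vsum AA.AB.lf_tform[OF b]) auto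
  also have "... = pair2 (d x) (%y z. b (h y) (h z))" using v b by (simp add: pair2_def)
  finally show ?thesis .
 qed
 ultimately have "point h" using hh by (simp add: point_def)
 then show ?thesis by (simp add: h_def)
qed

lemma S_conv: "point f ==> point g ==> (%x. S ((f\<star>g) x)) = (%x. S (g x))\<star>(%x. S (f x))"
proof (rule cv_inverse_unique[of _ "f\<star>g"])
 assume f: "point f" and g: "point g"
 have v: "vals f" "vals g" "vals (%x. S (f x))" "vals (%x. S (g x))" "vals (f\<star>g)" using f g by auto
 show "(%x. S ((f\<star>g) x))\<star>f\<star>g = un" by (rule S_left[OF point_conv[OF f g]])
 have "(f\<star>g)\<star>(%x. S (g x))\<star>(%x. S (f x)) = f\<star>(g\<star>(%x. S (g x)))\<star>(%x. S (f x))"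
  using v by (simp add: cv_assoc)
 also have "... = un" using v by (simp add: S_right[OF g] cv_un_l S_right[OF f])
 finally show "(f\<star>g)\<star>(%x. S (g x))\<star>(%x. S (f x)) = un" .
qed auto

lemma S_S_point: "point f ==> (%x. S (S (f x))) = f"
 by (rule cv_inverse_unique[of _ "%x. S (f x)"]) (auto simp: S_left point_S)

text \<open>
  The color commutator is the group commutator of points: the four legs of \<open>u\<close> and \<open>v\<close> are brought
  into the order of the definition by cocommutativity of the test coalgebra, which produces exactly the
  color factor of the definition.
\<close>

lemma com_points:
 assumes l: "lf A l" and u: "point u" and v: "point v"
 shows "pair2 (d x) (%y z. l (com (u y) (v z))) = l (((u\<star>v)\<star>(%x. S (u x))\<star>(%x. S (v x))) x)"
proof -
 have vl: "vals u" "vals v" using u v by auto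
 have "pair2 (d x) (%y z. l (com (u y) (v z))) = pair2 (d x) (%y z. pair2 (d y) (%y1 y2. pair2 (d z) (%z1 z2.
   \<phi> (dgr y2) (dgr z1) * l (u y1\<otimes>v z1\<otimes>S (u y2)\<otimes>S (v z2)))))"
 proof (rule pair2_cong)
  fix y z
  have "l (com (u y) (v z)) = pair2 (push u y) (%x1 x2. pair2 (push v z) (%y1 y2. l (R4 x1 x2 y1 y2)))"
   using vl by (intro lf_com[OF l] push_in u v) auto
  also have "... = pair2 (d y) (%y1 y2. pair2 (d z) (%z1 z2. l (R4 (u y1) (u y2) (v z1) (v z2))))"
   by (simp add: pair2_push)
  also have "... = pair2 (d y) (%y1 y2. pair2 (d z) (%z1 z2. \<phi> (dgr y2) (dgr z1) * l (u y1\<otimes>v z1\<otimes>S (u y2)\<otimes>S (v z2))))"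
   using vl by (intro pair2_cong) (simp add: R4_homog[OF _ point_hom[OF u] point_hom[OF v]] lfD(2)[OF l])
  finally show "l (com (u y) (v z)) = pair2 (d y) (%y1 y2. pair2 (d z) (%z1 z2. \<phi> (dgr y2) (dgr z1) * l (u y1\<otimes>v z1\<otimes>S (u y2)\<otimes>S (v z2))))" .
 qed
 also have "... = pair2 (d x) (%y z. pair2 (d y) (%y1 y2. pair2 (d z) (%z1 z2. l (u y1\<otimes>v y2\<otimes>S (u z1)\<otimes>S (v z2)))))"
  by (rule d_swap4)
 also have "... = pair2 (d x) (%y z. l ((u\<star>v) y\<otimes>((%x. S (u x))\<star>(%x. S (v x))) z))"
 proof (rule pair2_cong)
  fix y z
  have "l ((u\<star>v) y\<otimes>((%x. S (u x))\<star>(%x. S (v x))) z) = pair2 (d y) (%y1 y2. l ((u y1\<otimes>v y2)\<otimes>((%x. S (u x))\<star>(%x. S (v x))) z))"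
   using vl by (intro lf_cv[OF lf_mr[OF l]]) auto
  also have "... = pair2 (d y) (%y1 y2. pair2 (d z) (%z1 z2. l ((u y1\<otimes>v y2)\<otimes>(S (u z1)\<otimes>S (v z2)))))"
   using vl by (intro pair2_cong lf_cv[OF lf_ml[OF l]]) auto
  also have "... = pair2 (d y) (%y1 y2. pair2 (d z) (%z1 z2. l (u y1\<otimes>v y2\<otimes>S (u z1)\<otimes>S (v z2))))"
   using vl by (simp add: m_assoc)
  finally show "pair2 (d y) (%y1 y2. pair2 (d z) (%z1 z2. l (u y1\<otimes>v y2\<otimes>S (u z1)\<otimes>S (v z2)))) =
   l ((u\<star>v) y\<otimes>((%x. S (u x))\<star>(%x. S (v x))) z)" by simp
 qed
 also have "... = l (((u\<star>v)\<star>(%x. S (u x))\<star>(%x. S (v x))) x)"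
  using vl by (intro lf_cv[OF l, symmetric]) auto
 finally show ?thesis .
qed

lemma ad_points:
 assumes l: "lf A l" and a: "point a" and h: "hm h"
 shows "pair2 (d x) (%y z. l (ad (a y) (h z))) = l ((a\<star>h\<star>(%x. S (a x))) x)"
proof -
 have vl: "vals a" "vals h" using a hom_vals[OF h] by auto
 have "pair2 (d x) (%y z. l (ad (a y) (h z))) = pair2 (d x) (%y z. pair2 (d y) (%y1 y2. \<phi> (dgr y2) (dgr z) * l (a y1\<otimes>h z\<otimes>S (a y2))))"
 proof (rule pair2_cong)
  fix y z
  have "l (ad (a y) (h z)) = pair2 (push a y) (%x1 x2. l (R3 x1 x2 (h z)))"
   using vl by (intro lf_ad[OF l] push_in a) auto
  also have "... = pair2 (d y) (%y1 y2. l (R3 (a y1) (a y2) (h z)))" by (simp add: pair2_push)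
  also have "... = pair2 (d y) (%y1 y2. \<phi> (dgr y2) (dgr z) * l (a y1\<otimes>h z\<otimes>S (a y2)))"
   using vl by (intro pair2_cong) (simp add: R3_homog[OF _ point_hom[OF a] h[rule_format]] lfD(2)[OF l])
  finally show "l (ad (a y) (h z)) = pair2 (d y) (%y1 y2. \<phi> (dgr y2) (dgr z) * l (a y1\<otimes>h z\<otimes>S (a y2)))" .
 qed
 also have "... = pair2 (d x) (%y1 w. pair2 (d w) (%y2 z. \<phi> (dgr y2) (dgr z) * l (a y1\<otimes>h z\<otimes>S (a y2))))"
  by (rule d_coassoc)
 also have "... = pair2 (d x) (%y1 w. pair2 (d w) (%z y2. l (a y1\<otimes>h z\<otimes>S (a y2))))"
  by (intro pair2_cong d_cocomm[symmetric])
 also have "... = pair2 (d x) (%y1 w. l (a y1\<otimes>(h\<star>(%x. S (a x))) w))"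
 proof (rule pair2_cong)
  fix y1 w
  have "l (a y1\<otimes>(h\<star>(%x. S (a x))) w) = pair2 (d w) (%z y2. l (a y1\<otimes>(h z\<otimes>S (a y2))))"
   using vl by (intro lf_cv[OF lf_ml[OF l]]) auto
  then show "pair2 (d w) (%z y2. l (a y1\<otimes>h z\<otimes>S (a y2))) = l (a y1\<otimes>(h\<star>(%x. S (a x))) w)"
   using vl by (simp add: m_assoc)
 qed
 also have "... = l ((a\<star>h\<star>(%x. S (a x))) x)"
  using vl by (intro lf_cv[OF l, symmetric]) auto
 finally show ?thesis .
qed

end

section \<open>Graded subcoalgebras and their test coalgebras\<close>

context cchopf begin

text \<open>
  A graded subcoalgebra: stability under both actions of functionals is \<open>\<Delta> N \<subseteq> N \<otimes> N\<close>, without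
  mention of representatives (\<open>gsc_rep\<close>).
\<close>

definition gsc :: "'a set => bool" where
 "gsc N\<longleftrightarrow>graded_subspace A N\<and>(\<forall>j. lf A j\<longrightarrow>(\<forall>a\<in>N. Tr j a\<in>N\<and>Tl j a\<in>N))"

lemma gscD: "gsc N ==> graded_subspace A N" "gsc N ==> subsp A N"
 "gsc N ==> a\<in>N ==> a\<in>cA"
 "gsc N ==> lf A j ==> a\<in>N ==> Tr j a\<in>N"
 "gsc N ==> lf A j ==> a\<in>N ==> Tl j a\<in>N"
 by (auto simp: gsc_def gsub_subsp dest: subspD(1))

lemma gsc_of_rep:
 assumes N: "graded_subspace A N" and r: "\<And>a. a\<in>N ==> \<exists>f\<in>\<Delta> a. keys f\<subseteq>N\<times>N"
 shows "gsc N"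
 unfolding gsc_def
proof (intro conjI allI impI ballI)
 have s: "subsp A N" using N by (simp add: gsub_subsp)
 fix j a assume j: "lf A j" and a: "a\<in>N"
 have ac: "a\<in>cA" by (rule subspD(1)[OF s a])
 obtain f where f: "f\<in>\<Delta> a" "keys f\<subseteq>N\<times>N" using r[OF a] by auto
 show "Tr j a\<in>N"
 proof (rule lf_subspI[OF s])
  fix l assume l: "lf A l" and z: "\<And>x. x\<in>N ==> l x = 0"
  have "l (Tr j a) = pair2 f (%u v. j v * l u)"
   using sw_rep[OF bil_flip[OF bil_prod[OF j l]] f(1) ac] by (simp add: lf_Tr[OF l ac])
  also have "... = pair2 f (%u v. 0)" using f(2) z by (intro pair2_cong) auto
  finally show "l (Tr j a) = 0" by (simp add: pair2_def)
 qed (use ac j in auto)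
 show "Tl j a\<in>N"
 proof (rule lf_subspI[OF s])
  fix l assume l: "lf A l" and z: "\<And>x. x\<in>N ==> l x = 0"
  have "l (Tl j a) = pair2 f (%u v. j u * l v)"
   using sw_rep[OF bil_prod[OF j l] f(1) ac] by (simp add: lf_Tl[OF l ac])
  also have "... = pair2 f (%u v. 0)" using f(2) z by (intro pair2_cong) auto
  finally show "l (Tl j a) = 0" by (simp add: pair2_def)
 qed (use ac j in auto)
qed (rule N)

lemma gsc_hopf_subalgebra: "color_hopf_subalgebra A U ==> gsc U"
proof (rule gsc_of_rep)
 assume U: "color_hopf_subalgebra A U"
 then show "graded_subspace A U" by (simp add: color_hopf_subalgebra_def)
 fix a assume "a\<in>U"
 then obtain f where "keys f\<subseteq>U\<times>U" "\<Delta> a = AA.AB.cl f"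
  using U by (auto simp: color_hopf_subalgebra_def)
 then show "\<exists>f\<in>\<Delta> a. keys f\<subseteq>U\<times>U" using AA.AB.cl_self by auto
qed

definition hbasis :: "'a set => bool" where
 "hbasis Xs\<longleftrightarrow>indep A Xs\<and>Xs\<subseteq>hset A\<and>spn A Xs = cA"

definition hat :: "'a set => ('a => 'a => 'k) => 'a => 'a => 'k" where
 "hat Xs F u v = pair (coord A Xs u) (%y. pair (coord A Xs v) (F y))"

definition dd :: "'a set => 'a => ('a\<times>'a \<Rightarrow>\<^sub>0 'k)" where
 "dd Xs a = pbind (SOME f. f\<in>\<Delta> a) (%p. pbind (coord A Xs (fst p)) (%y. pbind (coord A Xs (snd p)) (%z. single (y, z) 1)))"

lemma pair2_dd: "pair2 (dd Xs a) F = sw a (hat Xs F)"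
 by (simp add: dd_def sw_def tform_def hat_def pair2_def pair_pbind)

lemma gsc_adapted:
 assumes N: "gsc N" shows "\<exists>XN Xs. XN\<subseteq>Xs\<and>hbasis Xs\<and>indep A XN\<and>XN\<subseteq>N\<inter>hset A\<and>spn A XN = N"
proof -
 obtain XN where XN: "indep A XN" "XN\<subseteq>N\<inter>hset A" "spn A XN = N"
  using homog_basis[OF gscD(1)[OF N]] by auto
 have "XN\<subseteq>cA\<inter>hset A" using XN gscD(3)[OF N] by auto
 from homog_basis_extend[OF gsub_carrier XN(1) this]
 obtain Xs where "XN\<subseteq>Xs" "hbasis Xs" by (auto simp: hbasis_def)
 then show ?thesis using XN by auto
qed

context
 fixes Xs assumes Xs: "hbasis Xs"
begin

lemma Xs': "indep A Xs" "cA\<subseteq>spn A Xs" "x\<in>Xs ==> x\<in>cA" "x\<in>Xs ==> x\<in>homog A (dg A x)"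
 using Xs dg_in hset_carrier by (auto simp: hbasis_def)

lemma Xs_nz: "x\<in>Xs ==> x \<noteq> \<zero>"
proof
 assume "x\<in>Xs" "x = \<zero>"
 then have "single \<zero> (1::'k) = 0" by (intro indepD[OF Xs'(1)]) (auto simp: keys_single)
 then show False by (metis lookup_single_eq lookup_zero zero_neq_one)
qed

lemma cx: "v\<in>cA ==> keys (coord A Xs v)\<subseteq>Xs"
 using coord(1)[OF Xs'(1)] Xs'(2) by auto

lemma cx_lf: "v\<in>cA ==> lf A l ==> pair (coord A Xs v) l = l v"
 using lf_vsum[of l "coord A Xs v" "%x. x"] coord(2)[OF Xs'(1), of v] Xs'(2,3) cx[of v] by (auto simp: subset_iff)

lemma lf_cx: "lf A (%v. pair (coord A Xs v) F)"
 by (rule lf_coord[OF Xs'(1,2)])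

lemma cx_basis: "x\<in>Xs ==> pair (coord A Xs x) F = F x"
 by (simp add: coord_basis[OF Xs'(1)])

lemma lookup_pair: "lookup f x = pair f (%z. if z = x then 1 else 0)"
 by (simp add: pair_superset[of "insert x (keys f)"] subset_insertI if_distrib cong: if_cong)

lemma lf_lookup: "lf A (%v. lookup (coord A Xs v) x)"
 unfolding lookup_pair by (rule lf_cx)

lemma bil_hat: "bil A A (hat Xs F)"
 unfolding hat_def
proof (rule bilI)
 show "lf A (%u. pair (coord A Xs u) (%y. pair (coord A Xs v) (F y)))" for v by (rule lf_cx)
 show "lf A (%v. pair (coord A Xs u) (%y. pair (coord A Xs v) (F y)))" for u by (intro lf_pair lf_cx)
qed

lemma hat_bil:
 assumes b: "bil A A b" and u: "u\<in>cA" and v: "v\<in>cA"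
 shows "hat Xs b u v = b u v"
proof -
 have "hat Xs b u v = pair (coord A Xs u) (%y. b y v)"
  unfolding hat_def using cx[OF u] Xs'(3) v by (intro pair_cong cx_lf bilD(1)[OF b]) auto
 then show ?thesis using cx_lf[OF u bilD(2)[OF b v]] by simp
qed

lemma hat_basis: "y\<in>Xs ==> z\<in>Xs ==> hat Xs F y z = F y z"
 by (simp add: hat_def cx_basis)

lemma pair2_dd_bil: "bil A A b ==> a\<in>cA ==> pair2 (dd Xs a) b = sw a b"
 unfolding pair2_dd by (rule sw_cong) (auto simp: hat_bil)

lemma lookup_dd: "lookup (dd Xs a) (y, z) = sw a (%u v. lookup (coord A Xs u) y * lookup (coord A Xs v) z)"
proof -
 have "lookup (dd Xs a) (y, z) = pair2 (dd Xs a) (%y' z'. (if y' = y then 1 else 0) * (if z' = z then 1 else 0))"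
  unfolding lookup_pair[of "dd Xs a"] pair2_def by (intro pair_cong) auto
 also have "... = sw a (%u v. lookup (coord A Xs u) y * lookup (coord A Xs v) z)"
  unfolding pair2_dd hat_def pair_cmult pair_cmult_right lookup_pair[symmetric] ..
 finally show ?thesis .
qed

lemma dd_Xs: "a\<in>cA ==> keys (dd Xs a)\<subseteq>Xs\<times>Xs"
proof (intro subsetI)
 fix p assume a: "a\<in>cA" and p: "p\<in>keys (dd Xs a)"
 obtain y z where yz: "p = (y, z)" by force
 have n: "sw a (%u v. lookup (coord A Xs u) y * lookup (coord A Xs v) z) \<noteq> 0"
  using p yz by (simp add: lookup_dd in_keys_iff)
 have "y\<in>Xs\<and>z\<in>Xs"
 proof (rule ccontr)
  assume c: "\<not> (y\<in>Xs\<and>z\<in>Xs)"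
  have zc: "lookup (coord A Xs v) x = 0" if v: "v\<in>cA" and x: "x \<notin> Xs" for v x
  proof -
   have "x \<notin> keys (coord A Xs v)" using cx[OF v] x by auto
   then show ?thesis by (simp add: in_keys_iff)
  qed
  have "sw a (%u v. lookup (coord A Xs u) y * lookup (coord A Xs v) z) = sw a (%u v. 0)"
  proof (rule sw_cong[OF a])
   fix u v assume "u\<in>cA" "v\<in>cA"
   then show "lookup (coord A Xs u) y * lookup (coord A Xs v) z = 0" using c zc[of u y] zc[of v z] by auto
  qed
  then show False using n by simp
 qed
 then show "p\<in>Xs\<times>Xs" using yz by simp
qed

lemma dd_in: "a\<in>cA ==> dd Xs a\<in>\<Delta> a"
proof -
 assume a: "a\<in>cA"
 have ok: "AA.AB.ok (dd Xs a)" using dd_Xs[OF a] Xs'(3) by auto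
 have "AA.AB.cl (dd Xs a) = \<Delta> a"
  by (rule AA.AB.tform_eqI) (use ok a in \<open>auto simp: AA.AB.cl_in AA.AB.tform_cl pair2_dd_bil sw_def\<close>)
 then show ?thesis using AA.AB.cl_self by blast
qed

lemma dd_homk: "a\<in>cA ==> homk (dd Xs a)"
 using dd_Xs[of a] Xs by (auto simp: hbasis_def)

lemma dd_deg:
 assumes a: "a\<in>homog A g" and p: "(y, z)\<in>keys (dd Xs a)"
 shows "dg A y + dg A z = g"
proof -
 have ac: "a\<in>cA" using a by auto
 have yz: "y\<in>Xs" "z\<in>Xs" using dd_Xs[OF ac] p by auto
 obtain f where f: "f\<in>\<Delta> a" "keys f\<subseteq>(\<Union>h. homog A h\<times>homog A (g - h))" using hom_rep_deg[OF a] by auto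
 have "pair2 f (%u v. lookup (coord A Xs u) y * lookup (coord A Xs v) z) \<noteq> 0"
  using p sw_rep[OF bil_prod[OF lf_lookup lf_lookup] f(1) ac] by (simp add: lookup_dd in_keys_iff)
 then obtain u v where uv: "(u, v)\<in>keys f" "lookup (coord A Xs u) y * lookup (coord A Xs v) z \<noteq> 0"
  using pair2_cong[of f "%u v. lookup (coord A Xs u) y * lookup (coord A Xs v) z" "%u v. 0"] by (auto simp: pair2_def)
 then obtain h where h: "u\<in>homog A h" "v\<in>homog A (g - h)" using f(2) by auto
 have k: "y\<in>keys (coord A Xs u)" "z\<in>keys (coord A Xs v)" using uv(2) by (auto simp: in_keys_iff)
 have "y\<in>homog A h" "z\<in>homog A (g - h)"
  using coord_homog[OF Xs'(1) _ Xs'(2) h(1)] coord_homog[OF Xs'(1) _ Xs'(2) h(2)] k Xs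
  by (auto simp: hbasis_def)
 then have "dg A y = h" "dg A z = g - h" using dg_eq Xs_nz yz by auto
 then show ?thesis by simp
qed

lemma dd_sub:
 assumes N: "gsc N" and XN: "XN\<subseteq>Xs" "spn A XN = N" and a: "a\<in>N"
 shows "keys (dd Xs a)\<subseteq>XN\<times>XN"
proof (intro subsetI)
 fix p assume p: "p\<in>keys (dd Xs a)"
 obtain y z where yz: "p = (y, z)" by force
 have ac: "a\<in>cA" by (rule gscD(3)[OF N a])
 let ?k = "%x v. lookup (coord A Xs v) x"
 have n: "sw a (%u v. ?k y u * ?k z v) \<noteq> 0"
  using p yz by (simp add: lookup_dd in_keys_iff)
 have v: "?k x w = 0" if "w\<in>N" "x \<notin> XN" for x w
 proof -
  have "w\<in>spn A XN" using that(1) XN(2) by simp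
  then obtain f where f: "keys f\<subseteq>XN" "vsum A f (%x. x) = w" by (auto simp: spn_def)
  have "coord A Xs w = f" using f XN(1) by (intro coord_eqI[OF Xs'(1)]) auto
  then show ?thesis using f(1) that(2) by (auto simp: in_keys_iff)
 qed
 have "sw a (%u v. ?k y u * ?k z v) = ?k y (Tr (?k z) a)"
  using lf_Tr[OF lf_lookup ac] by (simp add: mult.commute)
 then have "y\<in>XN" using n v[OF gscD(4)[OF N lf_lookup a]] by metis
 moreover have "sw a (%u v. ?k y u * ?k z v) = ?k z (Tl (?k y) a)"
  using lf_Tl[OF lf_lookup ac] by simp
 then have "z\<in>XN" using n v[OF gscD(5)[OF N lf_lookup a]] by metis
 ultimately show "p\<in>XN\<times>XN" using yz by simp
qed

end

text \<open>
  Expanding a representative along a basis adapted to \<open>N\<close>, both legs have coefficients obtained from \<open>a\<close>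
  by the two actions, hence lie in \<open>N\<close>.
\<close>

lemma gsc_rep:
 assumes N: "gsc N" and a: "a\<in>N"
 shows "\<exists>f\<in>\<Delta> a. keys f\<subseteq>(N\<inter>hset A)\<times>(N\<inter>hset A)"
proof -
 obtain XN Xs where x: "XN\<subseteq>Xs" "hbasis Xs" "XN\<subseteq>N\<inter>hset A" "spn A XN = N"
  using gsc_adapted[OF N] by auto
 have "keys (dd Xs a)\<subseteq>XN\<times>XN" by (rule dd_sub[OF x(2) N x(1,4) a])
 then show ?thesis using dd_in[OF x(2) gscD(3)[OF N a]] x(3) by blast
qed

text \<open>
  Every subcoalgebra has enough points: a homogeneous basis with its structure constants is a test
  coalgebra, and the inclusion is a point.
\<close>

lemma test_coalgebra:
 assumes N: "gsc N" and one: "\<one>\<in>N"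
 shows "\<exists>(dgr::'a => 'g) d eps \<iota>. points \<phi> A dgr d eps\<and>points.point A dgr d eps \<iota>\<and>range \<iota>\<subseteq>N\<and>N\<subseteq>spn A (range \<iota>)"
proof -
 obtain XN Xs where x: "XN\<subseteq>Xs" "hbasis Xs" "XN\<subseteq>N\<inter>hset A" "spn A XN = N" "indep A XN"
  using gsc_adapted[OF N] by auto
 define dgr where "dgr y = (if y\<in>XN then dg A y else 0)" for y
 define eps where "eps y = (if y\<in>XN then \<epsilon> y else 1)" for y
 define \<iota> where "\<iota> y = (if y\<in>XN then y else \<one>)" for y
 define d where "d y = (if y\<in>XN then dd Xs y else single (y, y) 1)" for y
 note Xs = x(2)
 note X' = Xs'[OF Xs]
 have c: "y\<in>carrier A" if "y\<in>XN" for y using that x(1) X'(3) by auto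
 have k: "keys (dd Xs y)\<subseteq>XN\<times>XN" if "y\<in>XN" for y
  using dd_sub[OF Xs N x(1,4)] that x(3) by auto
 have dk: "u\<in>XN\<and>v\<in>XN" if "y\<in>XN" "(u, v)\<in>keys (dd Xs y)" for y u v using k[OF that(1)] that(2) by auto
 have cocomm: "pair2 (dd Xs y) F = pair2 (dd Xs y) (%u v. \<phi> (dg A u) (dg A v) * F v u)" if y: "y\<in>XN" for y F
 proof -
  have "pair2 (dd Xs y) F = sw y (hat Xs F)" by (rule pair2_dd)
  also have "... = pair2 (dd Xs y) (%u v. \<phi> (dg A u) (dg A v) * hat Xs F v u)"
   by (rule sw_cocomm[OF bil_hat[OF Xs] c[OF y] dd_in[OF Xs c[OF y]] dd_homk[OF Xs c[OF y]]])
  also have "... = pair2 (dd Xs y) (%u v. \<phi> (dg A u) (dg A v) * F v u)"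
   using dk[OF y] x(1) by (intro pair2_cong) (auto simp: hat_basis[OF Xs] subset_iff)
  finally show ?thesis .
 qed
 have coassoc: "pair2 (dd Xs y) (%y' w. pair2 (dd Xs y') (%u v. F u v w)) = pair2 (dd Xs y) (%u z. pair2 (dd Xs z) (F u))"
  if y: "y\<in>XN" for y F
 proof -
  let ?g = "%u1 u2 v. pair (coord A Xs u1) (%a. pair (coord A Xs u2) (%b. pair (coord A Xs v) (%c. F a b c)))"
  have tg: "tri A ?g" by (intro triI lf_pair lf_cx[OF Xs])
  note co = sw_coassoc[OF tg c[OF y]]
  have b1: "bil A A (%u v. sw u (%u1 u2. ?g u1 u2 v))"
  proof (rule bilI)
   fix u assume u: "u\<in>carrier A"
   have "lf A (%v. pair2 (dd Xs u) (%u1 u2. ?g u1 u2 v))"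
    unfolding pair2_def by (intro lf_pair lf_cx[OF Xs])
   moreover have "pair2 (dd Xs u) (%u1 u2. ?g u1 u2 v) = sw u (%u1 u2. ?g u1 u2 v)" for v
    by (rule pair2_dd_bil[OF Xs _ u]) (intro bilI lf_pair lf_cx[OF Xs])
   ultimately show "lf A (%v. sw u (%u1 u2. ?g u1 u2 v))" by simp
  qed (intro lf_sw bilI lf_pair lf_cx[OF Xs])
  have b2: "bil A A (%u v. sw v (?g u))"
  proof (rule bilI)
   fix v assume v: "v\<in>carrier A"
   have "lf A (%u. pair2 (dd Xs v) (?g u))"
    unfolding pair2_def by (intro lf_pair lf_cx[OF Xs])
   moreover have "pair2 (dd Xs v) (?g u) = sw v (?g u)" for u
    by (rule pair2_dd_bil[OF Xs _ v]) (intro bilI lf_pair lf_cx[OF Xs])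
   ultimately show "lf A (%u. sw v (?g u))" by simp
  qed (intro lf_sw bilI lf_pair lf_cx[OF Xs])
  have "pair2 (dd Xs y) (%y' w. pair2 (dd Xs y') (%u v. F u v w)) = pair2 (dd Xs y) (%u v. sw u (%u1 u2. ?g u1 u2 v))"
  proof (rule pair2_cong)
   fix y' w assume "(y', w)\<in>keys (dd Xs y)"
   then have "w\<in>Xs" using dk[OF y] x(1) by auto
   then show "pair2 (dd Xs y') (%u v. F u v w) = sw y' (%u1 u2. ?g u1 u2 w)"
    unfolding pair2_dd hat_def by (simp add: cx_basis[OF Xs])
  qed
  also have "... = pair2 (dd Xs y) (%u v. sw v (?g u))"
   using co unfolding pair2_dd_bil[OF Xs b1 c[OF y]] pair2_dd_bil[OF Xs b2 c[OF y]] .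
  also have "... = pair2 (dd Xs y) (%u z. pair2 (dd Xs z) (F u))"
  proof (rule pair2_cong)
   fix u z assume "(u, z)\<in>keys (dd Xs y)"
   then have "u\<in>Xs" using dk[OF y] x(1) by auto
   then show "sw z (?g u) = pair2 (dd Xs z) (F u)"
    unfolding pair2_dd hat_def by (simp add: cx_basis[OF Xs])
  qed
  finally show ?thesis .
 qed
 have counit: "pair2 (dd Xs y) (%u v. \<epsilon> u * F v) = F y" if y: "y\<in>XN" for y and F :: "'a => 'k"
 proof -
  have "pair2 (dd Xs y) (%u v. \<epsilon> u * F v) = sw y (%u v. \<epsilon> u * pair (coord A Xs v) F)"
   unfolding pair2_dd
   by (rule sw_cong[OF c[OF y]]) (simp add: hat_def pair_cmult pair_cmult_right cx_lf[OF Xs _ lf_counit])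
  also have "... = F y" using x(1) y by (subst counit_l[OF c[OF y] lf_cx[OF Xs]]) (auto simp: cx_basis[OF Xs])
  finally show ?thesis .
 qed
 have dXN: "d y = dd Xs y" if "y\<in>XN" for y using that by (simp add: d_def)
 have T: "tcoalg \<phi> dgr d eps"
 proof
  show "commutation_factor \<phi>" by (rule cf)
  fix y and F :: "'a => 'a => 'a => 'k"
  show "pair2 (d y) (%y w. pair2 (d y) (%u v. F u v w)) = pair2 (d y) (%u z. pair2 (d z) (F u))"
  proof (cases "y\<in>XN")
   case True
   have "pair2 (d y) (%y w. pair2 (d y) (%u v. F u v w)) = pair2 (dd Xs y) (%y' w. pair2 (dd Xs y') (%u v. F u v w))"
    unfolding dXN[OF True] by (rule pair2_cong) (use dk[OF True] dXN in auto)
   also have "... = pair2 (dd Xs y) (%u z. pair2 (dd Xs z) (F u))" by (rule coassoc[OF True])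
   also have "... = pair2 (d y) (%u z. pair2 (d z) (F u))"
    unfolding dXN[OF True] by (rule pair2_cong) (use dk[OF True] dXN in auto)
   finally show ?thesis .
  qed (simp add: d_def pair2_single)
 next
  fix y and F :: "'a => 'a => 'k"
  show "pair2 (d y) F = pair2 (d y) (%y z. \<phi> (dgr y) (dgr z) * F z y)"
  proof (cases "y\<in>XN")
   case True
   have "pair2 (d y) F = pair2 (dd Xs y) (%u v. \<phi> (dg A u) (dg A v) * F v u)"
    unfolding dXN[OF True] by (rule cocomm[OF True])
   also have "... = pair2 (d y) (%y z. \<phi> (dgr y) (dgr z) * F z y)"
    unfolding dXN[OF True] by (rule pair2_cong) (use dk[OF True] in \<open>auto simp: dgr_def\<close>)
   finally show ?thesis .
  qed (simp add: d_def pair2_single dgr_def)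
 next
  fix y and F :: "'a => 'k"
  show "pair2 (d y) (%y z. eps y * F z) = F y"
  proof (cases "y\<in>XN")
   case True
   have "pair2 (d y) (%y z. eps y * F z) = pair2 (dd Xs y) (%u v. \<epsilon> u * F v)"
    unfolding dXN[OF True] by (rule pair2_cong) (use dk[OF True] in \<open>auto simp: eps_def\<close>)
   then show ?thesis using counit[OF True] by simp
  qed (simp add: d_def pair2_single eps_def)
 next
  fix x y z assume h: "(y, z)\<in>keys (d x)"
  show "dgr y + dgr z = dgr x"
  proof (cases "x\<in>XN")
   case True
   then have "x\<in>Xs" using \<open>XN\<subseteq>Xs\<close> by auto
   then show ?thesis using True h dk[OF True, of y z] dd_deg[OF Xs X'(4), of x y z] by (simp add: d_def dgr_def)
  qed (use h in \<open>simp add: d_def keys_single dgr_def split: if_splits\<close>)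
 next
  fix y assume "dgr y \<noteq> 0"
  then have y: "y\<in>XN" "dg A y \<noteq> 0" by (auto simp: dgr_def split: if_splits)
  then show "eps y = 0" using counit_degree[OF X'(4), of y] x(1) by (auto simp: eps_def)
 qed
 then interpret points \<phi> A dgr d eps by (simp add: points_def cchopf_axioms)
 have io: "y\<in>XN ==> \<iota> y = y" "y \<notin> XN ==> \<iota> y = \<one>" for y by (auto simp: \<iota>_def)
 have "point \<iota>"
  unfolding point_def
 proof (intro conjI allI impI)
  fix y
  show "\<iota> y\<in>homog A (dgr y)" using homog_one X'(4)[of y] x(1) by (auto simp: \<iota>_def dgr_def)
  show "\<epsilon> (\<iota> y) = eps y" by (simp add: \<iota>_def eps_def counit_one)
  fix b assume b: "bil A A b"
  show "sw (\<iota> y) b = pair2 (d y) (%y z. b (\<iota> y) (\<iota> z))"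
  proof (cases "y\<in>XN")
   case True
   have "sw (\<iota> y) b = pair2 (dd Xs y) b" using True by (simp add: io pair2_dd_bil[OF Xs b] c)
   also have "... = pair2 (d y) (%y z. b (\<iota> y) (\<iota> z))"
    unfolding dXN[OF True] by (rule pair2_cong) (use dk[OF True] in \<open>auto simp: io\<close>)
   finally show ?thesis .
  qed (simp add: io d_def pair2_single sw_one[OF b])
 qed
 moreover have "range \<iota>\<subseteq>N" using x(3) one by (auto simp: \<iota>_def)
 moreover have "N\<subseteq>spn A (range \<iota>)"
 proof -
  have "XN\<subseteq>range \<iota>" using io(1) by (metis rangeI subsetI)
  moreover have "range \<iota>\<subseteq>carrier A" using c by (auto simp: \<iota>_def)
  ultimately have "XN\<subseteq>spn A (range \<iota>)" using spn_superset by blast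
  then show ?thesis using spn_least[OF subsp_spn[OF \<open>range \<iota>\<subseteq>carrier A\<close>], of XN] x(4) by simp
 qed
 ultimately show ?thesis using points_axioms by blast
qed

end

section \<open>Points of products and commutators\<close>

locale tcoalg2 = C: tcoalg \<phi> dgr d eps + D: tcoalg \<phi> dgr' d' eps'
 for \<phi> :: "'g::ab_group_add => 'g => 'k::field" and dgr :: "'i => 'g" and d eps
  and dgr' :: "'j => 'g" and d' eps'
begin

abbreviation "pd \<equiv> dprod \<phi> dgr dgr' d d'"
abbreviation "pg \<equiv> %x::'i\<times>'j. dgr (fst x) + dgr' (snd x)"
abbreviation "pe \<equiv> %x::'i\<times>'j. eps (fst x) * eps' (snd x)"

lemma prod: "tcoalg \<phi> pg pd pe"
 by (rule tcoalg_prod) unfold_locales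

lemma phi_c: "\<phi> (dgr z) h * (e * (eps z * t)) = e * (eps z * t)" "\<phi> h (dgr z) * (e * (eps z * t)) = e * (eps z * t)"
 "\<phi> (dgr' z') h * (e * (eps' z' * t)) = e * (eps' z' * t)" "\<phi> h (dgr' z') * (e * (eps' z' * t)) = e * (eps' z' * t)"
 using C.phi_eps'(1)[of z h t] C.phi_eps'(2)[of h z t] D.phi_eps'(1)[of z' h t] D.phi_eps'(2)[of h z' t]
 by (metis mult.left_commute)+

lemma L1: "pair2 (pd (x, y)) (%p q. eps' (snd p) * (eps' (snd q) * G (fst p) (fst q))) = eps' y * pair2 (d x) G"
proof -
 have "pair2 (pd (x, y)) (%p q. eps' (snd p) * (eps' (snd q) * G (fst p) (fst q))) =
  pair2 (d x) (%a b. pair2 (d' y) (%u v. eps' u * (eps' v * G a b)))"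
  unfolding pair2_dprod by (intro pair2_cong) simp
 also have "... = eps' y * pair2 (d x) G" by (simp add: D.d_counit pair2_fun_cmult)
 finally show ?thesis .
qed

lemma L2: "pair2 (pd (x, y)) (%p q. eps (fst p) * (eps (fst q) * G (snd p) (snd q))) = eps x * pair2 (d' y) G"
proof -
 have "pair2 (pd (x, y)) (%p q. eps (fst p) * (eps (fst q) * G (snd p) (snd q))) =
  pair2 (d x) (%a b. eps a * (eps b * pair2 (d' y) G))"
  unfolding pair2_dprod pair2_fun_cmult[symmetric] by (intro pair2_cong) (simp add: phi_c)
 also have "... = eps x * pair2 (d' y) G" by (simp add: C.d_counit)
 finally show ?thesis .
qed

lemma L12: "pair2 (pd (x, y)) (%p q. eps' (snd p) * (eps (fst q) * G (fst p) (snd q))) = G x y"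
proof -
 have "pair2 (pd (x, y)) (%p q. eps' (snd p) * (eps (fst q) * G (fst p) (snd q))) =
  pair2 (d x) (%a b. eps b * pair2 (d' y) (%u v. eps' u * G a v))"
  unfolding pair2_dprod pair2_fun_cmult[symmetric]
 proof (intro pair2_cong)
  fix a b u v
  show "\<phi> (dgr b) (dgr' u) * (eps' (snd (a, u)) * (eps (fst (b, v)) * G (fst (a, u)) (snd (b, v)))) = eps b * (eps' u * G a v)"
   using D.eps_deg[of u] by (cases "dgr' u = 0") simp_all
 qed
 also have "... = G x y" by (simp add: D.d_counit C.d_counit_r)
 finally show ?thesis .
qed

lemma L21: "pair2 (pd (x, y)) (%p q. eps (fst p) * (eps' (snd q) * G (snd p) (fst q))) = \<phi> (dgr x) (dgr' y) * G y x"
proof -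
 have "pair2 (pd (x, y)) (%p q. eps (fst p) * (eps' (snd q) * G (snd p) (fst q))) =
  pair2 (d x) (%a b. eps a * pair2 (d' y) (%u v. eps' v * (\<phi> (dgr b) (dgr' u) * G u b)))"
  unfolding pair2_dprod pair2_fun_cmult[symmetric] by (intro pair2_cong) (simp add: mult_ac)
 also have "... = \<phi> (dgr x) (dgr' y) * G y x" by (simp add: D.d_counit_r C.d_counit)
 finally show ?thesis .
qed

end

locale points2 = cchopf \<phi> A + tcoalg2 \<phi> dgr d eps dgr' d' eps'
 for \<phi> :: "'g::ab_group_add => 'g => 'k::field" and A :: "('k, 'g, 'a, 'm) hopf_scheme" (structure)
  and dgr :: "'i => 'g" and d eps and dgr' :: "'j => 'g" and d' eps'

sublocale points2\<subseteq>P1: points \<phi> A dgr d eps ..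
sublocale points2\<subseteq>P2: points \<phi> A dgr' d' eps' ..
sublocale points2\<subseteq>PP: points \<phi> A "%x. dgr (fst x) + dgr' (snd x)" "dprod \<phi> dgr dgr' d d'" "%x. eps (fst x) * eps' (snd x)"
 by (rule points.intro[OF cchopf_axioms prod])

context points2 begin

text \<open>
  \<open>e1\<close> and \<open>e2\<close> inflate a point of one factor to the product coalgebra, through the counit of the other
  factor.
\<close>

definition e1 :: "('i => 'a) => 'i\<times>'j => 'a" where "e1 f p = eps' (snd p)\<odot>f (fst p)"
definition e2 :: "('j => 'a) => 'i\<times>'j => 'a" where "e2 f p = eps (fst p)\<odot>f (snd p)"

lemma hm_e1: "P1.hm f ==> PP.hm (e1 f)"
proof
 fix x :: "'i\<times>'j" assume f: "P1.hm f"
 have "f (fst x)\<in>cA" using f by auto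
 then show "e1 f x\<in>homog A (dgr (fst x) + dgr' (snd x))"
  using f subspD(4)[OF homog_subsp] D.eps_deg[of "snd x"]
  by (cases "dgr' (snd x) = 0") (auto simp: e1_def)
qed

lemma hm_e2: "P2.hm f ==> PP.hm (e2 f)"
proof
 fix x :: "'i\<times>'j" assume f: "P2.hm f"
 have "f (snd x)\<in>cA" using f by auto
 then show "e2 f x\<in>homog A (dgr (fst x) + dgr' (snd x))"
  using f subspD(4)[OF homog_subsp] C.eps_deg[of "fst x"]
  by (cases "dgr (fst x) = 0") (auto simp: e2_def)
qed

lemma point_e1: "P1.point f ==> PP.point (e1 f)"
 unfolding PP.point_def
proof (intro conjI allI impI)
 assume f: "P1.point f"
 fix x
 show "e1 f x\<in>homog A (dgr (fst x) + dgr' (snd x))" using hm_e1 P1.point_hom[OF f] by blast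
 show "\<epsilon> (e1 f x) = eps (fst x) * eps' (snd x)" using f by (simp add: e1_def counit_smult P1.point_eps)
 fix b assume b: "bil A A b"
 obtain u v where x: "x = (u, v)" by force
 have "sw (e1 f x) b = eps' v * pair2 (d u) (%y z. b (f y) (f z))"
  using f by (simp add: x e1_def lfD(2)[OF lf_sw[OF b]] P1.point_sw[OF f b])
 then show "sw (e1 f x) b = pair2 (pd x) (%y z. b (e1 f y) (e1 f z))"
  using f by (simp add: x e1_def lfD(2)[OF bilD(1)[OF b]] lfD(2)[OF bilD(2)[OF b]] L1[of u v "%y z. b (f y) (f z)"] mult.left_commute)
qed

lemma point_e2: "P2.point f ==> PP.point (e2 f)"
 unfolding PP.point_def
proof (intro conjI allI impI)
 assume f: "P2.point f"
 fix x
 show "e2 f x\<in>homog A (dgr (fst x) + dgr' (snd x))" using hm_e2 P2.point_hom[OF f] by blast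
 show "\<epsilon> (e2 f x) = eps (fst x) * eps' (snd x)" using f by (simp add: e2_def counit_smult P2.point_eps)
 fix b assume b: "bil A A b"
 obtain u v where x: "x = (u, v)" by force
 have "sw (e2 f x) b = eps u * pair2 (d' v) (%y z. b (f y) (f z))"
  using f by (simp add: x e2_def lfD(2)[OF lf_sw[OF b]] P2.point_sw[OF f b])
 then show "sw (e2 f x) b = pair2 (pd x) (%y z. b (e2 f y) (e2 f z))"
  using f by (simp add: x e2_def lfD(2)[OF bilD(1)[OF b]] lfD(2)[OF bilD(2)[OF b]] L2[of u v "%y z. b (f y) (f z)"] mult.left_commute)
qed

lemma eval12: "bil A A b ==> P1.vals f ==> P2.vals g ==> pair2 (pd (x, y)) (%p q. b (e1 f p) (e2 g q)) = b (f x) (g y)"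
 using L12[of x y "%u v. b (f u) (g v)"]
 by (simp add: e1_def e2_def lfD(2)[OF bilD(1)] lfD(2)[OF bilD(2)] mult.left_commute)

lemma eval21: "bil A A b ==> P1.vals f ==> P2.vals g ==>
  pair2 (pd (x, y)) (%p q. b (e2 g p) (e1 f q)) = \<phi> (dgr x) (dgr' y) * b (g y) (f x)"
 using L21[of x y "%u v. b (g u) (f v)"]
 by (simp add: e1_def e2_def lfD(2)[OF bilD(1)] lfD(2)[OF bilD(2)] mult.left_commute)

lemma eval22: "bil A A b ==> P2.vals f ==> P2.vals g ==>
  pair2 (pd (x, y)) (%p q. b (e2 f p) (e2 g q)) = eps x * pair2 (d' y) (%u v. b (f u) (g v))"
 using L2[of x y "%u v. b (f u) (g v)"]
 by (simp add: e1_def e2_def lfD(2)[OF bilD(1)] lfD(2)[OF bilD(2)] mult.left_commute)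

lemma vals_e: "P1.vals f ==> e1 f p\<in>cA" "P2.vals g ==> e2 g p\<in>cA"
 by (simp_all add: e1_def e2_def)

lemma conv12: "P1.vals f ==> P2.vals g ==> conv A pd (e1 f) (e2 g) (x, y) = f x\<otimes>g y"
proof (rule lf_eqI)
 fix l assume f: "P1.vals f" "P2.vals g" and l: "lf A l"
 show "l (conv A pd (e1 f) (e2 g) (x, y)) = l (f x\<otimes>g y)"
  using PP.lf_cv[OF l, of "e1 f" "e2 g" "(x, y)"] f vals_e eval12[OF bil_lf[OF mult_bilin l] f] by simp
qed (use vals_e in \<open>auto intro!: PP.cv_closed\<close>)

lemma conv21: "P1.vals f ==> P2.vals g ==> conv A pd (e2 g) (e1 f) (x, y) = \<phi> (dgr x) (dgr' y)\<odot>(g y\<otimes>f x)"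
proof (rule lf_eqI)
 fix l assume f: "P1.vals f" "P2.vals g" and l: "lf A l"
 show "l (conv A pd (e2 g) (e1 f) (x, y)) = l (\<phi> (dgr x) (dgr' y)\<odot>(g y\<otimes>f x))"
  using PP.lf_cv[OF l, of "e2 g" "e1 f" "(x, y)"] f vals_e eval21[OF bil_lf[OF mult_bilin l] f] by (simp add: lfD(2)[OF l])
qed (use vals_e in \<open>auto intro!: PP.cv_closed\<close>)

end

context cchopf begin

lemma gsc_carrier: "gsc (cA)"
 by (simp add: gsc_def gsub_carrier)

lemma lf_spn_eq:
 assumes "lf A l" "lf A m" "\<And>x. x\<in>Y ==> l x = m x" "Y\<subseteq>cA" "v\<in>spn A Y"
 shows "l v = m v"
proof -
 obtain f where f: "keys f\<subseteq>Y" "v = vsum A f (%x. x)" using assms(5) by (auto simp: spn_def)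
 then have k: "x\<in>keys f ==> x\<in>cA" for x using assms(4) by auto
 show ?thesis using f assms(3) k by (auto simp: lf_vsum assms(1,2) intro!: pair_cong)
qed

lemma bil_spn_eq:
 assumes b: "bil A A b" "bil A A c" "\<And>x y. x\<in>Y ==> y\<in>Z ==> b x y = c x y" "Y\<subseteq>cA" "Z\<subseteq>cA"
  "u\<in>spn A Y" "v\<in>spn A Z"
 shows "b u v = c u v"
proof -
 have vc: "v\<in>cA" using subspD(1)[OF subsp_spn[OF assms(5)]] assms(7) .
 show ?thesis
 proof (rule lf_spn_eq[OF bilD(2)[OF b(1) vc] bilD(2)[OF b(2) vc] _ assms(4,6)])
  fix x assume x: "x\<in>Y"
  then have xc: "x\<in>cA" using assms(4) by auto
  show "b x v = c x v"
   by (rule lf_spn_eq[OF bilD(1)[OF b(1) xc] bilD(1)[OF b(2) xc] _ assms(5,7)]) (use b(3) x in auto)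
 qed
qed

text \<open>
  The inclusion is a point, and inverses in a group are involutive. The same argument shows that
  the antipode reverses products.
\<close>

lemma S_S [simp]: "a\<in>cA ==> S (S a) = a"
proof -
 assume a: "a\<in>cA"
 obtain dgr :: "'a => 'g" and d eps \<iota> where t: "points \<phi> A dgr d eps" "points.point A dgr d eps \<iota>" "cA\<subseteq>spn A (range \<iota>)"
  using test_coalgebra[OF gsc_carrier] by auto
 interpret points \<phi> A dgr d eps by (rule t(1))
 have r: "range \<iota>\<subseteq>cA" using t(2) by auto
 have ss: "S (S (\<iota> x)) = \<iota> x" for x using S_S_point[OF t(2)] by metis
 show ?thesis
 proof (rule lf_eqI)
  fix l assume l: "lf A l"
  show "l (S (S a)) = l a"
   by (rule lf_spn_eq[OF lf_lin[OF l gr_lin[OF gr_comp[OF gr_S gr_S]]] l _ r]) (use a t(3) ss in auto)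
 qed (use a in auto)
qed

lemma S_mult:
 assumes a: "a\<in>homog A g" and b: "b\<in>homog A h"
 shows "S (a\<otimes>b) = \<phi> g h\<odot>(S b\<otimes>S a)"
proof -
 obtain dgr :: "'a => 'g" and d eps \<iota> where t: "points \<phi> A dgr d eps" "points.point A dgr d eps \<iota>" "cA\<subseteq>spn A (range \<iota>)"
  using test_coalgebra[OF gsc_carrier] by auto
 interpret points \<phi> A dgr d eps by (rule t(1))
 interpret W: points2 \<phi> A dgr d eps dgr d eps ..
 have r: "range \<iota>\<subseteq>cA" using t(2) by auto
 note pt = t(2)
 let ?b = "color_ext \<phi> A A A (%a b. S b\<otimes>S a)"
 have ib: "bilin A A A (%a b. S b\<otimes>S a)"
  by (intro bilinI lin_mult_l lin_mult_r gr_lin gr_S) auto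
 have cb: "bilin A A A ?b" by (rule AA.AB.color_ext_bilin[OF kspace_axioms ib])
 have sb: "bilin A A A (%a b. S (a\<otimes>b))"
  by (intro bilinI lin_comp[OF gr_lin[OF gr_S]] lin_mult_l lin_mult_r lin_id) auto
 have ac: "a\<in>cA" "b\<in>cA" using a b by auto
 have eS: "S (W.e1 f p) = W.e1 (%x. S (f x)) p" "S (W.e2 f p) = W.e2 (%x. S (f x)) p" if "vals f" for f p
  using that linD(3)[OF gr_lin[OF gr_S]] by (auto simp: W.e1_def W.e2_def)
 have "S (a\<otimes>b) = ?b a b"
 proof (rule lf_eqI)
  fix l assume l: "lf A l"
  show "l (S (a\<otimes>b)) = l (?b a b)"
  proof (rule bil_spn_eq[OF bil_lf[OF sb l] bil_lf[OF cb l] _ r r])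
   fix x y assume "x\<in>range \<iota>" "y\<in>range \<iota>"
   then obtain i j where ij: "x = \<iota> i" "y = \<iota> j" by auto
   note p1 = W.point_e1[OF pt] and p2 = W.point_e2[OF pt]
   have v: "vals \<iota>" "vals (%x. S (\<iota> x))" using pt by auto
   have "S (\<iota> i\<otimes>\<iota> j) = S (conv A W.pd (W.e1 \<iota>) (W.e2 \<iota>) (i, j))"
    using W.conv12[OF v(1) v(1)] by simp
   also have "... = conv A W.pd (W.e2 (%x. S (\<iota> x))) (W.e1 (%x. S (\<iota> x))) (i, j)"
    using fun_cong[OF W.PP.S_conv[OF p1 p2], of "(i, j)"] v(1) by (simp add: eS cong: if_cong)
   also have "... = \<phi> (dgr i) (dgr j)\<odot>(S (\<iota> j)\<otimes>S (\<iota> i))" by (rule W.conv21[OF v(2) v(2)])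
   also have "... = ?b (\<iota> i) (\<iota> j)"
    by (rule AA.AB.color_ext_homog[OF kspace_axioms ib point_hom[OF pt] point_hom[OF pt], symmetric])
   finally show "l (S (x\<otimes>y)) = l (?b x y)" by (simp add: ij)
  qed (use ac t(3) in auto)
 qed (use ac bilin_closed[OF cb] in auto)
 then show ?thesis using AA.AB.color_ext_homog[OF kspace_axioms ib a b] by simp
qed

lemma S_one: "S \<one> = \<one>"
proof (rule lf_eqI)
 fix l assume l: "lf A l"
 have "bil A A (%u v. l (u\<otimes>S v))" by (intro bil_mult[OF l] gr_lin gr_S lin_id)
 from sw_one[OF this] show "l (S \<one>) = l \<one>" using antipode_r[OF one_closed l] by (simp add: counit_one)
qed auto

lemma counit_S: "a\<in>cA ==> \<epsilon> (S a) = \<epsilon> a"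
proof -
 assume a: "a\<in>cA"
 have "\<epsilon> (S a) = sw a (%u v. \<epsilon> v * \<epsilon> (S u))"
  by (rule counit_r[OF a lf_lin[OF lf_counit gr_lin[OF gr_S]], symmetric])
 also have "... = sw a (%u v. \<epsilon> (S u\<otimes>v))" by (rule sw_cong[OF a]) (simp add: counit_mult mult.commute)
 also have "... = \<epsilon> a" using antipode_l[OF a lf_counit] by (simp add: counit_one)
 finally show ?thesis .
qed

text \<open>For homogeneous \<open>x\<close> the color factor of the adjoint action can be moved onto the second leg.\<close>

lemma lf_ad_homog:
 assumes l: "lf A l" and a: "a\<in>cA" and x: "x\<in>homog A h"
 shows "l (ad a x) = sw a (%u v. l (u\<otimes>x\<otimes>S (tw h v)))"
proof -
 have xc: "x\<in>cA" using x by auto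
 obtain f where f: "f\<in>\<Delta> a" "homk f" using hom_rep[OF a] by auto
 have b: "bil A A (%u v. l (u\<otimes>x\<otimes>S (tw h v)))"
  using xc by (intro bil_mult[OF l] lin_mult_r lin_id gr_lin gr_comp[OF gr_S gr_tw])
 have "l (ad a x) = pair2 f (%u v. l (R3 u v x))" by (rule lf_ad[OF l a xc f(1)])
 also have "... = pair2 f (%u v. l (u\<otimes>x\<otimes>S (tw h v)))"
 proof (rule pair2_cong)
  fix u v assume "(u, v)\<in>keys f"
  then have uv: "u\<in>cA" "v\<in>homog A (dg A v)" using f(2) dg_in hset_carrier by auto
  then have vc: "v\<in>cA" by auto
  have "S (tw h v) = \<phi> (dg A v) h\<odot>S v" using uv vc linD(3)[OF gr_lin[OF gr_S]] by (simp add: tw_homog)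
  then show "l (R3 u v x) = l (u\<otimes>x\<otimes>S (tw h v))"
   using uv vc xc by (simp add: R3_homog[OF uv x] smult_mult_right)
 qed
 finally show ?thesis using sw_rep[OF b f(1) a] by simp
qed

lemma counit_tw: "a\<in>cA ==> \<epsilon> (tw h a) = \<epsilon> a"
proof (rule lf_hset_eq[OF lf_lin[OF lf_counit gr_lin[OF gr_tw]] lf_counit])
 fix v assume "v\<in>hset A"
 then obtain g where g: "v\<in>homog A g" by (auto simp: hset_def)
 then show "\<epsilon> (tw h v) = \<epsilon> v" using counit_degree[OF g] by (cases "g = 0") (auto simp: tw_homog counit_smult)
qed

lemma tw_tw: "a\<in>cA ==> tw g (tw h a) = tw (g + h) a"
proof (rule lf_eqI)
 fix l assume a: "a\<in>cA" and l: "lf A l"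
 show "l (tw g (tw h a)) = l (tw (g + h) a)"
 proof (rule lf_hset_eq[OF lf_lin[OF l gr_lin[OF gr_comp[OF gr_tw gr_tw]]] lf_lin[OF l gr_lin[OF gr_tw]] _ a])
  fix v assume "v\<in>hset A"
  then obtain k where g: "v\<in>homog A k" by (auto simp: hset_def)
  then have "tw h v\<in>homog A k" by (rule grD(2)[OF gr_tw])
  then show "l (tw g (tw h v)) = l (tw (g + h) v)"
   using g homog_carrier[OF g] by (simp add: tw_homog[OF g] tw_homog[of _ k g] smult_smult phi_add mult.commute)
 qed
qed auto

lemma sw_tw:
 assumes b: "bil A A b" and a: "a\<in>cA"
 shows "sw (tw h a) b = sw a (%u v. b (tw h u) (tw h v))"
proof (rule lf_hset_eq[OF lf_lin[OF lf_sw[OF b] gr_lin[OF gr_tw]] lf_sw _ a])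
 show bb: "bil A A (%u v. b (tw h u) (tw h v))" by (rule bil_comp[OF b gr_lin[OF gr_tw] gr_lin[OF gr_tw]])
 fix x assume "x\<in>hset A"
 then obtain g where x: "x\<in>homog A g" by (auto simp: hset_def)
 have xc: "x\<in>cA" using x by auto
 obtain f where f: "f\<in>\<Delta> x" "keys f\<subseteq>(\<Union>h. homog A h\<times>homog A (g - h))" using hom_rep_deg[OF x] by auto
 have "sw (tw h x) b = \<phi> g h * sw x b" using x xc by (simp add: tw_homog lfD(2)[OF lf_sw[OF b]])
 also have "... = pair2 f (%u v. \<phi> g h * b u v)" by (simp add: sw_rep[OF b f(1) xc] pair2_fun_cmult)
 also have "... = pair2 f (%u v. b (tw h u) (tw h v))"
 proof (rule pair2_cong)
  fix u v assume "(u, v)\<in>keys f"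
  then obtain k where k: "u\<in>homog A k" "v\<in>homog A (g - k)" using f(2) by auto
  have kc: "u\<in>cA" "v\<in>cA" using k by auto
  have "\<phi> k h * \<phi> (g - k) h = \<phi> g h" by (simp flip: phi_add)
  then show "\<phi> g h * b u v = b (tw h u) (tw h v)"
   using kc by (simp add: tw_homog[OF k(1)] tw_homog[OF k(2)] lfD(2)[OF bilD(1)[OF b]] lfD(2)[OF bilD(2)[OF b]])
    (metis mult.assoc mult.commute)
 qed
 also have "... = sw x (%u v. b (tw h u) (tw h v))" by (rule sw_rep[OF bb f(1) xc, symmetric])
 finally show "sw (tw h x) b = sw x (%u v. b (tw h u) (tw h v))" .
qed

lemma ad_mult:
 assumes l: "lf A l" and a: "a\<in>cA" and x: "x\<in>homog A h" and y: "y\<in>homog A k"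
 shows "l (ad a (x\<otimes>y)) = sw a (%u v. l (ad u x\<otimes>ad (tw h v) y))"
proof -
 have c: "x\<in>cA" "y\<in>cA" using x y by auto
 note lS = gr_lin[OF gr_S] and lt = gr_lin[OF gr_tw]
 have lSt: "lin A A (%v. S (tw h v))" for h by (rule lin_comp[OF lS lt])
 let ?B = "%u w v. l (u\<otimes>x\<otimes>S (tw h w)\<otimes>ad (tw h v) y)"
 have r1: "l (ad u x\<otimes>ad (tw h v) y) = sw u (%u1 u2. ?B u1 u2 v)" if "u\<in>cA" "v\<in>cA" for u v
  using that c by (intro lf_ad_homog[OF lf_mult_r[OF l] _ x]) auto
 have r2: "l (s\<otimes>ad (tw h v) y) = sw v (%v1 v2. l (s\<otimes>(tw h v1\<otimes>y\<otimes>S (tw (h + k) v2))))" if "s\<in>cA" "v\<in>cA" for s v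
 proof -
  have "l (s\<otimes>ad (tw h v) y) = sw (tw h v) (%v1 v2. l (s\<otimes>(v1\<otimes>y\<otimes>S (tw k v2))))"
   using that by (intro lf_ad_homog[OF lf_mult_l[OF l] _ y]) auto
  also have "... = sw v (%v1 v2. l (s\<otimes>(tw h v1\<otimes>y\<otimes>S (tw k (tw h v2)))))"
   using that c by (intro sw_tw bil_mult[OF lf_mult_l[OF l]] lin_mult_r lin_id lSt) auto
  also have "... = sw v (%v1 v2. l (s\<otimes>(tw h v1\<otimes>y\<otimes>S (tw (h + k) v2))))"
   using that by (intro sw_cong) (simp_all add: tw_tw add.commute)
  finally show ?thesis .
 qed
 have ladl: "lin A A (%v. ad (tw h v) y)" by (rule lin_comp[OF bilinD(2)[OF ad_bilin c(2)] lt])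
 have "sw a (%u v. l (ad u x\<otimes>ad (tw h v) y)) = sw a (%u v. sw u (%u1 u2. ?B u1 u2 v))"
  by (rule sw_cong[OF a]) (rule r1)
 also have "... = sw a (%u v. sw v (?B u))"
  using c by (intro sw_coassoc[OF triI a] lf_lin[OF l] lin_mult_l lin_mult_r lin_id lSt ladl) auto
 also have "... = sw a (%u v. sw v (%w z. sw z (%v1 v2. l (u\<otimes>x\<otimes>S (tw h w)\<otimes>(tw h v1\<otimes>y\<otimes>S (tw (h + k) v2))))))"
  using c by (intro sw_cong[OF a] sw_cong r2) auto
 also have "... = sw a (%u v. sw v (%z v2. sw z (%w v1. l (u\<otimes>x\<otimes>S (tw h w)\<otimes>(tw h v1\<otimes>y\<otimes>S (tw (h + k) v2))))))"
 proof (rule sw_cong[OF a])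
  fix u v assume uv: "u\<in>cA" "v\<in>cA"
  show "sw v (%w z. sw z (%v1 v2. l (u\<otimes>x\<otimes>S (tw h w)\<otimes>(tw h v1\<otimes>y\<otimes>S (tw (h + k) v2))))) =
   sw v (%z v2. sw z (%w v1. l (u\<otimes>x\<otimes>S (tw h w)\<otimes>(tw h v1\<otimes>y\<otimes>S (tw (h + k) v2)))))"
   using c uv by (intro sw_coassoc[OF triI uv(2), symmetric] lf_lin[OF l] lin_mult_l lin_mult_r lin_id lSt lt) auto
 qed
 also have "... = sw a (%u v. sw v (%z v2. \<epsilon> z * l (u\<otimes>x\<otimes>y\<otimes>S (tw (h + k) v2))))"
 proof (intro sw_cong[OF a] sw_cong)
  fix u v z v2 assume u: "u\<in>cA" "z\<in>cA" "v2\<in>cA"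
  define s where "s = y\<otimes>S (tw (h + k) v2)"
  have sc: "s\<in>cA" using u c by (simp add: s_def)
  have "sw z (%w v1. l (u\<otimes>x\<otimes>S (tw h w)\<otimes>(tw h v1\<otimes>y\<otimes>S (tw (h + k) v2)))) =
   sw z (%w v1. l (u\<otimes>x\<otimes>(S (tw h w)\<otimes>tw h v1)\<otimes>s))"
   using u c by (intro sw_cong) (auto simp: s_def m_assoc)
  also have "... = sw (tw h z) (%w v1. l (u\<otimes>x\<otimes>(S w\<otimes>v1)\<otimes>s))"
   using u c sc
   by (intro sw_tw[symmetric] bil_mult[OF lf_mult_l[OF lf_mult_r[OF l]]] lS lin_id) auto
  also have "... = \<epsilon> (tw h z) * l (u\<otimes>x\<otimes>\<one>\<otimes>s)"
   using u c sc by (intro antipode_l lf_mult_l lf_mult_r l) auto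
  also have "... = \<epsilon> z * l (u\<otimes>x\<otimes>y\<otimes>S (tw (h + k) v2))"
   using u c by (simp add: counit_tw s_def m_assoc)
  finally show "sw z (%w v1. l (u\<otimes>x\<otimes>S (tw h w)\<otimes>(tw h v1\<otimes>y\<otimes>S (tw (h + k) v2)))) =
   \<epsilon> z * l (u\<otimes>x\<otimes>y\<otimes>S (tw (h + k) v2))" .
 qed auto
 also have "... = sw a (%u v. l (u\<otimes>x\<otimes>y\<otimes>S (tw (h + k) v)))"
  using c by (intro sw_cong[OF a] counit_l lf_lin[OF l] lin_mult_l lSt) auto
 also have "... = sw a (%u v. l (u\<otimes>(x\<otimes>y)\<otimes>S (tw (h + k) v)))"
  using c by (intro sw_cong[OF a]) (simp add: m_assoc)
 also have "... = l (ad a (x\<otimes>y))"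
  by (rule lf_ad_homog[OF l a homog_mult[OF x y], symmetric])
 finally show ?thesis by simp
qed

lemma counit_ad: "a\<in>cA ==> x\<in>cA ==> \<epsilon> (ad a x) = \<epsilon> a * \<epsilon> x"
proof (rule lf_hset_eq[OF lf_lin[OF lf_counit bilinD(1)[OF ad_bilin]] lf_cmult[OF lf_counit]])
 assume a: "a\<in>cA"
 fix x assume "x\<in>hset A"
 then obtain h where x: "x\<in>homog A h" by (auto simp: hset_def)
 have xc: "x\<in>cA" using x by auto
 have "\<epsilon> (ad a x) = sw a (%u v. \<epsilon> v * (\<epsilon> u * \<epsilon> x))"
  using xc by (subst lf_ad_homog[OF lf_counit a x], intro sw_cong[OF a]) (simp add: counit_mult counit_S counit_tw)
 also have "... = \<epsilon> a * \<epsilon> x" by (rule counit_r[OF a lf_cmult_right[OF lf_counit]])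
 finally show "\<epsilon> (ad a x) = \<epsilon> a * \<epsilon> x" .
qed

end

section \<open>The commutator subalgebra\<close>

context points begin

lemma S_left_cancel: "point f ==> vals z ==> (%x. S (f x))\<star>f\<star>z = z"
 by (subst cv_assoc[symmetric]) (auto simp: S_left cv_un_l)

lemma S_right_cancel: "point f ==> vals z ==> f\<star>(%x. S (f x))\<star>z = z"
 by (subst cv_assoc[symmetric]) (auto simp: S_right cv_un_l)

lemma com_points_in:
 assumes u: "point u" "\<And>x. u x\<in>U" and v: "point v" "\<And>x. v x\<in>V"
  and N: "subsp A N" "\<And>x y. x\<in>U ==> y\<in>V ==> com x y\<in>N"
 shows "((u\<star>v)\<star>(%x. S (u x))\<star>(%x. S (v x))) x\<in>N"
proof (rule lf_subspI[OF N(1)])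
 show "((u\<star>v)\<star>(%x. S (u x))\<star>(%x. S (v x))) x\<in>cA" using u(1) v(1) by (intro cv_closed) auto
 fix l assume l: "lf A l" and z: "\<And>x. x\<in>N ==> l x = 0"
 show "l (((u\<star>v)\<star>(%x. S (u x))\<star>(%x. S (v x))) x) = 0"
  using com_points[OF l u(1) v(1), of x] N(2) u(2) v(2) z by (simp add: pair2_def)
qed

lemma ad_points_in:
 assumes a: "point a" and h: "hm h" and N: "subsp A N" "\<And>y z. ad (a y) (h z)\<in>N"
 shows "(a\<star>h\<star>(%x. S (a x))) x\<in>N"
proof (rule lf_subspI[OF N(1)])
 show "(a\<star>h\<star>(%x. S (a x))) x\<in>cA" using a hom_vals[OF h] by (intro cv_closed) auto
 fix l assume l: "lf A l" and z: "\<And>x. x\<in>N ==> l x = 0"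
 show "l ((a\<star>h\<star>(%x. S (a x))) x) = 0"
  using ad_points[OF l a h, of x] N(2) z by (simp add: pair2_def)
qed

end

context cchopf begin

definition nhs :: "'a set => bool" where
 "nhs U\<longleftrightarrow>gsc U\<and>\<one>\<in>U\<and>(\<forall>x\<in>U. \<forall>y\<in>U. x\<otimes>y\<in>U)\<and>(\<forall>x\<in>U. S x\<in>U) \<and>
   (\<forall>a\<in>cA. \<forall>x\<in>U. ad a x\<in>U)"

lemma nhs_normal: "normal_color_hopf_subalgebra \<phi> A U ==> nhs U"
 using gsc_hopf_subalgebra[of U]
 by (auto simp: nhs_def normal_color_hopf_subalgebra_def color_hopf_subalgebra_def)

lemma normal_nhs: "nhs U ==> normal_color_hopf_subalgebra \<phi> A U"
 unfolding nhs_def normal_color_hopf_subalgebra_def color_hopf_subalgebra_def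
proof (intro conjI ballI)
 fix x assume U: "gsc U\<and>\<one>\<in>U\<and>(\<forall>x\<in>U. \<forall>y\<in>U. x\<otimes>y\<in>U)\<and>(\<forall>x\<in>U. S x\<in>U) \<and>
   (\<forall>a\<in>cA. \<forall>x\<in>U. ad a x\<in>U)" and x: "x\<in>U"
 obtain f where f: "f\<in>\<Delta> x" "keys f\<subseteq>(U\<inter>hset A)\<times>(U\<inter>hset A)" using gsc_rep[of U x] U x by auto
 have xc: "x\<in>cA" using U x gscD(3) by blast
 have "\<Delta> x = AA.AB.cl f" using AA.AB.rep_ok[OF comult_in[OF xc] f(1)] by simp
 then show "\<Delta> x\<in>AA.AB.cl ` {f. keys f\<subseteq>U\<times>U}" using f(2) by blast
qed (auto simp: gscD)

lemma lf_zero_spn: "lf A l ==> Y\<subseteq>cA ==> (\<And>x. x\<in>Y ==> l x = 0) ==> v\<in>spn A Y ==> l v = 0"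
 using lf_spn_eq[of l "%x. 0" Y v] by simp

lemma spn_lin:
 assumes h: "lin A A h" and Y: "Y\<subseteq>cA" and N: "subsp A N" "\<And>y. y\<in>Y ==> h y\<in>N" and v: "v\<in>spn A Y"
 shows "h v\<in>N"
proof (rule lf_subspI[OF N(1)])
 have vc: "v\<in>cA" using subspD(1)[OF subsp_spn[OF Y] v] .
 show "h v\<in>cA" by (rule linD(1)[OF h vc])
 fix l assume "lf A l" "\<And>x. x\<in>N ==> l x = 0"
 then show "l (h v) = 0" using lf_zero_spn[OF lf_lin[OF _ h] Y _ v, of l] N(2) by simp
qed

definition coms :: "'a set => 'a set => 'a set" where "coms U V = {com x y | x y. x\<in>U\<and>y\<in>V}"

text \<open>
  The commutators of \<open>U\<close> and \<open>V\<close> are spanned by the values of one point \<open>c = [x, y]\<close> on the product of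
  two test coalgebras. The clauses are group theory: \<open>c\<inverse> = [x\<inverse>, x y x\<inverse>]\<close> and
  \<open>a c a\<inverse> = [a x a\<inverse>, a y a\<inverse>]\<close> are again commutators, and \<open>c\<close> is trivial modulo \<open>I\<close> iff \<open>x y\<close> and
  \<open>y x\<close> agree modulo \<open>I\<close>.
\<close>

lemma com_test:
 assumes U: "nhs U" and V: "nhs V"
 shows "\<exists>(dgr::'a\<times>'a => 'g) d eps c. points \<phi> A dgr d eps\<and>points.point A dgr d eps c \<and>
  range c\<subseteq>coms U V\<and>coms U V\<subseteq>spn A (range c) \<and>
  (\<forall>m. S (c m)\<in>spn A (range c))\<and>(\<forall>a\<in>cA. \<forall>m. ad a (c m)\<in>spn A (range c)) \<and>
  (\<forall>I. subsp A I\<longrightarrow>(\<forall>m. \<forall>w\<in>cA. (c m\<ominus>eps m\<odot>\<one>)\<otimes>w\<in>I) \<longrightarrow>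
    (\<forall>g h. \<forall>x\<in>U\<inter>homog A g. \<forall>y\<in>V\<inter>homog A h. x\<otimes>y\<ominus>\<phi> g h\<odot>(y\<otimes>x)\<in>I)) \<and>
  (\<forall>I. subsp A I\<longrightarrow>(\<forall>i\<in>I. \<forall>w\<in>cA. i\<otimes>w\<in>I) \<longrightarrow>
    (\<forall>g h. \<forall>x\<in>U\<inter>homog A g. \<forall>y\<in>V\<inter>homog A h. x\<otimes>y\<ominus>\<phi> g h\<odot>(y\<otimes>x)\<in>I) \<longrightarrow>
    (\<forall>m. c m\<ominus>eps m\<odot>\<one>\<in>I))"
proof -
 have gU: "gsc U" "\<one>\<in>U" and gV: "gsc V" "\<one>\<in>V" using U V by (auto simp: nhs_def)
 note Uc = gscD(3)[OF gU(1)] and Vc = gscD(3)[OF gV(1)]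
 obtain dgr :: "'a => 'g" and d eps \<iota> where t: "points \<phi> A dgr d eps" "points.point A dgr d eps \<iota>" "range \<iota>\<subseteq>U" "U\<subseteq>spn A (range \<iota>)"
  using test_coalgebra[OF gU] by auto
 obtain dgr' :: "'a => 'g" and d' eps' \<iota>' where t': "points \<phi> A dgr' d' eps'" "points.point A dgr' d' eps' \<iota>'" "range \<iota>'\<subseteq>V" "V\<subseteq>spn A (range \<iota>')"
  using test_coalgebra[OF gV] by auto
 interpret P: points \<phi> A dgr d eps by (rule t(1))
 interpret P': points \<phi> A dgr' d' eps' by (rule t'(1))
 interpret W: points2 \<phi> A dgr d eps dgr' d' eps' ..
 have rc: "range \<iota>\<subseteq>cA" "range \<iota>'\<subseteq>cA" using t(3) t'(3) Uc Vc by auto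
 have vi: "P.vals \<iota>" "P.vals \<iota>'" using rc by auto
 define x where "x = W.e1 \<iota>"
 define y where "y = W.e2 \<iota>'"
 have px: "W.PP.point x" and py: "W.PP.point y" using W.point_e1[OF t(2)] W.point_e2[OF t'(2)] by (simp_all add: x_def y_def)
 have iU: "\<iota> i\<in>U" "\<iota>' i\<in>V" for i using t(3) t'(3) by auto
 have xU: "x p\<in>U" and yV: "y p\<in>V" for p
  unfolding x_def y_def W.e1_def W.e2_def
  using subspD(4)[OF gscD(2)[OF gU(1)] iU(1)] subspD(4)[OF gscD(2)[OF gV(1)] iU(2)] by auto
 let ?cv = "conv A W.pd"
 let ?Sx = "%p. S (x p)" and ?Sy = "%p. S (y p)"
 note [simp] = px py W.PP.point_S[OF px] W.PP.point_S[OF py]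
 have v [simp]: "x p\<in>cA" "y p\<in>cA" for p by auto
 define c where "c = ?cv (?cv x y) (?cv ?Sx ?Sy)"
 have pc: "W.PP.point c" unfolding c_def by (intro W.PP.point_conv) simp_all
 have c_eq: "c (i, j) = com (\<iota> i) (\<iota>' j)" for i j
 proof (rule lf_eqI)
  fix l assume l: "lf A l"
  have "l (c (i, j)) = pair2 (W.pd (i, j)) (%p q. l (com (x p) (y q)))"
   unfolding c_def by (rule W.PP.com_points[OF l px py, symmetric])
  also have "... = l (com (\<iota> i) (\<iota>' j))"
   unfolding x_def y_def using W.eval12[OF bil_lf[OF com_bilin l] vi] .
  finally show "l (c (i, j)) = l (com (\<iota> i) (\<iota>' j))" .
 qed (use pc vi in auto)
 have c_com: "range c\<subseteq>coms U V"
 proof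
  fix z assume "z\<in>range c"
  then obtain i j where "z = c (i, j)" by auto
  then show "z\<in>coms U V" using c_eq[of i j] iU by (auto simp: coms_def)
 qed
 have rcc: "range c\<subseteq>cA" using pc by auto
 let ?N = "spn A (range c)"
 have sN: "subsp A ?N" by (rule subsp_spn[OF rcc])
 have com_N: "com u w\<in>?N" if u: "u\<in>U" and w: "w\<in>V" for u w
 proof (rule lf_subspI[OF sN])
  fix l assume l: "lf A l" and z: "\<And>x. x\<in>?N ==> l x = 0"
  have "l (com u w) = (%u w. 0) u w"
  proof (rule bil_spn_eq[OF bil_lf[OF com_bilin l] _ _ rc])
   fix a b assume "a\<in>range \<iota>" "b\<in>range \<iota>'"
   then obtain i j where "a = \<iota> i" "b = \<iota>' j" by auto
   moreover have "c (i, j)\<in>?N" using spn_superset[OF rcc] by blast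
   ultimately show "l (com a b) = 0" using z[of "c (i, j)"] by (simp add: c_eq)
  qed (use u w t(4) t'(4) in \<open>auto simp: bil_def\<close>)
  then show "l (com u w) = 0" by simp
 qed (use u w Uc Vc in auto)
 \<comment> \<open>this is the identity \<open>[x, y]\<inverse> = [x\<inverse>, x y x\<inverse>]\<close>\<close>
 have "S (c m)\<in>?N" for m
 proof -
  define u where "u = ?Sx"
  define w where "w = ?cv x (?cv y ?Sx)"
  have pu: "W.PP.point u" and pw: "W.PP.point w" unfolding u_def w_def by (auto intro!: W.PP.point_conv)
  have uU: "u p\<in>U" for p using xU U by (auto simp: u_def nhs_def)
  have wV: "w p\<in>V" for p
   unfolding w_def by (rule W.PP.ad_points_in[OF px _ gscD(2)[OF gV(1)]]) (use V yV W.PP.point_hom[OF py] in \<open>auto simp: nhs_def\<close>)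
  have Su: "(%p. S (u p)) = x" unfolding u_def by simp
  have Sw: "(%p. S (w p)) = ?cv (?cv x ?Sy) ?Sx"
   unfolding w_def by (subst W.PP.S_conv, simp, rule W.PP.point_conv, simp, simp, subst W.PP.S_conv) simp_all
  have "?cv (?cv u w) (?cv (%p. S (u p)) (%p. S (w p))) = ?cv (?cv y x) (?cv ?Sy ?Sx)"
   unfolding Su Sw unfolding u_def w_def
   by (simp add: W.PP.cv_assoc W.PP.S_left_cancel W.PP.S_right_cancel)
  also have "... = (%p. S (c p))"
   unfolding c_def by (subst W.PP.S_conv, (rule W.PP.point_conv; simp)+, subst (1 2) W.PP.S_conv) simp_all
  finally have "S (c m) = ?cv (?cv u w) (?cv (%p. S (u p)) (%p. S (w p))) m" by metis
  then show ?thesis using W.PP.com_points_in[OF pu uU pw wV sN com_N] by simp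
 qed
 moreover have "ad a (c m)\<in>?N" if a: "a\<in>cA" for a m
 proof -
  obtain dgA :: "'a => 'g" and dA eA \<iota>A where tA: "points \<phi> A dgA dA eA" "points.point A dgA dA eA \<iota>A" "cA\<subseteq>spn A (range \<iota>A)"
   using test_coalgebra[OF gsc_carrier] by auto
  interpret PA: points \<phi> A dgA dA eA by (rule tA(1))
  interpret Z: points2 \<phi> A dgA dA eA W.pg W.pd W.pe
   unfolding points2_def tcoalg2_def using cchopf_axioms PA.tcoalg_axioms W.prod by simp
  let ?cz = "conv A Z.pd"
  have rA: "range \<iota>A\<subseteq>cA" using tA(2) by auto
  have iA [simp]: "\<iota>A i\<in>cA" for i using PA.point_vals[OF tA(2)] .
  have cc [simp]: "c n\<in>cA" for n using W.PP.point_vals[OF pc] .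
  define aa where "aa = Z.e1 \<iota>A"
  define xx where "xx = Z.e2 x"
  define yy where "yy = Z.e2 y"
  have pa: "Z.PP.point aa" and pxx: "Z.PP.point xx" and pyy: "Z.PP.point yy"
   using Z.point_e1[OF tA(2)] Z.point_e2[OF px] Z.point_e2[OF py] by (simp_all add: aa_def xx_def yy_def)
  note [simp] = pa pxx pyy Z.PP.point_S[OF pa] Z.PP.point_S[OF pxx] Z.PP.point_S[OF pyy]
  have vz [simp]: "aa p\<in>cA" "xx p\<in>cA" "yy p\<in>cA" for p by auto
  let ?Sa = "%p. S (aa p)" and ?Sxx = "%p. S (xx p)" and ?Syy = "%p. S (yy p)"
  have xxU: "xx p\<in>U" and yyV: "yy p\<in>V" for p
   unfolding xx_def yy_def Z.e2_def
   using subspD(4)[OF gscD(2)[OF gU(1)] xU] subspD(4)[OF gscD(2)[OF gV(1)] yV] by auto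
  define u where "u = ?cz aa (?cz xx ?Sa)"
  define w where "w = ?cz aa (?cz yy ?Sa)"
  define h where "h = ?cz (?cz xx yy) (?cz ?Sxx ?Syy)"
  have pu: "Z.PP.point u" and pw: "Z.PP.point w" and ph: "Z.PP.point h"
   unfolding u_def w_def h_def by (auto intro!: Z.PP.point_conv)
  have uU: "u p\<in>U" for p
   unfolding u_def by (rule Z.PP.ad_points_in[OF pa _ gscD(2)[OF gU(1)]]) (use U xxU Z.PP.point_hom[OF pxx] in \<open>auto simp: nhs_def\<close>)
  have wV: "w p\<in>V" for p
   unfolding w_def by (rule Z.PP.ad_points_in[OF pa _ gscD(2)[OF gV(1)]]) (use V yyV Z.PP.point_hom[OF pyy] in \<open>auto simp: nhs_def\<close>)
  have Su: "(%p. S (u p)) = ?cz (?cz aa ?Sxx) ?Sa"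
   unfolding u_def by (subst Z.PP.S_conv, simp, rule Z.PP.point_conv, simp, simp, subst Z.PP.S_conv) simp_all
  have Sw: "(%p. S (w p)) = ?cz (?cz aa ?Syy) ?Sa"
   unfolding w_def by (subst Z.PP.S_conv, simp, rule Z.PP.point_conv, simp, simp, subst Z.PP.S_conv) simp_all
  have eq: "?cz (?cz u w) (?cz (%p. S (u p)) (%p. S (w p))) = ?cz aa (?cz h ?Sa)"
   unfolding Su Sw unfolding u_def w_def h_def
   by (simp add: Z.PP.cv_assoc Z.PP.S_left_cancel Z.PP.S_right_cancel)
  have he: "h (i, n) = Z.e2 c (i, n)" for i n
  proof (rule lf_eqI)
   fix l assume l: "lf A l"
   have "l (h (i, n)) = pair2 (Z.pd (i, n)) (%p q. l (com (xx p) (yy q)))"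
    unfolding h_def by (rule Z.PP.com_points[OF l pxx pyy, symmetric])
   also have "... = eA i * pair2 (W.pd n) (%p q. l (com (x p) (y q)))"
    unfolding xx_def yy_def by (rule Z.eval22[OF bil_lf[OF com_bilin l]]) auto
   also have "... = eA i * l (c n)" unfolding c_def by (simp add: W.PP.com_points[OF l px py])
   finally show "l (h (i, n)) = l (Z.e2 c (i, n))" using pc by (simp add: Z.e2_def lfD(2)[OF l])
  qed (use ph pc in \<open>auto simp: Z.e2_def\<close>)
  have hc: "h = Z.e2 c" using he by auto
  have base: "ad (\<iota>A i) (c m)\<in>?N" for i
  proof -
   have "?cz aa (?cz h ?Sa) (i, m)\<in>?N"
    unfolding eq[symmetric] by (rule Z.PP.com_points_in[OF pu uU pw wV sN com_N])
   moreover have "?cz aa (?cz h ?Sa) (i, m) = ad (\<iota>A i) (c m)"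
   proof (rule lf_eqI)
    fix l assume l: "lf A l"
    have "l (?cz aa (?cz h ?Sa) (i, m)) = pair2 (Z.pd (i, m)) (%p q. l (ad (aa p) (h q)))"
     using Z.PP.point_hom[OF ph] by (intro Z.PP.ad_points[OF l pa, symmetric]) auto
    also have "... = l (ad (\<iota>A i) (c m))"
     unfolding aa_def hc by (rule Z.eval12[OF bil_lf[OF ad_bilin l]]) (use rA pc in auto)
    finally show "l (?cz aa (?cz h ?Sa) (i, m)) = l (ad (\<iota>A i) (c m))" .
   qed (use rA pc ph in \<open>auto intro!: Z.PP.cv_closed\<close>)
   ultimately show ?thesis by simp
  qed
  show "ad a (c m)\<in>?N"
   by (rule spn_lin[OF bilinD(2)[OF ad_bilin] rA sN]) (use base pc a tA(3) in auto)
 qed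
 moreover have "u\<otimes>w\<ominus>\<phi> g h\<odot>(w\<otimes>u)\<in>I"
  if I: "subsp A I" and cw: "\<forall>m. \<forall>w\<in>cA. (c m\<ominus>W.pe m\<odot>\<one>)\<otimes>w\<in>I"
   and u: "u\<in>U\<inter>homog A g" and w: "w\<in>V\<inter>homog A h" for I g h u w
 proof (rule lf_subspI[OF I])
  fix l assume l: "lf A l" and z: "\<And>x. x\<in>I ==> l x = 0"
  have uc: "u\<in>cA" "w\<in>cA" using u w by auto
  let ?b = "color_ext \<phi> A A A (%u w. w\<otimes>u)"
  have fl: "bilin A A A (%u w. w\<otimes>u)" using mult_bilin by (auto simp: bilin_def)
  have cb: "bilin A A A ?b" by (rule AA.AB.color_ext_bilin[OF kspace_axioms fl])
  have "l (u\<otimes>w) = l (?b u w)"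
  proof (rule bil_spn_eq[OF bil_lf[OF mult_bilin l] bil_lf[OF cb l] _ rc])
   fix a b assume "a\<in>range \<iota>" "b\<in>range \<iota>'"
   then obtain i j where ij: "a = \<iota> i" "b = \<iota>' j" by auto
   have e: "?cv x y = ?cv c (?cv y x)"
    unfolding c_def by (simp add: W.PP.cv_assoc W.PP.S_left_cancel W.PP.S_right_cancel W.PP.S_left W.PP.cv_un_r)
   have "l (?cv x y (i, j)) = pair2 (W.pd (i, j)) (%p q. l (c p\<otimes>?cv y x q))"
    unfolding e using pc by (intro W.PP.lf_cv[OF l]) auto
   also have "... = pair2 (W.pd (i, j)) (%p q. W.pe p * l (?cv y x q))"
   proof (rule pair2_cong)
    fix p q
    have q: "?cv y x q\<in>cA" by simp
    have "l ((c p\<ominus>W.pe p\<odot>\<one>)\<otimes>?cv y x q) = 0" using cw q by (intro z) blast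
    moreover have "l ((c p\<ominus>W.pe p\<odot>\<one>)\<otimes>?cv y x q) = l (c p\<otimes>?cv y x q) - W.pe p * l (?cv y x q)"
     using pc q lf_minus[OF lf_mult_r[OF l q], of "c p" "W.pe p\<odot>\<one>"] by (simp add: smult_mult_left lfD(2)[OF l])
    ultimately show "l (c p\<otimes>?cv y x q) = W.pe p * l (?cv y x q)" by simp
   qed
   also have "... = l (?cv y x (i, j))" by (rule W.PP.d_counit)
   also have "?cv y x (i, j) = \<phi> (dgr i) (dgr' j)\<odot>(\<iota>' j\<otimes>\<iota> i)"
    unfolding x_def y_def by (rule W.conv21[OF vi])
   also have "... = ?b (\<iota> i) (\<iota>' j)"
    by (rule AA.AB.color_ext_homog[OF kspace_axioms fl P.point_hom[OF t(2)] P'.point_hom[OF t'(2)], symmetric])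
   also have "?cv x y (i, j) = \<iota> i\<otimes>\<iota>' j" unfolding x_def y_def by (rule W.conv12[OF vi])
   finally show "l (a\<otimes>b) = l (?b a b)" by (simp add: ij)
  qed (use u w t(4) t'(4) in auto)
  then show "l (u\<otimes>w\<ominus>\<phi> g h\<odot>(w\<otimes>u)) = 0"
   using uc AA.AB.color_ext_homog[OF kspace_axioms fl, of u g w h \<phi>] u w by (simp add: lf_minus[OF l])
 qed (use u w in \<open>auto simp: a_minus_def\<close>)
 moreover have "c m\<ominus>W.pe m\<odot>\<one>\<in>I"
  if I: "subsp A I" and ri: "\<forall>i\<in>I. \<forall>w\<in>cA. i\<otimes>w\<in>I"
   and h: "\<forall>g h. \<forall>x\<in>U\<inter>homog A g. \<forall>y\<in>V\<inter>homog A h. x\<otimes>y\<ominus>\<phi> g h\<odot>(y\<otimes>x)\<in>I" for I m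
 proof (rule lf_subspI[OF I])
  fix l assume l: "lf A l" and z: "\<And>x. x\<in>I ==> l x = 0"
  have s [simp]: "?cv ?Sx ?Sy q\<in>cA" for q by simp
  have "l (c m) = pair2 (W.pd m) (%p q. l (?cv x y p\<otimes>?cv ?Sx ?Sy q))"
   unfolding c_def by (rule W.PP.lf_cv[OF l]) auto
  also have "... = pair2 (W.pd m) (%p q. l (?cv y x p\<otimes>?cv ?Sx ?Sy q))"
  proof (rule pair2_cong)
   fix p q :: "'a\<times>'a"
   obtain i j where p: "p = (i, j)" by force
   have e: "?cv x y p = \<iota> i\<otimes>\<iota>' j" "?cv y x p = \<phi> (dgr i) (dgr' j)\<odot>(\<iota>' j\<otimes>\<iota> i)"
    unfolding p x_def y_def by (rule W.conv12[OF vi], rule W.conv21[OF vi])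
   have "?cv x y p\<ominus>?cv y x p\<in>I"
    unfolding e using h P.point_hom[OF t(2), of i] P'.point_hom[OF t'(2), of j] iU by blast
   then have "l ((?cv x y p\<ominus>?cv y x p)\<otimes>?cv ?Sx ?Sy q) = 0" using ri s by (intro z) blast
   then show "l (?cv x y p\<otimes>?cv ?Sx ?Sy q) = l (?cv y x p\<otimes>?cv ?Sx ?Sy q)"
    using lf_minus[OF lf_mult_r[OF l s[of q]], of "?cv x y p" "?cv y x p"] by simp
  qed
  also have "... = l (?cv (?cv y x) (?cv ?Sx ?Sy) m)" by (rule W.PP.lf_cv[OF l, symmetric]) auto
  also have "?cv (?cv y x) (?cv ?Sx ?Sy) = W.PP.un"
   by (simp add: W.PP.cv_assoc W.PP.S_right_cancel W.PP.S_right)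
  also have "l (W.PP.un m) = W.pe m * l \<one>" by (simp add: W.PP.un_def lfD(2)[OF l])
  finally show "l (c m\<ominus>W.pe m\<odot>\<one>) = 0" using pc by (simp add: lf_minus[OF l] lfD(2)[OF l])
 qed (use pc in \<open>auto simp: a_minus_def\<close>)
 moreover have "coms U V\<subseteq>?N" using com_N by (auto simp: coms_def)
 ultimately show ?thesis using W.PP.points_axioms pc c_com by (intro exI[of _ W.pg] exI[of _ W.pd] exI[of _ W.pe] exI[of _ c]) blast
qed

end

inductive_set words :: "('a, 'm) ring_scheme => 'a set => 'a set" for A G where
 one: "\<one>\<^bsub>A\<^esub>\<in>words A G"
| cons: "g\<in>G ==> w\<in>words A G ==> g\<otimes>\<^bsub>A\<^esub>w\<in>words A G"

lemma (in graded_space) gsub_spn: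
 assumes Y: "Y\<subseteq>hset V" shows "graded_subspace V (spn V Y)"
proof -
 have Yc: "Y\<subseteq>carrier V" using Y hset_carrier by auto
 have s: "subsp V (spn V Y)" by (rule subsp_spn[OF Yc])
 show ?thesis unfolding gsub_subsp
 proof (intro conjI ballI allI s)
  fix v g assume "v\<in>spn V Y"
  then obtain f where f: "keys f\<subseteq>Y" "v = vsum V f (%x. x)" by (auto simp: spn_def)
  have kc: "x\<in>carrier V" if "x\<in>keys f" for x using f(1) Yc that by auto
  have "component V v g = vsum V f (%x. component V x g)"
   unfolding f(2) by (rule lin_vsum[OF kspace_axioms kspace_axioms lin_comp_g]) (rule kc)
  also have "...\<in>spn V Y"
  proof (rule vsum_in[OF s])
   fix x assume x: "x\<in>keys f"
   then obtain h where h: "x\<in>homog V h" using f(1) Y by (auto simp: hset_def)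
   show "component V x g\<in>spn V Y"
    using x f(1) spn_superset[OF Yc] subspD(2)[OF s] by (auto simp: comp_homog[OF h])
  qed
  finally show "component V v g\<in>spn V Y" .
 qed
qed

context cchopf begin

lemma prod_rep:
 assumes x: "x\<in>cA" "y\<in>cA" and f: "f\<in>\<Delta> x" "homk f" and g: "g\<in>\<Delta> y" "homk g"
  and P: "keys f\<subseteq>P\<times>P" "keys g\<subseteq>Q\<times>Q"
 shows "\<exists>h\<in>\<Delta> (x\<otimes>y). keys h\<subseteq>{a\<otimes>b | a b. a\<in>P\<and>b\<in>Q}\<times>{a\<otimes>b | a b. a\<in>P\<and>b\<in>Q}"
proof -
 let ?R = "{a\<otimes>b | a b. a\<in>P\<and>b\<in>Q}"
 let ?s = "%p q. single (fst p\<otimes>fst q, snd p\<otimes>snd q) (\<phi> (dg A (snd p)) (dg A (fst q)))"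
 define h where "h = pbind f (%p. pbind g (?s p))"
 have k: "\<exists>p\<in>keys f. \<exists>q\<in>keys g. z = (fst p\<otimes>fst q, snd p\<otimes>snd q)" if z: "z\<in>keys h" for z
 proof -
  obtain p where p: "p\<in>keys f" "z\<in>keys (pbind g (?s p))"
   using z keys_pbind[of f "%p. pbind g (?s p)"] by (auto simp: h_def)
  obtain q where q: "q\<in>keys g" "z\<in>keys (?s p q)" using p(2) keys_pbind[of g "?s p"] by auto
  show ?thesis using p q by (auto simp: keys_single split: if_splits)
 qed
 have ok: "AA.AB.ok h"
 proof
  fix z assume "z\<in>keys h"
  then obtain p q where pq: "p\<in>keys f" "q\<in>keys g" "z = (fst p\<otimes>fst q, snd p\<otimes>snd q)" using k by blast
  then have "fst p\<in>cA" "snd p\<in>cA" "fst q\<in>cA" "snd q\<in>cA"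
   using f(2) g(2) hset_carrier by auto
  then show "z\<in>cA\<times>cA" using pq(3) by simp
 qed
 have "AA.AB.cl h = \<Delta> (x\<otimes>y)"
 proof (rule AA.AB.tform_eqI)
  fix b assume b: "bil A A b"
  have "tform b (AA.AB.cl h) = pair2 h b" by (rule AA.AB.tform_cl[OF b ok])
  also have "... = sw (x\<otimes>y) b"
   by (simp add: sw_mult[OF b x f g] h_def pair2_def pair_pbind)
  finally show "tform b (AA.AB.cl h) = tform b (\<Delta> (x\<otimes>y))" by (simp add: sw_def)
 qed (use ok x in \<open>auto simp: AA.AB.cl_in\<close>)
 then have "h\<in>\<Delta> (x\<otimes>y)" using AA.AB.cl_self by blast
 moreover have "keys h\<subseteq>?R\<times>?R"
 proof
  fix z assume "z\<in>keys h"
  then obtain p q where pq: "p\<in>keys f" "q\<in>keys g" "z = (fst p\<otimes>fst q, snd p\<otimes>snd q)" using k by blast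
  then have "fst p\<in>P" "snd p\<in>P" "fst q\<in>Q" "snd q\<in>Q" using P by auto
  then show "z\<in>?R\<times>?R" using pq(3) by blast
 qed
 ultimately show ?thesis by blast
qed

lemma ad_one: "a\<in>cA ==> ad a \<one> = \<epsilon> a\<odot>\<one>"
proof (rule lf_eqI)
 fix l assume a: "a\<in>cA" and l: "lf A l"
 have t0: "tw 0 v = v" if "v\<in>cA" for v
 proof (rule lf_eqI)
  fix l assume l: "lf A l"
  show "l (tw 0 v) = l v"
   by (rule lf_hset_eq[OF lf_lin[OF l gr_lin[OF gr_tw]] l _ that]) (auto simp: hset_def tw_homog)
 qed (use that in auto)
 have "l (ad a \<one>) = sw a (%u v. l (u\<otimes>S v))"
  by (subst lf_ad_homog[OF l a homog_one], intro sw_cong[OF a]) (simp add: t0)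
 then show "l (ad a \<one>) = l (\<epsilon> a\<odot>\<one>)" using antipode_r[OF a l] by (simp add: lfD(2)[OF l])
qed auto

text \<open>
  Products of values of a point are values of products of points, so everything that is known for the
  generators passes to words; the antipode reverses words and the adjoint action distributes over them.
\<close>

lemma words_nhs:
 assumes G: "G\<subseteq>hset A" and rep: "\<And>g. g\<in>G ==> \<exists>f\<in>\<Delta> g. keys f\<subseteq>G\<times>G"
  and SG: "\<And>g. g\<in>G ==> S g\<in>spn A G" and adG: "\<And>a g. a\<in>cA ==> g\<in>G ==> ad a g\<in>spn A G"
 shows "nhs (spn A (words A G))" "G\<subseteq>words A G"
proof -
 let ?W = "words A G" and ?C = "spn A (words A G)"
 have Gc: "g\<in>cA" if "g\<in>G" for g using G that hset_carrier by auto
 have Wh: "w\<in>hset A" if "w\<in>?W" for w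
  using that
 proof induction
  case one
  then show ?case using homog_one by (rule hsetI)
 next
  case (cons g w)
  then show ?case using G homog_mult by (fastforce simp: hset_def)
 qed
 have Wc: "?W\<subseteq>cA" using Wh hset_carrier by auto
 have s: "subsp A ?C" by (rule subsp_spn[OF Wc])
 have gC: "graded_subspace A ?C" using Wh by (intro gsub_spn) auto
 have WC: "w\<in>?C" if "w\<in>?W" for w using spn_superset[OF Wc] that by auto
 show GW: "G\<subseteq>?W"
 proof
  fix g assume g: "g\<in>G"
  have "g\<otimes>\<one>\<in>?W" using g words.one by (rule words.cons)
  then show "g\<in>?W" using Gc[OF g] by simp
 qed
 have GC: "spn A G\<subseteq>?C" using GW WC by (intro spn_least[OF s]) auto
 have WW: "v\<otimes>w\<in>?W" if v: "v\<in>?W" and w: "w\<in>?W" for v w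
  using v
 proof induction
  case one
  then show ?case using w Wc by auto
 next
  case (cons g v)
  then show ?case using words.cons[of g G "v\<otimes>w"] Gc Wc w by (simp add: m_assoc subset_iff)
 qed
 have CC: "x\<otimes>y\<in>?C" if x: "x\<in>?C" and y: "y\<in>?C" for x y
 proof (rule spn_lin[OF bilinD(2)[OF mult_bilin] Wc s _ x])
  show yc: "y\<in>cA" by (rule subspD(1)[OF s y])
  fix v assume v: "v\<in>?W"
  then have vc: "v\<in>cA" using Wc by auto
  show "v\<otimes>y\<in>?C"
   by (rule spn_lin[OF bilinD(1)[OF mult_bilin vc] Wc s _ y]) (use WC WW v in auto)
 qed
 have Wrep: "\<exists>f\<in>\<Delta> w. keys f\<subseteq>?W\<times>?W" if "w\<in>?W" for w
  using that
 proof induction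
  case one
  have "single (\<one>, \<one>) 1\<in>\<Delta> \<one>" unfolding comult_one tens_def by (rule AA.AB.cl_self)
  then show ?case using words.one[of A G] by (intro bexI[of _ "single (\<one>, \<one>) 1"]) (auto simp: keys_single)
 next
  case (cons g w)
  obtain f where f: "f\<in>\<Delta> g" "keys f\<subseteq>G\<times>G" using rep cons(1) by blast
  obtain f' where f': "f'\<in>\<Delta> w" "keys f'\<subseteq>?W\<times>?W" using cons(3) by blast
  have hk: "homk f" "homk f'" using f(2) f'(2) G Wh by blast+
  obtain h where h: "h\<in>\<Delta> (g\<otimes>w)" "keys h\<subseteq>{a\<otimes>b | a b. a\<in>G\<and>b\<in>?W}\<times>{a\<otimes>b | a b. a\<in>G\<and>b\<in>?W}"
   using prod_rep[OF Gc[OF cons(1)] _ f(1) hk(1) f'(1) hk(2) f(2) f'(2)] cons(2) Wc by blast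
  have "{a\<otimes>b | a b. a\<in>G\<and>b\<in>?W}\<subseteq>?W" by (auto intro: words.cons)
  then show ?case using h by blast
 qed
 have gsc: "gsc ?C"
  unfolding gsc_def
 proof (intro conjI allI impI ballI gC)
  fix j a assume j: "lf A j" and a: "a\<in>?C"
  show "Tr j a\<in>?C"
  proof (rule spn_lin[OF Tr_lin[OF j] Wc s _ a])
   fix w assume w: "w\<in>?W"
   then have wc: "w\<in>cA" using Wc by auto
   obtain f where f: "f\<in>\<Delta> w" "keys f\<subseteq>?W\<times>?W" using Wrep[OF w] by auto
   show "Tr j w\<in>?C"
   proof (rule lf_subspI[OF s])
    fix l assume l: "lf A l" and z: "\<And>x. x\<in>?C ==> l x = 0"
    have "l (Tr j w) = pair2 f (%u v. j v * l u)"
     using sw_rep[OF bil_flip[OF bil_prod[OF j l]] f(1) wc] by (simp add: lf_Tr[OF l wc])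
    also have "... = pair2 f (%u v. 0)" using f(2) z WC by (intro pair2_cong) auto
    finally show "l (Tr j w) = 0" by (simp add: pair2_def)
   qed (use wc j in auto)
  qed
  show "Tl j a\<in>?C"
  proof (rule spn_lin[OF Tl_lin[OF j] Wc s _ a])
   fix w assume w: "w\<in>?W"
   then have wc: "w\<in>cA" using Wc by auto
   obtain f where f: "f\<in>\<Delta> w" "keys f\<subseteq>?W\<times>?W" using Wrep[OF w] by auto
   show "Tl j w\<in>?C"
   proof (rule lf_subspI[OF s])
    fix l assume l: "lf A l" and z: "\<And>x. x\<in>?C ==> l x = 0"
    have "l (Tl j w) = pair2 f (%u v. j u * l v)"
     using sw_rep[OF bil_prod[OF j l] f(1) wc] by (simp add: lf_Tl[OF l wc])
    also have "... = pair2 f (%u v. 0)" using f(2) z WC by (intro pair2_cong) auto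
    finally show "l (Tl j w) = 0" by (simp add: pair2_def)
   qed (use wc j in auto)
  qed
 qed
 have SW: "S w\<in>?C" if "w\<in>?W" for w
  using that
 proof induction
  case one
  then show ?case using WC[OF words.one] by (simp add: S_one)
 next
  case (cons g w)
  have "g\<in>hset A" "w\<in>hset A" using G cons Wh by auto
  then obtain h k where hk: "g\<in>homog A h" "w\<in>homog A k" by (auto simp: hset_def)
  have "S g\<in>?C" using SG[OF cons(1)] GC by auto
  then show ?case unfolding S_mult[OF hk] using CC[OF cons(3)] subspD(4)[OF s] by blast
 qed
 have adW: "\<forall>a\<in>cA. ad a w\<in>?C" if "w\<in>?W" for w
  using that
 proof induction
  case one
  then show ?case using WC[OF words.one] subspD(4)[OF s] by (auto simp: ad_one)
 next
  case (cons g w)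
  have "g\<in>hset A" "w\<in>hset A" using G cons Wh by auto
  then obtain h k where hk: "g\<in>homog A h" "w\<in>homog A k" by (auto simp: hset_def)
  have gw: "g\<in>cA" "w\<in>cA" using hk by auto
  show ?case
  proof
   fix a assume a: "a\<in>cA"
   show "ad a (g\<otimes>w)\<in>?C"
   proof (rule lf_subspI[OF s])
    fix l assume l: "lf A l" and z: "\<And>x. x\<in>?C ==> l x = 0"
    have "l (ad a (g\<otimes>w)) = sw a (%u v. l (ad u g\<otimes>ad (tw h v) w))" by (rule ad_mult[OF l a hk])
    also have "... = sw a (%u v. 0)"
    proof (rule sw_cong[OF a])
     fix u v assume uv: "u\<in>cA" "v\<in>cA"
     have "ad u g\<in>?C" using adG[OF uv(1) cons(1)] GC by auto
     moreover have "ad (tw h v) w\<in>?C" using cons(3) uv by auto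
     ultimately show "l (ad u g\<otimes>ad (tw h v) w) = 0" by (intro z CC)
    qed
    finally show "l (ad a (g\<otimes>w)) = 0" by simp
   qed (use a gw in auto)
  qed
 qed
 show "nhs ?C"
  unfolding nhs_def
 proof (intro conjI ballI gsc WC[OF words.one] CC)
  show "S x\<in>?C" if "x\<in>?C" for x by (rule spn_lin[OF gr_lin[OF gr_S] Wc s SW that])
  show "ad a x\<in>?C" if a: "a\<in>cA" and x: "x\<in>?C" for a x
   by (rule spn_lin[OF bilinD(1)[OF ad_bilin a] Wc s _ x]) (use adW a in auto)
 qed
qed

text \<open>
  The span of the commutators is already a subcoalgebra that is stable under \<open>S\<close> and the adjoint action,
  so the words in it form a normal Hopf subalgebra.
\<close>

lemma commutator_subalgebra_nhs:
 assumes U: "nhs U" and V: "nhs V"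
 shows "nhs (commutator_subalgebra \<phi> A U V)" "coms U V\<subseteq>commutator_subalgebra \<phi> A U V"
proof -
 obtain dgr :: "'a\<times>'a => 'g" and d eps c where t: "points \<phi> A dgr d eps" "points.point A dgr d eps c"
  "range c\<subseteq>coms U V" "coms U V\<subseteq>spn A (range c)" "\<forall>m. S (c m)\<in>spn A (range c)"
  "\<forall>a\<in>cA. \<forall>m. ad a (c m)\<in>spn A (range c)"
  using com_test[OF U V] by (elim exE conjE) (rule that, assumption+)
 interpret points \<phi> A dgr d eps by (rule t(1))
 let ?C = "spn A (words A (range c))"
 have h: "range c\<subseteq>hset A" using point_hom[OF t(2)] by (auto simp: hset_def)
 have rep: "\<exists>f\<in>\<Delta> g. keys f\<subseteq>range c\<times>range c" if "g\<in>range c" for g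
  using that push_in[OF t(2)] keys_push[of c] by blast
 have sg: "S g\<in>spn A (range c)" if "g\<in>range c" for g using that t(5) by (metis imageE)
 have ag: "ad a g\<in>spn A (range c)" if "a\<in>cA" "g\<in>range c" for a g
  using that t(6) by (metis imageE)
 have n: "nhs ?C" "range c\<subseteq>words A (range c)"
  by (rule words_nhs[OF h rep sg ag]; assumption)+
 have sC: "subsp A ?C" using n(1) by (auto simp: nhs_def gscD)
 have Wc: "words A (range c)\<subseteq>cA"
 proof
  fix w assume "w\<in>words A (range c)"
  then show "w\<in>cA" by induction (use t(2) in auto)
 qed
 have cC: "coms U V\<subseteq>?C"
  using t(4) n(2) spn_superset[OF Wc] by (intro order_trans[OF t(4) spn_least[OF sC]]) auto
 have e: "commutator_subalgebra \<phi> A U V = \<Inter>{Z. graded_subalgebra A Z\<and>coms U V\<subseteq>Z}"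
  by (simp add: commutator_subalgebra_def generated_graded_subalgebra_def coms_def)
 have "commutator_subalgebra \<phi> A U V = ?C"
 proof
  have "graded_subalgebra A ?C" using n(1) by (auto simp: nhs_def graded_subalgebra_def gscD)
  then show "commutator_subalgebra \<phi> A U V\<subseteq>?C" using cC unfolding e by blast
  show "?C\<subseteq>commutator_subalgebra \<phi> A U V"
   unfolding e
  proof (rule Inter_greatest)
   fix Z assume "Z\<in>{Z. graded_subalgebra A Z\<and>coms U V\<subseteq>Z}"
   then have Z: "graded_subalgebra A Z" "coms U V\<subseteq>Z" by auto
   have "w\<in>Z" if "w\<in>words A (range c)" for w
    using that by induction (use Z t(3) in \<open>auto simp: graded_subalgebra_def\<close>)
   then show "?C\<subseteq>Z" using Z by (intro spn_least) (auto simp: graded_subalgebra_def gsub_subsp)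
  qed
 qed
 then show "nhs (commutator_subalgebra \<phi> A U V)" "coms U V\<subseteq>commutator_subalgebra \<phi> A U V"
  using n(1) cC by auto
qed

lemma commutator_subalgebra_least:
 assumes "nhs B" "coms U V\<subseteq>B" shows "commutator_subalgebra \<phi> A U V\<subseteq>B"
 using assms unfolding commutator_subalgebra_def generated_graded_subalgebra_def coms_def nhs_def graded_subalgebra_def
 by (intro Inter_lower) (auto simp: gscD)

end

section \<open>The component of a subcoalgebra\<close>

context cchopf begin

definition ann :: "'a set => ('a => 'k) set" where
 "ann B = {j. lf A j\<and>(\<forall>b\<in>B. j b = 0)}"

lemma annD: "j\<in>ann B ==> lf A j" "j\<in>ann B ==> b\<in>B ==> j b = 0" by (auto simp: ann_def)

text \<open>
  For \<open>a\<close> in a subcoalgebra only the values of a form on that subcoalgebra matter.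
\<close>

lemma sw_in:
 assumes N: "gsc N" and a: "a\<in>N" and b: "bil A A b" "bil A A c"
  and e: "\<And>u v. u\<in>N ==> v\<in>N ==> b u v = c u v"
 shows "sw a b = sw a c"
proof -
 have ac: "a\<in>cA" by (rule gscD(3)[OF N a])
 obtain f where f: "f\<in>\<Delta> a" "keys f\<subseteq>(N\<inter>hset A)\<times>(N\<inter>hset A)" using gsc_rep[OF N a] by auto
 have "pair2 f b = pair2 f c" using f(2) e by (intro pair2_cong) auto
 then show ?thesis using sw_rep[OF b(1) f(1) ac] sw_rep[OF b(2) f(1) ac] by simp
qed

lemma Tr_ann: "gsc B ==> j\<in>ann B ==> b\<in>B ==> Tr j b = \<zero>"
proof (rule lf_eqI)
 fix l assume B: "gsc B" and j: "j\<in>ann B" and b: "b\<in>B" and l: "lf A l"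
 have bc: "b\<in>cA" by (rule gscD(3)[OF B b])
 have "l (Tr j b) = j (Tl l b)" by (rule Tr_swap[OF l annD(1)[OF j] bc])
 then show "l (Tr j b) = l \<zero>" using annD(2)[OF j gscD(5)[OF B l b]] by (simp add: lf_zero[OF l])
qed (auto dest: annD gscD)

lemma lf_comp: "lf A l ==> lf A (%v. l (component A v h))"
 by (rule lf_lin[OF _ lin_comp_g])

lemma ann_comp: "graded_subspace A B ==> j\<in>ann B ==> (%v. j (component A v h))\<in>ann B"
 by (auto simp: ann_def lf_comp gsub_subsp)

text \<open>
  The component of degree \<open>g\<close> of \<open>\<Delta> a\<close> is spanned by the terms with degrees \<open>h\<close> and \<open>g - h\<close>.
\<close>

lemma sw_component:
 assumes a: "a\<in>cA"
 shows "\<exists>H. finite H\<and>(\<forall>b. bil A A b \<longrightarrow>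
   sw (component A a g) b = (\<Sum>h\<in>H. sw a (%u v. b (component A u h) (component A v (g - h)))))"
proof -
 obtain f where f: "f\<in>\<Delta> a" "homk f" using hom_rep[OF a] by auto
 define H where "H = (%p. dg A (fst p)) ` keys f"
 have "sw (component A a g) b = (\<Sum>h\<in>H. sw a (%u v. b (component A u h) (component A v (g - h))))" if b: "bil A A b" for b
 proof -
  let ?b = "%u v. \<Sum>h\<in>degrees A u. b (component A u h) (component A v (g - h))"
  have bb: "bil A A ?b"
  proof (rule bilI)
   fix u assume u: "u\<in>cA"
   show "lf A (?b u)" using u by (intro lf_sum lf_comp bilD(1)[OF b]) auto
  next
   fix v assume v: "v\<in>cA"
   show "lf A (%u. ?b u v)" using v by (intro lf_degsum bilD(2)[OF b]) auto
  qed
  have b0: "b \<zero> v = 0" "b v \<zero> = 0" if "v\<in>cA" for v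
   using lf_zero[OF bilD(2)[OF b that]] lf_zero[OF bilD(1)[OF b that]] by auto
  have "sw (component A a g) b = sw a ?b"
  proof (rule lf_hset_eq[OF lf_comp[OF lf_sw[OF b]] lf_sw[OF bb] _ a])
   fix x assume "x\<in>hset A"
   then obtain k where k: "x\<in>homog A k" by (auto simp: hset_def)
   have xc: "x\<in>cA" using k by auto
   obtain f' where f': "f'\<in>\<Delta> x" "keys f'\<subseteq>(\<Union>h. homog A h\<times>homog A (k - h))" using hom_rep_deg[OF k] by auto
   have "sw x ?b = pair2 f' ?b" by (rule sw_rep[OF bb f'(1) xc])
   also have "... = pair2 f' (%u v. (if g = k then 1 else 0) * b u v)"
   proof (rule pair2_cong)
    fix u v assume "(u, v)\<in>keys f'"
    then obtain h where h: "u\<in>homog A h" "v\<in>homog A (k - h)" using f'(2) by auto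
    have hc: "u\<in>cA" "v\<in>cA" using h by auto
    show "?b u v = (if g = k then 1 else 0) * b u v"
     using h hc by (auto simp: degrees_homog[OF h(1)] comp_homog[OF h(2)] b0)
   qed
   also have "... = (if g = k then 1 else 0) * sw x b" by (simp add: pair2_fun_cmult sw_rep[OF b f'(1) xc])
   also have "... = sw (component A x g) b" using xc lf_zero[OF lf_sw[OF b]] by (simp add: comp_homog[OF k])
   finally show "sw (component A x g) b = sw x ?b" by simp
  qed
  also have "... = pair2 f ?b" by (rule sw_rep[OF bb f(1) a])
  also have "... = pair2 f (%u v. \<Sum>h\<in>H. b (component A u h) (component A v (g - h)))"
  proof (rule pair2_cong)
   fix u v assume uv: "(u, v)\<in>keys f"
   then have u: "u\<in>homog A (dg A u)" "v\<in>cA" using f(2) dg_in hset_carrier by auto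
   have uc: "u\<in>cA" using u by auto
   have "dg A u\<in>H" using uv by (force simp: H_def)
   then have "degrees A u\<subseteq>H" using degrees_homog[OF u(1)] by auto
   moreover have "finite H" by (simp add: H_def)
   ultimately show "?b u v = (\<Sum>h\<in>H. b (component A u h) (component A v (g - h)))"
    using b0 u uc by (intro sum.mono_neutral_left) (auto simp: degrees_def)
  qed
  also have "... = (\<Sum>h\<in>H. pair2 f (%u v. b (component A u h) (component A v (g - h))))"
   by (simp add: pair2_def pair_fun_sum)
  also have "... = (\<Sum>h\<in>H. sw a (%u v. b (component A u h) (component A v (g - h))))"
   by (intro sum.cong refl sw_rep[OF _ f(1) a, symmetric] bil_comp[OF b] lin_comp_g)
  finally show ?thesis .
 qed
 then show ?thesis by (intro exI[of _ H]) (auto simp: H_def)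
qed

text \<open>
  It suffices to test with functionals concentrated in one degree, since \<open>\<Delta> a\<close> involves finitely many
  degrees.
\<close>

lemma Tr_of_comps:
 assumes a: "a\<in>cA" and j: "lf A j" and N: "subsp A N"
  and h: "\<And>h. Tr (%v. j (component A v h)) a\<in>N"
 shows "Tr j a\<in>N"
proof (rule lf_subspI[OF N])
 fix l assume l: "lf A l" and z: "\<And>x. x\<in>N ==> l x = 0"
 obtain f where f: "f\<in>\<Delta> a" "homk f" using hom_rep[OF a] by auto
 define H where "H = (%p. dg A (snd p)) ` keys f"
 have fin: "finite H" by (simp add: H_def)
 have "l (Tr j a) = pair2 f (%u v. j v * l u)"
  using sw_rep[OF bil_flip[OF bil_prod[OF j l]] f(1) a] by (simp add: lf_Tr[OF l a])
 also have "... = pair2 f (%u v. \<Sum>h\<in>H. j (component A v h) * l u)"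
 proof (rule pair2_cong)
  fix u v assume uv: "(u, v)\<in>keys f"
  then have v: "v\<in>homog A (dg A v)" "dg A v\<in>H" using f(2) dg_in by (force simp: H_def)+
  have "(\<Sum>h\<in>H. j (component A v h) * l u) = (\<Sum>h\<in>H. if h = dg A v then j v * l u else 0)"
   by (intro sum.cong refl) (simp add: comp_homog[OF v(1)] lf_zero[OF j])
  then show "j v * l u = (\<Sum>h\<in>H. j (component A v h) * l u)" using v(2) fin by simp
 qed
 also have "... = (\<Sum>h\<in>H. pair2 f (%u v. j (component A v h) * l u))"
  by (simp add: pair2_def pair_fun_sum)
 also have "... = (\<Sum>h\<in>H. l (Tr (%v. j (component A v h)) a))"
  using sw_rep[OF bil_flip[OF bil_prod[OF lf_comp[OF j] l]] f(1) a] by (simp add: lf_Tr[OF l a])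
 also have "... = 0" using z h by simp
 finally show "l (Tr j a) = 0" .
qed (use a j in auto)

text \<open>
  By cocommutativity the right action is the left action up to color factors, and these preserve
  graded subspaces.
\<close>

lemma Tr_of_Tl:
 assumes a: "a\<in>cA" and j: "lf A j" and N: "graded_subspace A N"
  and h: "\<And>s. lf A s ==> Tl s a\<in>N"
 shows "Tr j a\<in>N"
proof -
 have s: "subsp A N" using N by (simp add: gsub_subsp)
 show ?thesis
 proof (rule lf_subspI[OF s])
  fix l assume l: "lf A l" and z: "\<And>x. x\<in>N ==> l x = 0"
  obtain f where f: "f\<in>\<Delta> a" "homk f" using hom_rep[OF a] by auto
  define H where "H = (%p. dg A (fst p)) ` keys f"
  have fin: "finite H" by (simp add: H_def)
  let ?t = "%h. tws (%k. \<phi> h k)"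
  have lt: "lf A (%v. l (?t h v))" for h by (rule lf_lin[OF l gr_lin[OF gr_tws]])
  have "l (Tr j a) = pair2 f (%u v. \<phi> (dg A u) (dg A v) * (j u * l v))"
   using sw_cocomm[OF bil_flip[OF bil_prod[OF j l]] a f] by (simp add: lf_Tr[OF l a])
  also have "... = pair2 f (%u v. \<Sum>h\<in>H. j (component A u h) * l (?t h v))"
  proof (rule pair2_cong)
   fix u v assume uv: "(u, v)\<in>keys f"
   then have u: "u\<in>homog A (dg A u)" "dg A u\<in>H" "v\<in>homog A (dg A v)" using f(2) dg_in by (force simp: H_def)+
   have vc: "v\<in>cA" using u by auto
   have "(\<Sum>h\<in>H. j (component A u h) * l (?t h v)) = (\<Sum>h\<in>H. if h = dg A u then j u * l (?t (dg A u) v) else 0)"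
    by (intro sum.cong refl) (simp add: comp_homog[OF u(1)] lf_zero[OF j])
   then show "\<phi> (dg A u) (dg A v) * (j u * l v) = (\<Sum>h\<in>H. j (component A u h) * l (?t h v))"
    using u(2) fin vc by (simp add: tws_homog[OF u(3)] lfD(2)[OF l])
  qed
  also have "... = (\<Sum>h\<in>H. pair2 f (%u v. j (component A u h) * l (?t h v)))"
   by (simp add: pair2_def pair_fun_sum)
  also have "... = (\<Sum>h\<in>H. l (?t h (Tl (%v. j (component A v h)) a)))"
   using sw_rep[OF bil_prod[OF lf_comp[OF j] lt] f(1) a] by (simp add: lf_Tl[OF lt a])
  also have "... = 0" using z h tws_in[OF N] lf_comp[OF j] by simp
  finally show "l (Tr j a) = 0" .
 qed (use a j in auto)
qed

lemma lin_diff: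
 assumes f: "lin A A f" and g: "lin A A g"
 shows "lin A A (%v. f v\<ominus>g v)"
proof (rule linI)
 show c: "f v\<ominus>g v\<in>cA" if "v\<in>cA" for v
  using linD(1)[OF f that] linD(1)[OF g that] by simp
 fix v assume v: "v\<in>cA"
 note fv = linD(1)[OF f v] linD(1)[OF g v]
 show "f (v\<oplus>w)\<ominus>g (v\<oplus>w) = (f v\<ominus>g v)\<oplus>(f w\<ominus>g w)" if w: "w\<in>cA" for w
 proof (rule lf_eqI)
  note fw = linD(1)[OF f w] linD(1)[OF g w]
  fix l assume l: "lf A l"
  show "l (f (v\<oplus>w)\<ominus>g (v\<oplus>w)) = l ((f v\<ominus>g v)\<oplus>(f w\<ominus>g w))"
   unfolding linD(2)[OF f v w] linD(2)[OF g v w] using fv fw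
   by (simp add: lf_minus[OF l] lfD(1)[OF l])
 qed (use v w c in auto)
 show "f (k\<odot>v)\<ominus>g (k\<odot>v) = k\<odot>(f v\<ominus>g v)" for k
 proof (rule lf_eqI)
  fix l assume l: "lf A l"
  show "l (f (k\<odot>v)\<ominus>g (k\<odot>v)) = l (k\<odot>(f v\<ominus>g v))"
   unfolding linD(3)[OF f v] linD(3)[OF g v] using fv
   by (simp add: lf_minus[OF l] lfD(2)[OF l] right_diff_distrib)
 qed (use v c in auto)
qed

text \<open>
  The wedge powers of \<open>B\<close>: \<open>a\<close> belongs to \<open>Bn B (Suc n)\<close> iff \<open>\<Delta> a\<close> is in
  \<open>Bn B n \<otimes> A + A \<otimes> B\<close>, which is tested by the functionals that vanish on \<open>B\<close>.
\<close>

primrec Bn :: "'a set => nat => 'a set" where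
 "Bn B 0 = B"
| "Bn B (Suc n) = {a\<in>cA. \<forall>j\<in>ann B. Tr j a\<in>Bn B n}"

lemma Bn_gsc: assumes B: "gsc B" shows "gsc (Bn B n)"
proof (induction n)
 case (Suc n)
 let ?M = "Bn B (Suc n)"
 note N = gscD(2)[OF Suc]
 have s: "subsp A ?M"
  unfolding subsp_def
 proof (intro conjI ballI allI)
  show "\<zero>\<in>?M"
  proof -
   have "Tr j \<zero>\<in>Bn B n" if "j\<in>ann B" for j
    using linD(3)[OF Tr_lin[OF annD(1)[OF that]] zero_closed, of 0] subspD(2)[OF N] annD(1)[OF that] by simp
   then show ?thesis by simp
  qed
 qed (use linD[OF Tr_lin[OF annD(1)]] subspD[OF N] in auto)
 have "component A a g\<in>?M" if a: "a\<in>?M" for a g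
 proof -
  have ac: "a\<in>cA" using a by simp
  obtain H where H: "finite H" "\<And>b. bil A A b ==> sw (component A a g) b = (\<Sum>h\<in>H. sw a (%u v. b (component A u h) (component A v (g - h))))"
   using sw_component[OF ac] by blast
  have "Tr i (component A a g)\<in>Bn B n" if i: "i\<in>ann B" for i
  proof (rule lf_subspI[OF N])
   note li = annD(1)[OF i]
   fix l assume l: "lf A l" and z: "\<And>x. x\<in>Bn B n ==> l x = 0"
   have "l (Tr i (component A a g)) = (\<Sum>h\<in>H. sw a (%u v. i (component A v (g - h)) * l (component A u h)))"
    using H(2)[OF bil_flip[OF bil_prod[OF li l]]] ac by (simp add: lf_Tr[OF l])
   also have "... = (\<Sum>h\<in>H. l (component A (Tr (%v. i (component A v (g - h))) a) h))"
    by (simp add: lf_Tr[OF lf_comp[OF l] ac])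
   also have "... = 0"
   proof (intro sum.neutral ballI z)
    fix h
    have "Tr (%v. i (component A v (g - h))) a\<in>Bn B n"
     using a ann_comp[OF gscD(1)[OF B] i] by simp
    then show "component A (Tr (%v. i (component A v (g - h))) a) h\<in>Bn B n"
     using gscD(1)[OF Suc] by (simp add: gsub_subsp)
   qed
   finally show "l (Tr i (component A a g)) = 0" .
  qed (use ac annD(1)[OF i] in auto)
  then show ?thesis using ac by simp
 qed
 then have g: "graded_subspace A ?M" using s by (simp add: gsub_subsp)
 show ?case
  unfolding gsc_def
 proof (intro conjI allI impI ballI g)
  fix j a assume j: "lf A j" and a: "a\<in>?M"
  have ac: "a\<in>cA" using a by simp
  have "(%v. i (Tr j v))\<in>ann B" if "i\<in>ann B" for i
   using that gscD(4)[OF B j] lf_Tr_comp[OF annD(1)[OF that] j] by (auto simp: ann_def)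
  then show "Tr j a\<in>?M" using a ac j by (auto simp: Tr_Tr annD(1))
  show "Tl j a\<in>?M" using a ac j gscD(5)[OF Suc j] by (auto simp: Tr_Tl annD(1))
 qed
qed (use B in simp)

lemma Bn_mono: "gsc B ==> Bn B n\<subseteq>Bn B (Suc n)"
proof (induction n)
 case 0
 then show ?case using Tr_ann[OF 0] gscD(2,3)[OF 0] subspD(2)[OF gscD(2)[OF 0]] by auto
qed auto

lemma Bn_mono': "gsc B ==> m \<le> n ==> Bn B m\<subseteq>Bn B n"
 using Bn_mono lift_Suc_mono_le[of "Bn B"] by blast

text \<open>
  \<open>B1 B\<close> is the component of \<open>B\<close>; \<open>B2 B\<close> collects the subcoalgebras that are disjoint from \<open>B\<close> and is
  shown to be a complement.
\<close>

definition B1 :: "'a set => 'a set" where "B1 B = (\<Union>n. Bn B n)"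
definition B2 :: "'a set => 'a set" where "B2 B = {a. \<exists>N. gsc N\<and>N\<inter>B\<subseteq>{\<zero>}\<and>a\<in>N}"

lemma B_B1: "B\<subseteq>B1 B" unfolding B1_def by (metis Bn.simps(1) UNIV_I UN_upper)

lemma gsc_directed:
 assumes ne: "\<zero>\<in>N" and el: "\<And>a. a\<in>N ==> \<exists>M. gsc M\<and>M\<subseteq>N\<and>a\<in>M"
  and d: "\<And>a b. a\<in>N ==> b\<in>N ==> a\<oplus>b\<in>N"
 shows "gsc N"
 unfolding gsc_def gsub_subsp subsp_def
proof (intro conjI allI impI ballI ne d)
 show "N\<subseteq>cA" using el gscD(3) by blast
 fix x assume x: "x\<in>N"
 then obtain M where M: "gsc M" "M\<subseteq>N" "x\<in>M" using el by blast
 show "c\<odot>x\<in>N" for c using subspD(4)[OF gscD(2)[OF M(1)] M(3)] M(2) by auto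
 show "component A x g\<in>N" for g using gscD(1)[OF M(1)] M(2,3) by (auto simp: gsub_subsp)
 show "Tr j x\<in>N" if "lf A j" for j using gscD(4)[OF M(1) that M(3)] M(2) by auto
 show "Tl j x\<in>N" if "lf A j" for j using gscD(5)[OF M(1) that M(3)] M(2) by auto
qed

lemma B1_gsc: assumes B: "gsc B" shows "gsc (B1 B)"
proof (rule gsc_directed)
 show "\<zero>\<in>B1 B" using B_B1 subspD(2)[OF gscD(2)[OF B]] by auto
 show "\<exists>M. gsc M\<and>M\<subseteq>B1 B\<and>a\<in>M" if "a\<in>B1 B" for a
  using that Bn_gsc[OF B] by (auto simp: B1_def)
 fix a b assume "a\<in>B1 B" "b\<in>B1 B"
 then obtain m n where "a\<in>Bn B m" "b\<in>Bn B n" by (auto simp: B1_def)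
 then have "a\<in>Bn B (max m n)" "b\<in>Bn B (max m n)" using Bn_mono'[OF B, of m "max m n"] Bn_mono'[OF B, of n "max m n"] by auto
 then have "a\<oplus>b\<in>Bn B (max m n)" by (rule subspD(3)[OF gscD(2)[OF Bn_gsc[OF B]]])
 then show "a\<oplus>b\<in>B1 B" by (auto simp: B1_def)
qed

text \<open>
  Compose the counit with a projection onto \<open>N\<close> that kills \<open>B\<close>. The resulting functional acts as the
  identity on \<open>N\<close>, but moves \<open>Bn B (Suc n)\<close> into \<open>Bn B n\<close>.
\<close>

lemma disjoint_Bn:
 assumes B: "gsc B" and N: "gsc N" and d: "N\<inter>B\<subseteq>{\<zero>}"
 shows "N\<inter>Bn B n\<subseteq>{\<zero>}"
proof (induction n)
 case (Suc n)
 obtain p where p: "gr p" "\<And>v. v\<in>N ==> p v = v" "\<And>v. v\<in>B ==> p v = \<zero>"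
  using retraction[OF gscD(1)[OF N] gscD(1)[OF B] d] by blast
 let ?i = "%v. \<epsilon> (p v)"
 have li: "lf A ?i" by (rule lf_lin[OF lf_counit gr_lin[OF p(1)]])
 have i: "?i\<in>ann B" using li p(3) by (auto simp: ann_def lf_zero[OF lf_counit])
 show ?case
 proof
  fix x assume x: "x\<in>N\<inter>Bn B (Suc n)"
  have xc: "x\<in>cA" using x by simp
  have "Tr ?i x\<in>N\<inter>Bn B n" using x i gscD(4)[OF N li] by auto
  then have "Tr ?i x = \<zero>" using Suc by auto
  moreover have "Tr ?i x = x"
  proof (rule lf_eqI)
   fix l assume l: "lf A l"
   have "l (Tr ?i x) = sw x (%u v. \<epsilon> v * l u)"
    unfolding lf_Tr[OF l xc] using x p(2)
    by (intro sw_in[OF N]) (auto intro: bil_flip[OF bil_prod[OF li l]] bil_flip[OF bil_prod[OF lf_counit l]])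
   then show "l (Tr ?i x) = l x" using counit_r[OF xc l] by simp
  qed (use xc li in auto)
  ultimately show "x\<in>{\<zero>}" by simp
 qed
qed (use d in simp)

lemma gsc_sum:
 assumes N: "gsc N" and M: "gsc M"
 shows "gsc {x\<oplus>y | x y. x\<in>N\<and>y\<in>M}"
proof -
 let ?S = "{x\<oplus>y | x y. x\<in>N\<and>y\<in>M}"
 note sN = gscD(2)[OF N] and sM = gscD(2)[OF M]
 note Nc = subspD(1)[OF sN] and Mc = subspD(1)[OF sM]
 show "gsc ?S"
  unfolding gsc_def gsub_subsp subsp_def
 proof (intro conjI allI impI ballI)
  show "?S\<subseteq>cA" using Nc Mc by auto
  have "\<zero> = \<zero>\<oplus>\<zero>" by simp
  then show "\<zero>\<in>?S" using subspD(2)[OF sN] subspD(2)[OF sM] by blast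
  fix a assume "a\<in>?S"
  then obtain x y where a: "a = x\<oplus>y" "x\<in>N" "y\<in>M" by auto
  note c = Nc[OF a(2)] Mc[OF a(3)]
  have "c\<odot>a = c\<odot>x\<oplus>c\<odot>y" for c using a(1) c by (simp add: smult_r_distr)
  then show "c\<odot>a\<in>?S" for c using subspD(4)[OF sN a(2)] subspD(4)[OF sM a(3)] by blast
  have "component A a g = component A x g\<oplus>component A y g" for g using a(1) c by (simp add: comp_add)
  moreover have "component A x g\<in>N" "component A y g\<in>M" for g
   using a(2,3) gscD(1)[OF N] gscD(1)[OF M] by (auto simp: gsub_subsp)
  ultimately show "component A a g\<in>?S" for g by blast
  show "Tr j a\<in>?S" if "lf A j" for j
   using linD(2)[OF Tr_lin[OF that] c] gscD(4)[OF N that a(2)] gscD(4)[OF M that a(3)] a(1) by blast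
  show "Tl j a\<in>?S" if "lf A j" for j
   using linD(2)[OF Tl_lin[OF that] c] gscD(5)[OF N that a(2)] gscD(5)[OF M that a(3)] a(1) by blast
  fix b assume "b\<in>?S"
  then obtain x' y' where b: "b = x'\<oplus>y'" "x'\<in>N" "y'\<in>M" by auto
  have "a\<oplus>b = (x\<oplus>x')\<oplus>(y\<oplus>y')"
   using a b c Nc[OF b(2)] Mc[OF b(3)] by (simp add: a_ac)
  then show "a\<oplus>b\<in>?S" using subspD(3)[OF sN a(2) b(2)] subspD(3)[OF sM a(3) b(3)] by blast
 qed
qed

text \<open>
  On \<open>Z = (N + M) \<inter> B\<close>, cut the two legs of \<open>\<Delta> z\<close> down by projections that are the identity on \<open>Z\<close> and
  kill \<open>N\<close>, respectively \<open>M\<close>. On \<open>Z\<close> nothing changes, while on \<open>N\<close> and on \<open>M\<close> the result is zero.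
\<close>

lemma disjoint_sum:
 assumes B: "gsc B" and N: "gsc N" "N\<inter>B\<subseteq>{\<zero>}" and M: "gsc M" "M\<inter>B\<subseteq>{\<zero>}"
 shows "{x\<oplus>y | x y. x\<in>N\<and>y\<in>M}\<inter>B\<subseteq>{\<zero>}"
proof -
 let ?S = "{x\<oplus>y | x y. x\<in>N\<and>y\<in>M}"
 note Nc = subspD(1)[OF gscD(2)[OF N(1)]] and Mc = subspD(1)[OF gscD(2)[OF M(1)]]
 note gS = gsc_sum[OF N(1) M(1)]
 let ?Z = "?S\<inter>B"
 have gZ: "gsc ?Z" using gS B unfolding gsc_def gsub_subsp by (auto intro: subsp_Int)
 obtain p where p: "gr p" "\<And>v. v\<in>?Z ==> p v = v" "\<And>v. v\<in>N ==> p v = \<zero>"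
 proof -
  have d: "?Z\<inter>N\<subseteq>{\<zero>}" using N(2) by auto
  show ?thesis using that retraction[OF gscD(1)[OF gZ] gscD(1)[OF N(1)] d] by blast
 qed
 obtain q where q: "gr q" "\<And>v. v\<in>?Z ==> q v = v" "\<And>v. v\<in>M ==> q v = \<zero>"
 proof -
  have d: "?Z\<inter>M\<subseteq>{\<zero>}" using M(2) by auto
  show ?thesis using that retraction[OF gscD(1)[OF gZ] gscD(1)[OF M(1)] d] by blast
 qed
 show "?Z\<subseteq>{\<zero>}"
 proof
  fix z assume z: "z\<in>?Z"
  then obtain x y where a: "z = x\<oplus>y" "x\<in>N" "y\<in>M" by auto
  note c = Nc[OF a(2)] Mc[OF a(3)]
  have zc: "z\<in>cA" using a c by simp
  have "z = \<zero>"
  proof (rule lf_eqI)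
   fix l assume l: "lf A l"
   have lp: "lf A (%u. l (p u))" and lq: "lf A (%v. \<epsilon> (q v))"
    using lf_lin[OF l gr_lin[OF p(1)]] lf_lin[OF lf_counit gr_lin[OF q(1)]] by auto
   have b0: "bil A A (%u v. 0 :: 'k)" by (simp add: bil_def)
   have bb: "bil A A (%u v. \<epsilon> (q v) * l (p u))" by (rule bil_flip[OF bil_prod[OF lq lp]])
   have "l z = sw z (%u v. \<epsilon> v * l u)" by (rule counit_r[OF zc l, symmetric])
   also have "... = sw z (%u v. \<epsilon> (q v) * l (p u))"
    using z p(2) q(2) by (intro sw_in[OF gZ] bb bil_flip[OF bil_prod[OF lf_counit l]]) auto
   also have "... = sw x (%u v. \<epsilon> (q v) * l (p u)) + sw y (%u v. \<epsilon> (q v) * l (p u))"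
    unfolding a(1) by (rule lfD(1)[OF lf_sw[OF bb] c])
   also have "sw x (%u v. \<epsilon> (q v) * l (p u)) = sw x (%u v. 0)"
    using a p(3) by (intro sw_in[OF N(1)] bb b0) (auto simp: lf_zero[OF l])
   also have "sw y (%u v. \<epsilon> (q v) * l (p u)) = sw y (%u v. 0)"
    using a q(3) by (intro sw_in[OF M(1)] bb b0) (auto simp: lf_zero[OF lf_counit])
   finally show "l z = l \<zero>" by (simp add: lf_zero[OF l])
  qed (use zc in auto)
  then show "z\<in>{\<zero>}" by simp
 qed
qed

lemma B2_gsc: assumes B: "gsc B" shows "gsc (B2 B)"
proof (rule gsc_directed)
 have "gsc {\<zero>}"
  unfolding gsc_def gsub_subsp using linD(3)[OF Tr_lin zero_closed, of _ 0] linD(3)[OF Tl_lin zero_closed, of _ 0]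
  by (auto simp: subsp_zero comp_homog[OF zero_homog])
 then show "\<zero>\<in>B2 B" by (auto simp: B2_def)
 show "\<exists>M. gsc M\<and>M\<subseteq>B2 B\<and>a\<in>M" if "a\<in>B2 B" for a
  using that by (auto simp: B2_def)
 fix a b assume "a\<in>B2 B" "b\<in>B2 B"
 then obtain N M where N: "gsc N" "N\<inter>B\<subseteq>{\<zero>}" "a\<in>N" and M: "gsc M" "M\<inter>B\<subseteq>{\<zero>}" "b\<in>M"
  by (auto simp: B2_def)
 then show "a\<oplus>b\<in>B2 B" using disjoint_sum[OF B N(1,2) M(1,2)] gsc_sum[OF N(1) M(1)] unfolding B2_def by blast
qed

lemma B1_B2: "gsc B ==> B1 B\<inter>B2 B\<subseteq>{\<zero>}"
 using disjoint_Bn by (fastforce simp: B1_def B2_def)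

text \<open>
  For a functional of degree zero the color factor in cocommutativity is trivial.
\<close>

lemma Tl_deg0:
 assumes j: "lf A j" "\<And>h v. v\<in>homog A h ==> h \<noteq> 0 ==> j v = 0" and a: "a\<in>cA"
 shows "Tl j a = Tr j a"
proof (rule lf_eqI)
 fix l assume l: "lf A l"
 obtain f where f: "f\<in>\<Delta> a" "homk f" using hom_rep[OF a] by auto
 have "l (Tl j a) = pair2 f (%u v. \<phi> (dg A u) (dg A v) * (j v * l u))"
  using sw_cocomm[OF bil_prod[OF j(1) l] a f] by (simp add: lf_Tl[OF l a])
 also have "... = pair2 f (%u v. j v * l u)"
 proof (rule pair2_cong)
  fix u v assume "(u, v)\<in>keys f"
  then have "v\<in>homog A (dg A v)" using f(2) dg_in by auto
  then show "\<phi> (dg A u) (dg A v) * (j v * l u) = j v * l u"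
   using j(2)[of v "dg A v"] by (cases "dg A v = 0") auto
 qed
 also have "... = l (Tr j a)"
  using sw_rep[OF bil_flip[OF bil_prod[OF j(1) l]] f(1) a] by (simp add: lf_Tr[OF l a])
 finally show "l (Tl j a) = l (Tr j a)" .
qed (use j a in auto)

definition W :: "'a set => 'a set" where "W B = {x\<oplus>y | x y. x\<in>B1 B\<and>y\<in>B2 B}"

text \<open>
  One level \<open>n\<close> serves all functionals: only finitely many coordinates of the second legs of \<open>\<Delta> x\<close> modulo
  \<open>B\<close> occur.
\<close>

lemma B1_closed:
 assumes B: "gsc B" and x: "x\<in>cA" and T: "\<And>i. i\<in>ann B ==> Tr i x\<in>B1 B"
 shows "x\<in>B1 B"
proof -
 have d: "B\<inter>{\<zero>}\<subseteq>{\<zero>}" by auto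
 have gz: "graded_subspace A {\<zero>}" by (auto simp: gsub_subsp subsp_zero comp_homog[OF zero_homog])
 obtain pB where p: "gr pB" "\<And>v. v\<in>B ==> pB v = v" "\<And>v. v\<in>cA ==> pB v\<in>B"
  using retraction[OF gscD(1)[OF B] gz d] by blast
 obtain Xs where Xs: "hbasis Xs" using homog_basis[OF gsub_carrier] by (auto simp: hbasis_def)
 obtain f where f: "AA.AB.ok f" "f\<in>\<Delta> x" using AA.AB.T_obtain[OF comult_in[OF x]] by metis
 have pc: "pB v\<in>cA" if "v\<in>cA" for v using linD(1)[OF gr_lin[OF p(1)] that] .
 let ?q = "%v. v\<ominus>pB v"
 have qlin: "lin A A ?q" by (rule lin_diff[OF lin_id gr_lin[OF p(1)]])
 let ?i = "%y v. lookup (coord A Xs (?q v)) y"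
 have iann: "?i y\<in>ann B" for y
 proof -
  have "lf A (?i y)" by (rule lf_lin[OF lf_lookup[OF Xs] qlin])
  moreover have "?i y b = 0" if "b\<in>B" for b
   using that p(2) gscD(3)[OF B that] lf_zero[OF lf_lookup[OF Xs]] by (simp add: r_neg a_minus_def)
  ultimately show ?thesis by (simp add: ann_def)
 qed
 define L where "L = (\<Union>z\<in>keys f. keys (coord A Xs (?q (snd z))))"
 have fin: "finite L" by (simp add: L_def)
 have "\<forall>y. \<exists>n. Tr (?i y) x\<in>Bn B n" using T[OF iann] by (auto simp: B1_def)
 then obtain nn where nn: "\<And>y. Tr (?i y) x\<in>Bn B (nn y)" by metis
 define n where "n = (\<Sum>y\<in>L. nn y)"
 have nL: "Tr (?i y) x\<in>Bn B n" if "y\<in>L" for y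
 proof -
  have "nn y \<le> n" unfolding n_def using fin that by (intro member_le_sum) auto
  then show ?thesis using nn Bn_mono'[OF B] by blast
 qed
 have "Tr i x\<in>Bn B n" if i: "i\<in>ann B" for i
 proof (rule lf_subspI[OF gscD(2)[OF Bn_gsc[OF B]]])
  note li = annD(1)[OF i]
  fix l assume l: "lf A l" and z: "\<And>x. x\<in>Bn B n ==> l x = 0"
  have "l (Tr i x) = pair2 f (%u v. i v * l u)"
   using sw_rep[OF bil_flip[OF bil_prod[OF li l]] f(2) x] by (simp add: lf_Tr[OF l x])
  also have "... = pair2 f (%u v. \<Sum>y\<in>L. i y * (?i y v * l u))"
  proof (rule pair2_cong)
   fix u v assume uv: "(u, v)\<in>keys f"
   then have v: "v\<in>cA" using f(1) by auto
   have "i v = i (?q v)" using v pc p(3) annD(2)[OF i] by (simp add: lf_minus[OF li])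
   also have "... = pair (coord A Xs (?q v)) i" by (rule cx_lf[OF Xs linD(1)[OF qlin v] li, symmetric])
   also have "... = (\<Sum>y\<in>L. ?i y v * i y)" using uv by (intro pair_superset fin) (force simp: L_def)
   finally show "i v * l u = (\<Sum>y\<in>L. i y * (?i y v * l u))" by (simp add: sum_distrib_left mult_ac)
  qed
  also have "... = (\<Sum>y\<in>L. i y * pair2 f (%u v. ?i y v * l u))"
   by (simp add: pair2_def pair_fun_sum pair_cmult)
  also have "... = (\<Sum>y\<in>L. i y * l (Tr (?i y) x))"
   using sw_rep[OF bil_flip[OF bil_prod[OF annD(1)[OF iann] l]] f(2) x] by (simp add: lf_Tr[OF l x])
  also have "... = 0" using nL z by simp
  finally show "l (Tr i x) = 0" .
 qed (use x annD(1)[OF i] in auto)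
 then have "x\<in>Bn B (Suc n)" using x by simp
 then show ?thesis unfolding B1_def by blast
qed

end

context cchopf begin

lemma B1_W: "gsc B ==> B1 B\<subseteq>W B"
proof
 fix x assume B: "gsc B" and x: "x\<in>B1 B"
 have "x = x\<oplus>\<zero>" using gscD(3)[OF B1_gsc[OF B] x] by simp
 then show "x\<in>W B" using x subspD(2)[OF gscD(2)[OF B2_gsc[OF B]]] unfolding W_def by blast
qed

lemma B2_W: "gsc B ==> B2 B\<subseteq>W B"
proof
 fix x assume B: "gsc B" and x: "x\<in>B2 B"
 have "x = \<zero>\<oplus>x" using gscD(3)[OF B2_gsc[OF B] x] by simp
 then show "x\<in>W B" using x subspD(2)[OF gscD(2)[OF B1_gsc[OF B]]] unfolding W_def by blast
qed

lemma W_gsc: "gsc B ==> gsc (W B)"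
 unfolding W_def by (rule gsc_sum[OF B1_gsc B2_gsc])

lemma gr_add_comp: "lf A j ==> gr p ==> lf A (%v. j (p v))"
 by (rule lf_lin[OF _ gr_lin])

text \<open>
  Subtracting from \<open>a\<close> its image under the functional that is the counit on \<open>B2 B\<close> and zero on \<open>B1 B\<close>
  leaves an element all of whose images lie in \<open>B1 B\<close>.
\<close>

lemma W_closed:
 assumes B: "gsc B" and a: "a\<in>cA" and T: "\<And>j. j\<in>ann B ==> Tr j a\<in>W B"
 shows "a\<in>W B"
proof -
 note g1 = B1_gsc[OF B] and g2 = B2_gsc[OF B]
 obtain p where p: "gr p" "\<And>v. v\<in>B1 B ==> p v = v" "\<And>v. v\<in>B2 B ==> p v = \<zero>"
  using retraction[OF gscD(1)[OF g1] gscD(1)[OF g2] B1_B2[OF B]] by blast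
 \<comment> \<open>the counit on \<open>B2 B\<close>, zero on \<open>B1 B\<close>\<close>
 define j0 where "j0 = (%v. \<epsilon> v - \<epsilon> (p v))"
 have l0: "lf A j0" unfolding j0_def by (rule lf_diff[OF lf_counit gr_add_comp[OF lf_counit p(1)]])
 have jB1: "j0 v = 0" if "v\<in>B1 B" for v using p(2)[OF that] by (simp add: j0_def)
 have jB2: "j0 v = \<epsilon> v" if "v\<in>B2 B" for v using p(3)[OF that] by (simp add: j0_def lf_zero[OF lf_counit])
 have ja: "j0\<in>ann B" using l0 jB1 B_B1 by (auto simp: ann_def)
 have d0: "j0 v = 0" if "v\<in>homog A h" "h \<noteq> 0" for h v
  using that counit_degree[OF that] counit_degree[OF grD(2)[OF p(1) that(1)] that(2)] by (simp add: j0_def)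
 let ?t = "Tr j0 a"
 define x where "x = a\<ominus>?t"
 have tc: "?t\<in>cA" using a l0 by simp
 then have xc: "x\<in>cA" using a by (simp add: x_def)
 have "x\<in>B1 B"
 proof (rule B1_closed[OF B xc])
  fix i assume i: "i\<in>ann B"
  note li = annD(1)[OF i]
  obtain u1 u2 where u: "Tr i a = u1\<oplus>u2" "u1\<in>B1 B" "u2\<in>B2 B" using T[OF i] unfolding W_def by blast
  note uc = gscD(3)[OF g1 u(2)] gscD(3)[OF g2 u(3)]
  have "Tr i x = u1"
  proof (rule lf_eqI)
   fix l assume l: "lf A l"
   have lt: "lf A (%v. l (Tr i v))" by (rule lf_lin[OF l Tr_lin[OF li]])
   have "l (Tr i ?t) = sw a (%u v. i (Tr j0 v) * l u)"
    using a l0 by (simp add: Tr_Tr[OF li l0 a] lf_Tr[OF l])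
   also have "... = sw a (%u v. j0 (Tr i v) * l u)"
    by (rule sw_cong[OF a]) (simp add: Tr_swap[OF l0 li] Tl_deg0[OF l0 d0])
   also have "... = l (Tr j0 (Tr i a))"
    using a l0 by (simp add: Tr_Tr[OF l0 li a] lf_Tr[OF l])
   also have "... = l (Tr j0 u1) + l (Tr j0 u2)"
    unfolding u(1) linD(2)[OF Tr_lin[OF l0] uc] using uc l0 by (intro lfD(1)[OF l]) auto
   also have "l (Tr j0 u1) = sw u1 (%u v. 0)"
    unfolding lf_Tr[OF l uc(1)] using jB1
    by (intro sw_in[OF g1 u(2)] bil_flip[OF bil_prod[OF l0 l]]) (auto simp: bil_def)
   also have "l (Tr j0 u2) = sw u2 (%u v. \<epsilon> v * l u)"
    unfolding lf_Tr[OF l uc(2)] using jB2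
    by (intro sw_in[OF g2 u(3)] bil_flip[OF bil_prod[OF l0 l]] bil_flip[OF bil_prod[OF lf_counit l]]) auto
   also have "... = l u2" by (rule counit_r[OF uc(2) l])
   finally have e: "l (Tr i ?t) = l u2" by simp
   have "l (Tr i x) = l (Tr i a) - l (Tr i ?t)" unfolding x_def by (rule lf_minus[OF lt a tc])
   then show "l (Tr i x) = l u1" unfolding e u(1) using lfD(1)[OF l uc] by simp
  qed (use xc li uc in auto)
  then show "Tr i x\<in>B1 B" using u by simp
 qed
 then have "x\<oplus>?t\<in>W B" using B1_W[OF B] T[OF ja] subspD(3)[OF gscD(2)[OF W_gsc[OF B]]] by blast
 moreover have "x\<oplus>?t = a"
  by (rule lf_eqI) (use a tc xc in \<open>auto simp: x_def lf_minus lfD(1)\<close>)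
 ultimately show ?thesis by simp
qed

lemma comp_Tr:
 assumes a: "a\<in>homog A g" and r: "lf A r"
 shows "component A (Tr r a) h = Tr (%v. r (component A v (g - h))) a"
  and "component A (Tl r a) h = Tl (%v. r (component A v (g - h))) a"
proof -
 have ac: "a\<in>cA" using a by auto
 obtain f where f: "f\<in>\<Delta> a" "keys f\<subseteq>(\<Union>h. homog A h\<times>homog A (g - h))" using hom_rep_deg[OF a] by auto
 have key: "r (component A v (g - h)) * l u = r v * l (component A u h)"
  "r (component A u (g - h)) * l v = r u * l (component A v h)"
  if uv: "(u, v)\<in>keys f" and l: "lf A l" for u v l
 proof -
  obtain k where "u\<in>homog A k" "v\<in>homog A (g - k)" using uv f(2) by auto
  then show "r (component A v (g - h)) * l u = r v * l (component A u h)"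
   "r (component A u (g - h)) * l v = r u * l (component A v h)"
   by (auto simp: comp_homog[of u k] comp_homog[of v "g - k"] lf_zero[OF r] lf_zero[OF l] algebra_simps)
 qed
 show "component A (Tr r a) h = Tr (%v. r (component A v (g - h))) a"
 proof (rule lf_eqI)
  fix l assume l: "lf A l"
  note r' = lf_comp[OF r, of "g - h"] and l' = lf_comp[OF l, of h]
  show "l (component A (Tr r a) h) = l (Tr (%v. r (component A v (g - h))) a)"
   unfolding lf_Tr[OF l' ac] lf_Tr[OF l ac] sw_rep[OF bil_flip[OF bil_prod[OF r l']] f(1) ac]
    sw_rep[OF bil_flip[OF bil_prod[OF r' l]] f(1) ac]
   by (rule pair2_cong) (simp add: key(1)[OF _ l])
 qed (use ac r lf_comp[OF r] in auto)
 show "component A (Tl r a) h = Tl (%v. r (component A v (g - h))) a"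
 proof (rule lf_eqI)
  fix l assume l: "lf A l"
  note r' = lf_comp[OF r, of "g - h"] and l' = lf_comp[OF l, of h]
  show "l (component A (Tl r a) h) = l (Tl (%v. r (component A v (g - h))) a)"
   unfolding lf_Tl[OF l' ac] lf_Tl[OF l ac] sw_rep[OF bil_prod[OF r l'] f(1) ac]
    sw_rep[OF bil_prod[OF r' l] f(1) ac]
   by (rule pair2_cong) (simp add: key(2)[OF _ l])
 qed (use ac r lf_comp[OF r] in auto)
qed

text \<open>
  The subcoalgebra generated by a homogeneous element: by cocommutativity the left orbit is already
  stable under the right action.
\<close>

lemma orbit_gsc:
 assumes a: "a\<in>homog A g"
 shows "gsc {Tl r a | r. lf A r}"
proof -
 let ?M = "{Tl r a | r. lf A r}"
 have ac: "a\<in>cA" using a by auto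
 have mem: "lf A r ==> x = Tl r a ==> x\<in>?M" for r x by blast
 have g: "graded_subspace A ?M"
  unfolding gsub_subsp subsp_def
 proof (intro conjI ballI allI)
  show "?M\<subseteq>cA" using ac by auto
  have "\<zero> = Tl (%v. 0) a"
   by (rule lf_eqI) (auto simp: ac lf_Tl lf_zero lf_def)
  then show "\<zero>\<in>?M" by (rule mem[rotated]) (simp add: lf_def)
  fix x assume "x\<in>?M"
  then obtain r where r: "x = Tl r a" "lf A r" by blast
  have "c\<odot>x = Tl (%v. c * r v) a" for c
   unfolding r(1) using r(2) ac lf_cmult[OF r(2)]
   by (intro lf_eqI) (auto simp: lf_Tl lfD(2) sw_cmult mult.assoc)
  then show "c\<odot>x\<in>?M" for c using lf_cmult[OF r(2)] by blast
  show "component A x h\<in>?M" for h unfolding r(1) comp_Tr(2)[OF a r(2)] using lf_comp[OF r(2)] by blast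
  fix y assume "y\<in>?M"
  then obtain s where s: "y = Tl s a" "lf A s" by blast
  have "x\<oplus>y = Tl (%v. r v + s v) a"
   unfolding r(1) s(1) using r(2) s(2) ac lf_add[OF r(2) s(2)]
   by (intro lf_eqI) (auto simp: lf_Tl lfD(1) sw_add distrib_right)
  then show "x\<oplus>y\<in>?M" using lf_add[OF r(2) s(2)] by blast
 qed
 have tl: "Tl s x\<in>?M" if s: "lf A s" and x: "x\<in>?M" for s x
 proof -
  obtain r where r: "x = Tl r a" "lf A r" using x by blast
  have ls: "lf A (%v. s (Tl r v))" by (rule lf_lin[OF s Tl_lin[OF r(2)]])
  have "Tl s x = Tl (%v. s (Tl r v)) a"
   unfolding r(1) using ac s r(2) ls
   by (intro lf_eqI) (auto simp: lf_Tl sw_Tl[OF bil_prod[OF s]])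
  then show ?thesis using ls by blast
 qed
 show ?thesis
  unfolding gsc_def
 proof (intro conjI allI impI ballI g)
  fix j x assume j: "lf A j" and x: "x\<in>?M"
  show "Tl j x\<in>?M" by (rule tl[OF j x])
  have xc: "x\<in>cA" using x ac by auto
  show "Tr j x\<in>?M" by (rule Tr_of_Tl[OF xc j g]) (rule tl[OF _ x])
 qed
qed

text \<open>
  Induction on the length of a representative of \<open>\<Delta> a\<close>. If some functional that vanishes on \<open>B\<close> keeps the
  second legs independent, it acts injectively on the subcoalgebra generated by \<open>a\<close>, which is therefore
  disjoint from \<open>B\<close>. Otherwise every such functional shortens the representative, and the claim follows
  from \<open>W_closed\<close>.
\<close>

lemma carrier_W_homog:
 assumes B: "gsc B"
 shows "finite K ==> a\<in>homog A g ==> (\<And>i. i\<in>K ==> xs i\<in>cA) ==> (\<And>i. i\<in>K ==> ys i\<in>cA)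
  ==> (\<And>b. bil A A b ==> sw a b = (\<Sum>i\<in>K. b (xs i) (ys i))) ==> a\<in>W B"
proof (induction "card K" arbitrary: K a g xs ys rule: less_induct)
 case less
 note fin = less.prems(1) and a = less.prems(2) and xs = less.prems(3) and ys = less.prems(4) and rep = less.prems(5)
 have ac: "a\<in>cA" using a by auto
 show ?case
 proof (cases "\<exists>j\<in>ann B. \<forall>c. (\<forall>l. lf A l\<longrightarrow>(\<Sum>i\<in>K. c i * l (Tr j (ys i))) = 0)\<longrightarrow>(\<forall>i\<in>K. c i = 0)")
  case True
  then obtain j where j: "j\<in>ann B"
   and ind: "\<And>c i. (\<And>l. lf A l ==> (\<Sum>i\<in>K. c i * l (Tr j (ys i))) = 0) ==> i\<in>K ==> c i = 0" by metis
  note lj = annD(1)[OF j]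
  let ?M = "{Tl r a | r. lf A r}"
  have "?M\<inter>B\<subseteq>{\<zero>}"
  proof
   fix x assume x: "x\<in>?M\<inter>B"
   then obtain r where r: "x = Tl r a" "lf A r" by blast
   have "(\<Sum>i\<in>K. r (xs i) * l (Tr j (ys i))) = 0" if l: "lf A l" for l
   proof -
    have lt: "lf A (%v. l (Tr j v))" by (rule lf_lin[OF l Tr_lin[OF lj]])
    have "l (Tr j x) = (\<Sum>i\<in>K. r (xs i) * l (Tr j (ys i)))"
     unfolding r(1) using lf_Tl[OF lt ac, of r] rep[OF bil_prod[OF r(2) lt]] by simp
    then show ?thesis using Tr_ann[OF B j, of x] x lf_zero[OF l] by simp
   qed
   then have z: "r (xs i) = 0" if "i\<in>K" for i using ind[of "%i. r (xs i)"] that by blast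
   have "x = \<zero>"
   proof (rule lf_eqI)
    fix l assume l: "lf A l"
    show "l x = l \<zero>" unfolding r(1) lf_Tl[OF l ac] rep[OF bil_prod[OF r(2) l]] lf_zero[OF l]
     using z by (intro sum.neutral) auto
   qed (use r ac in auto)
   then show "x\<in>{\<zero>}" by simp
  qed
  moreover have "a\<in>?M" using Tl_counit[OF ac] lf_counit by force
  ultimately have "a\<in>B2 B" unfolding B2_def using orbit_gsc[OF a] by blast
  then show ?thesis using B2_W[OF B] by blast
 next
  case False
  show ?thesis
  proof (rule W_closed[OF B ac])
   fix j assume j: "j\<in>ann B"
   show "Tr j a\<in>W B"
   proof (rule Tr_of_comps[OF ac annD(1)[OF j] gscD(2)[OF W_gsc[OF B]]])
    fix h
    define i where "i = (%v. j (component A v h))"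
    have ia: "i\<in>ann B" unfolding i_def by (rule ann_comp[OF gscD(1)[OF B] j])
    note li = annD(1)[OF ia]
    have "Tr i a = component A (Tr i a) (g - h)"
     unfolding comp_Tr(1)[OF a li]
    proof (rule lf_eqI)
     have i: "i v = i (component A v (g - (g - h)))" if "v\<in>cA" for v using that by (simp add: i_def)
     fix l assume "lf A l"
     then show "l (Tr i a) = l (Tr (%v. i (component A v (g - (g - h)))) a)"
      unfolding lf_Tr[OF \<open>lf A l\<close> ac] using i by (intro sw_cong[OF ac]) metis
    qed (use ac li lf_comp[OF li] in auto)
    then have ti: "Tr i a\<in>homog A (g - h)" using comp_in[of "Tr i a" "g - h"] ac li by simp
    \<comment> \<open>a dependency between the images of the second legs; it eliminates the term \<open>k\<close>\<close>
    obtain c k where c: "\<And>l. lf A l ==> (\<Sum>m\<in>K. c m * l (Tr i (ys m))) = 0" and k: "k\<in>K" "c k \<noteq> 0"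
     using False ia by metis
    let ?K = "K - {k}"
    let ?x = "%m. xs m\<ominus>(c m / c k)\<odot>xs k" and ?y = "%m. Tr i (ys m)"
    have card: "card ?K < card K" by (rule card_Diff1_less[OF fin k(1)])
    show "Tr (%v. j (component A v h)) a\<in>W B"
     unfolding i_def[symmetric]
    proof (rule less.hyps[OF card _ ti])
     show "finite ?K" using fin by simp
     show "?x m\<in>cA" if "m\<in>?K" for m using that xs k(1) by simp
     show "?y m\<in>cA" if "m\<in>?K" for m using that ys li by simp
     fix b assume b: "bil A A b"
     have y: "?y m\<in>cA" if "m\<in>K" for m using that ys li by simp
     have "sw (Tr i a) b = (\<Sum>m\<in>K. b (xs m) (?y m))"
      unfolding sw_Tr[OF b li ac] by (rule rep[OF bil_comp[OF b lin_id Tr_lin[OF li]]])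
     also have "... = b (xs k) (?y k) + (\<Sum>m\<in>?K. b (xs m) (?y m))" by (rule sum.remove[OF fin k(1)])
     also have "b (xs k) (?y k) = - (\<Sum>m\<in>?K. c m / c k * b (xs k) (?y m))"
     proof -
      have "0 = c k * b (xs k) (?y k) + (\<Sum>m\<in>?K. c m * b (xs k) (?y m))"
       using c[OF bilD(1)[OF b xs[OF k(1)]]] sum.remove[OF fin k(1), of "%m. c m * b (xs k) (?y m)"] by simp
      also have "(\<Sum>m\<in>?K. c m * b (xs k) (?y m)) = c k * (\<Sum>m\<in>?K. c m / c k * b (xs k) (?y m))"
       using k(2) by (simp add: sum_distrib_left)
      finally have "c k * (b (xs k) (?y k) + (\<Sum>m\<in>?K. c m / c k * b (xs k) (?y m))) = 0"
       by (simp add: distrib_left)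
      then show ?thesis using k(2) by (simp add: eq_neg_iff_add_eq_0)
     qed
     also have "- (\<Sum>m\<in>?K. c m / c k * b (xs k) (?y m)) + (\<Sum>m\<in>?K. b (xs m) (?y m)) = (\<Sum>m\<in>?K. b (?x m) (?y m))"
     proof -
      have "b (?x m) (?y m) = b (xs m) (?y m) - c m / c k * b (xs k) (?y m)" if m: "m\<in>?K" for m
      proof -
       have m': "m\<in>K" using m by simp
       show ?thesis using xs[OF m'] xs[OF k(1)]
        by (simp add: lf_minus[OF bilD(2)[OF b y[OF m']]] lfD(2)[OF bilD(2)[OF b y[OF m']]])
      qed
      then show ?thesis by (simp add: sum_subtractf)
     qed
     finally show "sw (Tr i a) b = (\<Sum>m\<in>?K. b (?x m) (?y m))" .
    qed
   qed
  qed
 qed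
qed

lemma carrier_W:
 assumes B: "gsc B"
 shows "cA = W B"
proof
 note s = gscD(2)[OF W_gsc[OF B]]
 show "W B\<subseteq>cA" using subspD(1)[OF s] by blast
 show "cA\<subseteq>W B"
 proof
  fix v assume v: "v\<in>cA"
  show "v\<in>W B"
  proof (rule comp_sum_in[OF s v])
   fix g
   let ?a = "component A v g"
   have a: "?a\<in>homog A g" using v by simp
   then have ac: "?a\<in>cA" by auto
   obtain f where f: "AA.AB.ok f" "f\<in>\<Delta> ?a" using AA.AB.T_obtain[OF comult_in[OF ac]] by metis
   obtain I :: "nat set" and e where e: "finite I" "bij_betw e I (keys f)"
    using finite_imp_nat_seg_image_inj_on[of "keys f"] by (metis bij_betw_imageI finite_Collect_less_nat finite_keys)
   have kc: "fst (e i)\<in>cA" "snd (e i)\<in>cA" if "i\<in>I" for i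
   proof -
    have "e i\<in>keys f" using e(2) that by (auto simp: bij_betw_def)
    then show "fst (e i)\<in>cA" "snd (e i)\<in>cA" using f(1) by (cases "e i"; auto)+
   qed
   show "?a\<in>W B"
   proof (rule carrier_W_homog[OF B e(1) a])
    show "lookup f (e i)\<odot>fst (e i)\<in>cA" if "i\<in>I" for i using kc[OF that] by simp
    show "snd (e i)\<in>cA" if "i\<in>I" for i using kc[OF that] by simp
    fix b assume b: "bil A A b"
    have "sw ?a b = (\<Sum>p\<in>keys f. lookup f p * b (fst p) (snd p))"
     by (simp add: sw_rep[OF b f(2) ac] pair2_def pair_def)
    also have "... = (\<Sum>i\<in>I. lookup f (e i) * b (fst (e i)) (snd (e i)))"
     by (rule sum.reindex_bij_betw[OF e(2), symmetric])
    also have "... = (\<Sum>i\<in>I. b (lookup f (e i)\<odot>fst (e i)) (snd (e i)))"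
     using kc by (intro sum.cong refl) (simp add: lfD(2)[OF bilD(2)[OF b]])
    finally show "sw ?a b = (\<Sum>i\<in>I. b (lookup f (e i)\<odot>fst (e i)) (snd (e i)))" .
   qed
  qed
 qed
qed

text \<open>
  The complement is a coalgebra complement, so the projection may be applied to either leg of the
  coproduct.
\<close>

lemma component_projection:
 assumes B: "gsc B"
 shows "\<exists>p. gr p\<and>(\<forall>v\<in>cA. p v\<in>B1 B)\<and>(\<forall>v\<in>B1 B. p v = v) \<and>
  (\<forall>a\<in>cA. \<forall>b. bil A A b\<longrightarrow>sw a (%u v. b (p u) v) = sw (p a) b\<and>sw a (%u v. b u (p v)) = sw (p a) b)"
proof -
 note g1 = B1_gsc[OF B] and g2 = B2_gsc[OF B]
 obtain p where p: "gr p" "\<And>v. v\<in>cA ==> p v\<in>B1 B" "\<And>v. v\<in>B1 B ==> p v = v" "\<And>v. v\<in>B2 B ==> p v = \<zero>"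
  using retraction[OF gscD(1)[OF g1] gscD(1)[OF g2] B1_B2[OF B]] by blast
 have "sw a (%u v. b (p u) v) = sw (p a) b" "sw a (%u v. b u (p v)) = sw (p a) b"
  if a: "a\<in>cA" and b: "bil A A b" for a b
 proof -
  obtain x y where x: "a = x\<oplus>y" "x\<in>B1 B" "y\<in>B2 B" using a carrier_W[OF B] unfolding W_def by blast
  note c = gscD(3)[OF g1 x(2)] gscD(3)[OF g2 x(3)]
  have pa: "p a = x" unfolding x(1) linD(2)[OF gr_lin[OF p(1)] c] using x p c by simp
  have bz: "b \<zero> v = 0" "b v \<zero> = 0" if "v\<in>cA" for v
   using lf_zero[OF bilD(2)[OF b that]] lf_zero[OF bilD(1)[OF b that]] by auto
  have b1: "bil A A (%u v. b (p u) v)" by (rule bil_comp[OF b gr_lin[OF p(1)] lin_id])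
  have b2: "bil A A (%u v. b u (p v))" by (rule bil_comp[OF b lin_id gr_lin[OF p(1)]])
  have b0: "bil A A (%u v. 0 :: 'k)" by (simp add: bil_def)
  have "sw x (%u v. b (p u) v) = sw x b" "sw x (%u v. b u (p v)) = sw x b"
   using p(3) by (auto intro!: sw_in[OF g1 x(2)] b1 b2 b)
  moreover have "sw y (%u v. b (p u) v) = sw y (%u v. 0)"
   using p(4) bz gscD(3)[OF g2] by (intro sw_in[OF g2 x(3) b1 b0]) simp
  moreover have "sw y (%u v. b u (p v)) = sw y (%u v. 0)"
   using p(4) bz gscD(3)[OF g2] by (intro sw_in[OF g2 x(3) b2 b0]) simp
  ultimately show "sw a (%u v. b (p u) v) = sw (p a) b" "sw a (%u v. b u (p v)) = sw (p a) b"
   unfolding pa unfolding x(1) lfD(1)[OF lf_sw[OF b1] c] lfD(1)[OF lf_sw[OF b2] c] by auto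
 qed
 then show ?thesis using p by blast
qed

end

section \<open>Retracting a Hopf algebra onto a Hopf subalgebra\<close>

context cchopf begin

text \<open>
  A color Hopf subalgebra, in terms of \<open>gsc\<close>.
\<close>

definition hs :: "'a set => bool" where
 "hs B\<longleftrightarrow>gsc B\<and>\<one>\<in>B\<and>(\<forall>x\<in>B. \<forall>y\<in>B. x\<otimes>y\<in>B)\<and>(\<forall>x\<in>B. S x\<in>B)"

lemma hsD: assumes "hs B"
 shows "gsc B" "\<one>\<in>B" "x\<in>B ==> y\<in>B ==> x\<otimes>y\<in>B" "x\<in>B ==> S x\<in>B"
  "x\<in>B ==> x\<in>cA" "subsp A B" "graded_subspace A B" "x\<in>B ==> tw h x\<in>B"
 using assms gscD[of B] tws_in[of B x] by (auto simp: hs_def tw_def)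

lemma gr_closed: "gr p ==> v\<in>cA ==> p v\<in>cA"
 by (rule linD(1)[OF gr_lin])

lemma gr_tw_commute: "gr p ==> v\<in>cA ==> p (tw h v) = tw h (p v)"
proof (rule lf_eqI)
 fix l assume p: "gr p" and v: "v\<in>cA" and l: "lf A l"
 show "l (p (tw h v)) = l (tw h (p v))"
 proof (rule lf_hset_eq[OF lf_lin[OF l gr_lin[OF gr_comp[OF p gr_tw]]] lf_lin[OF l gr_lin[OF gr_comp[OF gr_tw p]]] _ v])
  fix v assume "v\<in>hset A"
  then obtain g where g: "v\<in>homog A g" by (auto simp: hset_def)
  then have "v\<in>cA" by auto
  then show "l (p (tw h v)) = l (tw h (p v))"
   using linD(3)[OF gr_lin[OF p]] by (simp add: tw_homog[OF g] tw_homog[OF grD(2)[OF p g]])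
 qed
qed (auto simp: gr_closed)

lemma phi_neg: "\<phi> g (- h) = \<phi> h g"
proof -
 have "\<phi> g h * \<phi> g (- h) = \<phi> g h * \<phi> h g" by (simp add: phi_inv flip: phi_add)
 then show ?thesis using phi_nz by simp
qed

text \<open>
  The companion of \<open>sw_mult_tw\<close>: the factor \<open>\<phi>(|x\<^sub>2|, |y\<^sub>1|)\<close> is absorbed into the leg \<open>y\<^sub>1\<close>, as
  \<open>\<phi>(g, h) = \<phi>(h, -g)\<close>.
\<close>

lemma sw_mult_tw2:
 assumes b: "bil A A b" and x: "x\<in>cA" "y\<in>cA" and f: "f\<in>\<Delta> x" "homk f"
 shows "sw (x\<otimes>y) b = pair2 f (%x1 x2. sw y (%y1 y2. b (x1\<otimes>tw (- dg A x2) y1) (x2\<otimes>y2)))"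
proof -
 obtain g where g: "g\<in>\<Delta> y" "homk g" using hom_rep[OF x(2)] by auto
 show ?thesis
  unfolding sw_mult[OF b x f g]
 proof (rule pair2_cong)
  fix x1 x2 assume "(x1, x2)\<in>keys f"
  then have h: "x1\<in>cA" "x2\<in>cA" using f(2) hset_carrier by auto
  have "bil A A (%y1 y2. b (x1\<otimes>tw (- dg A x2) y1) (x2\<otimes>y2))"
   using h by (intro bil_comp[OF b] lin_mult_l lin_id gr_lin gr_tw)
  then have "sw y (%y1 y2. b (x1\<otimes>tw (- dg A x2) y1) (x2\<otimes>y2)) =
   pair2 g (%y1 y2. b (x1\<otimes>tw (- dg A x2) y1) (x2\<otimes>y2))" by (rule sw_rep[OF _ g(1) x(2)])
  also have "... = pair2 g (%y1 y2. \<phi> (dg A x2) (dg A y1) * b (x1\<otimes>y1) (x2\<otimes>y2))"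
  proof (rule pair2_cong)
   fix y1 y2 assume "(y1, y2)\<in>keys g"
   then have y: "y1\<in>homog A (dg A y1)" "y1\<in>cA" "y2\<in>cA" using g(2) dg_in hset_carrier by auto
   then show "b (x1\<otimes>tw (- dg A x2) y1) (x2\<otimes>y2) = \<phi> (dg A x2) (dg A y1) * b (x1\<otimes>y1) (x2\<otimes>y2)"
    using h lfD(2)[OF bilD(2)[OF b]] by (simp add: tw_homog smult_mult_right phi_neg)
  qed
  finally show "pair2 g (%y1 y2. \<phi> (dg A x2) (dg A y1) * b (x1\<otimes>y1) (x2\<otimes>y2)) =
   sw y (%y1 y2. b (x1\<otimes>tw (- dg A x2) y1) (x2\<otimes>y2))" by simp
 qed
qed

lemma tw_0: "y\<in>cA ==> tw 0 y = y"
proof (rule lf_eqI)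
 fix l assume y: "y\<in>cA" and l: "lf A l"
 show "l (tw 0 y) = l y"
 proof (rule lf_hset_eq[OF lf_lin[OF l gr_lin[OF gr_tw]] l _ y])
  fix v assume "v\<in>hset A"
  then obtain g where g: "v\<in>homog A g" by (auto simp: hset_def)
  then have "v\<in>cA" by auto
  then show "l (tw 0 v) = l v" by (simp add: tw_homog[OF g])
 qed
qed auto

lemma lf_pair2: "(\<And>u v. (u, v)\<in>keys f ==> lf V (F u v)) ==> lf V (%t. pair2 f (%u v. F u v t))"
 unfolding pair2_def by (rule lf_pair) auto

text \<open>
  The color version of \<open>b\<^sub>1 S(t b\<^sub>2) = b\<^sub>1 S(b\<^sub>2) S(t) = \<epsilon>(b) S(t)\<close>.
\<close>

lemma antipode_cancel:
 assumes l: "lf A l" and t: "t\<in>cA" and b: "b\<in>cA" and g: "g\<in>\<Delta> b" "homk g" and s: "s\<in>cA"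
 shows "pair2 g (%b1 b2. l (s\<otimes>b1\<otimes>S (tw (dg A b1) t\<otimes>b2))) = \<epsilon> b * l (s\<otimes>S t)"
proof (rule lf_hset_eq[OF _ _ _ t])
 note lS = gr_lin[OF gr_S] and lt = gr_lin[OF gr_tw]
 have gc: "(b1, b2)\<in>keys g ==> b1\<in>cA\<and>b2\<in>cA" for b1 b2 using g(2) hset_carrier by auto
 show "lf A (%t. \<epsilon> b * l (s\<otimes>S t))" by (intro lf_cmult lf_lin[OF l] lin_mult_l lS s)
 show "lf A (%t. pair2 g (%b1 b2. l (s\<otimes>b1\<otimes>S (tw (dg A b1) t\<otimes>b2))))"
 proof (rule lf_pair2)
  fix b1 b2 assume "(b1, b2)\<in>keys g"
  then have "b1\<in>cA" "b2\<in>cA" using gc by auto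
  then show "lf A (%t. l (s\<otimes>b1\<otimes>S (tw (dg A b1) t\<otimes>b2)))"
   using s by (intro lf_lin[OF l] lin_mult_l lin_comp[OF lS] lin_mult_r lt) auto
 qed
 fix t assume "t\<in>hset A"
 then obtain k where k: "t\<in>homog A k" by (auto simp: hset_def)
 have tc: "t\<in>cA" using k by auto
 have ls: "lf A (%w. l (s\<otimes>w\<otimes>S t))" using tc s by (intro lf_mult_l[OF lf_mult_r[OF l]]) auto
 let ?F = "%b1 b2. l (s\<otimes>(b1\<otimes>S b2)\<otimes>S t)"
 have bF: "bil A A ?F" by (rule bil_mult[OF ls lin_id lS])
 have "pair2 g (%b1 b2. l (s\<otimes>b1\<otimes>S (tw (dg A b1) t\<otimes>b2))) = pair2 g (%b1 b2. ?F (tw (- k) b1) (tw (- k) b2))"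
 proof (rule pair2_cong)
  fix b1 b2 assume "(b1, b2)\<in>keys g"
  then have h: "b1\<in>homog A (dg A b1)" "b2\<in>homog A (dg A b2)" and hc: "b1\<in>cA" "b2\<in>cA"
   using g(2) dg_in gc by auto
  have S2: "S (c\<odot>b2) = c\<odot>S b2" for c using linD(3)[OF lS hc(2)] .
  have S1: "S (c\<odot>(t\<otimes>b2)) = c\<odot>S (t\<otimes>b2)" for c using linD(3)[OF lS] tc hc by simp
  show "l (s\<otimes>b1\<otimes>S (tw (dg A b1) t\<otimes>b2)) = ?F (tw (- k) b1) (tw (- k) b2)"
   using s hc tc
   by (simp add: tw_homog[OF k] tw_homog[OF h(1)] tw_homog[OF h(2)] phi_neg smult_mult_left smult_mult_right S1 S2
     S_mult[OF k h(2)] m_assoc lfD(2)[OF l] mult_ac)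
 qed
 also have "... = sw b (%b1 b2. ?F (tw (- k) b1) (tw (- k) b2))"
  by (rule sw_rep[OF bil_comp[OF bF lt lt] g(1) b, symmetric])
 also have "... = sw (tw (- k) b) ?F" by (rule sw_tw[OF bF b, symmetric])
 also have "... = \<epsilon> b * l (s\<otimes>S t)"
  using antipode_r[of "tw (- k) b", OF _ ls] b s tc by (simp add: counit_tw)
 finally show "pair2 g (%b1 b2. l (s\<otimes>b1\<otimes>S (tw (dg A b1) t\<otimes>b2))) = \<epsilon> b * l (s\<otimes>S t)" .
qed

text \<open>
  A functional that vanishes on \<open>B\<close> still does so after right multiplication by elements of \<open>B\<close>.
\<close>

lemma Bn_right_mult:
 assumes B: "hs B"
 shows "a\<in>Bn B n ==> b\<in>B ==> a\<otimes>b\<in>Bn B n"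
proof (induction n arbitrary: a b)
 case (Suc n)
 note N = gscD(2)[OF Bn_gsc[OF hsD(1)[OF B]]]
 have ac: "a\<in>cA" "b\<in>cA" using Suc.prems hsD(5)[OF B] by auto
 obtain g where g: "g\<in>\<Delta> b" "keys g\<subseteq>(B\<inter>hset A)\<times>(B\<inter>hset A)" using gsc_rep[OF hsD(1)[OF B] Suc.prems(2)] by auto
 have hg: "homk g" using g(2) by auto
 have "Tr j (a\<otimes>b)\<in>Bn B n" if j: "j\<in>ann B" for j
 proof (rule lf_subspI[OF N])
  note lj = annD(1)[OF j]
  fix l assume l: "lf A l" and z: "\<And>x. x\<in>Bn B n ==> l x = 0"
  have "l (Tr j (a\<otimes>b)) = pair2 g (%y1 y2. sw a (%u v. j (tw (dg A y1) v\<otimes>y2) * l (u\<otimes>y1)))"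
   unfolding lf_Tr[OF l m_closed[OF ac]] by (rule sw_mult_tw[OF bil_flip[OF bil_prod[OF lj l]] ac g(1) hg])
  also have "... = pair2 g (%y1 y2. 0)"
  proof (rule pair2_cong)
   fix y1 y2 assume "(y1, y2)\<in>keys g"
   then have y: "y1\<in>B" "y2\<in>B" using g(2) by auto
   then have yc: "y1\<in>cA" "y2\<in>cA" using hsD(5)[OF B] by auto
   let ?j = "%v. j (tw (dg A y1) v\<otimes>y2)"
   have "lf A ?j" by (intro lf_lin[OF lj] lin_mult_r gr_lin gr_tw yc)
   moreover have "?j v = 0" if "v\<in>B" for v using annD(2)[OF j hsD(3)[OF B hsD(8)[OF B that] y(2)]] .
   ultimately have "?j\<in>ann B" by (simp add: ann_def)
   then have "Tr ?j a\<otimes>y1\<in>Bn B n" using Suc.prems(1) Suc.IH[OF _ y(1)] by simp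
   then show "sw a (%u v. ?j v * l (u\<otimes>y1)) = 0" using z lf_Tr[OF lf_mult_r[OF l yc(1)] ac(1), of ?j] by simp
  qed
  finally show "l (Tr j (a\<otimes>b)) = 0" by (simp add: pair2_def)
 qed (use ac annD(1)[OF j] in auto)
 then show ?case using ac by simp
qed (use hsD(3)[OF B] in simp)

text \<open>
  With \<open>e = \<epsilon> \<circ> p\<close> one has \<open>p(a) = a\<^sub>1 e(a\<^sub>2)\<close>, so it is enough that \<open>e(ab) = e(a)\<epsilon>(b)\<close>. Since
  \<open>p(x) b\<close> stays in the component, \<open>e(p(x) b) = e(x)\<epsilon>(b)\<close>. Therefore
  \<open>e(ab) = e(p(a b\<^sub>1) S(b\<^sub>2)) = e(a\<^sub>1 b\<^sub>1) e(a\<^sub>2 b\<^sub>2 S(b\<^sub>3)) = e(a\<^sub>1 b) e(a\<^sub>2) = e(p(a) b)\<close>.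
\<close>

lemma component_right_linear:
 assumes B: "hs B" and p: "gr p" "\<And>v. v\<in>cA ==> p v\<in>B1 B" "\<And>v. v\<in>B1 B ==> p v = v"
  and P: "\<And>a b. a\<in>cA ==> bil A A b ==> sw a (%u v. b (p u) v) = sw (p a) b"
   "\<And>a b. a\<in>cA ==> bil A A b ==> sw a (%u v. b u (p v)) = sw (p a) b"
  and a: "a\<in>cA" and b: "b\<in>B"
 shows "p (a\<otimes>b) = p a\<otimes>b"
proof -
 note BC = hsD(5)[OF B] and lp = gr_lin[OF p(1)]
 define e where "e = (%v. \<epsilon> (p v))"
 have le: "lf A e" unfolding e_def by (rule lf_lin[OF lf_counit lp])
 have e0: "e v = 0" if "v\<in>homog A h" "h \<noteq> 0" for v h
  unfolding e_def by (rule counit_degree[OF grD(2)[OF p(1) that(1)] that(2)])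
 have T1: "sw a (%u v. e u * l v) = l (p a)" "sw a (%u v. e v * l u) = l (p a)"
  if "a\<in>cA" "lf A l" for a l
  unfolding e_def using P(1)[OF that(1) bil_prod[OF lf_counit that(2)]] P(2)[OF that(1) bil_flip[OF bil_prod[OF lf_counit that(2)]]]
   counit_l[OF _ that(2)] counit_r[OF _ that(2)] linD(1)[OF lp that(1)] by auto
 have B1B: "x\<otimes>b\<in>B1 B" if "x\<in>B1 B" "b\<in>B" for x b
  using that Bn_right_mult[OF B] by (auto simp: B1_def)
 have B1e: "e x = \<epsilon> x" if "x\<in>B1 B" for x by (simp add: e_def p(3)[OF that])
 have pe: "e (p x\<otimes>b) = e x * \<epsilon> b" if "x\<in>cA" "b\<in>B" for x b
  using B1e[OF B1B[OF p(2)[OF that(1)] that(2)]] that BC[OF that(2)] linD(1)[OF lp that(1)]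
  by (simp add: counit_mult e_def)
 have twe: "e w * l (x\<otimes>tw (- dg A w) y) = e w * l (x\<otimes>y)" if "w\<in>hset A" "y\<in>cA" for w x y l
 proof (cases "dg A w = 0")
  case True
  then show ?thesis using tw_0[OF that(2)] by simp
 qed (use e0[OF dg_in[OF that(1)]] in simp)
 have eab: "e (a\<otimes>b) = e a * \<epsilon> b" if a: "a\<in>cA" and b: "b\<in>B" for a b
 proof -
  have bc: "b\<in>cA" by (rule BC[OF b])
  obtain f where f: "f\<in>\<Delta> a" "homk f" using hom_rep[OF a] by auto
  have fc: "(u, v)\<in>keys f ==> u\<in>cA\<and>v\<in>cA\<and>v\<in>hset A" for u v using f(2) hset_carrier by auto
  note lS = gr_lin[OF gr_S] and lt = gr_lin[OF gr_tw]
  have "e (a\<otimes>b) = sw b (%b1 b2. \<epsilon> b2 * e (a\<otimes>b1))" by (rule counit_r[OF bc lf_mult_l[OF le a], symmetric])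
  also have "... = sw b (%b1 b2. e (p (a\<otimes>b1)\<otimes>S b2))"
  proof (rule sw_in[OF hsD(1)[OF B] b])
   show "bil A A (%b1 b2. \<epsilon> b2 * e (a\<otimes>b1))" by (rule bil_flip[OF bil_prod[OF lf_counit lf_mult_l[OF le a]]])
   show "bil A A (%b1 b2. e (p (a\<otimes>b1)\<otimes>S b2))"
    by (rule bil_mult[OF le lin_comp[OF lp lin_mult_l[OF lin_id a]] lS])
   fix u v assume "u\<in>B" "v\<in>B"
   then show "\<epsilon> v * e (a\<otimes>u) = e (p (a\<otimes>u)\<otimes>S v)"
    using pe[of "a\<otimes>u" "S v"] a BC hsD(4)[OF B] by (simp add: counit_S)
  qed
  also have "... = sw b (%b1 b2. pair2 f (%a1 a2. sw b1 (%y1 y2. e (a1\<otimes>tw (- dg A a2) y1) * e ((a2\<otimes>y2)\<otimes>S b2))))"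
  proof (rule sw_cong[OF bc])
   fix b1 b2 assume bb: "b1\<in>cA" "b2\<in>cA"
   have l: "lf A (%x. e (x\<otimes>S b2))" using bb by (intro lf_mult_r[OF le]) simp
   have "e (p (a\<otimes>b1)\<otimes>S b2) = sw (a\<otimes>b1) (%u v. e u * e (v\<otimes>S b2))"
    using T1(1)[OF _ l, of "a\<otimes>b1"] a bb by simp
   also have "... = pair2 f (%a1 a2. sw b1 (%y1 y2. e (a1\<otimes>tw (- dg A a2) y1) * e ((a2\<otimes>y2)\<otimes>S b2)))"
    by (rule sw_mult_tw2[OF bil_prod[OF le l] a bb(1) f])
   finally show "e (p (a\<otimes>b1)\<otimes>S b2) = pair2 f (%a1 a2. sw b1 (%y1 y2. e (a1\<otimes>tw (- dg A a2) y1) * e ((a2\<otimes>y2)\<otimes>S b2)))" .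
  qed
  also have "... = pair2 f (%a1 a2. sw b (%b1 b2. sw b1 (%y1 y2. e (a1\<otimes>tw (- dg A a2) y1) * e ((a2\<otimes>y2)\<otimes>S b2))))"
   by (rule sw_pair2)
  also have "... = pair2 f (%a1 a2. e a2 * e (a1\<otimes>b))"
  proof (rule pair2_cong)
   fix a1 a2 assume "(a1, a2)\<in>keys f"
   then have aa: "a1\<in>cA" "a2\<in>cA" "a2\<in>hset A" using fc by auto
   let ?t = "tw (- dg A a2)"
   have lf1: "lf A (%y1. e (a1\<otimes>?t y1))" by (intro lf_lin[OF le] lin_mult_l lt aa)
   have lf2: "lf A (%y. e (a2\<otimes>y))" by (intro lf_mult_l[OF le] aa)
   have "sw b (%b1 b2. sw b1 (%y1 y2. e (a1\<otimes>?t y1) * e ((a2\<otimes>y2)\<otimes>S b2))) =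
    sw b (%b1 z. sw z (%y2 b2. e (a1\<otimes>?t b1) * e ((a2\<otimes>y2)\<otimes>S b2)))"
    using aa by (intro sw_coassoc[OF triI bc] lf_cmult lf_cmult_right lf1 lf_lin[OF le] lin_mult_l lin_mult_r lin_id lS) auto
   also have "... = sw b (%b1 z. \<epsilon> z * (e a2 * e (a1\<otimes>?t b1)))"
   proof (rule sw_cong[OF bc])
    fix b1 z assume z: "b1\<in>cA" "z\<in>cA"
    have "sw z (%y2 b2. e ((a2\<otimes>y2)\<otimes>S b2)) = sw z (%y2 b2. e (a2\<otimes>(y2\<otimes>S b2)))"
     using aa by (intro sw_cong z) (simp add: m_assoc)
    also have "... = \<epsilon> z * e a2" using antipode_r[OF z(2) lf2] aa by simp
    finally show "sw z (%y2 b2. e (a1\<otimes>?t b1) * e ((a2\<otimes>y2)\<otimes>S b2)) = \<epsilon> z * (e a2 * e (a1\<otimes>?t b1))"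
     by (simp add: sw_cmult)
   qed
   also have "... = e a2 * e (a1\<otimes>?t b)" by (rule counit_r[OF bc lf_cmult[OF lf1]])
   also have "... = e a2 * e (a1\<otimes>b)" by (rule twe[OF aa(3) bc])
   finally show "sw b (%b1 b2. sw b1 (%y1 y2. e (a1\<otimes>?t y1) * e ((a2\<otimes>y2)\<otimes>S b2))) = e a2 * e (a1\<otimes>b)" .
  qed
  also have "... = sw a (%u v. e v * e (u\<otimes>b))"
   by (rule sw_rep[OF bil_flip[OF bil_prod[OF le lf_mult_r[OF le bc]]] f(1) a, symmetric])
  also have "... = e (p a\<otimes>b)" by (rule T1(2)[OF a lf_mult_r[OF le bc]])
  finally show ?thesis using pe[OF a b] by simp
 qed
 have bc: "b\<in>cA" by (rule BC[OF b])
 obtain f where f: "f\<in>\<Delta> a" "homk f" using hom_rep[OF a] by auto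
 show ?thesis
 proof (rule lf_eqI)
  fix l assume l: "lf A l"
  have "l (p (a\<otimes>b)) = sw (a\<otimes>b) (%u v. e v * l u)" using T1(2)[OF m_closed[OF a bc] l] by simp
  also have "... = pair2 f (%a1 a2. sw b (%y1 y2. e (a2\<otimes>y2) * l (a1\<otimes>tw (- dg A a2) y1)))"
   by (rule sw_mult_tw2[OF bil_flip[OF bil_prod[OF le l]] a bc f])
  also have "... = pair2 f (%a1 a2. e a2 * l (a1\<otimes>b))"
  proof (rule pair2_cong)
   fix a1 a2 assume "(a1, a2)\<in>keys f"
   then have aa: "a1\<in>cA" "a2\<in>cA" "a2\<in>hset A" using f(2) hset_carrier by auto
   have l1: "lf A (%y1. l (a1\<otimes>tw (- dg A a2) y1))" by (intro lf_lin[OF l] lin_mult_l gr_lin gr_tw aa)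
   have "sw b (%y1 y2. e (a2\<otimes>y2) * l (a1\<otimes>tw (- dg A a2) y1)) = sw b (%y1 y2. \<epsilon> y2 * (e a2 * l (a1\<otimes>tw (- dg A a2) y1)))"
    using aa by (intro sw_in[OF hsD(1)[OF B] b] bil_flip[OF bil_prod[OF lf_mult_l[OF le] l1]] bil_flip[OF bil_prod[OF lf_counit lf_cmult[OF l1]]])
     (simp_all add: eab)
   also have "... = e a2 * l (a1\<otimes>tw (- dg A a2) b)" by (rule counit_r[OF bc lf_cmult[OF l1]])
   also have "... = e a2 * l (a1\<otimes>b)" by (rule twe[OF aa(3) bc])
   finally show "sw b (%y1 y2. e (a2\<otimes>y2) * l (a1\<otimes>tw (- dg A a2) y1)) = e a2 * l (a1\<otimes>b)" .
  qed
  also have "... = sw a (%u v. e v * l (u\<otimes>b))"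
   by (rule sw_rep[OF bil_flip[OF bil_prod[OF le lf_mult_r[OF l bc]]] f(1) a, symmetric])
  also have "... = l (p a\<otimes>b)" by (rule T1(2)[OF a lf_mult_r[OF l bc]])
  finally show "l (p (a\<otimes>b)) = l (p a\<otimes>b)" .
 qed (use a bc gr_closed[OF p(1)] in auto)
qed

end

context cchopf begin

text \<open>
  \<open>\<Delta> a\<close> lies in \<open>Bn B n \<otimes> A + Bn B (Suc n) \<otimes> B\<close>. Project both legs along complements of \<open>Bn B n\<close> and \<open>B\<close>;
  by the definition of \<open>Bn B (Suc n)\<close> all product forms then vanish.
\<close>

lemma sw_filtration:
 assumes B: "hs B" and a: "a\<in>Bn B (Suc n)" and b: "bil A A b"
  and 1: "\<And>u v. u\<in>Bn B n ==> v\<in>cA ==> b u v = 0"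
  and 2: "\<And>u v. u\<in>Bn B (Suc n) ==> v\<in>B ==> b u v = 0"
 shows "sw a b = 0"
proof -
 note gB = hsD(1)[OF B] and gn = Bn_gsc[OF hsD(1)[OF B], of n] and gs = Bn_gsc[OF hsD(1)[OF B], of "Suc n"]
 have ac: "a\<in>cA" using a by simp
 have gz: "graded_subspace A {\<zero>}" by (auto simp: gsub_subsp subsp_zero comp_homog[OF zero_homog])
 obtain p where p: "gr p" "\<And>v. v\<in>Bn B n ==> p v = v" "\<And>v. v\<in>cA ==> p v\<in>Bn B n"
  using retraction[OF gscD(1)[OF gn] gz] by blast
 obtain q where q: "gr q" "\<And>v. v\<in>B ==> q v = v" "\<And>v. v\<in>cA ==> q v\<in>B"
  using retraction[OF gscD(1)[OF gB] gz] by blast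
 note pc = gr_closed[OF p(1)] and qc = gr_closed[OF q(1)]
 have lp: "lin A A (%v. v\<ominus>p v)" and lq: "lin A A (%v. v\<ominus>q v)"
  by (rule lin_diff[OF lin_id gr_lin[OF p(1)]], rule lin_diff[OF lin_id gr_lin[OF q(1)]])
 have bb: "bil A A (%u v. b (u\<ominus>p u) (v\<ominus>q v))" by (rule bil_comp[OF b lp lq])
 have "sw a b = sw a (%u v. b (u\<ominus>p u) (v\<ominus>q v))"
 proof (rule sw_in[OF gs a b bb])
  fix u v assume u: "u\<in>Bn B (Suc n)" and v: "v\<in>Bn B (Suc n)"
  have c: "u\<in>cA" "v\<in>cA" using u v by auto
  have "b (u\<ominus>p u) (v\<ominus>q v) = b (u\<ominus>p u) v - b (u\<ominus>p u) (q v)"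
   by (rule lf_minus[OF bilD(1)[OF b] c(2) qc[OF c(2)]]) (use c pc in simp)
  also have "b (u\<ominus>p u) v = b u v - b (p u) v" by (rule lf_minus[OF bilD(2)[OF b c(2)] c(1) pc[OF c(1)]])
  also have "b (u\<ominus>p u) (q v) = b u (q v) - b (p u) (q v)"
   by (rule lf_minus[OF bilD(2)[OF b qc[OF c(2)]] c(1) pc[OF c(1)]])
  finally show "b u v = b (u\<ominus>p u) (v\<ominus>q v)"
   using 1[OF p(3)[OF c(1)] c(2)] 1[OF p(3)[OF c(1)] qc[OF c(2)]] 2[OF u q(3)[OF c(2)]] by simp
 qed
 also have "... = 0"
 proof -
  obtain f where f: "f\<in>\<Delta> a" "homk f" using hom_rep[OF ac] by auto
  have fc: "(u, v)\<in>keys f ==> u\<in>cA\<and>v\<in>cA" for u v using f(2) hset_carrier by auto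
  \<comment> \<open>a representative of the projected tensor\<close>
  define f' where "f' = pbind f (%z. single (fst z\<ominus>p (fst z), snd z\<ominus>q (snd z)) (1::'k))"
  have ev: "pair2 f' c = pair2 f (%u v. c (u\<ominus>p u) (v\<ominus>q v))" for c
   by (simp add: f'_def pair2_def pair_pbind)
  have ok: "AA.AB.ok f'"
  proof -
   have "keys f'\<subseteq>(\<Union>z\<in>keys f. {(fst z\<ominus>p (fst z), snd z\<ominus>q (snd z))})"
    unfolding f'_def by (rule order.trans[OF keys_pbind]) auto
   moreover have "(fst z\<ominus>p (fst z), snd z\<ominus>q (snd z))\<in>cA\<times>cA" if "z\<in>keys f" for z
    using fc[of "fst z" "snd z"] that pc[of "fst z"] qc[of "snd z"] by simp
   ultimately show ?thesis by blast
  qed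
  have "pair2 f' b = 0"
  proof (rule AA.AB.product_forms[OF ok _ b])
   fix l m assume l: "lf A l" and m: "lf A m"
   let ?m = "%v. m (v\<ominus>q v)"
   have lm: "lf A ?m" by (rule lf_lin[OF m lq])
   have ll: "lf A (%v. l (v\<ominus>p v))" by (rule lf_lin[OF l lp])
   have "?m x = 0" if "x\<in>B" for x using q(2)[OF that] hsD(5)[OF B that] by (simp add: lf_minus[OF m])
   then have "?m\<in>ann B" using lm by (simp add: ann_def)
   then have t: "Tr ?m a\<in>Bn B n" using a by simp
   have tc: "Tr ?m a\<in>cA" using ac lm by simp
   have "pair2 f' (%v w. l v * m w) = sw a (%u v. ?m v * l (u\<ominus>p u))"
    unfolding ev using sw_rep[OF bil_prod[OF ll lm] f(1) ac] by (simp add: mult.commute)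
   also have "... = l (Tr ?m a\<ominus>p (Tr ?m a))" by (rule lf_Tr[OF ll ac, symmetric])
   also have "... = 0" using p(2)[OF t] tc by (simp add: lf_minus[OF l])
   finally show "pair2 f' (%v w. l v * m w) = 0" .
  qed
  then show ?thesis unfolding ev by (simp add: sw_rep[OF bb f(1) ac])
 qed
 finally show ?thesis .
qed

text \<open>
  The convolution product of linear endomorphisms.
\<close>

definition star :: "('a => 'a) => ('a => 'a) => 'a => 'a" where
 "star F G a = tensor_lift A (%u v. F u\<otimes>G v) (\<Delta> a)"

lemma star_bilin: "lin A A F ==> lin A A G ==> bilin A A A (%u v. F u\<otimes>G v)"
proof (rule bilinI)
 assume F: "lin A A F" and G: "lin A A G"
 show "lin A A (%v. F u\<otimes>G v)" if "u\<in>cA" for u by (rule lin_mult_l[OF G linD(1)[OF F that]])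
 show "lin A A (%u. F u\<otimes>G v)" if "v\<in>cA" for v by (rule lin_mult_r[OF F linD(1)[OF G that]])
qed

lemma star_lin: "lin A A F ==> lin A A G ==> lin A A (star F G)"
 unfolding star_def[abs_def] by (rule lin_comp[OF AA.AB.lin_tensor_lift[OF kspace_axioms star_bilin] comult_lin])

lemma lf_star:
 assumes F: "lin A A F" and G: "lin A A G" and l: "lf A l" and a: "a\<in>cA"
 shows "l (star F G a) = sw a (%u v. l (F u\<otimes>G v))"
 unfolding star_def sw_def
 by (rule AA.AB.lf_tensor_lift[OF kspace_axioms _ comult_in[OF a] l]) (rule bilin_closed[OF star_bilin[OF F G]])

lemma star_gr:
 assumes F: "gr F" and G: "gr G" shows "gr (star F G)"
 unfolding gr_def
proof (intro conjI allI ballI)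
 note lF = gr_lin[OF F] and lG = gr_lin[OF G]
 show "lin A A (star F G)" by (rule star_lin[OF lF lG])
 fix g v assume v: "v\<in>homog A g"
 have vc: "v\<in>cA" using v by auto
 obtain f where f: "f\<in>\<Delta> v" "keys f\<subseteq>(\<Union>h. homog A h\<times>homog A (g - h))" using hom_rep_deg[OF v] by auto
 show "star F G v\<in>homog A g"
 proof (rule lf_subspI[OF homog_subsp])
  fix l assume l: "lf A l" and z: "\<And>x. x\<in>homog A g ==> l x = 0"
  have "l (star F G v) = pair2 f (%u w. l (F u\<otimes>G w))"
   unfolding lf_star[OF lF lG l vc] by (rule sw_rep[OF bil_mult[OF l lF lG] f(1) vc])
  also have "... = pair2 f (%u w. 0)"
  proof (rule pair2_cong)
   fix u w assume "(u, w)\<in>keys f"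
   then obtain h where "u\<in>homog A h" "w\<in>homog A (g - h)" using f(2) by auto
   then have "F u\<otimes>G w\<in>homog A (h + (g - h))" by (intro homog_mult grD(2)[OF F] grD(2)[OF G])
   then show "l (F u\<otimes>G w) = 0" using z by simp
  qed
  finally show "l (star F G v) = 0" by (simp add: pair2_def)
 qed (use linD(1)[OF star_lin[OF lF lG] vc] in simp)
qed

lemma gr_diff: "gr p ==> gr q ==> gr (%v. p v\<ominus>q v)"
 unfolding gr_def using lin_diff subsp_minus[OF homog_subsp] by blast

lemma gr_id: "gr (%v. v)" by (simp add: gr_def lin_id)

text \<open>
  On a right Hopf module \<open>M\<close> over \<open>B\<close> the projection \<open>E(m) = m\<^sub>1 S(m\<^sub>2)\<close> onto the coinvariants recovers \<open>m\<close>
  as \<open>E(m\<^sub>1) m\<^sub>2\<close>. Modulo \<open>Bn B n\<close>, the second leg of \<open>a\<close> in \<open>Bn B (Suc n)\<close> is in \<open>B\<close>, so the same formula,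
  with the second legs cut down to \<open>B\<close> by a linear projection \<open>q\<close> and \<open>E\<close> cut off along a linear complement
  of \<open>Bn B n\<close>, defines a right \<open>B\<close>-linear \<open>R\<close> that vanishes on \<open>Bn B n\<close> and is the identity modulo
  \<open>Bn B n\<close>. The step is \<open>a \<mapsto> a - R(a)\<close>.
\<close>

lemma filtration_step:
 assumes B: "hs B"
 shows "\<exists>r. gr r\<and>(\<forall>a\<in>Bn B (Suc n). r a\<in>Bn B n)\<and>(\<forall>a\<in>Bn B n. r a = a) \<and>
  (\<forall>a\<in>Bn B (Suc n). \<forall>b\<in>B. r (a\<otimes>b) = r a\<otimes>b)"
proof -
 note gB = hsD(1)[OF B] and gn = Bn_gsc[OF hsD(1)[OF B], of n] and gs = Bn_gsc[OF hsD(1)[OF B], of "Suc n"]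
 note BC = hsD(5)[OF B] and nC = gscD(3)[OF gn] and sC = gscD(3)[OF gs]
 note nB = Bn_right_mult[OF B, of _ n] and sB = Bn_right_mult[OF B, of _ "Suc n"]
 note mono = subsetD[OF Bn_mono[OF gB], of _ n]
 have gz: "graded_subspace A {\<zero>}" by (auto simp: gsub_subsp subsp_zero comp_homog[OF zero_homog])
 obtain p where p: "gr p" "\<And>v. v\<in>Bn B n ==> p v = v" "\<And>v. v\<in>cA ==> p v\<in>Bn B n"
  using retraction[OF gscD(1)[OF gn] gz] by blast
 obtain q where q: "gr q" "\<And>v. v\<in>B ==> q v = v" "\<And>v. v\<in>cA ==> q v\<in>B"
  using retraction[OF gscD(1)[OF gB] gz] by blast
 note pc = gr_closed[OF p(1)] and qc = gr_closed[OF q(1)]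
 \<comment> \<open>\<open>E\<close> projects onto coinvariants as far as second legs in \<open>B\<close> are concerned\<close>
 define E where "E = star (%v. v) (%v. S (q v))"
 define nE where "nE = (%v. E v\<ominus>p (E v))"
 define R where "R = star nE q"
 have gE: "gr E" unfolding E_def by (rule star_gr[OF gr_id gr_comp[OF gr_S q(1)]])
 have gnE: "gr nE" unfolding nE_def by (rule gr_diff[OF gE gr_comp[OF p(1) gE]])
 have gR: "gr R" unfolding R_def by (rule star_gr[OF gnE q(1)])
 note lS = gr_lin[OF gr_S] and lt = gr_lin[OF gr_tw] and lq = gr_lin[OF q(1)] and lnE = gr_lin[OF gnE]
 note lSq = lin_comp[OF lS lq]
 have lfE: "l (E a) = sw a (%u v. l (u\<otimes>S (q v)))" if "lf A l" "a\<in>cA" for l a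
  unfolding E_def by (rule lf_star[OF lin_id lSq that])
 have lfR: "l (R a) = sw a (%u v. l (nE u\<otimes>q v))" if "lf A l" "a\<in>cA" for l a
  unfolding R_def by (rule lf_star[OF lnE lq that])
 have b0: "bil A A (%u v. 0 :: 'k)" by (simp add: bil_def)
 have E1: "E a\<in>Bn B n" if a: "a\<in>Bn B n" for a
 proof (rule lf_subspI[OF gscD(2)[OF gn]])
  fix l assume l: "lf A l" and z: "\<And>x. x\<in>Bn B n ==> l x = 0"
  have "l (E a) = sw a (%u v. 0)"
   unfolding lfE[OF l nC[OF a]]
   by (rule sw_in[OF gn a bil_mult[OF l lin_id lSq] b0]) (intro z nB hsD(4)[OF B] q(3) nC)
  then show "l (E a) = 0" by simp
 qed (rule gr_closed[OF gE nC[OF a]])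
 have n1: "nE a = \<zero>" if a: "a\<in>Bn B n" for a
  using p(2)[OF E1[OF a]] nC[OF E1[OF a]] by (simp add: nE_def a_minus_def r_neg)
 \<comment> \<open>\<open>a\<^sub>1 b\<^sub>1 S(a\<^sub>2 b\<^sub>2) = \<epsilon>(b) a\<^sub>1 S(a\<^sub>2)\<close> for second legs in \<open>B\<close>; the other terms are in \<open>Bn B n\<close>\<close>
 have E2: "nE (a\<otimes>b) = \<epsilon> b\<odot>nE a" if a: "a\<in>Bn B (Suc n)" and b: "b\<in>B" for a b
 proof -
  note ac = sC[OF a] and bc = BC[OF b]
  obtain g where g: "g\<in>\<Delta> b" "keys g\<subseteq>(B\<inter>hset A)\<times>(B\<inter>hset A)" using gsc_rep[OF gB b] by auto
  have hg: "homk g" using g(2) by auto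
  have gBB: "(b1, b2)\<in>keys g ==> b1\<in>B\<and>b2\<in>B\<and>b1\<in>cA\<and>b2\<in>cA" for b1 b2
   using g(2) BC by auto
  have Ec: "E a\<in>cA" "E (a\<otimes>b)\<in>cA" using ac bc gr_closed[OF gE] by auto
  have d: "E (a\<otimes>b)\<ominus>\<epsilon> b\<odot>E a\<in>Bn B n"
  proof (rule lf_subspI[OF gscD(2)[OF gn]])
   fix l assume l: "lf A l" and z: "\<And>x. x\<in>Bn B n ==> l x = 0"
   let ?b = "%u v. pair2 g (%b1 b2. l (u\<otimes>b1\<otimes>S (q (tw (dg A b1) v\<otimes>b2)))) - \<epsilon> b * l (u\<otimes>S (q v))"
   have b1: "bil A A (%u v. l (u\<otimes>b1\<otimes>S (q (tw (dg A b1) v\<otimes>b2))))" if "(b1, b2)\<in>keys g" for b1 b2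
    using gBB[OF that] by (intro bil_mult[OF l] lin_mult_r lin_id lin_comp[OF lSq] lt) auto
   have bb: "bil A A ?b" by (intro bil_diff bil_pair2 bil_cmult b1 bil_mult[OF l lin_id lSq])
   have "l (E (a\<otimes>b)) - \<epsilon> b * l (E a) = sw a ?b"
    using sw_mult_tw[OF bil_mult[OF l lin_id lSq] ac bc g(1) hg]
    by (simp add: lfE[OF l] ac bc sw_diff sw_pair2 sw_cmult)
   also have "... = 0"
   proof (rule sw_filtration[OF B a bb])
    fix u v assume u: "u\<in>Bn B n" and v: "v\<in>cA"
    have "pair2 g (%b1 b2. l (u\<otimes>b1\<otimes>S (q (tw (dg A b1) v\<otimes>b2)))) = pair2 g (%b1 b2. 0)"
     using gBB u v by (intro pair2_cong z nB hsD(4)[OF B] q(3)) auto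
    moreover have "l (u\<otimes>S (q v)) = 0" using u v by (intro z nB hsD(4)[OF B] q(3))
    ultimately show "?b u v = 0" by (simp add: pair2_def)
   next
    fix u v assume u: "u\<in>Bn B (Suc n)" and v: "v\<in>B"
    have "pair2 g (%b1 b2. l (u\<otimes>b1\<otimes>S (q (tw (dg A b1) v\<otimes>b2)))) = pair2 g (%b1 b2. l (u\<otimes>b1\<otimes>S (tw (dg A b1) v\<otimes>b2)))"
     using gBB hsD(3,8)[OF B] v q(2) by (intro pair2_cong) simp
    also have "... = \<epsilon> b * l (u\<otimes>S v)" by (rule antipode_cancel[OF l BC[OF v] bc g(1) hg sC[OF u]])
    finally show "?b u v = 0" using q(2)[OF v] by simp
   qed
   finally show "l (E (a\<otimes>b)\<ominus>\<epsilon> b\<odot>E a) = 0" using Ec by (simp add: lf_minus[OF l] lfD(2)[OF l])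
  qed (use Ec in simp)
  note lp = gr_lin[OF p(1)]
  show ?thesis
  proof (rule lf_eqI)
   fix l assume l: "lf A l"
   let ?D = "\<epsilon> b\<odot>E a"
   have lpp: "lf A (%v. l (p v))" by (rule lf_lin[OF l lp])
   have "l (E (a\<otimes>b)\<ominus>?D) = l (p (E (a\<otimes>b)\<ominus>?D))" using p(2)[OF d] by simp
   then have "l (E (a\<otimes>b)) - \<epsilon> b * l (E a) = l (p (E (a\<otimes>b))) - \<epsilon> b * l (p (E a))"
    using Ec by (simp add: lf_minus[OF l] lf_minus[OF lpp] lfD(2)[OF l] lfD(2)[OF lpp])
   then show "l (nE (a\<otimes>b)) = l (\<epsilon> b\<odot>nE a)"
    using Ec pc by (simp add: nE_def lf_minus[OF l] lfD(2)[OF l] algebra_simps)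
  qed (use ac bc gr_closed[OF gnE] in auto)
 qed
 have R0: "R a = \<zero>" if a: "a\<in>Bn B n" for a
 proof (rule lf_eqI)
  fix l assume l: "lf A l"
  have "l (R a) = sw a (%u v. 0)"
   unfolding lfR[OF l nC[OF a]]
   by (rule sw_in[OF gn a bil_mult[OF l lnE lq] b0]) (simp add: n1 nC qc lf_zero[OF l])
  then show "l (R a) = l \<zero>" by (simp add: lf_zero[OF l])
 qed (use gr_closed[OF gR nC[OF a]] in auto)
 \<comment> \<open>\<open>a\<^sub>1 S(a\<^sub>2) a\<^sub>3 = a\<close> for second legs in \<open>B\<close>\<close>
 have R1: "a\<ominus>R a\<in>Bn B n" if a: "a\<in>Bn B (Suc n)" for a
 proof (rule lf_subspI[OF gscD(2)[OF gn]])
  note ac = sC[OF a]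
  fix l assume l: "lf A l" and z: "\<And>x. x\<in>Bn B n ==> l x = 0"
  let ?b = "%u w. sw w (%u2 v. l (u\<otimes>S (q u2)\<otimes>q v)) - \<epsilon> w * l u"
  have tri: "tri A (%u u2 v. l (u\<otimes>S (q u2)\<otimes>q v))"
   using qc by (intro triI lf_lin[OF l] lin_mult_l lin_mult_r lin_id lSq lq) auto
  have "sw a (%u v. l (nE u\<otimes>q v)) = sw a (%u v. l (E u\<otimes>q v))"
  proof (rule sw_cong[OF ac])
   fix u v assume c: "u\<in>cA" "v\<in>cA"
   note Ec = gr_closed[OF gE c(1)]
   have "l (p (E u)\<otimes>q v) = 0" by (intro z nB p(3) q(3) Ec c)
   then show "l (nE u\<otimes>q v) = l (E u\<otimes>q v)"
    unfolding nE_def using Ec pc qc c by (simp add: lf_minus[OF lf_mult_r[OF l qc[OF c(2)]]])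
  qed
  also have "... = sw a (%u v. sw u (%u1 u2. l (u1\<otimes>S (q u2)\<otimes>q v)))"
   by (rule sw_cong[OF ac]) (rule lfE[OF lf_mult_r[OF l qc]])
  also have "... = sw a (%u w. sw w (%u2 v. l (u\<otimes>S (q u2)\<otimes>q v)))" by (rule sw_coassoc[OF tri ac])
  also have "... - l a = sw a ?b" by (simp add: sw_diff counit_r[OF ac l])
  also have "... = 0"
  proof (rule sw_filtration[OF B a])
   show "bil A A ?b"
   proof (rule bil_diff[OF _ bil_flip[OF bil_prod[OF lf_counit l]]], rule bilI)
    show "lf A (%w. sw w (%u2 v. l (u\<otimes>S (q u2)\<otimes>q v)))" if "u\<in>cA" for u
     using tri that by (intro lf_sw) (simp add: tri_def)
    show "lf A (%u. sw w (%u2 v. l (u\<otimes>S (q u2)\<otimes>q v)))" if w: "w\<in>cA" for w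
    proof -
     obtain f where f: "f\<in>\<Delta> w" "homk f" using hom_rep[OF w] by auto
     have e: "sw w (%u2 v. l (u\<otimes>S (q u2)\<otimes>q v)) = pair2 f (%u2 v. l (u\<otimes>S (q u2)\<otimes>q v))" if "u\<in>cA" for u
      using tri that by (intro sw_rep f w) (simp add: tri_def)
     have "lf A (%u. pair2 f (%u2 v. l (u\<otimes>S (q u2)\<otimes>q v)))"
     proof (rule lf_pair2)
      fix u2 v assume "(u2, v)\<in>keys f"
      then have "u2\<in>cA" "v\<in>cA" using f(2) hset_carrier by auto
      then show "lf A (%u. l (u\<otimes>S (q u2)\<otimes>q v))" using qc by (intro lf_lin[OF l] lin_mult_r lin_id) auto
     qed
     then show ?thesis using e by (simp add: lf_def)
    qed
   qed
   fix u w assume u: "u\<in>Bn B n" and w: "w\<in>cA"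
   have "sw w (%u2 v. l (u\<otimes>S (q u2)\<otimes>q v)) = sw w (%u2 v. 0)"
    using u by (intro sw_cong w z nB hsD(4)[OF B] q(3))
   then show "?b u w = 0" using z[OF u] by simp
  next
   fix u w assume u: "u\<in>Bn B (Suc n)" and w: "w\<in>B"
   note uc = sC[OF u] and wc = BC[OF w]
   have "sw w (%u2 v. l (u\<otimes>S (q u2)\<otimes>q v)) = sw w (%u2 v. l (u\<otimes>(S u2\<otimes>v)))"
   proof (rule sw_in[OF gB w])
    show "bil A A (%u2 v. l (u\<otimes>S (q u2)\<otimes>q v))" using tri uc by (simp add: tri_def)
    show "bil A A (%u2 v. l (u\<otimes>(S u2\<otimes>v)))" by (rule bil_mult[OF lf_mult_l[OF l uc] lS lin_id])
   qed (simp add: q(2) m_assoc uc BC)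
   also have "... = \<epsilon> w * l u" using antipode_l[OF wc lf_mult_l[OF l uc]] uc by simp
   finally show "?b u w = 0" by simp
  qed
  finally show "l (a\<ominus>R a) = 0" using ac gr_closed[OF gR ac] by (simp add: lf_minus[OF l] lfR[OF l ac])
 qed (use sC[OF a] gr_closed[OF gR] in simp)
 have R2: "R (a\<otimes>b) = R a\<otimes>b" if a: "a\<in>Bn B (Suc n)" and b: "b\<in>B" for a b
 proof (rule lf_eqI)
  note ac = sC[OF a] and bc = BC[OF b]
  obtain g where g: "g\<in>\<Delta> b" "keys g\<subseteq>(B\<inter>hset A)\<times>(B\<inter>hset A)" using gsc_rep[OF gB b] by auto
  have hg: "homk g" using g(2) by auto
  fix l assume l: "lf A l"
  have bm: "bil A A (%u v. l (nE u\<otimes>q (v\<otimes>c)))" if "c\<in>cA" for c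
   using that by (intro bil_mult[OF l lnE] lin_comp[OF lq] lin_mult_r lin_id)
  have lb2: "lf A (%c. sw a (%u v. l (nE u\<otimes>q (v\<otimes>c))))"
  proof -
   obtain f where f: "f\<in>\<Delta> a" "homk f" using hom_rep[OF ac] by auto
   have e: "sw a (%u v. l (nE u\<otimes>q (v\<otimes>c))) = pair2 f (%u v. l (nE u\<otimes>q (v\<otimes>c)))" if "c\<in>cA" for c
    by (rule sw_rep[OF bm[OF that] f(1) ac])
   have "lf A (%c. pair2 f (%u v. l (nE u\<otimes>q (v\<otimes>c))))"
   proof (rule lf_pair2)
    fix u v assume "(u, v)\<in>keys f"
    then have "u\<in>cA" "v\<in>cA" using f(2) hset_carrier by auto
    then show "lf A (%c. l (nE u\<otimes>q (v\<otimes>c)))"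
     by (intro lf_lin[OF l] lin_mult_l lin_comp[OF lq] lin_id gr_closed[OF gnE])
   qed
   then show ?thesis using e by (simp add: lf_def)
  qed
  have "l (R (a\<otimes>b)) = pair2 g (%b1 b2. sw a (%u v. l (nE (u\<otimes>b1)\<otimes>q (tw (dg A b1) v\<otimes>b2))))"
   using ac bc by (subst lfR[OF l]) (auto intro!: sw_mult_tw[OF bil_mult[OF l lnE lq] ac bc g(1) hg])
  also have "... = pair2 g (%b1 b2. \<epsilon> b1 * sw a (%u v. l (nE u\<otimes>q (v\<otimes>b2))))"
  proof (rule pair2_cong)
   fix b1 b2 assume "(b1, b2)\<in>keys g"
   then have bb: "b1\<in>B" "b1\<in>homog A (dg A b1)" "b2\<in>B" using g(2) dg_in by auto
   note c = BC[OF bb(1)] BC[OF bb(3)]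
   have "sw a (%u v. l (nE (u\<otimes>b1)\<otimes>q (tw (dg A b1) v\<otimes>b2))) = sw a (%u v. \<epsilon> b1 * l (nE u\<otimes>q (v\<otimes>b2)))"
   proof (rule sw_in[OF gs a])
    show "bil A A (%u v. l (nE (u\<otimes>b1)\<otimes>q (tw (dg A b1) v\<otimes>b2)))"
     using c by (intro bil_mult[OF l] lin_comp[OF lnE] lin_comp[OF lq] lin_mult_r lin_id lt)
    show "bil A A (%u v. \<epsilon> b1 * l (nE u\<otimes>q (v\<otimes>b2)))" by (intro bil_cmult bm c)
    fix u v assume u: "u\<in>Bn B (Suc n)" and v: "v\<in>Bn B (Suc n)"
    have cc: "nE u\<in>cA" "q (v\<otimes>b2)\<in>cA" "v\<in>cA" "q (tw (dg A b1) v\<otimes>b2)\<in>cA"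
     using sC[OF u] sC[OF v] c by (auto intro!: qc gr_closed[OF gnE])
    show "l (nE (u\<otimes>b1)\<otimes>q (tw (dg A b1) v\<otimes>b2)) = \<epsilon> b1 * l (nE u\<otimes>q (v\<otimes>b2))"
     unfolding E2[OF u bb(1)] using cc counit_degree[OF bb(2)]
     by (cases "dg A b1 = 0") (simp_all add: tw_0 smult_mult_left lfD(2)[OF l] lf_zero[OF l])
   qed
   then show "sw a (%u v. l (nE (u\<otimes>b1)\<otimes>q (tw (dg A b1) v\<otimes>b2))) = \<epsilon> b1 * sw a (%u v. l (nE u\<otimes>q (v\<otimes>b2)))"
    by (simp add: sw_cmult)
  qed
  also have "... = sw b (%b1 b2. \<epsilon> b1 * sw a (%u v. l (nE u\<otimes>q (v\<otimes>b2))))"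
   by (rule sw_rep[OF bil_prod[OF lf_counit lb2] g(1) bc, symmetric])
  also have "... = sw a (%u v. l (nE u\<otimes>q (v\<otimes>b)))" by (rule counit_l[OF bc lb2])
  also have "... = sw a (%u v. l (nE u\<otimes>q v\<otimes>b))"
  proof -
   have b2: "bil A A (%u v. l (nE u\<otimes>q v\<otimes>b))" by (rule bil_mult[OF lf_mult_r[OF l bc] lnE lq])
   have "sw a (%u v. l (nE u\<otimes>q (v\<otimes>b)) - l (nE u\<otimes>q v\<otimes>b)) = 0"
   proof (rule sw_filtration[OF B a bil_diff[OF bm[OF bc] b2]])
    fix u v assume u: "u\<in>Bn B n" and v: "v\<in>cA"
    show "l (nE u\<otimes>q (v\<otimes>b)) - l (nE u\<otimes>q v\<otimes>b) = 0"
     using n1[OF u] v bc qc by simp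
   next
    fix u v assume u: "u\<in>Bn B (Suc n)" and v: "v\<in>B"
    show "l (nE u\<otimes>q (v\<otimes>b)) - l (nE u\<otimes>q v\<otimes>b) = 0"
     using gr_closed[OF gnE sC[OF u]] q(2)[OF v] q(2)[OF hsD(3)[OF B v b]] BC[OF v] bc by (simp add: m_assoc)
   qed
   then show ?thesis by (simp add: sw_diff)
  qed
  also have "... = l (R a\<otimes>b)" by (rule lfR[OF lf_mult_r[OF l bc] ac, symmetric])
  finally show "l (R (a\<otimes>b)) = l (R a\<otimes>b)" .
 qed (use sC[OF a] BC[OF b] gr_closed[OF gR] in auto)
 define r where "r = (%v. v\<ominus>R v)"
 have "gr r" unfolding r_def by (rule gr_diff[OF gr_id gR])
 moreover have "r a\<in>Bn B n" if "a\<in>Bn B (Suc n)" for a using R1[OF that] by (simp add: r_def)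
 moreover have "r a = a" if "a\<in>Bn B n" for a
  using nC[OF that] by (simp add: r_def R0[OF that] a_minus_def)
 moreover have "r (a\<otimes>b) = r a\<otimes>b" if "a\<in>Bn B (Suc n)" "b\<in>B" for a b
 proof (rule lf_eqI)
  note c = sC[OF that(1)] BC[OF that(2)] gr_closed[OF gR sC[OF that(1)]]
  fix l assume l: "lf A l"
  show "l (r (a\<otimes>b)) = l (r a\<otimes>b)"
   using c lf_minus[OF lf_mult_r[OF l c(2)] c(1,3)] by (simp add: r_def R2[OF that] lf_minus[OF l])
 qed (use sC[OF that(1)] BC[OF that(2)] gr_closed[OF gR] in \<open>auto simp: r_def\<close>)
 ultimately show ?thesis by blast
qed

end

context cchopf begin

lemma Bn_retraction:
 assumes B: "hs B"
 shows "\<exists>\<pi>. \<forall>n. gr (\<pi> n)\<and>(\<forall>a\<in>Bn B n. \<pi> n a\<in>B\<and>\<pi> (Suc n) a = \<pi> n a)\<and>(\<forall>a\<in>B. \<pi> n a = a) \<and>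
  (\<forall>a\<in>Bn B n. \<forall>b\<in>B. \<pi> n (a\<otimes>b) = \<pi> n a\<otimes>b)"
proof -
 have "\<forall>n. \<exists>r. gr r\<and>(\<forall>a\<in>Bn B (Suc n). r a\<in>Bn B n)\<and>(\<forall>a\<in>Bn B n. r a = a) \<and>
  (\<forall>a\<in>Bn B (Suc n). \<forall>b\<in>B. r (a\<otimes>b) = r a\<otimes>b)"
  using filtration_step[OF B] by blast
 then obtain r where r: "\<And>n. gr (r n)" "\<And>n a. a\<in>Bn B (Suc n) ==> r n a\<in>Bn B n"
  "\<And>n a. a\<in>Bn B n ==> r n a = a" "\<And>n a b. a\<in>Bn B (Suc n) ==> b\<in>B ==> r n (a\<otimes>b) = r n a\<otimes>b"
  by metis
 define \<pi> where "\<pi> = rec_nat (%v. v) (%n f v. f (r n v))"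
 have s: "\<pi> 0 = (%v. v)" "\<pi> (Suc n) = (%v. \<pi> n (r n v))" for n by (simp_all add: \<pi>_def)
 have BBn: "a\<in>B ==> a\<in>Bn B n" for a n using Bn_mono'[OF hsD(1)[OF B], of 0 n] by auto
 have "gr (\<pi> n)\<and>(\<forall>a\<in>Bn B n. \<pi> n a\<in>B\<and>\<pi> (Suc n) a = \<pi> n a)\<and>(\<forall>a\<in>B. \<pi> n a = a) \<and>
  (\<forall>a\<in>Bn B n. \<forall>b\<in>B. \<pi> n (a\<otimes>b) = \<pi> n a\<otimes>b)" for n
 proof (induction n)
  case 0
  then show ?case by (simp add: s gr_id r(3)[of _ 0])
 next
  case (Suc n)
  have "gr (\<pi> (Suc n))" unfolding s(2)[of n] using Suc.IH by (intro gr_comp[OF _ r(1)]) blast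
  moreover have "\<pi> (Suc n) a\<in>B" if "a\<in>Bn B (Suc n)" for a using Suc.IH r(2)[OF that] by (simp add: s(2))
  moreover have "\<pi> (Suc (Suc n)) a = \<pi> (Suc n) a" if "a\<in>Bn B (Suc n)" for a
   using r(3)[OF that] by (simp add: s(2)[of "Suc n"])
  moreover have "\<pi> (Suc n) a = a" if "a\<in>B" for a using Suc.IH that r(3)[OF BBn[OF that]] by (simp add: s(2))
  moreover have "\<pi> (Suc n) (a\<otimes>b) = \<pi> (Suc n) a\<otimes>b" if "a\<in>Bn B (Suc n)" "b\<in>B" for a b
   using Suc.IH r(4)[OF that] r(2)[OF that(1)] that(2) by (simp add: s(2))
  ultimately show ?case by blast
 qed
 then show ?thesis by blast
qed

text \<open>
  Project onto the component and step down from the first level that contains the result; any larger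
  level gives the same value.
\<close>

lemma hs_retraction:
 assumes B: "hs B"
 shows "\<exists>\<pi>. gr \<pi>\<and>(\<forall>a\<in>cA. \<pi> a\<in>B)\<and>(\<forall>a\<in>B. \<pi> a = a)\<and>(\<forall>a\<in>cA. \<forall>b\<in>B. \<pi> (a\<otimes>b) = \<pi> a\<otimes>b)"
proof -
 note gB = hsD(1)[OF B]
 obtain q where q: "\<And>n. gr (q n)" "\<And>n a. a\<in>Bn B n ==> q n a\<in>B" "\<And>n a. a\<in>Bn B n ==> q (Suc n) a = q n a"
  "\<And>n a. a\<in>B ==> q n a = a" "\<And>n a b. a\<in>Bn B n ==> b\<in>B ==> q n (a\<otimes>b) = q n a\<otimes>b"
  using Bn_retraction[OF B] by blast
 obtain p where p0: "gr p\<and>(\<forall>v\<in>cA. p v\<in>B1 B)\<and>(\<forall>v\<in>B1 B. p v = v) \<and>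
  (\<forall>a\<in>cA. \<forall>b. bil A A b\<longrightarrow>sw a (%u v. b (p u) v) = sw (p a) b\<and>sw a (%u v. b u (p v)) = sw (p a) b)"
  using component_projection[OF gB] by (rule exE)
 then have p: "gr p" "\<And>v. v\<in>cA ==> p v\<in>B1 B" "\<And>v. v\<in>B1 B ==> p v = v" by simp_all
 have P: "sw a (%u v. b (p u) v) = sw (p a) b" "sw a (%u v. b u (p v)) = sw (p a) b"
  if "a\<in>cA" "bil A A b" for a b
  using p0[THEN conjunct2, THEN conjunct2, THEN conjunct2, rule_format, OF that] by simp_all
 have pr: "p (a\<otimes>b) = p a\<otimes>b" if "a\<in>cA" "b\<in>B" for a b
  by (rule component_right_linear[OF B p P that])
 define \<pi> where "\<pi> = (%a. q (LEAST n. p a\<in>Bn B n) (p a))"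
 have ex: "\<exists>n. p a\<in>Bn B n" if "a\<in>cA" for a using p(2)[OF that] by (auto simp: B1_def)
 have qm: "q n x = q m x" if "x\<in>Bn B m" "m \<le> n" for x m n
  using that(2)
 proof (induction n rule: dec_induct)
  case (step n)
  have "x\<in>Bn B n" using Bn_mono'[OF gB step(1)] that(1) by blast
  then show ?case using q(3)[of x n] step.IH by simp
 qed simp
 have pi: "\<pi> a = q n (p a)" if "p a\<in>Bn B n" for a n
  unfolding \<pi>_def using qm[OF LeastI[of "%n. p a\<in>Bn B n", OF that] Least_le[of "%n. p a\<in>Bn B n", OF that]] by simp
 have B1: "p a\<in>Bn B n" if "a\<in>B" for a n
  using p(3)[OF subsetD[OF B_B1 that]] subsetD[OF Bn_mono'[OF gB, of 0 n], of a] that by simp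
 note lp = gr_lin[OF p(1)]
 have "gr \<pi>"
  unfolding gr_def
 proof (intro conjI linI allI ballI)
  fix a assume a: "a\<in>cA"
  obtain n where n: "p a\<in>Bn B n" using ex[OF a] by auto
  show "\<pi> a\<in>cA" unfolding pi[OF n] by (rule hsD(5)[OF B q(2)[OF n]])
  have c: "p (c\<odot>a)\<in>Bn B n" for c unfolding linD(3)[OF lp a] by (rule subspD(4)[OF gscD(2)[OF Bn_gsc[OF gB]] n])
  show "\<pi> (c\<odot>a) = c\<odot>\<pi> a" for c
   unfolding pi[OF n] pi[OF c] linD(3)[OF lp a] by (rule linD(3)[OF gr_lin[OF q(1)] linD(1)[OF lp a]])
  fix b assume b: "b\<in>cA"
  obtain m where m: "p b\<in>Bn B m" using ex[OF b] by auto
  let ?k = "max m n"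
  have k: "p a\<in>Bn B ?k" "p b\<in>Bn B ?k" using m n Bn_mono'[OF gB, of m ?k] Bn_mono'[OF gB, of n ?k] by auto
  have s: "p (a\<oplus>b)\<in>Bn B ?k" unfolding linD(2)[OF lp a b] by (rule subspD(3)[OF gscD(2)[OF Bn_gsc[OF gB]] k])
  show "\<pi> (a\<oplus>b) = \<pi> a\<oplus>\<pi> b"
   unfolding pi[OF k(1)] pi[OF k(2)] pi[OF s] linD(2)[OF lp a b]
   by (rule linD(2)[OF gr_lin[OF q(1)] linD(1)[OF lp a] linD(1)[OF lp b]])
 next
  fix g a assume a: "a\<in>homog A g"
  then have "a\<in>cA" by auto
  then obtain n where n: "p a\<in>Bn B n" using ex by auto
  show "\<pi> a\<in>homog A g" unfolding pi[OF n] by (intro grD(2)[OF q(1)] grD(2)[OF p(1)] a)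
 qed
 moreover have "\<pi> a\<in>B" if "a\<in>cA" for a using ex[OF that] q(2) pi by metis
 moreover have "\<pi> a = a" if "a\<in>B" for a
  using pi[OF B1[OF that, of 0]] p(3)[of a] B_B1[of B] that q(4)[OF that] by auto
 moreover have "\<pi> (a\<otimes>b) = \<pi> a\<otimes>b" if ab: "a\<in>cA" "b\<in>B" for a b
 proof -
  obtain n where n: "p a\<in>Bn B n" using ex[OF ab(1)] by auto
  have "p (a\<otimes>b)\<in>Bn B n" unfolding pr[OF ab] by (rule Bn_right_mult[OF B n ab(2)])
  then show ?thesis using pi[of "a\<otimes>b" n] pi[OF n] q(5)[OF n ab(2)] pr[OF ab] by simp
 qed
 ultimately show ?thesis by blast
qed

end

text \<open>
  A point that is trivial modulo \<open>AB\<^sup>+\<close> takes its values in \<open>B\<close>: the map \<open>\<theta>(a) = a\<^sub>1 S(\<pi>(a\<^sub>2))\<close> kills \<open>AB\<^sup>+\<close>,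
  so \<open>S \<circ> \<pi> \<circ> f\<close> is the convolution inverse of \<open>f\<close>, that is \<open>S \<circ> f\<close>.
\<close>

lemma (in points) coinvariant_in:
 assumes B: "hs B" and f: "point f"
  and I: "\<And>c. f c\<ominus>eps c\<odot>\<one>\<in>ideal_prod A (cA) (augmentation_ideal A B)"
 shows "f c\<in>B"
proof -
 note BC = hsD(5)[OF B]
 obtain \<pi> where gp: "gr \<pi>" and p: "\<And>a. a\<in>cA ==> \<pi> a\<in>B" "\<And>a. a\<in>B ==> \<pi> a = a"
  "\<And>a b. a\<in>cA ==> b\<in>B ==> \<pi> (a\<otimes>b) = \<pi> a\<otimes>b"
  using hs_retraction[OF B] by blast
 note lp = gr_lin[OF gp] and pc = gr_closed[OF gp]
 note lS = gr_lin[OF gr_S] and lt = gr_lin[OF gr_tw]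
 note lSp = lin_comp[OF lS lp]
 define \<theta> where "\<theta> = star (%v. v) (%v. S (\<pi> v))"
 have lth: "lin A A \<theta>" unfolding \<theta>_def by (rule star_lin[OF lin_id lSp])
 have lf\<theta>: "l (\<theta> a) = sw a (%u v. l (u\<otimes>S (\<pi> v)))" if "lf A l" "a\<in>cA" for l a
  unfolding \<theta>_def by (rule lf_star[OF lin_id lSp that])
 have th: "\<theta> (a\<otimes>b) = \<epsilon> b\<odot>\<theta> a" if a: "a\<in>cA" and b: "b\<in>B" for a b
 proof (rule lf_eqI)
  note bc = BC[OF b]
  obtain g where g: "g\<in>\<Delta> b" "keys g\<subseteq>(B\<inter>hset A)\<times>(B\<inter>hset A)" using gsc_rep[OF hsD(1)[OF B] b] by auto
  have hg: "homk g" using g(2) by auto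
  have gBB: "(b1, b2)\<in>keys g ==> b1\<in>B\<and>b2\<in>B\<and>b1\<in>cA\<and>b2\<in>cA" for b1 b2
   using g(2) BC by auto
  fix l assume l: "lf A l"
  have "l (\<theta> (a\<otimes>b)) = pair2 g (%b1 b2. sw a (%u v. l (u\<otimes>b1\<otimes>S (\<pi> (tw (dg A b1) v\<otimes>b2)))))"
   unfolding lf\<theta>[OF l m_closed[OF a bc]] by (rule sw_mult_tw[OF bil_mult[OF l lin_id lSp] a bc g(1) hg])
  also have "... = sw a (%u v. pair2 g (%b1 b2. l (u\<otimes>b1\<otimes>S (\<pi> (tw (dg A b1) v\<otimes>b2)))))" by (rule sw_pair2[symmetric])
  also have "... = sw a (%u v. \<epsilon> b * l (u\<otimes>S (\<pi> v)))"
  proof (rule sw_cong[OF a])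
   fix u v assume uv: "u\<in>cA" "v\<in>cA"
   have "pair2 g (%b1 b2. l (u\<otimes>b1\<otimes>S (\<pi> (tw (dg A b1) v\<otimes>b2)))) =
    pair2 g (%b1 b2. l (u\<otimes>b1\<otimes>S (tw (dg A b1) (\<pi> v)\<otimes>b2)))"
    using gBB uv by (intro pair2_cong) (simp add: p(3) gr_tw_commute[OF gp])
   also have "... = \<epsilon> b * l (u\<otimes>S (\<pi> v))" by (rule antipode_cancel[OF l pc[OF uv(2)] bc g(1) hg uv(1)])
   finally show "pair2 g (%b1 b2. l (u\<otimes>b1\<otimes>S (\<pi> (tw (dg A b1) v\<otimes>b2)))) = \<epsilon> b * l (u\<otimes>S (\<pi> v))" .
  qed
  finally show "l (\<theta> (a\<otimes>b)) = l (\<epsilon> b\<odot>\<theta> a)"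
   using linD(1)[OF lth a] by (simp add: lf\<theta>[OF l a] sw_cmult lfD(2)[OF l])
 qed (use a BC[OF b] linD(1)[OF lth] in auto)
 have ker: "x\<in>cA\<and>\<theta> x = \<zero>" if "x\<in>ideal_prod A (cA) (augmentation_ideal A B)" for x
  using that
 proof (induction rule: ideal_prod.induct)
  case (prod i j)
  then show ?case using th[of i j] BC[of j] linD(1)[OF lth] by (auto simp: augmentation_ideal_def)
 next
  case (sum s1 s2)
  then show ?case using linD(2)[OF lth] by auto
 qed
 have th1: "\<theta> \<one> = \<one>"
 proof (rule lf_eqI)
  fix l assume l: "lf A l"
  show "l (\<theta> \<one>) = l \<one>"
   unfolding lf\<theta>[OF l one_closed] sw_one[OF bil_mult[OF l lin_id lSp]] by (simp add: p(2) hsD(2)[OF B] S_one)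
 qed (use linD(1)[OF lth] in auto)
 have v: "vals f" "vals (%x. S (f x))" "vals (%x. S (\<pi> (f x)))" using f pc by auto
 have "f\<star>(%x. S (\<pi> (f x))) = un"
 proof
  fix x
  have fx: "f x\<in>cA" using f by simp
  have "\<theta> (f x) = \<theta> ((f x\<ominus>eps x\<odot>\<one>)\<oplus>eps x\<odot>\<one>)" using fx by (simp add: a_minus_def a_assoc l_neg)
  also have "... = \<theta> (f x\<ominus>eps x\<odot>\<one>)\<oplus>\<theta> (eps x\<odot>\<one>)" using fx by (intro linD(2)[OF lth]) auto
  also have "... = un x" using ker[OF I] linD(3)[OF lth one_closed] th1 by (simp add: un_def)
  finally have t: "\<theta> (f x) = un x" .
  show "(f\<star>(%x. S (\<pi> (f x)))) x = un x"
  proof (rule lf_eqI)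
   fix l assume l: "lf A l"
   show "l ((f\<star>(%x. S (\<pi> (f x)))) x) = l (un x)"
    unfolding t[symmetric] lf\<theta>[OF l fx] point_sw[OF f bil_mult[OF l lin_id lSp]] by (rule lf_cv[OF l v(1,3)])
  qed (use cv_closed[OF v(1,3)] in auto)
 qed
 then have "(%x. S (f x)) = (%x. S (\<pi> (f x)))" by (rule cv_inverse_unique[OF v(2,1,3) S_left[OF f]])
 then have "S (f c)\<in>B" using hsD(4)[OF B p(1)] f by (metis point_vals)
 then have "S (S (f c))\<in>B" by (rule hsD(4)[OF B])
 then show ?thesis using f by simp
qed

section \<open>Huq commuting subobjects\<close>

text \<open>
  A family of projections determines the decomposition; this avoids choosing representatives when
  subspaces and quotients are graded.
\<close>

lemma graded_spaceI:
 fixes V :: "('k::field, 'g::ab_group_add, 'a, 'm) graded_module_scheme" (structure)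
 assumes V: "kspace V" and s: "\<And>g. subsp V (homog V g)" and P: "\<And>g. lin V V (P g)"
  "\<And>g v. v\<in>carrier V ==> P g v\<in>homog V g" "\<And>g h v. v\<in>homog V h ==> P g v = (if g = h then v else \<zero>)"
  and f: "\<And>v. v\<in>carrier V ==> \<exists>H. finite H\<and>(\<forall>g. g \<notin> H\<longrightarrow>P g v = \<zero>)\<and>(\<forall>l. lf V l\<longrightarrow>l v = (\<Sum>g\<in>H. l (P g v)))"
 shows "graded_space V" "v\<in>carrier V ==> component V v = (%g. P g v)"
proof -
 interpret kspace V by fact
 have lfs: "l (\<Oplus>x\<in>S. F x) = (\<Sum>x\<in>S. l (F x))" if "lf V l" "finite S" "\<And>x. x\<in>S ==> F x\<in>carrier V" for l S and F :: "'g => _"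
  using that(2,3) by (induction S) (auto simp: lf_zero[OF that(1)] lfD(1)[OF that(1)])
 have hc: "x\<in>carrier V" if "x\<in>homog V g" for x g using subspD(1)[OF s that] .
 have ex: "decomposition V v (%g. P g v)" if v: "v\<in>carrier V" for v
 proof -
  obtain H where H: "finite H" "\<And>g. g \<notin> H ==> P g v = \<zero>" "\<And>l. lf V l ==> l v = (\<Sum>g\<in>H. l (P g v))" using f[OF v] by blast
  have sub: "{g. P g v \<noteq> \<zero>}\<subseteq>H" using H(2) by auto
  then have fin: "finite {g. P g v \<noteq> \<zero>}" using H(1) finite_subset by blast
  have "v = (\<Oplus>g\<in>{g. P g v \<noteq> \<zero>}. P g v)"
  proof (rule lf_eqI[OF v])
   show "(\<Oplus>g\<in>{g. P g v \<noteq> \<zero>}. P g v)\<in>carrier V" using hc P(2) v by (intro finsum_closed) auto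
   fix l assume l: "lf V l"
   have "l v = (\<Sum>g\<in>{g. P g v \<noteq> \<zero>}. l (P g v))"
    unfolding H(3)[OF l] using sub H(1) by (intro sum.mono_neutral_right) (auto simp: lf_zero[OF l])
   also have "... = l (\<Oplus>g\<in>{g. P g v \<noteq> \<zero>}. P g v)" using hc P(2) v fin by (intro lfs[OF l, symmetric]) auto
   finally show "l v = l (\<Oplus>g\<in>{g. P g v \<noteq> \<zero>}. P g v)" .
  qed
  then show ?thesis using P(2)[OF v] fin by (simp add: decomposition_def)
 qed
 have uniq: "c = (%g. P g v)" if c: "decomposition V v c" for v c
 proof
  fix h
  have c': "\<And>g. c g\<in>homog V g" "finite {g. c g \<noteq> \<zero>}" "v = (\<Oplus>g\<in>{g. c g \<noteq> \<zero>}. c g)" using c by (auto simp: decomposition_def)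
  have vc: "v\<in>carrier V" unfolding c'(3) using hc c'(1) by (intro finsum_closed) auto
  show "c h = P h v"
  proof (rule lf_eqI)
   fix l assume l: "lf V l"
   have "l (P h v) = (\<Sum>g\<in>{g. c g \<noteq> \<zero>}. l (P h (c g)))"
    unfolding c'(3) using hc c'(1,2) by (intro lfs lf_lin[OF l P(1)]) auto
   also have "... = (\<Sum>g\<in>{g. c g \<noteq> \<zero>}. if h = g then l (c h) else 0)"
    by (intro sum.cong refl) (auto simp: P(3)[OF c'(1)] lf_zero[OF l])
   also have "... = l (c h)" using c'(2) by (auto simp: lf_zero[OF l])
   finally show "l (c h) = l (P h v)" by simp
  qed (use hc[OF c'(1)] hc[OF P(2)] vc in auto)
 qed
 show "graded_space V"
  unfolding graded_space_def graded_space_axioms_def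
 proof (intro conjI allI impI)
  show "module ring_of_type_algebra V" by (rule module_axioms)
  show "submodule (homog V g) ring_of_type_algebra V" for g using s subsp_submodule by simp
  show "\<exists>!c. decomposition V v c" if "v\<in>carrier V" for v 
   using ex[OF that] uniq[of v] by (intro ex1I[of _ "%g. P g v"]) blast+
 qed
 show "component V v = (%g. P g v)" if "v\<in>carrier V"
  unfolding component_def by (rule the_equality[of "decomposition V v" "%g. P g v", OF ex[OF that] uniq])
qed

lemma (in kspace2) tform_cong:
 assumes t: "t\<in>carrier T" and e: "\<And>v w. v\<in>carrier V ==> w\<in>carrier W ==> b v w = c v w"
 shows "tform b t = tform c t"
proof -
 obtain f where "f\<in>t" using T_obtain[OF t] by metis
 then have "ok (SOME f. f\<in>t)" using rep_ok[OF t someI[of "%f. f\<in>t" f]] by blast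
 then show ?thesis unfolding tform_def using e by (intro pair2_cong) auto
qed

lemma tensor_rel_mono:
 fixes V :: "('k::field, 'a, 'm) module_scheme" and V' :: "('k, 'a, 'n) module_scheme"
 assumes c: "carrier V'\<subseteq>carrier V" and e: "ring.add V' = ring.add V" "module.smult V' = module.smult V"
 shows "tensor_rel V' V'\<subseteq>tensor_rel V V"
proof
 fix r assume "r\<in>tensor_rel V' V'"
 then show "r\<in>tensor_rel V V"
  by (induction rule: tensor_rel.induct) (use c in \<open>auto simp: e intro: tensor_rel.intros\<close>)
qed

text \<open>
  The part of the structure of a color Hopf algebra on which Huq commutation depends.
\<close>

locale cbialg = graded_algebra Q
 for \<phi> :: "'g::ab_group_add => 'g => 'k::field" and Q :: "('k, 'g, 'a, 'm) hopf_scheme" (structure) +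
 assumes phi00: "\<phi> 0 0 = 1"
  and comult_lin: "lin Q (tensor_space Q Q) (comult Q)"
  and comult_mult: "a\<in>carrier Q ==> b\<in>carrier Q ==>
   comult Q (a\<otimes>b) = comult Q a\<otimes>\<^bsub>color_tensor \<phi> Q Q\<^esub>comult Q b"
  and lf_counit: "lf Q (counit Q)"
  and counit_mult: "a\<in>carrier Q ==> b\<in>carrier Q ==> counit Q (a\<otimes>b) = counit Q a * counit Q b"

sublocale cbialg\<subseteq>QQ: galg2 Q Q ..

context cbialg begin

text \<open>
  A graded subbialgebra, so that its \<open>subobject\<close> has a coproduct.
\<close>

definition sba :: "'a set => bool" where
 "sba W\<longleftrightarrow>graded_subspace Q W\<and>\<one>\<in>W\<and>(\<forall>x\<in>W. \<forall>y\<in>W. x\<otimes>y\<in>W)\<and>(\<forall>x\<in>W. \<exists>f\<in>comult Q x. keys f\<subseteq>W\<times>W)"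

lemma sub_simps: "carrier (subobject Q W) = W" "ring.add (subobject Q W) = ring.add Q" "ring.zero (subobject Q W) = \<zero>"
 "monoid.mult (subobject Q W) = monoid.mult Q" "monoid.one (subobject Q W) = \<one>" "module.smult (subobject Q W) = module.smult Q"
 "homog (subobject Q W) g = homog Q g\<inter>W" "counit (subobject Q W) = counit Q"
 by (simp_all add: subobject_def)

lemma sub_kspace: "subsp Q W ==> kspace (subobject Q W)"
 unfolding kspace_def
proof (rule moduleI)
 assume W: "subsp Q W"
 note c = subspD(1)[OF W]
 show "cring (ring_of_type_algebra :: 'k ring)" by (rule cring_from_type_algebra)
 show "abelian_group (subobject Q W)"
 proof (rule abelian_groupI)
  fix x assume "x\<in>carrier (subobject Q W)"
  then have "x\<in>W" by (simp add: sub_simps)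
  then have "(-1)\<odot>x\<in>W" "(-1)\<odot>x\<oplus>x = \<zero>"
   using subspD(4)[OF W] c neg_smult[of x] l_neg[of x] by auto
  then show "\<exists>y\<in>carrier (subobject Q W). y\<oplus>\<^bsub>subobject Q W\<^esub>x = \<zero>\<^bsub>subobject Q W\<^esub>" by (auto simp: sub_simps)
 qed (use W c in \<open>auto simp: sub_simps subspD a_ac\<close>)
qed (use subspD[of Q W] in \<open>auto simp: sub_simps smult_addl smult_addr smult_smult\<close>)

lemma lin_sub: "lin Q P h ==> subsp Q W ==> lin (subobject Q W) P h"
 using subspD(1)[of Q W] by (auto simp: lin_def sub_simps)

lemma lf_sub: "lf Q l ==> subsp Q W ==> lf (subobject Q W) l"
 using subspD(1)[of Q W] by (auto simp: lf_def sub_simps)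

lemma sub_algebra:
 assumes W: "sba W" shows "graded_algebra (subobject Q W)"
proof -
 let ?M = "subobject Q W"
 have g: "graded_subspace Q W" and s: "subsp Q W" and cW: "\<And>x g. x\<in>W ==> component Q x g\<in>W"
  and 1: "\<one>\<in>W" and m: "\<And>x y. x\<in>W ==> y\<in>W ==> x\<otimes>y\<in>W"
  using W by (auto simp: sba_def gsub_subsp)
 note c = subspD(1)[OF s]
 interpret M: kspace ?M by (rule sub_kspace[OF s])
 have gz: "graded_subspace Q {\<zero>}" by (auto simp: gsub_subsp subsp_zero comp_homog[OF zero_homog])
 obtain p where p: "gr p" "\<And>v. v\<in>W ==> p v = v" "\<And>v. v\<in>carrier Q ==> p v\<in>W"
  using retraction[OF g gz] by blast
 have M: "graded_space ?M"
 proof (rule graded_spaceI(1)[where P = "%g v. component Q v g"])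
  show "kspace ?M" by (rule M.kspace_axioms)
  show "subsp ?M (homog ?M g)" for g
   using subsp_Int[OF homog_subsp s, of g] by (auto simp: subsp_def sub_simps)
  show "lin ?M ?M (%v. component Q v g)" for g
   using linD[OF lin_comp_g[of g]] c cW by (intro linI) (auto simp: sub_simps)
  show "component Q v g\<in>homog ?M g" if "v\<in>carrier ?M" for g v using that c cW by (auto simp: sub_simps)
  show "component Q v g = (if g = h then v else \<zero>\<^bsub>?M\<^esub>)" if "v\<in>homog ?M h" for g h v
   using that by (auto simp: sub_simps comp_homog)
  fix v assume "v\<in>carrier ?M"
  then have v: "v\<in>W" "v\<in>carrier Q" using c by (auto simp: sub_simps)
  have "l v = (\<Sum>g\<in>degrees Q v. l (component Q v g))" if l: "lf ?M l" for l
  proof -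
   have "lin Q ?M p" using linD[OF grD(1)[OF p(1)]] p(3) by (intro linI) (auto simp: sub_simps)
   then have "lf Q (%v. l (p v))" by (rule lf_lin[OF l])
   from lf_comp_sum[OF this v(2)] show ?thesis using v(1) cW p(2) by simp
  qed
  then show "\<exists>H. finite H\<and>(\<forall>g. g \<notin> H\<longrightarrow>component Q v g = \<zero>\<^bsub>?M\<^esub>)\<and>(\<forall>l. lf ?M l\<longrightarrow>l v = (\<Sum>g\<in>H. l (component Q v g)))"
   using v by (intro exI[of _ "degrees Q v"]) (auto simp: degrees_def[of Q v] sub_simps finite_degrees[unfolded degrees_def])
 qed
 have R: "ring ?M"
 proof (rule ringI)
  show "abelian_group ?M" by (rule M.abelian_group_axioms)
  show "monoid ?M" by (rule monoidI) (use 1 m c in \<open>auto simp: sub_simps m_assoc\<close>)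
 qed (use c in \<open>auto simp: sub_simps l_distr r_distr\<close>)
 show ?thesis
  unfolding graded_algebra_def graded_algebra_axioms_def
 proof (intro conjI M R allI impI)
  fix a b e assume "a\<in>carrier ?M" "b\<in>carrier ?M"
  then have "a\<in>carrier Q" "b\<in>carrier Q" using c by (auto simp: sub_simps)
  then show "(e\<odot>\<^bsub>?M\<^esub>a)\<otimes>\<^bsub>?M\<^esub>b = e\<odot>\<^bsub>?M\<^esub>(a\<otimes>\<^bsub>?M\<^esub>b)" "a\<otimes>\<^bsub>?M\<^esub>(e\<odot>\<^bsub>?M\<^esub>b) = e\<odot>\<^bsub>?M\<^esub>(a\<otimes>\<^bsub>?M\<^esub>b)"
   by (simp_all add: sub_simps smult_mult_left smult_mult_right)
 qed (use 1 m homog_one homog_mult in \<open>auto simp: sub_simps\<close>)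
qed

text \<open>
  The representative chosen in \<open>subobject\<close> also represents the coproduct of the ambient algebra, because
  relations over a subspace are relations over the whole space.
\<close>

lemma sub_comult:
 assumes W: "sba W" and x: "x\<in>W"
 shows "comult (subobject Q W) x\<in>carrier (tensor_space (subobject Q W) (subobject Q W))"
  and "f\<in>comult (subobject Q W) x ==> f\<in>comult Q x\<and>keys f\<subseteq>W\<times>W"
proof -
 let ?M = "subobject Q W" and ?N = "Q\<lparr>carrier := W\<rparr>"
 let ?f = "SOME f. f\<in>comult Q x\<and>keys f\<subseteq>W\<times>W"
 have "\<exists>f. f\<in>comult Q x\<and>keys f\<subseteq>W\<times>W" using W x by (auto simp: sba_def)
 then have f: "?f\<in>comult Q x" "keys ?f\<subseteq>W\<times>W" using someI_ex[of "%f. f\<in>comult Q x\<and>keys f\<subseteq>W\<times>W"] by blast+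
 have s: "subsp Q W" using W by (simp add: sba_def gsub_subsp)
 interpret M: kspace2 ?M ?M using sub_kspace[OF s] by (simp add: kspace2_def)
 have "tensor_rel ?N ?N = tensor_rel ?M ?M"
  by (intro equalityI tensor_rel_mono) (simp_all add: sub_simps)
 then have cl: "tensor_class ?N ?N g = M.cl g" for g by (simp add: tensor_class_def)
 have "comult ?M x = tensor_class ?N ?N ?f" unfolding subobject_def by simp
 then have eq: "comult ?M x = M.cl ?f" unfolding cl .
 show "comult ?M x\<in>carrier M.T" unfolding eq using f(2) by (intro M.cl_in) (simp add: sub_simps)
 assume g: "f\<in>comult ?M x"
 have xc: "x\<in>carrier Q" using x subspD(1)[OF s] by simp
 have "f - ?f\<in>tensor_rel ?M ?M" using g by (simp add: eq M.cl_mem)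
 then have "f - ?f\<in>tensor_rel Q Q" using tensor_rel_mono[of ?M Q] subspD(1)[OF s] by (auto simp: sub_simps)
 then have "f\<in>QQ.AB.cl ?f" by (simp add: QQ.AB.cl_mem)
 moreover have "QQ.AB.cl ?f = comult Q x" using QQ.AB.rep_ok[OF linD(1)[OF comult_lin xc] f(1)] by simp
 ultimately show "f\<in>comult Q x\<and>keys f\<subseteq>W\<times>W"
  using M.rep_ok[of "comult ?M x" f] g M.cl_in[of ?f] f(2) by (simp add: eq sub_simps)
qed

end

context cbialg begin

text \<open>
  In \<open>U \<otimes> V\<close> one has \<open>(1 \<otimes> y)(x \<otimes> 1) = \<phi>(|y|, |x|) x \<otimes> y\<close> and \<open>(x \<otimes> 1)(1 \<otimes> y) = x \<otimes> y\<close>; apply the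
  morphism.
\<close>

lemma huq_commute_commutes:
 assumes U: "sba U" and V: "sba V" and H: "huq_commute \<phi> Q U V"
  and x: "x\<in>U" "x\<in>homog Q h" and y: "y\<in>V" "y\<in>homog Q g"
 shows "y\<otimes>x = \<phi> g h\<odot>(x\<otimes>y)"
proof -
 let ?M = "subobject Q U" and ?N = "subobject Q V"
 let ?T = "hopf_tensor \<phi> ?M ?N"
 interpret M: graded_algebra ?M by (rule sub_algebra[OF U])
 interpret N: graded_algebra ?N by (rule sub_algebra[OF V])
 interpret MN: galg2 ?M ?N ..
 have Ts: "carrier ?T = carrier MN.AB.T" "monoid.mult ?T = monoid.mult (MN.CT \<phi>)" "module.smult ?T = module.smult MN.AB.T"
  by (simp_all add: hopf_tensor_def Let_def hopf.defs graded_module.defs MN.CT_simps)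
 obtain p where p: "hopf_hom ?T Q p" "\<And>x. x\<in>U ==> p (tens ?M ?N x \<one>) = x" "\<And>y. y\<in>V ==> p (tens ?M ?N \<one> y) = y"
  using H by (auto simp: huq_commute_def)
 have pm: "p (s\<otimes>\<^bsub>MN.CT \<phi>\<^esub>t) = p s\<otimes>p t" if "s\<in>carrier MN.AB.T" "t\<in>carrier MN.AB.T" for s t
  using p(1) that by (auto simp: hopf_hom_def Ts)
 have ps: "p (c\<odot>\<^bsub>MN.AB.T\<^esub>s) = c\<odot>p s" if "s\<in>carrier MN.AB.T" for s c
  using p(1) that by (auto simp: hopf_hom_def graded_linear_def Ts)
 have h: "x\<in>homog ?M h" "y\<in>homog ?N g" "\<one>\<in>homog ?M 0" "\<one>\<in>homog ?N 0"
  using x y U V homog_one by (auto simp: sub_simps sba_def)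
 have c: "x\<in>carrier ?M" "y\<in>carrier ?N" "\<one>\<in>carrier ?M" "\<one>\<in>carrier ?N" using h by blast+
 have xc: "x\<in>carrier Q" "y\<in>carrier Q" using x y by auto
 have "y\<otimes>x = p (tens ?M ?N \<one> y)\<otimes>p (tens ?M ?N x \<one>)" using p x y by simp
 also have "... = p (MN.Q4 \<phi> \<one> y x \<one>)" using c pm by (simp flip: MN.CT_mult_tens)
 also have "... = \<phi> g h\<odot>p (tens ?M ?N x y)"
  using MN.Q4_homog[OF c(3) h(2,1) c(4)] ps c xc by (simp add: sub_simps)
 also have "p (tens ?M ?N x y) = p (MN.Q4 \<phi> x \<one> \<one> y)"
  using MN.Q4_homog[OF c(1) h(4,3) c(2), of \<phi>] c xc phi00 by (simp add: sub_simps MN.AB.T.smult_1)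
 also have "... = p (tens ?M ?N x \<one>)\<otimes>p (tens ?M ?N \<one> y)" using c pm by (simp flip: MN.CT_mult_tens)
 also have "... = x\<otimes>y" using p x y by simp
 finally show ?thesis .
qed

text \<open>
  The morphism is \<open>x \<otimes> y \<mapsto> xy\<close>. It is multiplicative by the commutation rule, and it respects the
  coproducts because \<open>\<Delta>(xy) = \<Delta>(x)\<Delta>(y)\<close> carries the same color factor as the coproduct of \<open>U \<otimes> V\<close>.
\<close>

lemma huq_commuteI:
 assumes U: "sba U" and V: "sba V"
  and H: "\<And>g h x y. x\<in>U ==> x\<in>homog Q h ==> y\<in>V ==> y\<in>homog Q g ==> y\<otimes>x = \<phi> g h\<odot>(x\<otimes>y)"
 shows "huq_commute \<phi> Q U V"
proof -
 let ?M = "subobject Q U" and ?N = "subobject Q V"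
 let ?T = "hopf_tensor \<phi> ?M ?N"
 interpret M: graded_algebra ?M by (rule sub_algebra[OF U])
 interpret N: graded_algebra ?N by (rule sub_algebra[OF V])
 interpret MN: galg2 ?M ?N ..
 have sU: "subsp Q U" "\<And>x. x\<in>U ==> x\<in>carrier Q" "\<one>\<in>U" and sV: "subsp Q V" "\<And>x. x\<in>V ==> x\<in>carrier Q" "\<one>\<in>V"
  using U V subspD(1) by (auto simp: sba_def gsub_subsp)
 let ?C = "MN.CT \<phi>"
 let ?TC = "tensor_space ?C ?C"
 interpret C: kspace ?C by (rule MN.CT_kspace)
 interpret CC: kspace2 ?C ?C ..
 define p where "p = tensor_lift Q (\<otimes>)"
 have pb: "bilin ?M ?N Q (\<otimes>)"
  using sU sV by (intro bilinI lin_sub bilinD[OF mult_bilin]) (auto simp: sub_simps)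
 have lp: "lin MN.AB.T Q p" unfolding p_def by (rule MN.AB.lin_tensor_lift[OF kspace_axioms pb])
 have pt: "p (tens ?M ?N x y) = x\<otimes>y" if "x\<in>U" "y\<in>V" for x y
  unfolding p_def using MN.AB.tensor_lift_tens[OF kspace_axioms pb, of x y] that by (simp add: sub_simps)
 have lfp: "l (p t) = pair2 f (%a b. l (a\<otimes>b))" if "lf Q l" "t\<in>carrier MN.AB.T" "f\<in>t" for l t f
  unfolding p_def using MN.AB.lf_tensor_lift[OF kspace_axioms bilin_closed[OF pb] that(2,1)]
   MN.AB.tform_rep[OF bil_lf[OF pb that(1)] that(3,2)] by (rule trans)
 have Cl: "lin V' ?C f\<longleftrightarrow>lin V' MN.AB.T f" "lin ?C W' f'\<longleftrightarrow>lin MN.AB.T W' f'" for V' :: "('k, 'z, 'x) module_scheme" and f and W' :: "('k, 'z2, 'x2) module_scheme" and f'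
  by (simp_all add: lin_def MN.CT_simps)
 have Ts: "carrier ?T = carrier MN.AB.T" "monoid.mult ?T = monoid.mult ?C" "module.smult ?T = module.smult MN.AB.T"
  "ring.add ?T = ring.add MN.AB.T" "homog ?T = homog MN.AB.T" "monoid.one ?T = tens ?M ?N \<one> \<one>"
  by (simp_all add: hopf_tensor_def Let_def hopf.defs graded_module.defs MN.CT_simps sub_simps)
 have gl: "graded_linear ?T Q p"
  unfolding graded_linear_def Ts
 proof (intro conjI allI subsetI)
  fix g z assume "z\<in>p ` homog MN.AB.T g"
  then obtain f where f: "keys f\<subseteq>(\<Union>h. homog ?M h\<times>homog ?N (g - h))" "z = p (MN.AB.cl f)"
   unfolding MN.AB.T_simps by auto
  have ok: "MN.AB.ok f" using f(1) by auto
  show "z\<in>homog Q g"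
  proof (rule lf_subspI[OF homog_subsp])
   show "z\<in>carrier Q" unfolding f(2) by (rule linD(1)[OF lp MN.AB.cl_in[OF ok]])
   fix l assume l: "lf Q l" and z: "\<And>x. x\<in>homog Q g ==> l x = 0"
   have "l z = pair2 f (%a b. l (a\<otimes>b))"
    unfolding f(2) by (rule lfp[OF l MN.AB.cl_in[OF ok] MN.AB.cl_self])
   also have "... = pair2 f (%a b. 0)"
   proof (rule pair2_cong)
    fix a b assume "(a, b)\<in>keys f"
    then obtain h where "a\<in>homog Q h" "b\<in>homog Q (g - h)" using f(1) by (auto simp: sub_simps)
    from homog_mult[OF this] show "l (a\<otimes>b) = 0" using z by simp
   qed
   finally show "l z = 0" by (simp add: pair2_def)
  qed
 qed (use linD[OF lp] in auto)
 have mult: "p (s\<otimes>\<^bsub>?C\<^esub>t) = p s\<otimes>p t" if s: "s\<in>carrier MN.AB.T" and t: "t\<in>carrier MN.AB.T" for s t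
 proof (rule lf_eqI)
  note pc = linD(1)[OF lp s] linD(1)[OF lp t]
  show "p (s\<otimes>\<^bsub>?C\<^esub>t)\<in>carrier Q" by (rule linD(1)[OF lp MN.CT_mult_closed[OF s t]])
  show "p s\<otimes>p t\<in>carrier Q" using pc by simp
  fix l assume l: "lf Q l"
  obtain f g where f: "MN.AB.ok f" "f\<in>s" and g: "MN.AB.ok g" "g\<in>t"
   using MN.AB.T_obtain[OF s] MN.AB.T_obtain[OF t] by metis
  have lr: "lf Q (%x. l (x\<otimes>c))" "lf Q (%x. l (c\<otimes>x))" if "c\<in>carrier Q" for c
   using that by (auto intro: lf_lin[OF l] bilinD[OF mult_bilin])
  note L = lf_lin[OF l lp]
  have "l (p (s\<otimes>\<^bsub>?C\<^esub>t)) = pair2 f (%a b. pair2 g (%a' b'. l (p (MN.Q4 \<phi> a b a' b'))))"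
   by (rule MN.lf_CT_mult[OF L s t f(2) g(2)])
  also have "... = pair2 f (%a b. pair2 g (%a' b'. l ((a\<otimes>b)\<otimes>(a'\<otimes>b'))))"
  proof (intro pair2_cong)
   fix a b a' b' assume "(a, b)\<in>keys f" "(a', b')\<in>keys g"
   then have c: "a\<in>carrier ?M" "b\<in>carrier ?N" "a'\<in>carrier ?M" "b'\<in>carrier ?N" using f g by auto
   then have cQ: "a\<in>carrier Q" "b\<in>carrier Q" "a'\<in>carrier Q" "b'\<in>carrier Q" using sU sV by (auto simp: sub_simps)
   show "l (p (MN.Q4 \<phi> a b a' b')) = l ((a\<otimes>b)\<otimes>(a'\<otimes>b'))"
   proof (rule MN.BA.bil_hset_eq[OF bil_lf[OF MN.Q4_mid[OF c(1,4)] L] _ _ c(2,3)])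
    have bb: "bil Q Q (%b a'. l ((a\<otimes>b)\<otimes>(a'\<otimes>b')))"
    proof (rule bilI)
     show "lf Q (%a'. l ((a\<otimes>b)\<otimes>(a'\<otimes>b')))" if "b\<in>carrier Q" for b
      using that cQ by (intro lf_lin[OF lr(2)] bilinD[OF mult_bilin]) auto
     show "lf Q (%b. l ((a\<otimes>b)\<otimes>(a'\<otimes>b')))" if "a'\<in>carrier Q" for a'
      using that cQ by (intro lf_lin[OF lr(1)] bilinD[OF mult_bilin]) auto
    qed
    show "bil ?N ?M (%b a'. l ((a\<otimes>b)\<otimes>(a'\<otimes>b')))"
     using bilD[OF bb] sU sV by (intro bilI lf_sub) (auto simp: sub_simps)
    fix b a' assume "b\<in>hset ?N" "a'\<in>hset ?M"
    then obtain g h where h: "b\<in>homog ?N g" "a'\<in>homog ?M h" by (auto simp: hset_def)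
    then have hQ: "b\<in>homog Q g" "b\<in>V" "b\<in>carrier Q" "a'\<in>homog Q h" "a'\<in>U" "a'\<in>carrier Q" by (auto simp: sub_simps)
    have "p (MN.Q4 \<phi> a b a' b') = \<phi> g h\<odot>p (tens ?M ?N (a\<otimes>a') (b\<otimes>b'))"
     using MN.Q4_homog[OF c(1) h c(4), of \<phi>] linD(3)[OF lp, of "tens ?M ?N (a\<otimes>a') (b\<otimes>b')"] c h hQ U V
     by (simp add: sub_simps sba_def)
    also have "... = \<phi> g h\<odot>((a\<otimes>a')\<otimes>(b\<otimes>b'))"
     using pt c hQ U V by (simp add: sub_simps sba_def)
    also have "... = a\<otimes>(\<phi> g h\<odot>(a'\<otimes>b))\<otimes>b'"
     using cQ hQ by (simp add: smult_mult_left smult_mult_right m_assoc)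
    also have "... = (a\<otimes>b)\<otimes>(a'\<otimes>b')"
     using cQ hQ by (simp add: H[OF hQ(5,4,2,1), symmetric] m_assoc)
    finally show "l (p (MN.Q4 \<phi> a b a' b')) = l ((a\<otimes>b)\<otimes>(a'\<otimes>b'))" by simp
   qed
  qed
  also have "... = pair2 f (%a b. l ((a\<otimes>b)\<otimes>p t))"
  proof (rule pair2_cong)
   fix a b assume "(a, b)\<in>keys f"
   then have "a\<otimes>b\<in>carrier Q" using f sU sV by (auto simp: sub_simps)
   from lfp[OF lr(2)[OF this] t g(2)]
   show "pair2 g (%a' b'. l ((a\<otimes>b)\<otimes>(a'\<otimes>b'))) = l ((a\<otimes>b)\<otimes>p t)" by simp
  qed
  also have "... = l (p s\<otimes>p t)" using lfp[OF lr(1)[OF pc(2)] s f(2)] by simp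
  finally show "l (p (s\<otimes>\<^bsub>?C\<^esub>t)) = l (p s\<otimes>p t)" .
 qed
 let ?TQ = "tensor_space Q Q"
 let ?tm = "tensor_map Q Q p p"
 have tb: "bilin ?C ?C ?TQ (%s t. tens Q Q (p s) (p t))"
  using linD(1)[OF lp] by (intro bilinI) (auto simp: Cl MN.CT_simps intro!: lin_comp[OF _ lp] bilinD[OF QQ.AB.tens_bilin])
 have ltm: "lin ?TC ?TQ ?tm" unfolding tensor_map_def by (rule CC.lin_tensor_lift[OF QQ.AB.T_kspace tb])
 define CE where "CE = (%a1 b2. color_ext \<phi> ?M ?N ?TC (%a2 b1. tens ?C ?C (tens ?M ?N a1 b1) (tens ?M ?N a2 b2)))"
 have ceb: "bilin ?M ?N ?TC (%a2 b1. tens ?C ?C (tens ?M ?N a1 b1) (tens ?M ?N a2 b2))"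
  if "a1\<in>carrier ?M" "b2\<in>carrier ?N" for a1 b2
  using that
  by (intro bilinI lin_comp[OF bilinD(1)[OF CC.tens_bilin]] lin_comp[OF bilinD(2)[OF CC.tens_bilin]])
   (auto simp: Cl MN.CT_simps intro: bilinD[OF MN.AB.tens_bilin])
 note CEb = MN.AB.color_ext_bilin[OF CC.T_kspace ceb]
 define Xf where "Xf = (%a b. tensor_lift ?TC (%a1 a2. tensor_lift ?TC (%b1 b2. CE a1 b2 a2 b1) (comult ?N b)) (comult ?M a))"
 interpret MM: kspace2 ?M ?M ..
 interpret NN: kspace2 ?N ?N ..
 note cM = sub_comult[OF U] and cN = sub_comult[OF V]
 have inc: "tensor_lift ?TC (%b1 b2. CE a1 b2 a2 b1) (comult ?N b)\<in>carrier ?TC"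
  if "a1\<in>carrier ?M" "a2\<in>carrier ?M" "b\<in>V" for a1 a2 b
  using that unfolding CE_def by (intro NN.tensor_lift_closed[OF CC.T_kspace _ cN(1)] bilin_closed[OF CEb]) auto
 have Xc: "Xf a b\<in>carrier ?TC" if "a\<in>U" "b\<in>V" for a b
  unfolding Xf_def using that by (intro MM.tensor_lift_closed[OF CC.T_kspace _ cM(1)] inc) auto
 have key: "l (?tm (Xf a b)) = l (comult Q (a\<otimes>b))" if l: "lf ?TQ l" and a: "a\<in>U" and b: "b\<in>V" for l a b
 proof -
  note L = lf_lin[OF l ltm]
  note ac = sU(2)[OF a] and bc = sV(2)[OF b]
  let ?f = "SOME f. f\<in>comult ?M a" and ?g = "SOME f. f\<in>comult ?N b"
  have "?f\<in>comult ?M a" "?g\<in>comult ?N b"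
   using MM.T_obtain[OF cM(1)[OF a]] NN.T_obtain[OF cN(1)[OF b]] by (metis someI)+
  then have f: "?f\<in>comult Q a" "keys ?f\<subseteq>U\<times>U" and g: "?g\<in>comult Q b" "keys ?g\<subseteq>V\<times>V"
   using cM(2)[OF a] cN(2)[OF b] by blast+
  have "l (?tm (Xf a b)) = pair2 ?f (%a1 a2. l (?tm (tensor_lift ?TC (%b1 b2. CE a1 b2 a2 b1) (comult ?N b))))"
   unfolding Xf_def using MM.lf_tensor_lift[OF CC.T_kspace inc[OF _ _ b] cM(1)[OF a] L] by (simp add: tform_def)
  also have "... = pair2 ?f (%a1 a2. pair2 ?g (%b1 b2. l (QQ.Q4 \<phi> a1 a2 b1 b2)))"
  proof (rule pair2_cong)
   fix a1 a2 assume "(a1, a2)\<in>keys ?f"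
   then have aa: "a1\<in>U" "a2\<in>U" using f(2) by auto
   have "l (?tm (tensor_lift ?TC (%b1 b2. CE a1 b2 a2 b1) (comult ?N b))) = pair2 ?g (%b1 b2. l (?tm (CE a1 b2 a2 b1)))"
    using NN.lf_tensor_lift[OF CC.T_kspace _ cN(1)[OF b] L, of "%b1 b2. CE a1 b2 a2 b1"] aa bilin_closed[OF CEb]
    by (simp add: tform_def CE_def sub_simps)
   also have "... = pair2 ?g (%b1 b2. l (QQ.Q4 \<phi> a1 a2 b1 b2))"
   proof (rule pair2_cong)
    fix b1 b2 assume "(b1, b2)\<in>keys ?g"
    then have bb: "b1\<in>V" "b2\<in>V" using g(2) by auto
    have c: "a1\<in>carrier ?M" "b2\<in>carrier ?N" "a2\<in>carrier ?M" "b1\<in>carrier ?N" using aa bb by (auto simp: sub_simps)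
    have cQ: "a1\<in>carrier Q" "b2\<in>carrier Q" using aa bb sU sV by auto
    show "l (?tm (CE a1 b2 a2 b1)) = l (QQ.Q4 \<phi> a1 a2 b1 b2)"
    proof (rule MN.AB.bil_hset_eq[OF _ _ _ c(3,4)])
     show "bil ?M ?N (%a2 b1. l (?tm (CE a1 b2 a2 b1)))" unfolding CE_def by (rule bil_lf[OF CEb[OF c(1,2)] L])
     show "bil ?M ?N (%a2 b1. l (QQ.Q4 \<phi> a1 a2 b1 b2))"
      using bilD[OF bil_lf[OF QQ.Q4_mid[OF cQ] l]] sU sV by (intro bilI lf_sub) (auto simp: sub_simps)
     fix a2 b1 assume "a2\<in>hset ?M" "b1\<in>hset ?N"
     then obtain g h where h: "a2\<in>homog ?M g" "b1\<in>homog ?N h" by (auto simp: hset_def)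
     then have hQ: "a2\<in>homog Q g" "a2\<in>U" "b1\<in>homog Q h" "b1\<in>V" by (auto simp: sub_simps)
     have tc: "tens ?M ?N a1 b1\<in>carrier ?C" "tens ?M ?N a2 b2\<in>carrier ?C" using c h by (auto simp: MN.CT_simps)
     have "?tm (CE a1 b2 a2 b1) = \<phi> g h\<odot>\<^bsub>?TQ\<^esub>?tm (tens ?C ?C (tens ?M ?N a1 b1) (tens ?M ?N a2 b2))"
      unfolding CE_def MN.AB.color_ext_homog[OF CC.T_kspace ceb[OF c(1,2)] h] using tc by (intro linD(3)[OF ltm]) auto
     also have "?tm (tens ?C ?C (tens ?M ?N a1 b1) (tens ?M ?N a2 b2)) = tens Q Q (a1\<otimes>b1) (a2\<otimes>b2)"
      unfolding tensor_map_def CC.tensor_lift_tens[OF QQ.AB.T_kspace tb tc] using aa bb hQ by (simp add: pt)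
     also have "\<phi> g h\<odot>\<^bsub>?TQ\<^esub>tens Q Q (a1\<otimes>b1) (a2\<otimes>b2) = QQ.Q4 \<phi> a1 a2 b1 b2"
      by (rule QQ.Q4_homog[OF cQ(1) hQ(1,3) cQ(2), symmetric])
     finally show "l (?tm (CE a1 b2 a2 b1)) = l (QQ.Q4 \<phi> a1 a2 b1 b2)" by simp
    qed
   qed
   finally show "l (?tm (tensor_lift ?TC (%b1 b2. CE a1 b2 a2 b1) (comult ?N b))) = pair2 ?g (%b1 b2. l (QQ.Q4 \<phi> a1 a2 b1 b2))" .
  qed
  also have "... = l (comult Q (a\<otimes>b))"
   unfolding comult_mult[OF ac bc]
   by (rule QQ.lf_CT_mult[OF l linD(1)[OF comult_lin ac] linD(1)[OF comult_lin bc] f(1) g(1), symmetric])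
  finally show ?thesis .
 qed
 have comult: "comult Q (p t) = ?tm (comult ?T t)" if t: "t\<in>carrier MN.AB.T" for t
 proof -
  have e: "comult ?T t = tensor_lift ?TC Xf t"
   by (simp add: hopf_tensor_def Let_def hopf.defs graded_module.defs Xf_def[abs_def] CE_def)
  have Xc': "Xf a b\<in>carrier ?TC" if "a\<in>carrier ?M" "b\<in>carrier ?N" for a b using that Xc by (simp add: sub_simps)
  show ?thesis
   unfolding e
  proof (rule QQ.AB.T.lf_eqI)
   show "comult Q (p t)\<in>carrier ?TQ" by (rule linD(1)[OF comult_lin linD(1)[OF lp t]])
   show "?tm (tensor_lift ?TC Xf t)\<in>carrier ?TQ"
    by (rule linD(1)[OF ltm MN.AB.tensor_lift_closed[OF CC.T_kspace Xc' t]])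
   fix l assume l: "lf ?TQ l"
   have "l (?tm (tensor_lift ?TC Xf t)) = tform (%a b. l (?tm (Xf a b))) t"
    by (rule MN.AB.lf_tensor_lift[OF CC.T_kspace Xc' t lf_lin[OF l ltm]])
   also have "... = tform (%a b. l (comult Q (a\<otimes>b))) t"
    by (rule MN.AB.tform_cong[OF t]) (simp add: key[OF l] sub_simps)
   also have "... = l (comult Q (p t))"
    unfolding p_def by (rule MN.AB.lf_tensor_lift[OF kspace_axioms bilin_closed[OF pb] t lf_lin[OF l comult_lin], symmetric])
   finally show "l (comult Q (p t)) = l (?tm (tensor_lift ?TC Xf t))" by simp
  qed
 qed
 have counit: "counit Q (p t) = counit ?T t" if t: "t\<in>carrier MN.AB.T" for t
 proof -
  have "counit Q (p t) = tform (%a b. counit Q (a\<otimes>b)) t"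
   unfolding p_def by (rule MN.AB.lf_tensor_lift[OF kspace_axioms bilin_closed[OF pb] t lf_counit])
  also have "... = tform (%a b. counit Q a * counit Q b) t"
   by (rule MN.AB.tform_cong[OF t]) (use sU sV in \<open>auto simp: counit_mult sub_simps\<close>)
  also have "... = counit ?T t"
   by (simp add: hopf_tensor_def Let_def hopf.defs graded_module.defs tform_def pair2_def pair_def sub_simps)
  finally show ?thesis .
 qed
 have "hopf_hom ?T Q p"
  unfolding hopf_hom_def Ts using gl mult comult counit pt[OF sU(3) sV(3)] by simp
 then show ?thesis
  unfolding huq_commute_def using pt sU sV by (intro exI[of _ p]) simp
qed

end

section \<open>The quotient by a normal Hopf subalgebra\<close>

context cchopf begin

abbreviation "aug B \<equiv> augmentation_ideal A B"
abbreviation "AB B \<equiv> ideal_prod A (cA) (aug B)"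

lemma aug_graded: "gsc B ==> graded_subspace A (aug B)"
 unfolding gsub_subsp
proof (intro conjI ballI allI)
 assume B: "gsc B"
 show "subsp A (aug B)"
  using subspD[OF gscD(2)[OF B]] gscD(3)[OF B]
  by (auto simp: subsp_def augmentation_ideal_def counit_add counit_smult lf_zero[OF lf_counit])
 fix b g assume b: "b\<in>aug B"
 then have bB: "b\<in>B" "\<epsilon> b = 0" "b\<in>cA" using gscD(3)[OF B] by (auto simp: augmentation_ideal_def)
 have "\<epsilon> (component A b g) = 0"
 proof (cases "g = 0")
  case True
  have "\<epsilon> (component A b 0) = \<epsilon> b"
  proof (rule lf_hset_eq[OF lf_comp[OF lf_counit] lf_counit _ bB(3)])
   fix v assume "v\<in>hset A"
   then obtain h where h: "v\<in>homog A h" by (auto simp: hset_def)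
   then show "\<epsilon> (component A v 0) = \<epsilon> v"
    using counit_degree[OF h] by (cases "h = 0") (auto simp: comp_homog[OF h] lf_zero[OF lf_counit])
  qed
  then show ?thesis using True bB by simp
 qed (use counit_degree[OF comp_in[OF bB(3)]] in simp)
 then show "component A b g\<in>aug B"
  using bB gscD(1)[OF B] by (simp add: augmentation_ideal_def gsub_subsp)
qed

text \<open>
  Both \<open>A\<close> and \<open>B\<^sup>+\<close> are graded, so bilinear identities on \<open>AB\<^sup>+\<close> may be checked on homogeneous factors.
\<close>

lemma aug_reduce:
 assumes B: "gsc B" and b: "bil A A b" and e: "\<And>g h i j. i\<in>homog A g ==> j\<in>aug B ==> j\<in>homog A h ==> b i j = 0"
  and i: "i\<in>cA" and j: "j\<in>aug B"
 shows "b i j = 0"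
proof -
 note g = aug_graded[OF B]
 have jc: "j\<in>cA" using j g subspD(1) by (auto simp: gsub_subsp)
 have "b i j = (\<Sum>g\<in>degrees A i. b (component A i g) j)" by (rule lf_comp_sum[OF bilD(2)[OF b jc] i])
 also have "... = (\<Sum>g\<in>degrees A i. 0)"
 proof (rule sum.cong[OF refl])
  fix k
  have "b (component A i k) j = (\<Sum>h\<in>degrees A j. b (component A i k) (component A j h))"
   by (rule lf_comp_sum[OF bilD(1)[OF b] jc]) (use i in simp)
  also have "... = 0" using e[OF comp_in[OF i] _ comp_in[OF jc]] g j by (intro sum.neutral) (auto simp: gsub_subsp)
  finally show "b (component A i k) j = 0" .
 qed
 finally show ?thesis by simp
qed

lemma prod_subsp:
 assumes P: "subsp A P" and R: "subsp A R"
 shows "subsp A (ideal_prod A P R)"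
proof -
 note c = subspD(1)[OF P] subspD(1)[OF R]
 have cc: "x\<in>cA" if "x\<in>ideal_prod A P R" for x using that c by (induction rule: ideal_prod.induct) auto
 have "e\<odot>x\<in>ideal_prod A P R" if "x\<in>ideal_prod A P R" for e x
  using that
 proof (induction rule: ideal_prod.induct)
  case (prod i j)
  have "e\<odot>(i\<otimes>j) = (e\<odot>i)\<otimes>j" using prod c by (simp add: smult_mult_left)
  then show ?case using ideal_prod.prod[of "e\<odot>i" P j R A] prod subspD(4)[OF P] by simp
 next
  case (sum s1 s2)
  then show ?case using cc by (simp add: smult_r_distr ideal_prod.sum)
 qed
 moreover have "\<zero>\<in>ideal_prod A P R"
  using ideal_prod.prod[OF subspD(2)[OF P] subspD(2)[OF R], of A] by simp
 ultimately show ?thesis using cc by (auto simp: subsp_def intro: ideal_prod.sum)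
qed

text \<open>
  The color version of \<open>ac = (a\<^sub>1 c S(a\<^sub>2)) a\<^sub>3\<close>, which moves \<open>c\<close> to the left of \<open>a\<close>.
\<close>

lemma mult_ad:
 assumes l: "lf A l" and a: "a\<in>cA" and c: "c\<in>homog A h"
 shows "l (a\<otimes>c) = sw a (%u v. l (ad u c\<otimes>tw h v))"
proof -
 have cc: "c\<in>cA" using c by auto
 note lS = gr_lin[OF gr_S] and lt = gr_lin[OF gr_tw]
 have "sw a (%u v. l (ad u c\<otimes>tw h v)) = sw a (%u v. sw u (%u1 u2. l (u1\<otimes>c\<otimes>S (tw h u2)\<otimes>tw h v)))"
  by (intro sw_cong[OF a] lf_ad_homog[OF lf_mult_r[OF l] _ c]) auto
 also have "... = sw a (%u w. sw w (%w1 w2. l (u\<otimes>c\<otimes>S (tw h w1)\<otimes>tw h w2)))"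
  using cc by (intro sw_coassoc[OF triI a] lf_lin[OF l] lin_mult_l lin_mult_r lin_id lin_comp[OF lS lt] lt) auto
 also have "... = sw a (%u w. \<epsilon> w * l (u\<otimes>c))"
 proof (rule sw_cong[OF a])
  fix u w assume uw: "u\<in>cA" "w\<in>cA"
  have ls: "lf A (%x. l (u\<otimes>c\<otimes>x))" using uw cc by (intro lf_mult_l[OF l]) simp
  have "sw w (%w1 w2. l (u\<otimes>c\<otimes>S (tw h w1)\<otimes>tw h w2)) = sw w (%w1 w2. l (u\<otimes>c\<otimes>(S (tw h w1)\<otimes>tw h w2)))"
   using uw cc by (intro sw_cong) (auto simp: m_assoc)
  also have "... = sw (tw h w) (%w1 w2. l (u\<otimes>c\<otimes>(S w1\<otimes>w2)))"
   using uw by (intro sw_tw[symmetric] bil_mult[OF ls lS lin_id]) auto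
  also have "... = \<epsilon> w * l (u\<otimes>c)" using antipode_l[OF _ ls, of "tw h w"] uw cc by (simp add: counit_tw)
  finally show "sw w (%w1 w2. l (u\<otimes>c\<otimes>S (tw h w1)\<otimes>tw h w2)) = \<epsilon> w * l (u\<otimes>c)" .
 qed
 also have "... = l (a\<otimes>c)" by (rule counit_r[OF a lf_mult_r[OF l cc]])
 finally show ?thesis by simp
qed

lemma nhsD: assumes "nhs B" shows "gsc B" "hs B" "a\<in>cA ==> x\<in>B ==> ad a x\<in>B"
 using assms by (auto simp: nhs_def hs_def)

text \<open>
  \<open>AB\<^sup>+ \<subseteq> B\<^sup>+A\<close> by normality and \<open>mult_ad\<close>. The antipode maps \<open>B\<^sup>+A\<close> into \<open>AB\<^sup>+\<close>; being involutive, it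
  turns the first inclusion into the second.
\<close>

lemma AB_eq_BA:
 assumes B: "nhs B" shows "AB B = ideal_prod A (aug B) (cA)"
proof -
 let ?I = "AB B" and ?J = "ideal_prod A (aug B) (cA)"
 note gB = nhsD(1)[OF B] and BC = gscD(3)[OF nhsD(1)[OF B]]
 have sa: "subsp A (aug B)" using aug_graded[OF gB] by (simp add: gsub_subsp)
 have sI: "subsp A ?I" and sJ: "subsp A ?J" by (rule prod_subsp[OF subsp_carrier sa], rule prod_subsp[OF sa subsp_carrier])
 have 1: "x\<in>?J" if "x\<in>?I" for x
  using that
 proof (induction rule: ideal_prod.induct)
  case (prod i j)
  show ?case
  proof (rule lf_subspI[OF sJ])
   show "i\<otimes>j\<in>cA" using prod subspD(1)[OF sa] by simp
   fix l assume l: "lf A l" and z: "\<And>x. x\<in>?J ==> l x = 0"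
   show "l (i\<otimes>j) = 0"
   proof (rule aug_reduce[OF gB bil_mult[OF l lin_id lin_id] _ prod])
    fix g h i j assume h: "i\<in>homog A g" "j\<in>aug B" "j\<in>homog A h"
    have "l (i\<otimes>j) = sw i (%u v. 0)"
     unfolding mult_ad[OF l homog_carrier[OF h(1)] h(3)]
    proof (rule sw_cong[OF homog_carrier[OF h(1)]])
     fix u v assume uv: "u\<in>cA" "v\<in>cA"
     have "ad u j\<in>aug B"
      using h(2) nhsD(3)[OF B uv(1)] counit_ad[OF uv(1)] BC by (simp add: augmentation_ideal_def)
     then show "l (ad u j\<otimes>tw h v) = 0" using uv by (intro z ideal_prod.prod) auto
    qed
    then show "l (i\<otimes>j) = 0" by simp
   qed
  qed
 qed (rule ideal_prod.sum)
 have 2: "S x\<in>?I" if "x\<in>?J" for x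
  using that
 proof (induction rule: ideal_prod.induct)
  case (prod j i)
  show ?case
  proof (rule lf_subspI[OF sI])
   show "S (j\<otimes>i)\<in>cA" using prod subspD(1)[OF sa] by simp
   fix l assume l: "lf A l" and z: "\<And>x. x\<in>?I ==> l x = 0"
   have b: "bil A A (%i j. l (S (j\<otimes>i)))"
    by (rule bil_flip[OF bil_mult[OF lf_lin[OF l gr_lin[OF gr_S]] lin_id lin_id]])
   show "l (S (j\<otimes>i)) = 0"
   proof (rule aug_reduce[OF gB b _ prod(2,1)])
    fix g h i j assume h: "i\<in>homog A g" "j\<in>aug B" "j\<in>homog A h"
    have "S j\<in>aug B" using h(2) hsD(4)[OF nhsD(2)[OF B]] BC by (auto simp: augmentation_ideal_def counit_S)
    then have "\<phi> h g\<odot>(S i\<otimes>S j)\<in>?I" using h(1) by (intro subspD(4)[OF sI] ideal_prod.prod) auto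
    then show "l (S (j\<otimes>i)) = 0" unfolding S_mult[OF h(3,1)] by (rule z)
   qed
  qed
 next
  case (sum s1 s2)
  then show ?case using linD(2)[OF gr_lin[OF gr_S] subspD(1)[OF sJ sum(1)] subspD(1)[OF sJ sum(2)]] by (simp add: ideal_prod.sum)
 qed
 show ?thesis
 proof (intro equalityI subsetI)
  show "x\<in>?J" if "x\<in>?I" for x by (rule 1[OF that])
  fix x assume x: "x\<in>?J"
  have "S (S x)\<in>?I" by (intro 2 1 x)
  then show "x\<in>?I" using subspD(1)[OF sJ x] by simp
 qed
qed

end

text \<open>
  A graded ideal over which counit and coproduct descend. The last assumption is
  \<open>\<Delta> I \<subseteq> I \<otimes> A + A \<otimes> I\<close>, expressed by forms.
\<close>

locale cquot = cchopf \<phi> A + ideal I A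
 for \<phi> :: "'g::ab_group_add => 'g => 'k::field" and A :: "('k, 'g, 'a, 'm) hopf_scheme" (structure) and I +
 assumes gI: "graded_subspace A I"
  and eI: "x\<in>I ==> \<epsilon> x = 0"
  and cI: "x\<in>I ==> bil A A b ==> (\<And>u v. u\<in>I ==> v\<in>carrier A ==> b u v = 0) ==>
    (\<And>u v. u\<in>carrier A ==> v\<in>I ==> b u v = 0) ==> sw x b = 0"

context cchopf begin

lemma AB_one:
 assumes b: "b\<in>B" and B: "hs B" and u: "u\<in>cA" and m: "lf A m" and z: "\<And>x. x\<in>AB B ==> m x = 0"
 shows "m (u\<otimes>b) = \<epsilon> b * m u"
proof -
 have bc: "b\<in>cA" by (rule hsD(5)[OF B b])
 have "b\<ominus>\<epsilon> b\<odot>\<one>\<in>aug B"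
  using b bc subsp_minus[OF hsD(6)[OF B] b subspD(4)[OF hsD(6)[OF B] hsD(2)[OF B]]]
  by (simp add: augmentation_ideal_def lf_minus[OF lf_counit] counit_smult counit_one)
 then have "m (u\<otimes>(b\<ominus>\<epsilon> b\<odot>\<one>)) = 0" using u by (intro z ideal_prod.prod) auto
 then show ?thesis
  using lf_minus[OF lf_mult_l[OF m u] bc, of "\<epsilon> b\<odot>\<one>"] u by (simp add: smult_mult_right lfD(2)[OF m])
qed

text \<open>
  Modulo \<open>AB\<^sup>+\<close>, right multiplication by \<open>b\<close> is the scalar \<open>\<epsilon>(b)\<close>. Hence \<open>\<Delta>(ab)\<close> agrees with \<open>\<epsilon>(b)\<Delta>(a)\<close> in
  both legs.
\<close>

lemma AB_cquot:
 assumes B: "nhs B" shows "cquot \<phi> A (AB B)"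
proof -
 let ?I = "AB B"
 note gB = nhsD(1)[OF B] and BC = gscD(3)[OF nhsD(1)[OF B]]
 have sa: "subsp A (aug B)" using aug_graded[OF gB] by (simp add: gsub_subsp)
 have sI: "subsp A ?I" by (rule prod_subsp[OF subsp_carrier sa])
 note cI = subspD(1)[OF sI]
 have l: "w\<otimes>x\<in>?I" if "x\<in>?I" "w\<in>cA" for w x
  using that(1)
 proof (induction rule: ideal_prod.induct)
  case (prod i j)
  have "w\<otimes>(i\<otimes>j) = (w\<otimes>i)\<otimes>j" using prod that(2) subspD(1)[OF sa] by (simp add: m_assoc)
  then show ?case using ideal_prod.prod[of "w\<otimes>i" "cA" j "aug B" A] prod that(2) by simp
 next
  case (sum s1 s2)
  then show ?case using that(2) cI by (simp add: r_distr ideal_prod.sum)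
 qed
 have r: "x\<otimes>w\<in>?I" if "x\<in>?I" "w\<in>cA" for w x
  using that(1) unfolding AB_eq_BA[OF B]
 proof (induction rule: ideal_prod.induct)
  case (prod i j)
  have "(i\<otimes>j)\<otimes>w = i\<otimes>(j\<otimes>w)" using prod that(2) subspD(1)[OF sa] by (simp add: m_assoc)
  then show ?case using ideal_prod.prod[of i "aug B" "j\<otimes>w" "cA" A] prod that(2) by simp
 next
  case (sum s1 s2)
  then show ?case using that(2) cI by (simp add: AB_eq_BA[OF B] l_distr ideal_prod.sum)
 qed
 have id: "ideal ?I A"
 proof (rule idealI)
  show "ring A" by (rule ring_axioms)
  show "subgroup ?I (add_monoid A)"
  proof (rule add.subgroupI)
   show "\<ominus> x\<in>?I" if "x\<in>?I" for x using subspD(4)[OF sI that, of "-1"] cI[OF that] by (simp add: neg_smult)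
  qed (use sI in \<open>auto simp: subsp_def\<close>)
 qed (use l r in auto)
 have gI: "graded_subspace A ?I"
  unfolding gsub_subsp
 proof (intro conjI sI ballI allI)
  fix x k assume "x\<in>?I"
  then show "component A x k\<in>?I"
  proof (induction rule: ideal_prod.induct)
   case (prod i j)
   show ?case
   proof (rule lf_subspI[OF sI])
    show "component A (i\<otimes>j) k\<in>cA" using prod subspD(1)[OF sa] by simp
    fix l assume l: "lf A l" and z: "\<And>x. x\<in>?I ==> l x = 0"
    show "l (component A (i\<otimes>j) k) = 0"
    proof (rule aug_reduce[OF gB bil_mult[OF lf_comp[OF l] lin_id lin_id] _ prod])
     fix g h i j assume h: "i\<in>homog A g" "j\<in>aug B" "j\<in>homog A h"
     have "i\<otimes>j\<in>?I" using h by (intro ideal_prod.prod) auto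
     then show "l (component A (i\<otimes>j) k) = 0"
      by (simp add: comp_homog[OF homog_mult[OF h(1,3)]] z lf_zero[OF l])
    qed
   qed
  next
   case (sum s1 s2)
   then show ?case using cI by (simp add: comp_add ideal_prod.sum)
  qed
 qed
 have e: "\<epsilon> x = 0" if "x\<in>?I" for x
  using that
 proof (induction rule: ideal_prod.induct)
  case (prod i j)
  then show ?case using BC by (auto simp: augmentation_ideal_def counit_mult)
 next
  case (sum s1 s2)
  then show ?case using cI by (simp add: counit_add)
 qed
 have c: "sw x b = 0" if x: "x\<in>?I" and b: "bil A A b" and 1: "\<And>u v. u\<in>?I ==> v\<in>cA ==> b u v = 0"
   and 2: "\<And>u v. u\<in>cA ==> v\<in>?I ==> b u v = 0" for x b
  using x
 proof (induction rule: ideal_prod.induct)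
  case (prod i j)
  have j: "j\<in>B" "\<epsilon> j = 0" "j\<in>cA" using prod(2) BC by (auto simp: augmentation_ideal_def)
  obtain g where g: "g\<in>\<Delta> j" "keys g\<subseteq>(B\<inter>hset A)\<times>(B\<inter>hset A)" using gsc_rep[OF gB j(1)] by auto
  have hg: "homk g" using g(2) by auto
  have "sw (i\<otimes>j) b = pair2 g (%y1 y2. sw i (%u v. b (u\<otimes>y1) (tw (dg A y1) v\<otimes>y2)))"
   by (rule sw_mult_tw[OF b prod(1) j(3) g(1) hg])
  also have "... = pair2 g (%y1 y2. \<epsilon> y1 * (\<epsilon> y2 * sw i b))"
  proof (rule pair2_cong)
   fix y1 y2 assume "(y1, y2)\<in>keys g"
   then have y: "y1\<in>B" "y2\<in>B" "y1\<in>homog A (dg A y1)" using g(2) dg_in by auto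
   note yc = BC[OF y(1)] BC[OF y(2)]
   have "sw i (%u v. b (u\<otimes>y1) (tw (dg A y1) v\<otimes>y2)) = sw i (%u v. \<epsilon> y1 * (\<epsilon> y2 * b u v))"
   proof (rule sw_cong[OF prod(1)])
    fix u v assume uv: "u\<in>cA" "v\<in>cA"
    have tc: "tw (dg A y1) v\<otimes>y2\<in>cA" using uv yc by simp
    have "b (u\<otimes>y1) (tw (dg A y1) v\<otimes>y2) = \<epsilon> y1 * b u (tw (dg A y1) v\<otimes>y2)"
     by (rule AB_one[OF y(1) nhsD(2)[OF B] uv(1) bilD(2)[OF b tc] 1[OF _ tc]])
    also have "b u (tw (dg A y1) v\<otimes>y2) = \<epsilon> y2 * b u (tw (dg A y1) v)"
     by (rule AB_one[OF y(2) nhsD(2)[OF B] _ bilD(1)[OF b uv(1)] 2[OF uv(1)]]) (use uv in simp)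
    also have "\<epsilon> y1 * (\<epsilon> y2 * b u (tw (dg A y1) v)) = \<epsilon> y1 * (\<epsilon> y2 * b u v)"
     using counit_degree[OF y(3)] uv by (cases "dg A y1 = 0") (auto simp: tw_0)
    finally show "b (u\<otimes>y1) (tw (dg A y1) v\<otimes>y2) = \<epsilon> y1 * (\<epsilon> y2 * b u v)" .
   qed
   then show "sw i (%u v. b (u\<otimes>y1) (tw (dg A y1) v\<otimes>y2)) = \<epsilon> y1 * (\<epsilon> y2 * sw i b)" by (simp add: sw_cmult)
  qed
  also have "... = sw j (%y1 y2. \<epsilon> y1 * (\<epsilon> y2 * sw i b))"
   by (rule sw_rep[OF bil_prod[OF lf_counit lf_cmult_right[OF lf_counit]] g(1) j(3), symmetric])
  also have "... = 0" using counit_l[OF j(3) lf_cmult_right[OF lf_counit]] j(2) by simp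
  finally show ?case .
 next
  case (sum s1 s2)
  then show ?case using lfD(1)[OF lf_sw[OF b] cI[OF sum(1)] cI[OF sum(2)]] by simp
 qed
 show ?thesis
  unfolding cquot_def cquot_axioms_def using cchopf_axioms id gI e c by blast
qed

end

context cquot begin

abbreviation "Qt \<equiv> quotient_hopf A I"
abbreviation "q \<equiv> (+>) I"

lemma q_eq: "a\<in>cA ==> b\<in>cA ==> q a = q b\<longleftrightarrow>a\<ominus>b\<in>I"
 using quotient_eq_iff_same_a_r_cos[OF ideal_axioms] by simp

lemma I_subsp: "subsp A I" using gI by (simp add: gsub_subsp)

lemma q_elem: "a\<in>cA ==> b\<in>q a ==> b\<in>cA\<and>b\<ominus>a\<in>I"
 using a_elemrcos_carrier[of a b] a_repr_independence[OF _ _ a_subgroup, of b a] q_eq[of b a] by simp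

lemma q_self: "a\<in>cA ==> a\<in>q a" by (rule a_rcos_self)

lemma q_some: "a\<in>cA ==> (SOME b. b\<in>q a)\<in>cA\<and>(SOME b. b\<in>q a)\<ominus>a\<in>I"
 using q_elem[of a "SOME b. b\<in>q a"] someI[of "%b. b\<in>q a" a] q_self by blast

lemma q_lin_eq: "lin A P h ==> kspace P ==> (\<And>x. x\<in>I ==> h x = \<zero>\<^bsub>P\<^esub>) ==> a\<in>cA ==> h (SOME b. b\<in>q a) = h a"
proof -
 assume h: "lin A P h" and P: "kspace P" and z: "\<And>x. x\<in>I ==> h x = \<zero>\<^bsub>P\<^esub>" and a: "a\<in>cA"
 interpret P: kspace P by fact
 let ?b = "SOME b. b\<in>q a"
 have b: "?b\<in>cA" "?b\<ominus>a\<in>I" using q_some[OF a] by auto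
 have "?b = (?b\<ominus>a)\<oplus>a" using a b(1) by (simp add: a_minus_def a_assoc l_neg)
 then have "h ?b = h (?b\<ominus>a)\<oplus>\<^bsub>P\<^esub>h a" using linD(2)[OF h, of "?b\<ominus>a" a] a b(1) by simp
 then show ?thesis using z[OF b(2)] linD(1)[OF h a] by simp
qed

lemma Q_simps: "carrier Qt = q ` cA" "monoid.one Qt = q \<one>" "ring.zero Qt = q \<zero>" "homog Qt g = q ` homog A g"
 "a\<in>cA ==> b\<in>cA ==> q a\<oplus>\<^bsub>Qt\<^esub>q b = q (a\<oplus>b)"
 "a\<in>cA ==> b\<in>cA ==> q a\<otimes>\<^bsub>Qt\<^esub>q b = q (a\<otimes>b)"
 "a\<in>cA ==> c\<odot>\<^bsub>Qt\<^esub>q a = q (c\<odot>a)"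
proof -
 note d = quotient_hopf_def quotient_module_def Let_def graded_module.defs hopf.defs module.defs ring.defs FactRing_def
 show "carrier Qt = q ` cA" by (auto simp: d A_RCOSETS_def')
 show "monoid.one Qt = q \<one>" "homog Qt g = q ` homog A g" by (simp_all add: d)
 show "ring.zero Qt = q \<zero>" using a_rcos_zero[OF ideal_axioms, of \<zero>] by (simp add: d additive_subgroup.zero_closed[OF additive_subgroup_axioms])
 assume a: "a\<in>cA"
 have "(\<Union>b\<in>q a. q (c\<odot>b)) = q (c\<odot>a)"
 proof -
  have "q (c\<odot>b) = q (c\<odot>a)" if "b\<in>q a" for b
  proof -
   have b: "b\<in>cA" "b\<ominus>a\<in>I" using q_elem[OF a that] by auto
   have "c\<odot>b\<ominus>c\<odot>a = c\<odot>(b\<ominus>a)" using a b(1) by (simp add: a_minus_def smult_r_distr smult_r_minus)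
   then show ?thesis using q_eq[of "c\<odot>b" "c\<odot>a"] a b subspD(4)[OF I_subsp b(2)] by simp
  qed
  then show ?thesis using q_self[OF a] by blast
 qed
 then show "c\<odot>\<^bsub>Qt\<^esub>q a = q (c\<odot>a)" by (simp add: d)
 assume b: "b\<in>cA"
 show "q a\<oplus>\<^bsub>Qt\<^esub>q b = q (a\<oplus>b)" using a_rcos_sum[OF a b] by (simp add: d)
 show "q a\<otimes>\<^bsub>Qt\<^esub>q b = q (a\<otimes>b)" using rcoset_mult_add[OF a b] by (simp add: d)
qed

lemma Q_kspace: "kspace Qt"
 unfolding kspace_def
proof (rule moduleI)
 show "cring (ring_of_type_algebra :: 'k ring)" by (rule cring_from_type_algebra)
 show "abelian_group Qt"
 proof (rule abelian_groupI)
  fix x assume "x\<in>carrier Qt"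
  then obtain a where a: "a\<in>cA" "x = q a" by (auto simp: Q_simps)
  then show "\<exists>y\<in>carrier Qt. y\<oplus>\<^bsub>Qt\<^esub>x = \<zero>\<^bsub>Qt\<^esub>"
   by (intro bexI[of _ "q (\<ominus> a)"]) (auto simp: Q_simps l_neg)
 qed (auto simp: Q_simps a_ac)
qed (auto simp: Q_simps smult_addl smult_addr smult_smult)

lemma q_lin: "lin A Qt q" by (intro linI) (auto simp: Q_simps)

lemma q_lf: "lf Qt l ==> lf A (%a. l (q a))" by (rule lf_lin[OF _ q_lin])

lemma Q_graded: "graded_space Qt" and Q_comp: "a\<in>cA ==> component Qt (q a) g = q (component A a g)"
proof -
 interpret Q: kspace Qt by (rule Q_kspace)
 let ?P = "%g C. q (component A (SOME a. a\<in>C) g)"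
 have P: "?P g (q a) = q (component A a g)" if a: "a\<in>cA" for g a
 proof (rule q_lin_eq[OF lin_comp[OF q_lin lin_comp_g] Q_kspace _ a])
  fix x assume "x\<in>I"
  then have "component A x g\<in>I" using gI by (simp add: gsub_subsp)
  then show "q (component A x g) = \<zero>\<^bsub>Qt\<^esub>" using a_rcos_zero[OF ideal_axioms] I_subsp by (simp add: Q_simps subsp_def)
 qed
 have lf: "l (q a) = (\<Sum>g\<in>degrees A a. l (q (component A a g)))" if "lf Qt l" "a\<in>cA" for l a
  by (rule lf_comp_sum[OF q_lf[OF that(1)] that(2)])
 have zc: "q (component A a g) = \<zero>\<^bsub>Qt\<^esub>" if "g \<notin> degrees A a" for a g using that by (simp add: degrees_def Q_simps)
 have 1: "kspace Qt" by (rule Q_kspace)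
 have 2: "subsp Qt (homog Qt g)" for g
  unfolding subsp_def
  using subspD[OF homog_subsp[of g]]
  by (auto simp: Q_simps image_iff)
 have 3: "lin Qt Qt (?P g)" for g
 proof (rule linI)
  fix x assume "x\<in>carrier Qt"
  then obtain a where a: "a\<in>cA" "x = q a" by (auto simp: Q_simps)
  show "?P g x\<in>carrier Qt" using a by (simp add: P) (simp add: Q_simps)
  show "?P g (c\<odot>\<^bsub>Qt\<^esub>x) = c\<odot>\<^bsub>Qt\<^esub>?P g x" for c using a P[of "c\<odot>a"] by (simp add: Q_simps P comp_smult)
  fix y assume "y\<in>carrier Qt"
  then obtain b where b: "b\<in>cA" "y = q b" by (auto simp: Q_simps)
  show "?P g (x\<oplus>\<^bsub>Qt\<^esub>y) = ?P g x\<oplus>\<^bsub>Qt\<^esub>?P g y" using a b P[of "a\<oplus>b"] by (simp add: Q_simps P comp_add)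
 qed
 have 4: "?P g v\<in>homog Qt g" if "v\<in>carrier Qt" for g v using that by (auto simp: Q_simps P)
 have 5: "?P g v = (if g = h then v else \<zero>\<^bsub>Qt\<^esub>)" if v: "v\<in>homog Qt h" for g h v
 proof -
  obtain a where a: "a\<in>homog A h" "v = q a" using v by (auto simp: Q_simps)
  then show ?thesis using P[of a g] by (auto simp: comp_homog[OF a(1)] Q_simps)
 qed
 have 6: "\<exists>H. finite H\<and>(\<forall>g. g \<notin> H\<longrightarrow>?P g v = \<zero>\<^bsub>Qt\<^esub>)\<and>(\<forall>l. lf Qt l\<longrightarrow>l v = (\<Sum>g\<in>H. l (?P g v)))" if v: "v\<in>carrier Qt" for v
 proof -
  obtain a where a: "a\<in>cA" "v = q a" using v by (auto simp: Q_simps)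
  show ?thesis using a lf zc by (intro exI[of _ "degrees A a"]) (simp add: P)
 qed
 show "graded_space Qt" by (rule graded_spaceI(1)[of Qt ?P, OF 1 2 3 4 5 6])
 show "component Qt (q a) g = q (component A a g)" if "a\<in>cA"
  using graded_spaceI(2)[of Qt ?P "q a", OF 1 2 3 4 5 6] that P[OF that] by (simp add: Q_simps)
qed

lemma Q_algebra: "graded_algebra Qt"
proof -
 interpret Q: kspace Qt by (rule Q_kspace)
 have R: "ring Qt"
 proof (rule ringI)
  show "abelian_group Qt" by (rule Q.abelian_group_axioms)
  show "monoid Qt" by (rule monoidI) (auto simp: Q_simps m_assoc)
 qed (auto simp: Q_simps l_distr r_distr)
 show ?thesis
  unfolding graded_algebra_def graded_algebra_axioms_def
 proof (intro conjI Q_graded R allI impI)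
  show "\<one>\<^bsub>Qt\<^esub>\<in>homog Qt 0" using homog_one by (auto simp: Q_simps)
  fix a b g h assume "a\<in>homog Qt g" "b\<in>homog Qt h"
  then obtain x y where x: "x\<in>homog A g" "a = q x" "y\<in>homog A h" "b = q y" by (auto simp: Q_simps)
  then show "a\<otimes>\<^bsub>Qt\<^esub>b\<in>homog Qt (g + h)" using homog_mult[OF x(1,3)] homog_carrier by (auto simp: Q_simps)
 qed (auto simp: Q_simps smult_mult_left smult_mult_right)
qed

lemma Q_counit: "a\<in>cA ==> counit Qt (q a) = \<epsilon> a"
proof -
 assume a: "a\<in>cA"
 let ?b = "SOME b. b\<in>q a"
 have "\<epsilon> ?b - \<epsilon> a = 0" using q_some[OF a] a eI[of "?b\<ominus>a"] by (simp add: lf_minus[OF lf_counit])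
 then show ?thesis by (simp add: quotient_hopf_def Let_def hopf.defs graded_module.defs)
qed

lemma Q_comult:
 assumes a: "a\<in>cA"
 shows "comult Qt (q a)\<in>carrier (tensor_space Qt Qt)"
  and "lf (tensor_space Qt Qt) l ==> l (comult Qt (q a)) = sw a (%u v. l (tens Qt Qt (q u) (q v)))"
proof -
 interpret QQ: kspace2 Qt Qt using Q_kspace by (simp add: kspace2_def)
 let ?b = "SOME b. b\<in>q a"
 have b: "?b\<in>cA" "?b\<ominus>a\<in>I" using q_some[OF a] by auto
 have e: "comult Qt (q a) = tensor_lift (tensor_space Qt Qt) (%u v. tens Qt Qt (q u) (q v)) (\<Delta> ?b)"
 proof -
  let ?Q = "quotient_module A I"
  have f: "carrier ?Q = carrier Qt" "ring.add ?Q = ring.add Qt" "module.smult ?Q = module.smult Qt" "homog ?Q = homog Qt"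
   by (simp_all add: quotient_hopf_def Let_def hopf.defs graded_module.defs)
  have "tensor_rel ?Q ?Q = tensor_rel Qt Qt" by (intro equalityI tensor_rel_mono) (simp_all add: f)
  then have t: "tensor_space ?Q ?Q = tensor_space Qt Qt" "tens ?Q ?Q = tens Qt Qt"
   by (simp_all add: tensor_space_def tens_def[abs_def] tensor_class_def[abs_def] f)
  have "comult Qt (q a) = tensor_map ?Q ?Q q q (\<Delta> ?b)"
   by (simp add: quotient_hopf_def Let_def hopf.defs graded_module.defs)
  then show ?thesis unfolding tensor_map_def t .
 qed
 have tc: "tens Qt Qt (q u) (q v)\<in>carrier QQ.T" if "u\<in>cA" "v\<in>cA" for u v
  using that by (intro QQ.tens_in) (auto simp: Q_simps)
 show "comult Qt (q a)\<in>carrier (tensor_space Qt Qt)"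
  unfolding e by (rule AA.AB.tensor_lift_closed[OF QQ.T_kspace tc comult_in[OF b(1)]])
 assume l: "lf (tensor_space Qt Qt) l"
 let ?c = "%u v. l (tens Qt Qt (q u) (q v))"
 have t: "bil Qt Qt (%x y. l (tens Qt Qt x y))" by (rule bil_lf[OF QQ.tens_bilin l])
 have qc: "q u\<in>carrier Qt" if "u\<in>cA" for u using that by (auto simp: Q_simps)
 have bb: "bil A A ?c" by (intro bilI q_lf bilD[OF t] qc)
 have z: "q x = \<zero>\<^bsub>Qt\<^esub>" if "x\<in>I" for x using a_rcos_zero[OF ideal_axioms] that subspD(2)[OF I_subsp] by (simp add: Q_simps)
 have "sw (?b\<ominus>a) ?c = 0"
  using qc z QQ.V.lf_zero[OF bilD(1)[OF t]] QQ.V.lf_zero[OF bilD(2)[OF t]] by (intro cI[OF b(2) bb]) auto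
 then have "sw ?b ?c = sw a ?c" using lf_minus[OF lf_sw[OF bb] b(1) a] by simp
 moreover have "l (comult Qt (q a)) = sw ?b ?c"
  unfolding e sw_def by (rule AA.AB.lf_tensor_lift[OF QQ.T_kspace tc comult_in[OF b(1)] l])
 ultimately show "l (comult Qt (q a)) = sw a ?c" by simp
qed

text \<open>
  Representatives of the coproduct are carried over leg by leg.
\<close>

lemma Q_push:
 assumes a: "a\<in>cA" and f: "f\<in>\<Delta> a"
 shows "pbind f (%p. single (q (fst p), q (snd p)) 1)\<in>comult Qt (q a)"
proof -
 interpret QQ: kspace2 Qt Qt using Q_kspace by (simp add: kspace2_def)
 let ?f = "pbind f (%p. single (q (fst p), q (snd p)) (1::'k))"
 have fo: "AA.AB.ok f" using AA.AB.rep_ok[OF comult_in[OF a] f] by blast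
 have "keys ?f\<subseteq>(\<Union>p\<in>keys f. {(q (fst p), q (snd p))})" by (rule order.trans[OF keys_pbind]) auto
 moreover have "(q (fst p), q (snd p))\<in>carrier Qt\<times>carrier Qt" if "p\<in>keys f" for p
  using fo that by (cases p) (auto simp: Q_simps)
 ultimately have ok: "QQ.ok ?f" by blast
 have qc: "q u\<in>carrier Qt" if "u\<in>cA" for u using that by (auto simp: Q_simps)
 have "QQ.cl ?f = comult Qt (q a)"
 proof (rule QQ.T.lf_eqI[OF QQ.cl_in[OF ok] Q_comult(1)[OF a]])
  fix l assume l: "lf QQ.T l"
  have t: "bil Qt Qt (%x y. l (tens Qt Qt x y))" by (rule bil_lf[OF QQ.tens_bilin l])
  have bb: "bil A A (%u v. l (tens Qt Qt (q u) (q v)))" by (intro bilI q_lf bilD[OF t] qc)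
  show "l (QQ.cl ?f) = l (comult Qt (q a))"
   unfolding QQ.lf_cl[OF l ok] Q_comult(2)[OF a l] sw_rep[OF bb f a] by (simp add: pair2_def pair_pbind)
 qed
 then show ?thesis using QQ.cl_self by blast
qed

lemma Q_cbialg: "cbialg \<phi> Qt"
proof -
 interpret Q: graded_algebra Qt by (rule Q_algebra)
 interpret QQ: galg2 Qt Qt ..
 have qc: "q u\<in>carrier Qt" if "u\<in>cA" for u using that by (auto simp: Q_simps)
 have lt: "bil A A (%u v. l (tens Qt Qt (q u) (q v)))" if "lf QQ.AB.T l" for l
  by (intro bilI q_lf bilD[OF bil_lf[OF QQ.AB.tens_bilin that]] qc)
 have lin: "lin Qt QQ.AB.T (comult Qt)"
 proof (rule linI)
  fix x assume "x\<in>carrier Qt"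
  then obtain a where a: "a\<in>cA" "x = q a" by (auto simp: Q_simps)
  show xc: "comult Qt x\<in>carrier QQ.AB.T" using Q_comult(1)[OF a(1)] a(2) by simp
  show "comult Qt (c\<odot>\<^bsub>Qt\<^esub>x) = c\<odot>\<^bsub>QQ.AB.T\<^esub>comult Qt x" for c
  proof (rule QQ.AB.T.lf_eqI)
   fix l assume l: "lf QQ.AB.T l"
   show "l (comult Qt (c\<odot>\<^bsub>Qt\<^esub>x)) = l (c\<odot>\<^bsub>QQ.AB.T\<^esub>comult Qt x)"
    using a xc Q_comult(2)[OF _ l] by (simp add: Q_simps lfD(2)[OF l] lfD(2)[OF lf_sw[OF lt[OF l]]])
  qed (use a xc Q_comult(1)[of "c\<odot>a"] in \<open>auto simp: Q_simps\<close>)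
  fix y assume "y\<in>carrier Qt"
  then obtain b where b: "b\<in>cA" "y = q b" by (auto simp: Q_simps)
  have yc: "comult Qt y\<in>carrier QQ.AB.T" using Q_comult(1)[OF b(1)] b(2) by simp
  show "comult Qt (x\<oplus>\<^bsub>Qt\<^esub>y) = comult Qt x\<oplus>\<^bsub>QQ.AB.T\<^esub>comult Qt y"
  proof (rule QQ.AB.T.lf_eqI)
   fix l assume l: "lf QQ.AB.T l"
   show "l (comult Qt (x\<oplus>\<^bsub>Qt\<^esub>y)) = l (comult Qt x\<oplus>\<^bsub>QQ.AB.T\<^esub>comult Qt y)"
    using a b xc yc Q_comult(2)[OF _ l] by (simp add: Q_simps lfD(1)[OF l] lfD(1)[OF lf_sw[OF lt[OF l]]])
  qed (use a b xc yc Q_comult(1)[of "a\<oplus>b"] in \<open>auto simp: Q_simps\<close>)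
 qed
 have mult: "comult Qt (x\<otimes>\<^bsub>Qt\<^esub>y) = comult Qt x\<otimes>\<^bsub>QQ.CT \<phi>\<^esub>comult Qt y"
  if "x\<in>carrier Qt" "y\<in>carrier Qt" for x y
 proof -
  obtain a b where a: "a\<in>cA" "x = q a" and b: "b\<in>cA" "y = q b" using \<open>x\<in>_\<close> \<open>y\<in>_\<close> by (auto simp: Q_simps)
  obtain f g where f: "f\<in>\<Delta> a" "homk f" and g: "g\<in>\<Delta> b" "homk g" using hom_rep[OF a(1)] hom_rep[OF b(1)] by auto
  note ca = Q_comult(1)[OF a(1)] and cb = Q_comult(1)[OF b(1)]
  show ?thesis
   unfolding a(2) b(2)
  proof (rule QQ.AB.T.lf_eqI)
   show "comult Qt (q a\<otimes>\<^bsub>Qt\<^esub>q b)\<in>carrier QQ.AB.T" using a b Q_comult(1)[of "a\<otimes>b"] by (simp add: Q_simps)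
   show "comult Qt (q a)\<otimes>\<^bsub>QQ.CT \<phi>\<^esub>comult Qt (q b)\<in>carrier QQ.AB.T" by (rule QQ.CT_mult_closed[OF ca cb])
   fix l assume l: "lf QQ.AB.T l"
   have "l (comult Qt (q a)\<otimes>\<^bsub>QQ.CT \<phi>\<^esub>comult Qt (q b)) =
    pair2 f (%x1 x2. pair2 g (%y1 y2. l (QQ.Q4 \<phi> (q x1) (q x2) (q y1) (q y2))))"
    unfolding QQ.lf_CT_mult[OF l ca cb Q_push[OF a(1) f(1)] Q_push[OF b(1) g(1)]] by (simp add: pair2_def pair_pbind)
   also have "... = pair2 f (%x1 x2. pair2 g (%y1 y2. \<phi> (dg A x2) (dg A y1) * l (tens Qt Qt (q (x1\<otimes>y1)) (q (x2\<otimes>y2)))))"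
   proof (intro pair2_cong)
    fix x1 x2 y1 y2 assume "(x1, x2)\<in>keys f" "(y1, y2)\<in>keys g"
    then have h: "x1\<in>cA" "x2\<in>homog A (dg A x2)" "y1\<in>homog A (dg A y1)" "y2\<in>cA" "x2\<in>cA" "y1\<in>cA"
     using f(2) g(2) dg_in hset_carrier by auto
    have hq: "q x2\<in>homog Qt (dg A x2)" "q y1\<in>homog Qt (dg A y1)" using h by (auto simp: Q_simps)
    show "l (QQ.Q4 \<phi> (q x1) (q x2) (q y1) (q y2)) = \<phi> (dg A x2) (dg A y1) * l (tens Qt Qt (q (x1\<otimes>y1)) (q (x2\<otimes>y2)))"
     unfolding QQ.Q4_homog[OF qc[OF h(1)] hq qc[OF h(4)]]
     using h qc[of "x1\<otimes>y1"] qc[of "x2\<otimes>y2"] by (simp add: Q_simps(6) lfD(2)[OF l])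
   qed
   also have "... = sw (a\<otimes>b) (%u v. l (tens Qt Qt (q u) (q v)))"
    by (rule sw_mult[OF lt[OF l] a(1) b(1) f g, symmetric])
   also have "... = l (comult Qt (q a\<otimes>\<^bsub>Qt\<^esub>q b))"
    using a b Q_comult(2)[OF _ l, of "a\<otimes>b"] by (simp add: Q_simps)
   finally show "l (comult Qt (q a\<otimes>\<^bsub>Qt\<^esub>q b)) = l (comult Qt (q a)\<otimes>\<^bsub>QQ.CT \<phi>\<^esub>comult Qt (q b))" by simp
  qed
 qed
 show ?thesis
  unfolding cbialg_def cbialg_axioms_def
 proof (intro conjI Q_algebra lin allI impI mult)
  show "\<phi> 0 0 = 1" by (simp add: phi_0)
  show "lf Qt (counit Qt)" by (auto simp: lf_def Q_simps Q_counit counit_add counit_smult)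
  show "counit Qt (x\<otimes>\<^bsub>Qt\<^esub>y) = counit Qt x * counit Qt y" if "x\<in>carrier Qt" "y\<in>carrier Qt" for x y
   using that by (auto simp: Q_simps Q_counit counit_mult)
 qed
qed

lemma Q_sba:
 assumes U: "hs U" shows "cbialg.sba Qt (q ` U)"
proof -
 interpret Q: cbialg \<phi> Qt by (rule Q_cbialg)
 note Uc = hsD(5)[OF U]
 show ?thesis
  unfolding Q.sba_def Q.gsub_subsp
 proof (intro conjI ballI allI)
  show "subsp Qt (q ` U)"
   unfolding subsp_def
  proof (intro conjI ballI allI)
   show "q ` U\<subseteq>carrier Qt" using Uc by (auto simp: Q_simps)
   show "\<zero>\<^bsub>Qt\<^esub>\<in>q ` U" using subspD(2)[OF hsD(6)[OF U]] by (auto simp: Q_simps)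
   fix x assume "x\<in>q ` U"
   then obtain u where u: "u\<in>U" "x = q u" by auto
   then show "c\<odot>\<^bsub>Qt\<^esub>x\<in>q ` U" for c using subspD(4)[OF hsD(6)[OF U]] Uc by (auto simp: Q_simps)
   fix y assume "y\<in>q ` U"
   then show "x\<oplus>\<^bsub>Qt\<^esub>y\<in>q ` U" using u subspD(3)[OF hsD(6)[OF U]] Uc by (auto simp: Q_simps)
  qed
  show "\<one>\<^bsub>Qt\<^esub>\<in>q ` U" using hsD(2)[OF U] by (auto simp: Q_simps)
  fix x assume "x\<in>q ` U"
  then obtain u where u: "u\<in>U" "x = q u" by auto
  note uc = Uc[OF u(1)]
  show "component Qt x g\<in>q ` U" for g
   unfolding u(2) Q_comp[OF uc] using hsD(7)[OF U] u(1) by (auto simp: gsub_subsp)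
  obtain f where f: "f\<in>\<Delta> u" "keys f\<subseteq>(U\<inter>hset A)\<times>(U\<inter>hset A)" using gsc_rep[OF hsD(1)[OF U] u(1)] by auto
  let ?f = "pbind f (%p. single (q (fst p), q (snd p)) (1::'k))"
  have "keys ?f\<subseteq>(\<Union>p\<in>keys f. {(q (fst p), q (snd p))})" by (rule order.trans[OF keys_pbind]) auto
  moreover have "(q (fst p), q (snd p))\<in>q ` U\<times>q ` U" if "p\<in>keys f" for p
   using f(2) that by (cases p) auto
  ultimately have "keys ?f\<subseteq>q ` U\<times>q ` U" by blast
  then show "\<exists>f\<in>comult Qt x. keys f\<subseteq>q ` U\<times>q ` U" unfolding u(2) using Q_push[OF uc f(1)] by blast
  fix y assume "y\<in>q ` U"
  then show "x\<otimes>\<^bsub>Qt\<^esub>y\<in>q ` U" using u hsD(3)[OF U] Uc by (auto simp: Q_simps)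
 qed
qed

lemma q_zero: "x\<in>cA ==> y\<in>cA ==> x\<ominus>c\<odot>y\<in>I\<longleftrightarrow>q x = c\<odot>\<^bsub>Qt\<^esub>q y"
 using q_eq[of x "c\<odot>y"] by (simp add: Q_simps)

text \<open>
  A homogeneous element of the image of \<open>U\<close> is the image of a homogeneous element of \<open>U\<close>, namely of the
  component of any preimage.
\<close>

lemma huq_commute_iff:
 assumes U: "hs U" and V: "hs V"
 shows "huq_commute \<phi> Qt (q ` U) (q ` V) \<longleftrightarrow>
  (\<forall>g h. \<forall>x\<in>U\<inter>homog A g. \<forall>y\<in>V\<inter>homog A h. x\<otimes>y\<ominus>\<phi> g h\<odot>(y\<otimes>x)\<in>I)" (is "?l\<longleftrightarrow>?r")
proof
 interpret Q: cbialg \<phi> Qt by (rule Q_cbialg)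
 note sU = Q_sba[OF U] and sV = Q_sba[OF V] and Uc = hsD(5)[OF U] and Vc = hsD(5)[OF V]
 {
  assume l: ?l
  show ?r
  proof (intro allI ballI)
   fix g h x y assume x: "x\<in>U\<inter>homog A g" and y: "y\<in>V\<inter>homog A h"
   then have c: "x\<in>cA" "y\<in>cA" by auto
   have "q y\<otimes>\<^bsub>Qt\<^esub>q x = \<phi> h g\<odot>\<^bsub>Qt\<^esub>(q x\<otimes>\<^bsub>Qt\<^esub>q y)"
    using x y by (intro Q.huq_commute_commutes[OF sU sV l]) (auto simp: Q_simps)
   then have "\<phi> g h\<odot>\<^bsub>Qt\<^esub>q (y\<otimes>x) = q ((\<phi> g h * \<phi> h g)\<odot>(x\<otimes>y))"
    using c by (simp add: Q_simps smult_smult)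
   then have "q (x\<otimes>y) = \<phi> g h\<odot>\<^bsub>Qt\<^esub>q (y\<otimes>x)" using c by (simp add: phi_inv)
   then show "x\<otimes>y\<ominus>\<phi> g h\<odot>(y\<otimes>x)\<in>I" using c by (simp add: q_zero)
  qed
 }
 assume r: ?r
 have lift: "\<exists>u\<in>W\<inter>homog A g. C = q u" if W: "hs W" and C: "C\<in>q ` W" "C\<in>homog Qt g" for W C g
 proof -
  obtain u where u: "u\<in>W" "C = q u" using C(1) by auto
  have "C = component Qt C g" using Q.comp_homog_same[OF C(2)] by simp
  then have "C = q (component A u g)" using Q_comp[OF hsD(5)[OF W u(1)]] u(2) by simp
  then show ?thesis using u(1) hsD(7)[OF W] hsD(5)[OF W u(1)] by (auto simp: gsub_subsp)
 qed
 show ?l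
 proof (rule Q.huq_commuteI[OF sU sV])
  fix g h x y assume "x\<in>q ` U" "x\<in>homog Qt h" "y\<in>q ` V" "y\<in>homog Qt g"
  then obtain u v where u: "u\<in>U\<inter>homog A h" "x = q u" and v: "v\<in>V\<inter>homog A g" "y = q v"
   using lift[OF U] lift[OF V] by metis
  have c: "u\<in>cA" "v\<in>cA" using u v by auto
  have "u\<otimes>v\<ominus>\<phi> h g\<odot>(v\<otimes>u)\<in>I" using r u v by blast
  then have "q (u\<otimes>v) = \<phi> h g\<odot>\<^bsub>Qt\<^esub>q (v\<otimes>u)" using c by (simp add: q_zero)
  then have "\<phi> g h\<odot>\<^bsub>Qt\<^esub>q (u\<otimes>v) = q ((\<phi> g h * \<phi> h g)\<odot>(v\<otimes>u))" using c by (simp add: Q_simps smult_smult)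
  then show "y\<otimes>\<^bsub>Qt\<^esub>x = \<phi> g h\<odot>\<^bsub>Qt\<^esub>(x\<otimes>\<^bsub>Qt\<^esub>y)" using c u v by (simp add: Q_simps phi_inv)
 qed
qed

end

context cchopf begin

lemma commute_modulo_iff:
 assumes U: "nhs U" and V: "nhs V" and B: "nhs B"
 shows "commute_modulo \<phi> A U V B \<longleftrightarrow>
  (\<forall>g h. \<forall>x\<in>U\<inter>homog A g. \<forall>y\<in>V\<inter>homog A h. x\<otimes>y\<ominus>\<phi> g h\<odot>(y\<otimes>x)\<in>AB B)"
proof -
 interpret C: cquot \<phi> A "AB B" by (rule AB_cquot[OF B])
 show ?thesis
  unfolding commute_modulo_def Let_def using C.huq_commute_iff[OF nhsD(2)[OF U] nhsD(2)[OF V]] by simp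
qed

lemma huq_commutator:
 assumes U: "nhs U" and V: "nhs V"
 shows "is_huq_commutator \<phi> A U V (commutator_subalgebra \<phi> A U V)"
proof -
 let ?C = "commutator_subalgebra \<phi> A U V"
 have C: "nhs ?C" "coms U V\<subseteq>?C" using commutator_subalgebra_nhs[OF U V] by auto
 obtain dgr :: "'a\<times>'a => 'g" and d eps c where t: "points \<phi> A dgr d eps" "points.point A dgr d eps c"
  "range c\<subseteq>coms U V" "coms U V\<subseteq>spn A (range c)"
  and N4: "\<forall>I. subsp A I\<longrightarrow>(\<forall>m. \<forall>w\<in>cA. (c m\<ominus>eps m\<odot>\<one>)\<otimes>w\<in>I) \<longrightarrow>
    (\<forall>g h. \<forall>x\<in>U\<inter>homog A g. \<forall>y\<in>V\<inter>homog A h. x\<otimes>y\<ominus>\<phi> g h\<odot>(y\<otimes>x)\<in>I)"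
  and N5: "\<forall>I. subsp A I\<longrightarrow>(\<forall>i\<in>I. \<forall>w\<in>cA. i\<otimes>w\<in>I) \<longrightarrow>
    (\<forall>g h. \<forall>x\<in>U\<inter>homog A g. \<forall>y\<in>V\<inter>homog A h. x\<otimes>y\<ominus>\<phi> g h\<odot>(y\<otimes>x)\<in>I) \<longrightarrow>
    (\<forall>m. c m\<ominus>eps m\<odot>\<one>\<in>I)"
  using com_test[OF U V] by (elim exE conjE) (rule that, assumption+)
 interpret P: points \<phi> A dgr d eps by (rule t(1))
 have cC: "c m\<in>?C" for m using t(3) C(2) by auto
 have cc: "c m\<in>cA" for m using t(2) by simp
 interpret IC: cquot \<phi> A "AB ?C" by (rule AB_cquot[OF C(1)])
 have "commute_modulo \<phi> A U V ?C"
  unfolding commute_modulo_iff[OF U V C(1)]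
 proof (rule N4[THEN spec, THEN mp, OF IC.I_subsp, THEN mp], intro allI ballI)
  fix m w assume w: "w\<in>cA"
  note hC = nhsD(2)[OF C(1)]
  have "c m\<ominus>eps m\<odot>\<one>\<in>aug ?C"
   using cC cc subsp_minus[OF hsD(6)[OF hC] cC subspD(4)[OF hsD(6)[OF hC] hsD(2)[OF hC]]]
   by (simp add: augmentation_ideal_def lf_minus[OF lf_counit] counit_smult counit_one P.point_eps[OF t(2)])
  then have "\<one>\<otimes>(c m\<ominus>eps m\<odot>\<one>)\<in>AB ?C" by (intro ideal_prod.prod) auto
  then show "(c m\<ominus>eps m\<odot>\<one>)\<otimes>w\<in>AB ?C" using w cc by (intro IC.I_r_closed) auto
 qed
 moreover have "?C\<subseteq>B" if nB: "normal_color_hopf_subalgebra \<phi> A B" and cB: "commute_modulo \<phi> A U V B" for B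
 proof -
  have B: "nhs B" by (rule nhs_normal[OF nB])
  interpret IB: cquot \<phi> A "AB B" by (rule AB_cquot[OF B])
  have "c m\<in>B" for m
  proof (rule P.coinvariant_in[OF nhsD(2)[OF B] t(2)])
   have r: "\<forall>i\<in>AB B. \<forall>w\<in>cA. i\<otimes>w\<in>AB B" by (auto intro: IB.I_r_closed)
   show "c m\<ominus>eps m\<odot>\<one>\<in>AB B" for m
    using N5[THEN spec, THEN mp, OF IB.I_subsp, THEN mp, OF r, THEN mp, OF cB[unfolded commute_modulo_iff[OF U V B]]] by blast
  qed
  then have "spn A (range c)\<subseteq>B" using gscD(2)[OF nhsD(1)[OF B]] by (intro spn_least) auto
  then have "coms U V\<subseteq>B" using t(4) by blast
  then show ?thesis by (rule commutator_subalgebra_least[OF B])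
 qed
 ultimately show ?thesis unfolding is_huq_commutator_def using normal_nhs[OF C(1)] by blast
qed

end

theorem proposition3p7:
  fixes \<phi> :: "'g::ab_group_add \<Rightarrow> 'g \<Rightarrow> 'k::field"
    and A :: "('k, 'g, 'a) hopf"
    and U V :: "'a set"
  assumes "CHAR('k) \<noteq> 2"
    and "fin_gen_group TYPE('g)"
    and "commutation_factor \<phi>"
    and "cocommutative_color_hopf_algebra \<phi> A"
    and "normal_color_hopf_subalgebra \<phi> A U"
    and "normal_color_hopf_subalgebra \<phi> A V"
  shows "is_huq_commutator \<phi> A U V (commutator_subalgebra \<phi> A U V)"
proof -
  interpret cchopf \<phi> A
    using assms(3,4) by (simp add: cchopf_def cchopf_axioms_def)
  show ?thesis by (rule huq_commutator[OF nhs_normal[OF assms(5)] nhs_normal[OF assms(6)]])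
qed

end
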